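(* Let $\mathcal{M}$ be a $\sigma$-finite infinite factor, let $A\in\mathcal{M}^+$ and let $\{B_j\}_{j=1}^\infty\subseteq\mathcal{M}^+$ with $\alpha:=\sup_{j\ge1}\|B_j\|<\infty$. Assume that one of the following two conditions holds: (i) $\tau((A-\alpha I)_+)=\infty$ when $\mathcal{M}$ is semifinite (resp., $\|A\|>\alpha$ when $\mathcal{M}$ is of type III), and there are a $\beta>0$ and a non-zero projection $P\in\mathcal{M}$ for which $P\prec\chi_{(\beta,\infty)}(B_j)$ for infinitely many indices $j$. (ii) $\|A\|_e\ge\alpha$ when $\mathcal{M}$ is semifinite (resp., $\|A\|\ge\alpha$ when $\mathcal{M}$ is of type III), $\chi_{\{\alpha\}}(B_j)=0$ for all $j$, and there are $0<\beta<\gamma<\alpha$ and a non-zero projection $P\in\mathcal{M}$ such that $P\prec\chi_{(\beta,\gamma]}(B_j)$ for infinitely many indices $j$. Then there exist mutually orthogonal projections $\{E_j\}_{j=1}^\infty\subseteq\mathcal{M}$ with $\sum_{j=1}^\infty E_j=I$ and $E_j\sim I$ for all $j$, and a partial isometry $V\in\mathcal{M}$, such that $V^*V\ge R_A$ and $E_jVAV^*E_j\sim B_j$ for all $j$. If in addition $N_A\sim I$, then we can take $V=I$.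
   Context: $\mathcal{M}$ acts on a Hilbert space; $\mathcal{M}^+$ is its set of positive elements. A $\sigma$-finite infinite factor is either semifinite (type I$_\infty$ or II$_\infty$) or of type III. When $\mathcal{M}$ is semifinite, $\tau$ is its faithful normal semifinite trace (on type I$_\infty$ normalized to be $1$ on rank-one projections), $\mathcal{J}$ is the norm-closed two-sided ideal generated by the finite projections of $\mathcal{M}$, $\pi:\mathcal{M}\to\mathcal{M}/\mathcal{J}$ is the quotient map and $\|A\|_e=\|\pi(A)\|$. For $B,C\in\mathcal{M}^+$, $B\sim C$ means $B=XX^*$ and $C=X^*X$ for some $X\in\mathcal{M}$; for projections this is Murray-von Neumann equivalence, and $P\prec Q$ means $P$ is equivalent to a subprojection of $Q$. $R_A$ and $N_A$ are the range projection of $A$ and the projection on the null space of $A$. $\chi_S(B)$ is the spectral projection of $B$ for the Borel set $S$, and $X_+$ is the positive part of a selfadjoint $X$. Infinite sums of operators converge in the strong operator topology. *)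

theory Defs
  imports "HOL-Analysis.Analysis" "HOL-Library.Nonpos_Ints"
begin

text \<open>The inner product is linear in its first argument.\<close>

class chilbert_space = banach +
  fixes scaleC :: "complex \<Rightarrow> 'a \<Rightarrow> 'a"  (infixr \<open>*\<^sub>C\<close> 75)
    and cinner :: "'a \<Rightarrow> 'a \<Rightarrow> complex"
  assumes scaleC_add_right: "c *\<^sub>C (x + y) = c *\<^sub>C x + c *\<^sub>C y"
    and scaleC_add_left: "(c + d) *\<^sub>C x = c *\<^sub>C x + d *\<^sub>C x"
    and scaleC_scaleC: "c *\<^sub>C d *\<^sub>C x = (c * d) *\<^sub>C x"
    and scaleC_of_real: "complex_of_real r *\<^sub>C x = r *\<^sub>R x"
    and cinner_add_left: "cinner (x + y) z = cinner x z + cinner y z"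
    and cinner_scaleC_left: "cinner (c *\<^sub>C x) y = c * cinner x y"
    and cinner_commute: "cinner x y = cnj (cinner y x)"
    and norm_eq_sqrt_cinner: "norm x = sqrt (Re (cinner x x))"

text \<open>
  The library type of bounded operators only demands real linearity, so complex linearity is an
  explicit predicate; the operator norm and the strong operator topology are those of the library.
\<close>

type_synonym 'h oper = "'h \<Rightarrow>\<^sub>L 'h"

definition complex_linear :: "'h::chilbert_space oper \<Rightarrow> bool" where
  "complex_linear T \<longleftrightarrow> (\<forall>c x. T (c *\<^sub>C x) = c *\<^sub>C T x)"

definition cadjoint :: "'h::chilbert_space oper \<Rightarrow> 'h oper" where
  "cadjoint T = (THE S :: 'h oper. \<forall>x y. cinner (T x) y = cinner x (S y))"

definition positive_op :: "'h::chilbert_space oper \<Rightarrow> bool" where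
  "positive_op T \<longleftrightarrow> complex_linear T \<and> (\<forall>x. cinner (T x) x \<in> \<real>\<^sub>\<ge>\<^sub>0)"

definition op_le :: "'h::chilbert_space oper \<Rightarrow> 'h oper \<Rightarrow> bool" where
  "op_le S T \<longleftrightarrow> positive_op (T - S)"

definition projection_op :: "'h::chilbert_space oper \<Rightarrow> bool" where
  "projection_op P \<longleftrightarrow> complex_linear P \<and> P o\<^sub>L P = P \<and> cadjoint P = P"

definition partial_isometry :: "'h::chilbert_space oper \<Rightarrow> bool" where
  "partial_isometry V \<longleftrightarrow> complex_linear V \<and> projection_op (cadjoint V o\<^sub>L V)"

definition proj_onto :: "'h::chilbert_space set \<Rightarrow> 'h oper" where
  "proj_onto S = (THE P. projection_op P \<and> range P = S)"

definition range_proj :: "'h::chilbert_space oper \<Rightarrow> 'h oper" where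
  "range_proj T = proj_onto (closure (range T))"

definition null_proj :: "'h::chilbert_space oper \<Rightarrow> 'h oper" where
  "null_proj T = proj_onto {x. T x = 0}"

definition sot_sums :: "(nat \<Rightarrow> 'h::chilbert_space oper) \<Rightarrow> 'h oper \<Rightarrow> bool" where
  "sot_sums F S \<longleftrightarrow> limitin strong_operator_topology (\<lambda>n. \<Sum>j<n. F j) S sequentially"

text \<open>
  The spectral measure of a selfadjoint \<open>B\<close>: the projection-valued Borel measure \<open>E\<close> with compact
  support such that \<open>B\<close> is the integral of \<open>t\<close> with respect to \<open>E\<close>. The values outside the Borel
  sets are fixed to be \<open>0\<close> in order to make \<open>E\<close> unique.
\<close>

definition spectral_measure_of ::
    "'h::chilbert_space oper \<Rightarrow> (real set \<Rightarrow> 'h oper) \<Rightarrow> bool" where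
  "spectral_measure_of B E \<longleftrightarrow>
     (\<forall>S\<in>sets borel. projection_op (E S)) \<and>
     (\<forall>S. S \<notin> sets borel \<longrightarrow> E S = 0) \<and>
     E UNIV = id_blinfun \<and>
     (\<forall>S\<in>sets borel. \<forall>T\<in>sets borel. E (S \<inter> T) = E S o\<^sub>L E T) \<and>
     (\<forall>F. range F \<subseteq> sets borel \<and> disjoint_family F \<longrightarrow>
            sot_sums (\<lambda>j. E (F j)) (E (\<Union>j::nat. F j))) \<and>
     (\<exists>r. E {-r..r} = id_blinfun) \<and>
     (\<forall>x. has_bochner_integral
            (measure_of UNIV (sets borel) (\<lambda>S. ennreal (Re (cinner (E S x) x))))
            complex_of_real (cinner (B x) x))"

definition spectral_proj :: "'h::chilbert_space oper \<Rightarrow> real set \<Rightarrow> 'h oper" where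
  "spectral_proj B = (THE E. spectral_measure_of B E)"

definition pos_part :: "'h::chilbert_space oper \<Rightarrow> 'h oper" where
  "pos_part X = (THE P. \<exists>N. positive_op P \<and> positive_op N \<and> X = P - N \<and> P o\<^sub>L N = 0)"

definition commutant :: "'h::chilbert_space oper set \<Rightarrow> 'h oper set" where
  "commutant M = {T. complex_linear T \<and> (\<forall>S\<in>M. T o\<^sub>L S = S o\<^sub>L T)}"

text \<open>
  A bicommutant is automatically a unital algebra of complex linear operators, so only closure under
  adjoints has to be asked for.
\<close>

definition von_neumann_algebra :: "'h::chilbert_space oper set \<Rightarrow> bool" where
  "von_neumann_algebra M \<longleftrightarrow> (\<forall>T\<in>M. cadjoint T \<in> M) \<and> commutant (commutant M) = M"

definition center :: "'h::chilbert_space oper set \<Rightarrow> 'h oper set" where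
  "center M = M \<inter> commutant M"

definition factor :: "'h::chilbert_space oper set \<Rightarrow> bool" where
  "factor M \<longleftrightarrow> von_neumann_algebra M \<and> (\<forall>T\<in>center M. \<exists>c. \<forall>x. T x = c *\<^sub>C x)"

definition positives :: "'h::chilbert_space oper set \<Rightarrow> 'h oper set" where
  "positives M = {T \<in> M. positive_op T}"

definition projections :: "'h::chilbert_space oper set \<Rightarrow> 'h oper set" where
  "projections M = {P \<in> M. projection_op P}"

definition sigma_finite_vna :: "'h::chilbert_space oper set \<Rightarrow> bool" where
  "sigma_finite_vna M \<longleftrightarrow>
     (\<forall>F. F \<subseteq> projections M - {0} \<and> (\<forall>P\<in>F. \<forall>Q\<in>F. P \<noteq> Q \<longrightarrow> P o\<^sub>L Q = 0) \<longrightarrow> countable F)"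

definition equivalent_in ::
    "'h::chilbert_space oper set \<Rightarrow> 'h oper \<Rightarrow> 'h oper \<Rightarrow> bool" where
  "equivalent_in M B C \<longleftrightarrow> (\<exists>X\<in>M. B = X o\<^sub>L cadjoint X \<and> C = cadjoint X o\<^sub>L X)"

definition subequivalent_in ::
    "'h::chilbert_space oper set \<Rightarrow> 'h oper \<Rightarrow> 'h oper \<Rightarrow> bool" where
  "subequivalent_in M P Q \<longleftrightarrow> (\<exists>Q'\<in>projections M. op_le Q' Q \<and> equivalent_in M P Q')"

definition finite_projection :: "'h::chilbert_space oper set \<Rightarrow> 'h oper \<Rightarrow> bool" where
  "finite_projection M P \<longleftrightarrow> P \<in> projections M \<and>
     (\<forall>Q\<in>projections M. op_le Q P \<and> equivalent_in M Q P \<longrightarrow> Q = P)"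

definition minimal_projection :: "'h::chilbert_space oper set \<Rightarrow> 'h oper \<Rightarrow> bool" where
  "minimal_projection M P \<longleftrightarrow> P \<in> projections M \<and> P \<noteq> 0 \<and>
     (\<forall>Q\<in>projections M. op_le Q P \<longrightarrow> Q = 0 \<or> Q = P)"

definition infinite_vna :: "'h::chilbert_space oper set \<Rightarrow> bool" where
  "infinite_vna M \<longleftrightarrow> \<not> finite_projection M id_blinfun"

definition semifinite_vna :: "'h::chilbert_space oper set \<Rightarrow> bool" where
  "semifinite_vna M \<longleftrightarrow>
     (\<forall>Z\<in>projections M \<inter> center M. Z \<noteq> 0 \<longrightarrow>
        (\<exists>P. finite_projection M P \<and> P \<noteq> 0 \<and> op_le P Z))"

definition type_III_vna :: "'h::chilbert_space oper set \<Rightarrow> bool" where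
  "type_III_vna M \<longleftrightarrow> (\<forall>P. finite_projection M P \<longrightarrow> P = 0)"

definition is_sup_in :: "'h::chilbert_space oper set \<Rightarrow> 'h oper set \<Rightarrow> 'h oper \<Rightarrow> bool" where
  "is_sup_in M D S \<longleftrightarrow> S \<in> positives M \<and> (\<forall>T\<in>D. op_le T S) \<and>
     (\<forall>U\<in>positives M. (\<forall>T\<in>D. op_le T U) \<longrightarrow> op_le S U)"

definition op_directed :: "'h::chilbert_space oper set \<Rightarrow> bool" where
  "op_directed D \<longleftrightarrow> D \<noteq> {} \<and> (\<forall>S\<in>D. \<forall>T\<in>D. \<exists>U\<in>D. op_le S U \<and> op_le T U)"

text \<open>Only the values of \<open>\<tau>\<close> on the positive cone of \<open>M\<close> matter.\<close>

definition trace_on ::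
    "'h::chilbert_space oper set \<Rightarrow> ('h oper \<Rightarrow> ennreal) \<Rightarrow> bool" where
  "trace_on M \<tau> \<longleftrightarrow>
     (\<forall>S\<in>positives M. \<forall>T\<in>positives M. \<tau> (S + T) = \<tau> S + \<tau> T) \<and>
     (\<forall>T\<in>positives M. \<forall>r\<ge>0. \<tau> (r *\<^sub>R T) = ennreal r * \<tau> T) \<and>
     (\<forall>X\<in>M. \<tau> (cadjoint X o\<^sub>L X) = \<tau> (X o\<^sub>L cadjoint X))"

definition faithful_on ::
    "'h::chilbert_space oper set \<Rightarrow> ('h oper \<Rightarrow> ennreal) \<Rightarrow> bool" where
  "faithful_on M \<tau> \<longleftrightarrow> (\<forall>T\<in>positives M. \<tau> T = 0 \<longrightarrow> T = 0)"

definition normal_on ::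
    "'h::chilbert_space oper set \<Rightarrow> ('h oper \<Rightarrow> ennreal) \<Rightarrow> bool" where
  "normal_on M \<tau> \<longleftrightarrow>
     (\<forall>D S. D \<subseteq> positives M \<and> op_directed D \<and> is_sup_in M D S \<longrightarrow> \<tau> S = (SUP T\<in>D. \<tau> T))"

definition semifinite_on ::
    "'h::chilbert_space oper set \<Rightarrow> ('h oper \<Rightarrow> ennreal) \<Rightarrow> bool" where
  "semifinite_on M \<tau> \<longleftrightarrow>
     (\<forall>T\<in>positives M. T \<noteq> 0 \<longrightarrow> (\<exists>S\<in>positives M. S \<noteq> 0 \<and> op_le S T \<and> \<tau> S < \<infinity>))"

text \<open>
  In a type I factor the rank-one projections (of the full operator algebra to which the factor is
  isomorphic) are its minimal projections; a type II factor has none, so that the normalization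
  clause is void there.
\<close>

definition normalized_fns_trace ::
    "'h::chilbert_space oper set \<Rightarrow> ('h oper \<Rightarrow> ennreal) \<Rightarrow> bool" where
  "normalized_fns_trace M \<tau> \<longleftrightarrow>
     trace_on M \<tau> \<and> faithful_on M \<tau> \<and> normal_on M \<tau> \<and> semifinite_on M \<tau> \<and>
     (\<forall>P. minimal_projection M P \<longrightarrow> \<tau> P = 1)"

text \<open>Closure under complex multiples follows from closure under multiplication by \<open>M\<close>.\<close>

definition closed_two_sided_ideal ::
    "'h::chilbert_space oper set \<Rightarrow> 'h oper set \<Rightarrow> bool" where
  "closed_two_sided_ideal M I \<longleftrightarrow> I \<subseteq> M \<and> closed I \<and> 0 \<in> I \<and>
     (\<forall>S\<in>I. \<forall>T\<in>I. S + T \<in> I) \<and> (\<forall>S\<in>I. \<forall>X\<in>M. X o\<^sub>L S \<in> I \<and> S o\<^sub>L X \<in> I)"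

definition finite_ideal :: "'h::chilbert_space oper set \<Rightarrow> 'h oper set" where
  "finite_ideal M = closed_two_sided_ideal M hull {P. finite_projection M P}"

text \<open>The quotient norm of the class of \<open>T\<close> is its distance to the ideal.\<close>

definition essential_norm :: "'h::chilbert_space oper set \<Rightarrow> 'h oper \<Rightarrow> real" where
  "essential_norm M T = infdist T (finite_ideal M)"

end

theory Submission
  imports Defs
begin

text \<open>
  Suppose that \<open>Y j \<in> M\<close> satisfy \<open>(Y j)* A (Y j) = B j\<close> and that the sum of the \<open>(Y j) (Y j)*\<close> is \<open>I\<close>.
  If the \<open>S j \<in> M\<close> are isometries whose ranges decompose the identity, then \<open>V\<close>, the sum of the
  \<open>(S j) (Y j)*\<close>, is an isometry, and the compression of \<open>V A V*\<close> to the range of \<open>S j\<close> is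
  \<open>(S j) (B j) (S j)*\<close>, which is equivalent to \<open>B j\<close>. If the null projection of \<open>A\<close> is equivalent to \<open>I\<close>,
  then \<open>V\<close> can be replaced by a unitary, and the ranges are conjugated by it instead.

  The \<open>Y j\<close> are constructed recursively. The remainder \<open>K\<close>, that is \<open>I\<close> minus the sum of the previous
  \<open>(Y i) (Y i)*\<close>, stays a positive contraction and acts as the identity on projections \<open>G k\<close> commuting
  with \<open>A\<close> that are reserved for the later steps. With \<open>L\<close> supported by the current \<open>G\<close> and
  \<open>L* A L = I\<close>, put \<open>Y = (s K W + L H) B\<^sup>1\<^sup>/\<^sup>2\<close>, where \<open>W\<close> is a partial isometry from a
  subprojection of a spectral projection of \<open>B\<close> onto a small projection \<open>R\<close>, and \<open>H\<close> is the correction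
  that makes \<open>Y* A Y = B\<close>. Every step removes at least a multiple of \<open>s\<^sup>2\<close> of what is left on \<open>R\<close>; as every \<open>R\<close> of a
  decomposition of the identity recurs with divergent sum of the \<open>s\<^sup>2\<close>, the remainders tend to \<open>0\<close>.

  The estimate \<open>Y Y* \<le> K\<close> needs room between \<open>A\<close> and \<open>B\<close>. It is provided by orthogonal blocks that commute
  with \<open>A\<close>, dominate a fixed projection and on which \<open>A \<ge> \<alpha> + \<epsilon> k\<close> with divergent sum of the
  \<open>\<epsilon> k\<close> in case (i), and \<open>A \<ge> c k\<close> with \<open>c k\<close> increasing to \<open>\<alpha>\<close> in case (ii). The blocks are cut out of the
  spectral projections of \<open>A\<close>.
\<close>

subsection \<open>Complex Hilbert spaces\<close>

text \<open>With \<open>b\<close> the root of \<open>B j\<close>, already \<open>Y = L b\<close>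
  solves \<open>Y* A Y = B j\<close>, but nothing forces the sum of these \<open>Y Y*\<close> to be
  \<open>I\<close>. The term \<open>s K W b\<close> feeds in what is still missing, and its price is
  the obstacle of the proof: \<open>Y Y*\<close> must stay below \<open>K\<close>. Where
  \<open>B <= g\<close> and \<open>A >= c\<close>, a weighted Cauchy-Schwarz inequality permits
  \<open>s^2\<close> up to \<open>1/g - 1/c\<close>, and the lower bound \<beta> of \<open>B\<close>
  turns \<open>s^2\<close> into an actual loss of \<open>K\<close>. In case (ii) \<open>g\<close> is
  \<gamma>, which lies below \<open>c 0\<close>, so a fixed \<open>s\<close> serves infinitely
  often. In case (i) \<open>g\<close> is \<alpha> and \<open>c\<close> is \<alpha> +
  \<open>e\<close>, so the budget is comparable to \<open>e\<close>; if \<open>A\<close> has no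
  uniform gap above \<alpha>, the divergence of the sum of the \<open>e\<close> is what the infinite
  trace of \<open>(A - \<alpha>)\<^sub>+\<close> provides. The factor \<open>K\<close> in front of
  \<open>W\<close> needs no root, because \<open>K^2 <= K\<close> for a positive contraction.
  Semifinite and type III factors are treated alike through the projections equivalent to
  \<open>I\<close>: those of infinite trace, respectively all nonzero ones.\<close>

abbreviation adj :: "'h::chilbert_space oper \<Rightarrow> 'h oper" where
  "adj \<equiv> cadjoint"

abbreviation opcomp :: "'h::chilbert_space oper \<Rightarrow> 'h oper \<Rightarrow> 'h oper"  (infixl \<open>\<cdot>\<close> 70) where
  "S \<cdot> T \<equiv> S o\<^sub>L T"

lemma compose_add_left: "(S + T) \<cdot> U = S \<cdot> U + T \<cdot> U"
  and compose_add_right: "U \<cdot> (S + T) = U \<cdot> S + U \<cdot> T"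
  and compose_diff_left: "(S - T) \<cdot> U = S \<cdot> U - T \<cdot> U"
  and compose_diff_right: "U \<cdot> (S - T) = U \<cdot> S - U \<cdot> T"
  and compose_scaleR_left: "(r *\<^sub>R S) \<cdot> U = r *\<^sub>R (S \<cdot> U)"
  and compose_scaleR_right: "U \<cdot> (r *\<^sub>R S) = r *\<^sub>R (U \<cdot> S)"
  and compose_assoc: "(U \<cdot> V) \<cdot> W = U \<cdot> (V \<cdot> W)"
  and compose_id_left: "id_blinfun \<cdot> U = U"
  and compose_id_right: "U \<cdot> id_blinfun = U"
  by (rule blinfun_eqI, simp add: blinfun.bilinear_simps)+

lemmas compose_simps = compose_add_left compose_add_right compose_diff_left compose_diff_right
  compose_scaleR_left compose_scaleR_right compose_id_left compose_id_right

lemma cinner_add_right: "cinner x (y + z) = cinner x y + cinner x (z::'a::chilbert_space)"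
  by (metis cinner_add_left cinner_commute complex_cnj_add)

lemma cinner_scaleC_right: "cinner x (c *\<^sub>C y) = cnj c * cinner x (y::'a::chilbert_space)"
  by (metis cinner_commute cinner_scaleC_left complex_cnj_mult)

lemma cinner_scaleR_left: "cinner (r *\<^sub>R x) y = of_real r * cinner x (y::'a::chilbert_space)"
  by (metis cinner_scaleC_left scaleC_of_real)

lemma cinner_scaleR_right: "cinner x (r *\<^sub>R y) = of_real r * cinner x (y::'a::chilbert_space)"
  by (metis cinner_scaleC_right complex_cnj_complex_of_real scaleC_of_real)

lemma cinner_zero_left [simp]: "cinner 0 (y::'a::chilbert_space) = 0"
  using cinner_scaleR_left[of 0 0 y] by simp

lemma cinner_zero_right [simp]: "cinner (y::'a::chilbert_space) 0 = 0"
  using cinner_scaleR_right[of y 0 0] by simp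

lemma cinner_minus_left: "cinner (- x) y = - cinner x (y::'a::chilbert_space)"
  using cinner_scaleR_left[of "-1" x y] by simp

lemma cinner_minus_right: "cinner x (- y) = - cinner x (y::'a::chilbert_space)"
  using cinner_scaleR_right[of x "-1" y] by simp

lemma cinner_diff_left: "cinner (x - y) z = cinner x z - cinner y (z::'a::chilbert_space)"
  using cinner_add_left[of x "- y" z] by (simp add: cinner_minus_left)

lemma cinner_diff_right: "cinner x (y - z) = cinner x y - cinner x (z::'a::chilbert_space)"
  using cinner_add_right[of x y "- z"] by (simp add: cinner_minus_right)

lemmas cinner_simps = cinner_add_left cinner_add_right cinner_diff_left cinner_diff_right
  cinner_minus_left cinner_minus_right cinner_scaleC_left cinner_scaleC_right
  cinner_scaleR_left cinner_scaleR_right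

lemma scaleC_0_left [simp]: "0 *\<^sub>C (x::'a::chilbert_space) = 0"
  using scaleC_of_real[of 0 x] by simp

lemma scaleC_1 [simp]: "1 *\<^sub>C (x::'a::chilbert_space) = x"
  using scaleC_of_real[of 1 x] by simp

lemma scaleC_0_right [simp]: "c *\<^sub>C (0::'a::chilbert_space) = 0"
  using scaleC_add_right[of c 0 0] by simp

lemma scaleC_minus1: "(-1) *\<^sub>C (x::'a::chilbert_space) = - x"
  using scaleC_of_real[of "-1" x] by simp

lemma scaleC_minus_right: "c *\<^sub>C (- x) = - (c *\<^sub>C (x::'a::chilbert_space))"
  using scaleC_add_right[of c x "-x"] by (simp add: eq_neg_iff_add_eq_0 add.commute)

lemma scaleC_diff_right: "c *\<^sub>C (x - y) = c *\<^sub>C x - c *\<^sub>C (y::'a::chilbert_space)"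
  using scaleC_add_right[of c x "-y"] by (simp add: scaleC_minus_right)

lemma scaleC_scaleR_commute: "c *\<^sub>C (r *\<^sub>R x) = r *\<^sub>R (c *\<^sub>C (x::'a::chilbert_space))"
  by (metis mult.commute scaleC_of_real scaleC_scaleC)

lemma cinner_self: "cinner x (x::'a::chilbert_space) = of_real ((norm x)\<^sup>2)"
proof -
  have im: "Im (cinner x x) = 0"
    by (metis cinner_commute cnj.simps(2) equal_neg_zero)
  have nn: "sqrt (Re (cinner x x)) \<ge> 0" by (metis norm_eq_sqrt_cinner norm_ge_zero)
  hence "Re (cinner x x) \<ge> 0" by (meson not_less real_sqrt_lt_0_iff)
  hence "Re (cinner x x) = (norm x)\<^sup>2" by (simp add: norm_eq_sqrt_cinner)
  thus ?thesis using im by (simp add: complex_eq_iff)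
qed

lemma Re_cinner_self [simp]: "Re (cinner x (x::'a::chilbert_space)) = (norm x)\<^sup>2"
  by (simp add: cinner_self)

lemma Re_cinner_commute: "Re (cinner x y) = Re (cinner y (x::'a::chilbert_space))"
  by (metis cinner_commute cnj.simps(1))

lemma norm_add_square:
  "(norm (x + y))\<^sup>2 = (norm x)\<^sup>2 + (norm y)\<^sup>2 + 2 * Re (cinner x (y::'a::chilbert_space))"
proof -
  have "(norm (x + y))\<^sup>2 = Re (cinner (x + y) (x + y))" by simp
  also have "\<dots> = (norm x)\<^sup>2 + (norm y)\<^sup>2 + 2 * Re (cinner x y)"
    unfolding cinner_add_left cinner_add_right using Re_cinner_commute[of x y] by simp
  finally show ?thesis .
qed

lemma norm_diff_square:
  "(norm (x - y))\<^sup>2 = (norm x)\<^sup>2 + (norm y)\<^sup>2 - 2 * Re (cinner x (y::'a::chilbert_space))"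
  using norm_add_square[of x "- y"] by (simp add: cinner_minus_right)

lemma pythagoras: "cinner x (y::'a::chilbert_space) = 0 \<Longrightarrow> (norm (x + y))\<^sup>2 = (norm x)\<^sup>2 + (norm y)\<^sup>2"
  by (simp add: norm_add_square)

lemma parallelogram:
  "(norm (x + y))\<^sup>2 + (norm (x - y))\<^sup>2 = 2 * (norm x)\<^sup>2 + 2 * (norm (y::'a::chilbert_space))\<^sup>2"
  by (simp add: norm_add_square norm_diff_square)

lemma norm_scaleC: "norm (c *\<^sub>C x) = cmod c * norm (x::'a::chilbert_space)"
proof -
  have "(norm (c *\<^sub>C x))\<^sup>2 = Re (c * cnj c * cinner x x)"
    by (subst Re_cinner_self[symmetric], simp only: cinner_simps) (simp add: mult.assoc mult.left_commute)
  also have "\<dots> = (cmod c * norm x)\<^sup>2"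
    by (simp add: cinner_self complex_norm_square[symmetric] power_mult_distrib del: of_real_power)
  finally show ?thesis by simp
qed

text \<open>The common core of Cauchy--Schwarz and of the minimality argument for projections.\<close>

lemma quadratic_nonneg:
  fixes a d :: real and b :: complex
  assumes "\<And>c. 0 \<le> a + 2 * Re (cnj c * b) + (cmod c)\<^sup>2 * d" and "0 \<le> d"
  shows "(cmod b)\<^sup>2 \<le> a * d"
proof -
  \<comment> \<open>\<open>c = - t b\<close> with real \<open>t\<close> aligns the phase of the
    cross term with \<open>b\<close>, which leaves a real quadratic in \<open>t\<close>.\<close>
  have *: "0 \<le> a - 2 * t * (cmod b)\<^sup>2 + t\<^sup>2 * (cmod b)\<^sup>2 * d" for t
  proof -
    have "Re (cnj (- (of_real t * b)) * b) = - t * (cmod b)\<^sup>2"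
      unfolding cmod_power2 by (simp add: algebra_simps power2_eq_square)
    moreover have "(cmod (- (of_real t * b)))\<^sup>2 = t\<^sup>2 * (cmod b)\<^sup>2"
      by (simp add: norm_mult power_mult_distrib)
    ultimately show ?thesis
      using assms(1)[of "- (of_real t * b)"] by (simp add: algebra_simps)
  qed
  show ?thesis
  proof (cases "d = 0")
    case True
    have "(cmod b)\<^sup>2 = 0"
    proof (rule ccontr)
      assume "(cmod b)\<^sup>2 \<noteq> 0"
      \<comment> \<open>For \<open>d = 0\<close> this \<open>t\<close> gives the expression the
        value \<open>-1\<close>.\<close>
      thus False using *[of "(a + 1) / (2 * (cmod b)\<^sup>2)"] True by (simp add: field_simps)
    qed
    thus ?thesis using True by simp
  next
    case False
    hence "d > 0" using assms(2) by simp
    have "0 \<le> a - (cmod b)\<^sup>2 / d"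
      using *[of "1 / d"] \<open>d > 0\<close> by (simp add: field_simps power2_eq_square)
    thus ?thesis using \<open>d > 0\<close> by (simp add: field_simps)
  qed
qed

lemma cauchy_schwarz: "cmod (cinner x y) \<le> norm x * norm (y::'a::chilbert_space)"
proof -
  have "(cmod (cinner x y))\<^sup>2 \<le> (norm x)\<^sup>2 * (norm y)\<^sup>2"
  proof (rule quadratic_nonneg)
    fix c
    have "0 \<le> (norm (x + c *\<^sub>C y))\<^sup>2" by simp
    thus "0 \<le> (norm x)\<^sup>2 + 2 * Re (cnj c * cinner x y) + (cmod c)\<^sup>2 * (norm y)\<^sup>2"
      by (simp add: norm_add_square cinner_simps norm_scaleC power_mult_distrib)
  qed simp
  thus ?thesis by (simp add: power_mult_distrib[symmetric])
qed

lemma Re_cauchy_schwarz: "Re (cinner x y) \<le> norm x * norm (y::'a::chilbert_space)"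
  using cauchy_schwarz[of x y] complex_Re_le_cmod order_trans by blast

interpretation cinner: bounded_bilinear "cinner :: 'a::chilbert_space \<Rightarrow> 'a \<Rightarrow> complex"
proof
  show "\<exists>K. \<forall>a b. cmod (cinner (a::'a) b) \<le> norm a * norm b * K"
    by (rule exI[of _ 1]) (simp add: cauchy_schwarz)
qed (simp_all add: cinner_simps scaleR_conv_of_real)

lemma cinner_ext: "(\<And>z. cinner x z = cinner y z) \<Longrightarrow> x = (y::'a::chilbert_space)"
proof -
  assume "\<And>z. cinner x z = cinner y z"
  hence "cinner (x - y) (x - y) = 0" by (simp add: cinner_diff_left)
  thus ?thesis by (simp add: cinner_self)
qed

lemma cinner_ext': "(\<And>z. cinner z x = cinner z y) \<Longrightarrow> x = (y::'a::chilbert_space)"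
  by (rule cinner_ext) (metis cinner_commute)

definition csubspace :: "'a::chilbert_space set \<Rightarrow> bool" where
  "csubspace S \<longleftrightarrow> 0 \<in> S \<and> (\<forall>x\<in>S. \<forall>y\<in>S. x + y \<in> S) \<and> (\<forall>c. \<forall>x\<in>S. c *\<^sub>C x \<in> S)"

lemma csubspaceD:
  assumes "csubspace S"
  shows "0 \<in> S" "x \<in> S \<Longrightarrow> y \<in> S \<Longrightarrow> x + y \<in> S" "x \<in> S \<Longrightarrow> c *\<^sub>C x \<in> S"
    "x \<in> S \<Longrightarrow> y \<in> S \<Longrightarrow> x - y \<in> S" "x \<in> S \<Longrightarrow> r *\<^sub>R x \<in> S"
proof -
  show 1: "0 \<in> S" "\<And>x y. x \<in> S \<Longrightarrow> y \<in> S \<Longrightarrow> x + y \<in> S" "\<And>x c. x \<in> S \<Longrightarrow> c *\<^sub>C x \<in> S"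
    using assms by (auto simp: csubspace_def)
  show "x \<in> S \<Longrightarrow> y \<in> S \<Longrightarrow> x - y \<in> S"
    using 1(2)[of x "- y"] 1(3)[of y "-1"] by (simp add: scaleC_minus1)
  show "x \<in> S \<Longrightarrow> r *\<^sub>R x \<in> S" using 1(3)[of x "of_real r"] by (simp add: scaleC_of_real)
qed

lemma csubspace_closure: "csubspace S \<Longrightarrow> csubspace (closure S)"
proof -
  assume S: "csubspace S"
  have c: "bounded_linear (\<lambda>x::'a. c *\<^sub>C x)" for c
    by (rule bounded_linear_intro[where K = "cmod c"])
      (simp_all add: scaleC_add_right scaleC_scaleR_commute norm_scaleC mult.commute)
  show ?thesis unfolding csubspace_def
  proof (intro conjI ballI allI)
    show "0 \<in> closure S" using csubspaceD(1)[OF S] closure_subset by blast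
    fix x assume x: "x \<in> closure S"
    then obtain f where f: "\<And>n. f n \<in> S" "f \<longlonglongrightarrow> x" by (metis closure_sequential)
    show "c *\<^sub>C x \<in> closure S" for c
    proof -
      have "(\<lambda>n. c *\<^sub>C f n) \<longlonglongrightarrow> c *\<^sub>C x" by (rule bounded_linear.tendsto[OF c f(2)])
      thus ?thesis using csubspaceD(3)[OF S] f(1) by (meson closure_sequential)
    qed
    fix y assume "y \<in> closure S"
    then obtain g where g: "\<And>n. g n \<in> S" "g \<longlonglongrightarrow> y" by (metis closure_sequential)
    have "(\<lambda>n. f n + g n) \<longlonglongrightarrow> x + y" by (rule tendsto_add[OF f(2) g(2)])
    thus "x + y \<in> closure S" using csubspaceD(2)[OF S] f(1) g(1) by (meson closure_sequential)
  qed
qed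

text \<open>Points of \<open>S\<close> that almost realize the distance form a Cauchy sequence by
  the parallelogram law, because midpoints stay in \<open>S\<close>. Orthogonality at the limit
  \<open>w\<close> is the vanishing first variation along \<open>w - c z\<close>, that is
  \<open>quadratic_nonneg\<close> with \<open>a = 0\<close>.\<close>

lemma orthogonal_projection_exists:
  fixes S :: "'a::chilbert_space set"
  assumes S: "csubspace S" and cl: "closed S"
  shows "\<exists>y\<in>S. \<forall>z\<in>S. cinner (x - y) z = 0"
proof -
  define d where "d = infdist x S"
  have ne: "S \<noteq> {}" using csubspaceD(1)[OF S] by auto
  have dle: "d \<le> norm (x - y)" if "y \<in> S" for y
    unfolding d_def using infdist_le[OF that, of x] by (simp add: dist_norm)
  have "\<exists>y\<in>S. norm (x - y) < d + 1 / Suc n" for n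
  proof -
    have "(INF a\<in>S. dist x a) < d + 1 / Suc n" using ne by (simp add: d_def infdist_def)
    thus ?thesis using cInf_lessD[of "(\<lambda>a. dist x a) ` S"] ne by (auto simp: dist_norm)
  qed
  then obtain y where y: "\<And>n. y n \<in> S" "\<And>n. norm (x - y n) < d + 1 / Suc n" by metis
  have d0: "d \<ge> 0" by (simp add: d_def infdist_nonneg)
  have bd: "(norm (y m - y n))\<^sup>2 \<le> 4 * (2 * d + 1) / Suc k" if "k \<le> m" "k \<le> n" for m n k
  proof -
    have q: "(norm (x - y i))\<^sup>2 \<le> d\<^sup>2 + (2 * d + 1) / Suc k" if "k \<le> i" for i
    proof -
      have "norm (x - y i) \<le> d + 1 / Suc k"
        using y(2)[of i] that by (smt (verit) frac_le of_nat_0_less_iff of_nat_mono zero_less_Suc Suc_le_mono)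
      hence "(norm (x - y i))\<^sup>2 \<le> (d + 1 / Suc k)\<^sup>2" by (intro power_mono) auto
      also have "\<dots> = d\<^sup>2 + 2 * d / Suc k + (1 / Suc k) * (1 / Suc k)"
        by (simp add: power2_sum) (simp add: power2_eq_square)
      also have "\<dots> \<le> d\<^sup>2 + 2 * d / Suc k + 1 * (1 / Suc k)"
        by (intro add_left_mono mult_right_mono) auto
      finally show ?thesis by (simp add: add_divide_distrib)
    qed
    have "(norm ((x - y m) + (x - y n)))\<^sup>2 = 4 * (norm (x - (1/2) *\<^sub>R (y m + y n)))\<^sup>2"
    proof -
      have "(x - y m) + (x - y n) = 2 *\<^sub>R (x - (1/2) *\<^sub>R (y m + y n))"
        by (simp add: scaleR_diff_right scaleR_2)
      thus ?thesis by (simp add: power_mult_distrib)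
    qed
    moreover have "d\<^sup>2 \<le> (norm (x - (1/2) *\<^sub>R (y m + y n)))\<^sup>2"
      using dle csubspaceD[OF S] y(1) d0 by (intro power_mono) auto
    ultimately have "4 * d\<^sup>2 + (norm ((x - y m) - (x - y n)))\<^sup>2 \<le> 2 * (norm (x - y m))\<^sup>2 + 2 * (norm (x - y n))\<^sup>2"
      using parallelogram[of "x - y m" "x - y n"] by simp
    hence "(norm ((x - y m) - (x - y n)))\<^sup>2 \<le> 4 * ((2 * d + 1) / Suc k)"
      using q[OF that(1)] q[OF that(2)] by linarith
    thus ?thesis by (simp add: norm_minus_commute del: of_nat_Suc)
  qed
  have "Cauchy y"
  proof (rule metric_CauchyI)
    fix e :: real assume e: "e > 0"
    obtain k where "4 * (2 * d + 1) / e\<^sup>2 < real k" using reals_Archimedean2 by blast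
    hence k: "4 * (2 * d + 1) / e\<^sup>2 < Suc k" by simp
    hence "4 * (2 * d + 1) / Suc k < e\<^sup>2" using e by (simp add: field_simps)
    hence "(norm (y m - y n))\<^sup>2 < e\<^sup>2" if "k \<le> m" "k \<le> n" for m n using bd[OF that] by linarith
    hence "norm (y m - y n) < e" if "k \<le> m" "k \<le> n" for m n
      using that e by (meson less_eq_real_def power_less_imp_less_base)
    thus "\<exists>M. \<forall>m\<ge>M. \<forall>n\<ge>M. dist (y m) (y n) < e" by (auto simp: dist_norm)
  qed
  then obtain w where w: "y \<longlonglongrightarrow> w" by (meson Cauchy_convergent convergent_def)
  have wS: "w \<in> S" using closed_sequentially[OF cl] y(1) w by blast
  have "(\<lambda>n. norm (x - y n)) \<longlonglongrightarrow> norm (x - w)" by (intro tendsto_intros w)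
  moreover have "(\<lambda>n. d + 1 / Suc n) \<longlonglongrightarrow> d + 0"
    by (intro tendsto_add tendsto_const LIMSEQ_Suc lim_1_over_n)
  ultimately have "norm (x - w) \<le> d + 0"
    by (rule LIMSEQ_le) (use y(2) less_imp_le in blast)
  hence wd: "norm (x - w) \<le> norm (x - v)" if "v \<in> S" for v using dle[OF that] by simp
  show ?thesis
  proof (intro bexI[OF _ wS] ballI)
    fix z assume z: "z \<in> S"
    have "(cmod (cinner (x - w) z))\<^sup>2 \<le> 0 * (norm z)\<^sup>2"
    proof (rule quadratic_nonneg)
      fix c
      have "norm (x - w) \<le> norm (x - (w - c *\<^sub>C z))"
        by (intro wd csubspaceD(4)[OF S] csubspaceD(3)[OF S] z wS)
      hence "(norm (x - w))\<^sup>2 \<le> (norm ((x - w) + c *\<^sub>C z))\<^sup>2" by (intro power_mono) (auto simp: algebra_simps)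
      thus "0 \<le> 0 + 2 * Re (cnj c * cinner (x - w) z) + (cmod c)\<^sup>2 * (norm z)\<^sup>2"
        by (simp only: norm_add_square cinner_simps norm_scaleC power_mult_distrib)
    qed simp
    thus "cinner (x - w) z = 0" by simp
  qed
qed

text \<open>The kernel is a closed hyperplane; a vector \<open>u\<close> normal to it represents
  \<open>f\<close> after rescaling.\<close>

lemma riesz_representation:
  fixes f :: "'a::chilbert_space \<Rightarrow> complex"
  assumes f: "bounded_linear f" and fc: "\<And>c x. f (c *\<^sub>C x) = c * f x"
  shows "\<exists>w. \<forall>x. f x = cinner x w"
proof (cases "\<forall>x. f x = 0")
  case True thus ?thesis by (intro exI[of _ 0]) simp
next
  case False
  then obtain x0 where x0: "f x0 \<noteq> 0" by auto
  let ?S = "{x. f x = 0}"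
  interpret f: bounded_linear f by (rule f)
  have "csubspace ?S" by (auto simp: csubspace_def f.add fc f.zero)
  moreover have "closed ?S"
    by (rule closed_Collect_eq) (auto intro: bounded_linear.continuous_on[OF f] continuous_on_id)
  ultimately obtain y where y: "f y = 0" "\<And>z. f z = 0 \<Longrightarrow> cinner (x0 - y) z = 0"
    using orthogonal_projection_exists[of ?S x0] by auto
  define u where "u = x0 - y"
  have fu: "f u \<noteq> 0" using x0 y(1) by (simp add: u_def f.diff)
  hence u: "cinner u u \<noteq> 0" by (auto simp: cinner_self f.zero)
  have "f x = cinner x ((cnj (f u / cinner u u)) *\<^sub>C u)" for x
  proof -
    have "f (x - (f x / f u) *\<^sub>C u) = 0" using fu by (simp add: f.diff fc)
    hence "cinner u (x - (f x / f u) *\<^sub>C u) = 0" using y(2) by (simp add: u_def)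
    hence "cinner (x - (f x / f u) *\<^sub>C u) u = 0" by (metis cinner_commute complex_cnj_zero)
    thus ?thesis using fu u by (simp add: cinner_simps field_simps)
  qed
  thus ?thesis by blast
qed

subsection \<open>Adjoints\<close>

named_theorems cl_intros

lemma complex_linearD: "complex_linear T \<Longrightarrow> T (c *\<^sub>C x) = c *\<^sub>C T x"
  by (simp add: complex_linear_def)

lemma cl_id [cl_intros, simp]: "complex_linear id_blinfun"
  by (simp add: complex_linear_def)

lemma cl_0 [cl_intros, simp]: "complex_linear 0"
  by (simp add: complex_linear_def)

lemma cl_add [cl_intros]: "complex_linear S \<Longrightarrow> complex_linear T \<Longrightarrow> complex_linear (S + T)"
  by (simp add: complex_linear_def blinfun.bilinear_simps scaleC_add_right)

lemma cl_diff [cl_intros]: "complex_linear S \<Longrightarrow> complex_linear T \<Longrightarrow> complex_linear (S - T)"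
  by (simp add: complex_linear_def blinfun.bilinear_simps scaleC_diff_right)

lemma cl_scaleR [cl_intros]: "complex_linear T \<Longrightarrow> complex_linear (r *\<^sub>R T)"
  by (simp add: complex_linear_def blinfun.bilinear_simps scaleC_scaleR_commute)

lemma cl_compose [cl_intros]: "complex_linear S \<Longrightarrow> complex_linear T \<Longrightarrow> complex_linear (S \<cdot> T)"
  by (simp add: complex_linear_def)

lemma cl_sum [cl_intros]: "(\<And>i. i \<in> I \<Longrightarrow> complex_linear (f i)) \<Longrightarrow> complex_linear (sum f I)"
  by (induction I rule: infinite_finite_induct) (auto intro: cl_intros)

lemma adj_unique:
  assumes "\<And>x y. cinner (blinfun_apply T x) y = cinner x (blinfun_apply S y)"
  shows "adj T = S"
  unfolding cadjoint_def
proof (rule the_equality)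
  fix S' :: "'a oper" assume S': "\<forall>x y. cinner (T x) y = cinner x (S' y)"
  show "S' = S"
    by (rule blinfun_eqI, rule cinner_ext') (metis assms S')
qed (simp add: assms)

lemma adj_exists:
  fixes T :: "'h::chilbert_space oper"
  assumes T: "complex_linear T"
  shows "\<exists>S. complex_linear S \<and> (\<forall>x y. cinner (T x) y = cinner x (S y))"
proof -
  have "\<exists>w. \<forall>x. cinner (T x) y = cinner x w" for y
  proof (rule riesz_representation)
    show "bounded_linear (\<lambda>x. cinner (T x) y)"
      by (intro bounded_linear_compose[OF cinner.bounded_linear_left] blinfun.bounded_linear_right)
  qed (simp add: complex_linearD[OF T] cinner_simps)
  then obtain f where f: "\<And>x y. cinner (T x) y = cinner x (f y)" by metis
  have add: "f (x + y) = f x + f y" for x y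
    by (rule cinner_ext') (simp add: f[symmetric] cinner_simps)
  have sc: "f (c *\<^sub>C x) = c *\<^sub>C f x" for c x
    by (rule cinner_ext') (simp add: f[symmetric] cinner_simps)
  have "bounded_linear f"
  proof (rule bounded_linear_intro[where K = "norm T"])
    show "f (x + y) = f x + f y" for x y by (rule add)
    show "f (r *\<^sub>R x) = r *\<^sub>R f x" for r x using sc[of "of_real r" x] by (simp add: scaleC_of_real)
    show "norm (f y) \<le> norm y * norm T" for y
    proof (cases "f y = 0")
      case False
      have "norm (f y) * norm (f y) = Re (cinner (T (f y)) y)"
        unfolding f by (simp add: power2_eq_square)
      also have "\<dots> \<le> norm (T (f y)) * norm y" by (rule Re_cauchy_schwarz)
      also have "\<dots> \<le> norm T * norm (f y) * norm y" by (intro mult_right_mono norm_blinfun) auto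
      finally show ?thesis using False by (simp add: mult.commute mult.left_commute)
    qed simp
  qed
  hence "blinfun_apply (Blinfun f) = f" by (rule bounded_linear_Blinfun_apply)
  thus ?thesis by (intro exI[of _ "Blinfun f"]) (simp add: complex_linear_def sc f)
qed

lemma
  assumes "complex_linear T"
  shows adj_right: "cinner (T x) y = cinner x (adj T y)"
    and cl_adj [cl_intros]: "complex_linear (adj T)"
  using adj_exists[OF assms] adj_unique by metis+

lemma adj_left:
  assumes "complex_linear T"
  shows "cinner (adj T x) y = cinner x (T y)"
  by (metis adj_right[OF assms] cinner_commute)

lemma adj_adj: "complex_linear T \<Longrightarrow> adj (adj T) = T"
  by (rule adj_unique) (simp add: adj_left)

lemma adj_id [simp]: "adj id_blinfun = id_blinfun"
  by (rule adj_unique) simp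

lemma adj_0 [simp]: "adj 0 = 0"
  by (rule adj_unique) simp

lemma adj_add: "complex_linear S \<Longrightarrow> complex_linear T \<Longrightarrow> adj (S + T) = adj S + adj T"
  by (rule adj_unique) (simp add: adj_right blinfun.bilinear_simps cinner_simps)

lemma adj_diff: "complex_linear S \<Longrightarrow> complex_linear T \<Longrightarrow> adj (S - T) = adj S - adj T"
  by (rule adj_unique) (simp add: adj_right blinfun.bilinear_simps cinner_simps)

lemma adj_scaleR: "complex_linear T \<Longrightarrow> adj (r *\<^sub>R T) = r *\<^sub>R adj T"
  by (rule adj_unique) (simp add: adj_right blinfun.bilinear_simps cinner_simps)

lemma adj_compose: "complex_linear S \<Longrightarrow> complex_linear T \<Longrightarrow> adj (S \<cdot> T) = adj T \<cdot> adj S"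
  by (rule adj_unique) (simp add: adj_right)

lemma norm_adj_apply: 
  assumes "complex_linear T"
  shows "(norm (T x))\<^sup>2 = Re (cinner (adj T (T x)) x)"
  by (simp add: adj_left[OF assms])

subsection \<open>Positive operators\<close>

abbreviation qf :: "'h::chilbert_space oper \<Rightarrow> 'h \<Rightarrow> real" where
  "qf T x \<equiv> Re (cinner (T x) x)"

definition selfadj :: "'h::chilbert_space oper \<Rightarrow> bool" where
  "selfadj T \<longleftrightarrow> complex_linear T \<and> adj T = T"

lemma selfadj_cl: "selfadj T \<Longrightarrow> complex_linear T"
  by (simp add: selfadj_def)

lemma selfadj_adj: "selfadj T \<Longrightarrow> adj T = T"
  by (simp add: selfadj_def)

lemma selfadj_swap: "selfadj T \<Longrightarrow> cinner (T x) y = cinner x (T y)"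
  by (metis adj_right selfadj_def)

lemma selfadj_Im: "selfadj T \<Longrightarrow> Im (cinner (T x) x) = 0"
  by (metis cinner_commute cnj.simps(2) equal_neg_zero selfadj_swap)

lemma selfadj_real: "selfadj T \<Longrightarrow> cinner (T x) x = of_real (qf T x)"
  by (simp add: complex_eq_iff selfadj_Im)

lemma selfadjI:
  assumes "complex_linear T" "\<And>x y. cinner (T x) y = cinner x (T y)"
  shows "selfadj T"
  using assms adj_unique selfadj_def by blast

text \<open>Polarization: reality at \<open>x + y\<close> makes the imaginary parts of
  \<open>cinner (T x) y\<close> and \<open>cinner (T y) x\<close> opposite, and the same fact with
  \<open>i x\<close> for \<open>x\<close> makes their real parts equal.\<close>

lemma selfadjI_real:
  assumes T: "complex_linear T" and r: "\<And>x. Im (cinner (T x) x) = 0"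
  shows "selfadj T"
proof (rule selfadjI[OF T])
  fix x y
  have 1: "Im (cinner (T x) y) + Im (cinner (T y) x) = 0" for x y
    using r[of "x + y"] r[of x] r[of y] by (simp add: blinfun.bilinear_simps cinner_simps)
  have "Re (cinner (T x) y) = Re (cinner (T y) x)"
    using 1[of "\<i> *\<^sub>C x" y] by (simp add: complex_linearD[OF T] cinner_simps)
  thus "cinner (T x) y = cinner x (T y)"
    using 1[of x y] cinner_commute[of x "T y"] by (simp add: complex_eq_iff)
qed

lemma selfadj_eqI:
  assumes "selfadj S" "selfadj T" "\<And>x. qf S x = qf T x"
  shows "S = T"
proof (rule blinfun_eqI, rule cinner_ext)
  fix x z
  define D where "D = S - T"
  have D: "selfadj D" using assms(1,2) by (simp add: D_def selfadj_def cl_diff adj_diff)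
  have q: "qf D x = 0" for x using assms(3)[of x] by (simp add: D_def blinfun.bilinear_simps cinner_simps)
  have 1: "Re (cinner (D x) y) = 0" for x y
  proof -
    have "Re (cinner (D x) y) + Re (cinner (D y) x) = 0"
      using q[of "x + y"] q[of x] q[of y] by (simp add: blinfun.bilinear_simps cinner_simps)
    moreover have "Re (cinner (D y) x) = Re (cinner (D x) y)"
      by (metis D Re_cinner_commute selfadj_swap)
    ultimately show ?thesis by simp
  qed
  have "Im (cinner (D x) z) = 0"
    using 1[of x "\<i> *\<^sub>C z"] by (simp add: cinner_simps)
  hence "cinner (D x) z = 0" using 1[of x z] by (simp add: complex_eq_iff)
  thus "cinner (S x) z = cinner (T x) z"
    by (simp add: D_def blinfun.bilinear_simps cinner_simps)
qed

lemma positive_op_iff: "positive_op T \<longleftrightarrow> selfadj T \<and> (\<forall>x. 0 \<le> qf T x)"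
proof
  assume T: "positive_op T"
  hence "Im (cinner (T x) x) = 0 \<and> 0 \<le> qf T x" for x
    by (auto simp: positive_op_def complex_nonneg_Reals_iff)
  thus "selfadj T \<and> (\<forall>x. 0 \<le> qf T x)"
    using T selfadjI_real by (auto simp: positive_op_def)
next
  assume "selfadj T \<and> (\<forall>x. 0 \<le> qf T x)"
  thus "positive_op T"
    by (auto simp: positive_op_def complex_nonneg_Reals_iff selfadj_cl selfadj_Im)
qed

lemma positive_selfadj: "positive_op T \<Longrightarrow> selfadj T"
  and positive_qf: "positive_op T \<Longrightarrow> 0 \<le> qf T x"
  by (auto simp: positive_op_iff)

lemma positive_cl: "positive_op T \<Longrightarrow> complex_linear T"
  by (simp add: positive_op_def)

lemma selfadj_id [simp]: "selfadj id_blinfun" by (simp add: selfadj_def)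
lemma selfadj_0 [simp]: "selfadj 0" by (simp add: selfadj_def)
lemma selfadj_add: "selfadj S \<Longrightarrow> selfadj T \<Longrightarrow> selfadj (S + T)"
  by (simp add: selfadj_def cl_add adj_add)
lemma selfadj_diff: "selfadj S \<Longrightarrow> selfadj T \<Longrightarrow> selfadj (S - T)"
  by (simp add: selfadj_def cl_diff adj_diff)
lemma selfadj_scaleR: "selfadj T \<Longrightarrow> selfadj (r *\<^sub>R T)"
  by (simp add: selfadj_def cl_scaleR adj_scaleR)
lemma selfadj_commuting: "selfadj S \<Longrightarrow> selfadj T \<Longrightarrow> S \<cdot> T = T \<cdot> S \<Longrightarrow> selfadj (S \<cdot> T)"
  by (simp add: selfadj_def cl_compose adj_compose)

lemma qf_add: "qf (S + T) x = qf S x + qf T x"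
  by (simp add: blinfun.bilinear_simps cinner_simps)
lemma qf_diff: "qf (S - T) x = qf S x - qf T x"
  by (simp add: blinfun.bilinear_simps cinner_simps)
lemma qf_scaleR: "qf (r *\<^sub>R T) x = r * qf T x"
  by (simp add: blinfun.bilinear_simps cinner_simps)
lemma qf_scale_arg: "qf T (r *\<^sub>R x) = r\<^sup>2 * qf T x"
  by (simp add: blinfun.bilinear_simps cinner_simps power2_eq_square)
lemma qf_id: "qf id_blinfun x = (norm x)\<^sup>2"
  by simp
lemma qf_conj: "complex_linear X \<Longrightarrow> qf (adj X \<cdot> T \<cdot> X) x = qf T (X x)"
  by (simp add: adj_left)
lemma qf_gram: "complex_linear X \<Longrightarrow> qf (adj X \<cdot> X) x = (norm (X x))\<^sup>2"
  by (simp add: adj_left)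
lemma qf_gram': "complex_linear X \<Longrightarrow> qf (X \<cdot> adj X) x = (norm (adj X x))\<^sup>2"
  by (simp add: adj_right)
lemma positive_0 [simp]: "positive_op 0" by (simp add: positive_op_iff)
lemma positive_id [simp]: "positive_op id_blinfun" by (simp add: positive_op_iff)
lemma positive_add: "positive_op S \<Longrightarrow> positive_op T \<Longrightarrow> positive_op (S + T)"
  by (simp add: positive_op_iff qf_add selfadj_add del: plus_blinfun.rep_eq)
lemma positive_scaleR: "0 \<le> r \<Longrightarrow> positive_op T \<Longrightarrow> positive_op (r *\<^sub>R T)"
  by (simp add: positive_op_iff qf_scaleR selfadj_scaleR del: scaleR_blinfun.rep_eq)
lemma selfadj_conj: "selfadj T \<Longrightarrow> complex_linear X \<Longrightarrow> selfadj (adj X \<cdot> T \<cdot> X)"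
  by (rule selfadjI) (auto intro!: cl_intros simp: adj_left adj_right selfadj_adj selfadj_cl)
lemma positive_conj: "positive_op T \<Longrightarrow> complex_linear X \<Longrightarrow> positive_op (adj X \<cdot> T \<cdot> X)"
  by (simp add: positive_op_iff selfadj_conj adj_left)
lemma positive_gram: "complex_linear X \<Longrightarrow> positive_op (adj X \<cdot> X)"
  using positive_conj[OF positive_id, of X] by (simp add: compose_simps)
lemma positive_gram': "complex_linear X \<Longrightarrow> positive_op (X \<cdot> adj X)"
  using positive_gram[OF cl_adj, of X] by (simp add: adj_adj)
lemma positive_square: "selfadj X \<Longrightarrow> positive_op (X \<cdot> X)"
  using positive_gram[of X] by (simp add: selfadj_def)

lemma qf_le_norm: "qf T x \<le> norm T * (norm x)\<^sup>2"
proof -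
  have "qf T x \<le> norm (T x) * norm x" by (rule Re_cauchy_schwarz)
  also have "\<dots> \<le> norm T * norm x * norm x" by (intro mult_right_mono norm_blinfun) auto
  finally show ?thesis by (simp add: power2_eq_square mult.assoc)
qed

lemma positive_cauchy_schwarz:
  assumes T: "positive_op T"
  shows "(cmod (cinner (T x) y))\<^sup>2 \<le> qf T x * qf T y"
proof (rule quadratic_nonneg)
  fix c
  have "Re (c * cinner (T y) x) = Re (cnj c * cinner (T x) y)"
    using cinner_commute[of "T y" x] selfadj_swap[OF positive_selfadj[OF T], of x y]
    by simp
  moreover have "Re (c * (cnj c * cinner (T y) y)) = (cmod c)\<^sup>2 * qf T y"
  proof -
    have "c * (cnj c * cinner (T y) y) = of_real ((cmod c)\<^sup>2) * cinner (T y) y"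
      by (metis complex_norm_square mult.assoc)
    thus ?thesis by (simp only: Re_complex_of_real times_complex.sel Im_complex_of_real)
  qed
  moreover have "qf T (x + c *\<^sub>C y) = qf T x + Re (cnj c * cinner (T x) y)
      + Re (c * cinner (T y) x) + Re (c * (cnj c * cinner (T y) y))"
    by (simp only: blinfun.bilinear_simps cinner_simps complex_linearD[OF positive_cl[OF T]] plus_complex.sel)
      (simp only: mult.left_commute[of c "cnj c"] add_ac distrib_left plus_complex.sel)
  ultimately show "0 \<le> qf T x + 2 * Re (cnj c * cinner (T x) y) + (cmod c)\<^sup>2 * qf T y"
    using positive_qf[OF T, of "x + c *\<^sub>C y"] by linarith
qed (simp add: positive_qf[OF T])

lemma positive_qf_zero:
  assumes T: "positive_op T" and "qf T x = 0"
  shows "T x = 0"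
proof -
  have "(cmod (cinner (T x) (T x)))\<^sup>2 \<le> 0"
    using positive_cauchy_schwarz[OF T, of x "T x"] assms(2) by simp
  thus ?thesis by (simp add: cinner_self)
qed

text \<open>This is \<open>T^2 <= c T\<close>, obtained from the Cauchy-Schwarz inequality of the
  form of \<open>T\<close> at \<open>x\<close> and \<open>T x\<close>. Square roots would give it
  too, but their construction relies on it through monotone limits.\<close>

lemma positive_norm_square_le:
  assumes T: "positive_op T" and c: "\<And>y. qf T y \<le> c * (norm y)\<^sup>2"
  shows "(norm (T x))\<^sup>2 \<le> c * qf T x"
proof (cases "T x = 0")
  case True thus ?thesis by simp
next
  case False
  let ?n = "(norm (T x))\<^sup>2"
  have "?n * ?n \<le> qf T x * qf T (T x)"
    using positive_cauchy_schwarz[OF T, of x "T x"]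
    by (simp add: cinner_self power2_eq_square norm_mult)
  also have "\<dots> \<le> qf T x * (c * ?n)" by (intro mult_left_mono c positive_qf[OF T])
  finally have "?n * ?n \<le> (c * qf T x) * ?n" by (simp add: mult_ac)
  moreover have "?n > 0" using False by simp
  ultimately show ?thesis by (rule mult_right_le_imp_le)
qed

lemma positive_norm_le:
  assumes T: "positive_op T" and c: "\<And>y. qf T y \<le> c * (norm y)\<^sup>2" and "0 \<le> c"
  shows "norm T \<le> c"
proof (rule norm_blinfun_bound[OF \<open>0 \<le> c\<close>])
  fix x
  have "(norm (T x))\<^sup>2 \<le> c * (c * (norm x)\<^sup>2)"
    using positive_norm_square_le[OF T c, of x] c[of x] \<open>0 \<le> c\<close> by (meson mult_left_mono order_trans)
  also have "\<dots> = (c * norm x)\<^sup>2" by (simp add: power2_eq_square mult_ac)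
  finally show "norm (T x) \<le> c * norm x"
    using \<open>0 \<le> c\<close> by (meson mult_nonneg_nonneg norm_ge_zero power2_le_imp_le)
qed

lemma op_le_qf: "op_le S T \<Longrightarrow> qf S x \<le> qf T x"
  using positive_qf[of "T - S" x] by (simp add: op_le_def qf_diff del: minus_blinfun.rep_eq)

lemma op_leI: "selfadj S \<Longrightarrow> selfadj T \<Longrightarrow> (\<And>x. qf S x \<le> qf T x) \<Longrightarrow> op_le S T"
  by (simp add: op_le_def positive_op_iff selfadj_diff qf_diff del: minus_blinfun.rep_eq)

subsection \<open>Strong limits\<close>

abbreviation slim :: "(nat \<Rightarrow> 'h::chilbert_space oper) \<Rightarrow> 'h oper \<Rightarrow> bool" where
  "slim F S \<equiv> (\<forall>x. (\<lambda>n. F n x) \<longlonglongrightarrow> S x)"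

lemma limitin_sot: "limitin strong_operator_topology F S sequentially \<longleftrightarrow> slim F S"
proof
  assume L: "limitin strong_operator_topology F S sequentially"
  show "slim F S"
  proof
    fix x
    have "limitin euclidean ((\<lambda>f. blinfun_apply f x) \<circ> F) (blinfun_apply S x) sequentially"
      by (rule continuous_map_limit[OF strong_operator_topology_continuous_evaluation L])
    thus "(\<lambda>n. F n x) \<longlonglongrightarrow> S x" by (simp add: o_def)
  qed
next
  assume L: "slim F S"
  show "limitin strong_operator_topology F S sequentially"
    unfolding limitin_def strong_operator_topology_topspace
  proof (intro conjI allI impI UNIV_I)
    fix U assume U: "openin strong_operator_topology U \<and> S \<in> U"
    then obtain W where W: "open W" "U = blinfun_apply -` W"
      by (auto simp: strong_operator_topology_def openin_pullback_topology)
    have "(\<lambda>n. blinfun_apply (F n)) \<longlonglongrightarrow> blinfun_apply S"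
    proof -
      have "limitin (product_topology (\<lambda>i. euclidean) UNIV) (\<lambda>n. blinfun_apply (F n)) (blinfun_apply S) sequentially"
        using L by (simp add: limitin_componentwise extensional_UNIV)
      thus ?thesis by (simp add: euclidean_product_topology)
    qed
    thus "\<forall>\<^sub>F n in sequentially. F n \<in> U"
      using W U topological_tendstoD[of _ _ sequentially W] by auto
  qed
qed

lemma sot_sums_iff: "sot_sums F S \<longleftrightarrow> (\<forall>x. (\<lambda>j. F j x) sums S x)"
  by (simp add: sot_sums_def limitin_sot sums_def blinfun.sum_left)

lemma strong_limit_exists:
  fixes X :: "nat \<Rightarrow> 'h::chilbert_space oper"
  assumes conv: "\<And>x. convergent (\<lambda>n. X n x)" and bd: "\<And>n x. norm (X n x) \<le> c * norm x"
    and c: "\<And>n. complex_linear (X n)"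
  shows "\<exists>Y. complex_linear Y \<and> slim X Y \<and> (\<forall>x. norm (Y x) \<le> c * norm x)"
proof -
  define f where "f x = lim (\<lambda>n. X n x)" for x
  have f: "(\<lambda>n. X n x) \<longlonglongrightarrow> f x" for x
    unfolding f_def using conv by (simp add: convergent_LIMSEQ_iff)
  have nf: "norm (f x) \<le> c * norm x" for x
    using tendsto_norm[OF f[of x]] bd by (intro LIMSEQ_le_const2) auto
  have "bounded_linear f"
  proof (rule bounded_linear_intro[where K = c])
    show "f (x + y) = f x + f y" for x y
      using tendsto_add[OF f[of x] f[of y]] f[of "x + y"]
      by (simp add: blinfun.bilinear_simps LIMSEQ_unique)
    show "f (r *\<^sub>R x) = r *\<^sub>R f x" for r x
      using tendsto_scaleR[OF tendsto_const f[of x], of r] f[of "r *\<^sub>R x"]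
      by (simp add: blinfun.bilinear_simps LIMSEQ_unique)
    show "norm (f x) \<le> norm x * c" for x using nf[of x] by (simp add: mult.commute)
  qed
  hence B: "blinfun_apply (Blinfun f) = f" by (rule bounded_linear_Blinfun_apply)
  have sc: "f (a *\<^sub>C x) = a *\<^sub>C f x" for a x
  proof -
    have "bounded_linear (\<lambda>x::'h. a *\<^sub>C x)"
      by (rule bounded_linear_intro[where K = "cmod a"])
        (simp_all add: scaleC_add_right scaleC_scaleR_commute norm_scaleC mult.commute)
    from bounded_linear.tendsto[OF this f[of x]] f[of "a *\<^sub>C x"] show ?thesis
      by (simp add: complex_linearD[OF c] LIMSEQ_unique)
  qed
  show ?thesis
    by (rule exI[of _ "Blinfun f"]) (auto simp: B complex_linear_def sc f nf)
qed

lemma slim_unique: "slim F S \<Longrightarrow> slim F T \<Longrightarrow> S = T"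
  by (rule blinfun_eqI) (metis LIMSEQ_unique)

lemma slim_cl:
  assumes "slim F (S::'h::chilbert_space oper)" and "\<And>n. complex_linear (F n)"
  shows "complex_linear S"
  unfolding complex_linear_def
proof (intro allI)
  fix c x
  have "bounded_linear (\<lambda>x::'h. c *\<^sub>C x)"
    by (rule bounded_linear_intro[where K = "cmod c"])
      (simp_all add: scaleC_add_right scaleC_scaleR_commute norm_scaleC mult.commute)
  from bounded_linear.tendsto[OF this assms(1)[rule_format]] assms(2)
  have "(\<lambda>n. F n (c *\<^sub>C x)) \<longlonglongrightarrow> c *\<^sub>C S x"
    by (simp add: complex_linearD)
  thus "S (c *\<^sub>C x) = c *\<^sub>C S x" using assms(1) LIMSEQ_unique by blast
qed

lemma slim_commute:
  assumes "slim F S" "\<And>n. F n \<cdot> T = T \<cdot> F n"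
  shows "S \<cdot> T = T \<cdot> S"
proof (rule blinfun_eqI)
  fix x
  have e: "F n (T x) = T (F n x)" for n
    using assms(2)[of n] by (metis blinfun_apply_blinfun_compose)
  have "(\<lambda>n. blinfun_apply (F n) (blinfun_apply T x)) \<longlonglongrightarrow> blinfun_apply T (blinfun_apply S x)"
    unfolding e using assms(1) by (intro blinfun.tendsto[OF tendsto_const]) auto
  thus "blinfun_apply (S \<cdot> T) x = blinfun_apply (T \<cdot> S) x"
    using assms(1) LIMSEQ_unique by auto
qed

lemma slim_selfadj:
  assumes "slim F S" "\<And>n. selfadj (F n)"
  shows "selfadj S"
proof (rule selfadjI)
  show "complex_linear S" by (rule slim_cl[OF assms(1)]) (simp add: selfadj_cl assms(2))
  fix x y
  have 1: "(\<lambda>n. cinner (F n x) y) \<longlonglongrightarrow> cinner (S x) y"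
    using assms(1) by (intro cinner.tendsto tendsto_const) auto
  have 2: "(\<lambda>n. cinner x (F n y)) \<longlonglongrightarrow> cinner x (S y)"
    using assms(1) by (intro cinner.tendsto tendsto_const) auto
  show "cinner (S x) y = cinner x (S y)"
    using 1 2 selfadj_swap[OF assms(2)] LIMSEQ_unique by simp
qed

lemma slim_qf: "slim F S \<Longrightarrow> (\<lambda>n. qf (F n) x) \<longlonglongrightarrow> qf S x"
  by (intro tendsto_Re cinner.tendsto tendsto_const) auto

lemma slim_positive:
  assumes "slim F S" "\<And>n. positive_op (F n)"
  shows "positive_op S"
  using slim_selfadj[OF assms(1)] assms(2) LIMSEQ_le_const[OF slim_qf[OF assms(1)]]
  by (auto simp: positive_op_iff)

text \<open>Vigier's theorem. The numbers \<open>qf (X n) x\<close> converge by monotonicity, and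
  \<open>positive_norm_square_le\<close> for the differences turns this into the Cauchy property of
  \<open>X n x\<close>.\<close>

lemma increasing_strong_limit:
  fixes X :: "nat \<Rightarrow> 'h::chilbert_space oper"
  assumes sa: "\<And>n. selfadj (X n)" and inc: "\<And>n x. qf (X n) x \<le> qf (X (Suc n)) x"
    and bd: "\<And>n x. qf (X n) x \<le> c * (norm x)\<^sup>2"
  shows "\<exists>Y. selfadj Y \<and> slim X Y \<and> (\<forall>n x. qf (X n) x \<le> qf Y x)"
proof -
  have mono: "qf (X m) x \<le> qf (X n) x" if "m \<le> n" for m n x
    using lift_Suc_mono_le[of "\<lambda>n. qf (X n) x", OF inc that] .
  \<comment> \<open>The forms of the differences are at most \<open>c + norm (X 0)\<close>; the
    absolute value keeps the constant nonnegative when \<open>c\<close> is negative.\<close>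
  define d where "d = \<bar>c\<bar> + norm (X 0)"
  have d: "c + norm (X 0) \<le> d" "0 \<le> d" by (auto simp: d_def)
  have pos: "positive_op (X n - X m)" if "m \<le> n" for m n
    using mono[OF that] sa by (simp add: positive_op_iff selfadj_diff qf_diff del: minus_blinfun.rep_eq)
  have lo: "- norm (X 0) * (norm x)\<^sup>2 \<le> qf (X n) x" for n x
    using qf_le_norm[of "- X 0" x] mono[of 0 n x]
    by (simp add: blinfun.bilinear_simps cinner_simps)
  have bdd: "qf (X n - X m) x \<le> d * (norm x)\<^sup>2" for m n x
  proof -
    have "qf (X n - X m) x \<le> (c + norm (X 0)) * (norm x)\<^sup>2"
      using bd[of n x] lo[of x m] by (simp add: qf_diff algebra_simps del: minus_blinfun.rep_eq)
    also have "\<dots> \<le> d * (norm x)\<^sup>2" using d by (intro mult_right_mono) auto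
    finally show ?thesis .
  qed
  have key: "(norm (X n x - X m x))\<^sup>2 \<le> d * (qf (X n) x - qf (X m) x)" if "m \<le> n" for m n x
    using positive_norm_square_le[OF pos[OF that] bdd, of x]
    by (simp add: blinfun.bilinear_simps cinner_simps)
  have conv: "convergent (\<lambda>n. X n x)" for x
  proof -
    have "Bseq (\<lambda>n. qf (X n) x)"
    proof (rule BseqI'[where K = "norm (X 0) * (norm x)\<^sup>2 + \<bar>c\<bar> * (norm x)\<^sup>2"])
      fix n
      have "c * (norm x)\<^sup>2 \<le> \<bar>c\<bar> * (norm x)\<^sup>2" by (intro mult_right_mono) auto
      moreover have "0 \<le> norm (X 0) * (norm x)\<^sup>2" "0 \<le> \<bar>c\<bar> * (norm x)\<^sup>2" by auto
      ultimately show "norm (qf (X n) x) \<le> norm (X 0) * (norm x)\<^sup>2 + \<bar>c\<bar> * (norm x)\<^sup>2"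
        using lo[of x n] bd[of n x] by (simp only: real_norm_def abs_le_iff) linarith
    qed
    moreover have "monoseq (\<lambda>n. qf (X n) x)" using mono by (intro monoI1) auto
    ultimately have "Cauchy (\<lambda>n. qf (X n) x)"
      using Bseq_monoseq_convergent Cauchy_convergent_iff by blast
    have "Cauchy (\<lambda>n. X n x)"
    proof (rule metric_CauchyI)
      fix e :: real assume e: "e > 0"
      hence "e\<^sup>2 / (d + 1) > 0" using d(2) by simp
      then obtain N where N: "\<And>m n. m \<ge> N \<Longrightarrow> n \<ge> N \<Longrightarrow> dist (qf (X m) x) (qf (X n) x) < e\<^sup>2 / (d + 1)"
        using \<open>Cauchy (\<lambda>n. qf (X n) x)\<close> unfolding Cauchy_def by metis
      have le: "norm (X n x - X m x) < e" if "N \<le> m" "m \<le> n" for m n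
      proof -
        have "qf (X n) x - qf (X m) x \<ge> 0" using mono[OF that(2)] by simp
        hence "d * (qf (X n) x - qf (X m) x) \<le> (d + 1) * (qf (X n) x - qf (X m) x)"
          by (intro mult_right_mono) auto
        moreover have "(d + 1) * (qf (X n) x - qf (X m) x) < e\<^sup>2"
          using N[of n m] that d(2) \<open>qf (X n) x - qf (X m) x \<ge> 0\<close>
          by (simp only: dist_real_def abs_of_nonneg) (simp add: pos_less_divide_eq mult.commute)
        ultimately have "(norm (X n x - X m x))\<^sup>2 < e\<^sup>2"
          using key[OF that(2), of x] by linarith
        thus ?thesis using e by (meson less_eq_real_def power_less_imp_less_base)
      qed
      show "\<exists>M. \<forall>m\<ge>M. \<forall>n\<ge>M. dist (X m x) (X n x) < e"
      proof (intro exI[of _ N] allI impI)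
        fix m n assume "N \<le> m" "N \<le> n"
        thus "dist (blinfun_apply (X m) x) (blinfun_apply (X n) x) < e"
          using le[of m n] le[of n m] by (cases "m \<le> n") (auto simp: dist_norm norm_minus_commute)
      qed
    qed
    thus ?thesis by (simp add: Cauchy_convergent_iff)
  qed
  have nb: "norm (X n x) \<le> (norm (X 0) + d) * norm x" for n x
  proof -
    have "norm (X n - X 0) \<le> d" by (rule positive_norm_le[OF pos bdd d(2)]) simp
    hence "norm ((X n - X 0) x) \<le> d * norm x"
      by (meson mult_right_mono norm_blinfun norm_ge_zero order_trans)
    thus ?thesis using norm_blinfun[of "X 0" x] norm_triangle_sub[of "X n x" "X 0 x"]
      by (simp add: blinfun.bilinear_simps algebra_simps)
  qed
  obtain Y where Y: "slim X Y"
    using strong_limit_exists[OF conv nb] sa selfadj_cl by metis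
  have "qf (X n) x \<le> qf Y x" for n x
    by (rule LIMSEQ_le_const[OF slim_qf[OF Y, of x]]) (auto intro!: exI[of _ n] mono)
  thus ?thesis using Y slim_selfadj[OF Y sa] by blast
qed

subsection \<open>Square roots\<close>

text \<open>\<open>nonneg_polys X\<close> consists of the polynomials in \<open>X\<close> with nonnegative coefficients; the
  increments of the iteration below lie in it, so that they are positive when \<open>X\<close> is.\<close>

inductive nonneg_polys :: "'h::chilbert_space oper \<Rightarrow> 'h oper \<Rightarrow> bool" for X where
  pow: "nonneg_polys X (((o\<^sub>L) X ^^ k) id_blinfun)"
| zero: "nonneg_polys X 0"
| add: "nonneg_polys X S \<Longrightarrow> nonneg_polys X T \<Longrightarrow> nonneg_polys X (S + T)"
| scale: "nonneg_polys X S \<Longrightarrow> 0 \<le> r \<Longrightarrow> nonneg_polys X (r *\<^sub>R S)"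

lemma opow_add: "((o\<^sub>L) X ^^ (m + n)) id_blinfun = ((o\<^sub>L) X ^^ m) id_blinfun \<cdot> ((o\<^sub>L) X ^^ n) id_blinfun"
  by (induction m) (simp_all add: compose_id_left compose_assoc)

lemma nonneg_polys_mult:
  assumes "nonneg_polys X S" "nonneg_polys X T"
  shows "nonneg_polys X (S \<cdot> T)"
  using assms(1)
proof induction
  case (pow k)
  show ?case using assms(2)
  proof induction
    case (pow j)
    show ?case using nonneg_polys.pow[of X "k + j"] by (simp add: opow_add)
  qed (simp_all add: compose_simps nonneg_polys.intros)
qed (simp_all add: compose_simps nonneg_polys.intros)

lemma nonneg_polys_commute:
  assumes "nonneg_polys X S" "X \<cdot> T = T \<cdot> X"
  shows "S \<cdot> T = T \<cdot> S"
  using assms(1)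
proof induction
  case (pow k)
  show ?case
  proof (induction k)
    case (Suc k)
    thus ?case by (simp add: compose_assoc) (metis assms(2) compose_assoc)
  qed (simp add: compose_simps)
qed (simp_all add: compose_simps)

lemma opow_commute: "((o\<^sub>L) X ^^ k) id_blinfun \<cdot> X = X \<cdot> ((o\<^sub>L) X ^^ k) id_blinfun"
  by (induction k) (simp_all add: compose_simps compose_assoc)

lemma selfadj_opow: "selfadj X \<Longrightarrow> selfadj (((o\<^sub>L) X ^^ k) id_blinfun)"
  by (induction k) (auto intro!: selfadj_commuting simp: opow_commute)

lemma nonneg_polys_positive:
  assumes X: "positive_op X" and "nonneg_polys X S"
  shows "positive_op S"
  using assms(2)
proof induction
  case (pow k)
  \<comment> \<open>\<open>X^k\<close> is \<open>Z Z\<close> or \<open>Z X Z\<close>, a square or a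
    congruence of \<open>X\<close>.\<close>
  define Z where "Z = ((o\<^sub>L) X ^^ (k div 2)) id_blinfun"
  have Z: "selfadj Z" unfolding Z_def by (rule selfadj_opow[OF positive_selfadj[OF X]])
  show ?case
  proof (cases "even k")
    case True
    hence "k = k div 2 + k div 2" by presburger
    hence "((o\<^sub>L) X ^^ k) id_blinfun = Z \<cdot> Z" unfolding Z_def by (metis opow_add)
    thus ?thesis using positive_square[OF Z] by simp
  next
    case False
    hence "k = k div 2 + Suc (k div 2)" by presburger
    hence "((o\<^sub>L) X ^^ k) id_blinfun = Z \<cdot> (X \<cdot> Z)"
      unfolding Z_def by (metis opow_add funpow.simps(2) comp_apply)
    also have "\<dots> = adj Z \<cdot> X \<cdot> Z" using Z by (simp add: selfadj_adj compose_assoc)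
    finally show ?thesis using positive_conj[OF X selfadj_cl[OF Z]] by simp
  qed
qed (auto intro: positive_add positive_scaleR)

lemma sqrt_exists_contraction:
  assumes T: "positive_op T" and le: "\<And>x. qf T x \<le> (norm x)\<^sup>2"
  shows "\<exists>R. positive_op R \<and> R \<cdot> R = T \<and> (\<forall>S. T \<cdot> S = S \<cdot> T \<longrightarrow> R \<cdot> S = S \<cdot> R)"
proof -
  define X where "X = id_blinfun - T"
  have X: "positive_op X" using T le
    by (simp add: X_def positive_op_iff selfadj_diff qf_diff del: minus_blinfun.rep_eq)
  have Xle: "qf X x \<le> (norm x)\<^sup>2" for x
    using positive_qf[OF T, of x] by (simp add: X_def qf_diff del: minus_blinfun.rep_eq)
  have Xn: "norm (X x) \<le> norm x" for x
  proof -
    have "norm X \<le> 1" by (rule positive_norm_le[OF X]) (use Xle in auto)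
    thus ?thesis by (metis mult_1 mult_right_mono norm_blinfun norm_ge_zero order_trans)
  qed
  \<comment> \<open>The equation \<open>(I - Z)^2 = I - X\<close> reads
    \<open>Z = (X + Z^2) / 2\<close>, which is iterated from \<open>0\<close>; the limit is the
    power series of \<open>1 - sqrt (1 - t)\<close> at \<open>X\<close>.\<close>
  define Y where "Y = rec_nat (0::'a oper) (\<lambda>_ Y. (1/2) *\<^sub>R (X + (Y \<cdot> Y)))"
  have Y0: "Y 0 = 0" and YS: "\<And>n. Y (Suc n) = (1/2) *\<^sub>R (X + (Y n \<cdot> Y n))" by (simp_all add: Y_def)
  have polX: "nonneg_polys X X" using nonneg_polys.pow[of X 1] by (simp add: compose_simps)
  have pol: "nonneg_polys X (Y n)" for n
    by (induction n) (auto simp: Y0 YS intro!: nonneg_polys.zero nonneg_polys.add nonneg_polys.scale nonneg_polys_mult polX)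
  have inc: "nonneg_polys X (Y (Suc n) - Y n)" for n
  proof (induction n)
    case 0 show ?case by (auto simp: Y0 YS compose_simps intro!: nonneg_polys.add nonneg_polys.scale polX)
  next
    case (Suc n)
    have c: "Y n \<cdot> Y (Suc n) = Y (Suc n) \<cdot> Y n"
      by (rule nonneg_polys_commute[OF pol]) (metis nonneg_polys_commute[OF pol])
    have "Y (Suc (Suc n)) - Y (Suc n) = (1/2) *\<^sub>R ((Y (Suc n) \<cdot> Y (Suc n)) - (Y n \<cdot> Y n))"
      by (subst YS, subst (3) YS) (simp add: scaleR_diff_right[symmetric])
    also have "(Y (Suc n) \<cdot> Y (Suc n)) - (Y n \<cdot> Y n) = (Y (Suc n) + Y n) \<cdot> (Y (Suc n) - Y n)"
      using c by (simp add: compose_simps)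
    finally show ?case
      using Suc pol by (auto intro!: nonneg_polys.scale nonneg_polys_mult nonneg_polys.add)
  qed
  have Yp: "positive_op (Y n)" for n by (rule nonneg_polys_positive[OF X pol])
  have Yn: "norm (Y n x) \<le> norm x" for n x
  proof (induction n arbitrary: x)
    case (Suc n)
    have "norm ((Y (Suc n)) x) \<le> (1/2) * (norm (X x) + norm (Y n (Y n x)))"
      by (simp add: YS blinfun.bilinear_simps norm_triangle_ineq)
    also have "\<dots> \<le> (1/2) * (norm x + norm x)"
      using Xn[of x] Suc[of x] Suc[of "Y n x"] by simp
    finally show ?case by simp
  qed (simp add: Y0)
  have Yq: "qf (Y n) x \<le> 1 * (norm x)\<^sup>2" for n x
  proof -
    have "qf (Y n) x \<le> norm (Y n x) * norm x" by (rule Re_cauchy_schwarz)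
    also have "\<dots> \<le> norm x * norm x" by (intro mult_right_mono Yn) auto
    finally show ?thesis by (simp add: power2_eq_square)
  qed
  have Yi: "qf (Y n) x \<le> qf (Y (Suc n)) x" for n x
    using positive_qf[OF nonneg_polys_positive[OF X inc], of n x] by (simp add: qf_diff del: minus_blinfun.rep_eq)
  then obtain Z where Z: "selfadj Z" "slim Y Z"
    using increasing_strong_limit[of Y 1, OF positive_selfadj[OF Yp] Yi Yq] by metis
  have Zq: "qf Z x \<le> (norm x)\<^sup>2" for x
    by (rule LIMSEQ_le_const2[OF slim_qf[OF Z(2), of x]]) (use Yq in auto)
  have ZZ: "slim (\<lambda>n. Y n \<cdot> Y n) (Z \<cdot> Z)"
  proof
    fix x
    have "(\<lambda>n. Y n (Y n x - Z x)) \<longlonglongrightarrow> 0"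
    proof (rule Lim_null_comparison)
      show "(\<lambda>n. norm (Y n x - Z x)) \<longlonglongrightarrow> 0"
        using Z(2) by (simp add: LIM_zero tendsto_norm_zero)
    qed (simp add: Yn)
    from tendsto_add[OF this Z(2)[rule_format, of "blinfun_apply Z x"]]
    show "(\<lambda>n. blinfun_apply (Y n \<cdot> Y n) x) \<longlonglongrightarrow> blinfun_apply (Z \<cdot> Z) x"
      by (simp add: blinfun.bilinear_simps)
  qed
  have Zfix: "Z = (1/2) *\<^sub>R (X + (Z \<cdot> Z))"
  proof (rule slim_unique)
    show "slim (\<lambda>n. Y (Suc n)) Z"
    proof
      fix x show "(\<lambda>n. (Y (Suc n)) x) \<longlonglongrightarrow> Z x"
        by (rule LIMSEQ_Suc) (simp add: Z(2))
    qed
    show "slim (\<lambda>n. Y (Suc n)) ((1/2) *\<^sub>R (X + (Z \<cdot> Z)))"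
    proof
      fix x
      have "(\<lambda>n. (1/2) *\<^sub>R (blinfun_apply X x + blinfun_apply (Y n \<cdot> Y n) x)) \<longlonglongrightarrow> (1/2) *\<^sub>R (blinfun_apply X x + blinfun_apply (Z \<cdot> Z) x)"
        by (intro tendsto_scaleR[OF tendsto_const] tendsto_add[OF tendsto_const] ZZ[rule_format])
      thus "(\<lambda>n. (Y (Suc n)) x) \<longlonglongrightarrow> ((1/2) *\<^sub>R (X + (Z \<cdot> Z))) x"
        by (simp add: YS blinfun.bilinear_simps)
    qed
  qed
  define R where "R = id_blinfun - Z"
  have "positive_op R" using Z(1) Zq by (simp add: R_def positive_op_iff selfadj_diff qf_diff del: minus_blinfun.rep_eq)
  moreover have "R \<cdot> R = T"
  proof -
    have "2 *\<^sub>R Z = X + (Z \<cdot> Z)" by (subst Zfix) simp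
    hence "Z \<cdot> Z = 2 *\<^sub>R Z - X" by simp
    thus ?thesis by (simp add: R_def compose_simps X_def scaleR_2)
  qed
  moreover have "R \<cdot> S = S \<cdot> R" if "T \<cdot> S = S \<cdot> T" for S
  proof -
    have "X \<cdot> S = S \<cdot> X" using that by (simp add: X_def compose_simps)
    hence "Z \<cdot> S = S \<cdot> Z" by (intro slim_commute[OF Z(2)] nonneg_polys_commute[OF pol])
    thus ?thesis by (simp add: R_def compose_simps)
  qed
  ultimately show ?thesis by blast
qed

lemma sqrt_exists:
  assumes T: "positive_op T"
  shows "\<exists>R. positive_op R \<and> R \<cdot> R = T \<and> (\<forall>S. T \<cdot> S = S \<cdot> T \<longrightarrow> R \<cdot> S = S \<cdot> R)"
proof -
  define c where "c = norm T + 1"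
  have c: "c > 0" by (simp add: c_def add_nonneg_pos)
  have q: "qf ((1/c) *\<^sub>R T) x \<le> (norm x)\<^sup>2" for x
  proof -
    have "qf T x \<le> c * (norm x)\<^sup>2" using qf_le_norm[of T x] by (simp add: c_def distrib_right add_increasing2)
    thus ?thesis using c by (simp add: qf_scaleR field_simps del: scaleR_blinfun.rep_eq)
  qed
  have p: "positive_op ((1/c) *\<^sub>R T)" using c T by (intro positive_scaleR) auto
  from sqrt_exists_contraction[OF p q] obtain R where
    R: "positive_op R" "R \<cdot> R = (1/c) *\<^sub>R T" "\<And>S. ((1/c) *\<^sub>R T) \<cdot> S = S \<cdot> ((1/c) *\<^sub>R T) \<Longrightarrow> R \<cdot> S = S \<cdot> R"
    by blast
  show ?thesis
  proof (intro exI[of _ "sqrt c *\<^sub>R R"] conjI allI impI)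
    show "positive_op (sqrt c *\<^sub>R R)" using R(1) c by (auto intro: positive_scaleR)
    show "sqrt c *\<^sub>R R \<cdot> sqrt c *\<^sub>R R = T" using R(2) c by (simp add: compose_simps)
    show "sqrt c *\<^sub>R R \<cdot> S = S \<cdot> sqrt c *\<^sub>R R" if "T \<cdot> S = S \<cdot> T" for S
      using R(3)[of S] that by (simp add: compose_simps)
  qed
qed

subsection \<open>Projections\<close>

lemma proj_selfadj: "projection_op P \<Longrightarrow> selfadj P"
  by (simp add: projection_op_def selfadj_def)

lemma proj_cl: "projection_op P \<Longrightarrow> complex_linear P"
  by (simp add: projection_op_def)

lemma proj_adj: "projection_op P \<Longrightarrow> adj P = P"
  by (simp add: projection_op_def)

lemma proj_idem: "projection_op P \<Longrightarrow> P \<cdot> P = P"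
  by (simp add: projection_op_def)

lemma proj_idem_apply: "projection_op P \<Longrightarrow> P (P x) = P x"
  by (metis blinfun_apply_blinfun_compose proj_idem)

lemma projI: "selfadj P \<Longrightarrow> P \<cdot> P = P \<Longrightarrow> projection_op P"
  by (simp add: projection_op_def selfadj_def)

lemma proj_id [simp]: "projection_op id_blinfun" by (rule projI) (simp_all add: compose_simps)
lemma proj_0 [simp]: "projection_op 0" by (rule projI) simp_all

lemma qf_proj: "projection_op P \<Longrightarrow> qf P x = (norm (P x))\<^sup>2"
  by (metis Re_cinner_self proj_idem_apply proj_selfadj selfadj_swap)

lemma proj_positive: "projection_op P \<Longrightarrow> positive_op P"
  by (simp add: positive_op_iff proj_selfadj qf_proj)

lemma proj_complement: "projection_op P \<Longrightarrow> projection_op (id_blinfun - P)"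
  by (rule projI) (simp_all add: selfadj_diff proj_selfadj compose_simps proj_idem)

lemma proj_split_norm:
  "projection_op P \<Longrightarrow> (norm x)\<^sup>2 = (norm (P x))\<^sup>2 + (norm (x - P x))\<^sup>2"
proof -
  assume P: "projection_op P"
  have "cinner (P x) (x - P x) = 0"
    by (simp add: selfadj_swap[OF proj_selfadj[OF P]] blinfun.bilinear_simps proj_idem_apply[OF P])
  from pythagoras[OF this] show ?thesis by simp
qed

lemma norm_proj_le: "projection_op P \<Longrightarrow> norm (P x) \<le> norm x"
  by (rule power2_le_imp_le) (simp_all add: proj_split_norm[of P x])

lemma proj_norm_eq: "projection_op P \<Longrightarrow> norm (P x) = norm x \<Longrightarrow> P x = x"
  using proj_split_norm[of P x] by simp

lemma proj_range: "projection_op P \<Longrightarrow> range (blinfun_apply P) = {x. P x = x}"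
  by (auto simp: proj_idem_apply) (metis rangeI)

lemma proj_eqI:
  assumes P: "projection_op P" and Q: "projection_op Q"
    and eq: "\<And>x. P x = x \<longleftrightarrow> Q x = x"
  shows "P = Q"
proof -
  have "Q \<cdot> P = P" by (rule blinfun_eqI) (simp add: eq[symmetric] proj_idem_apply[OF P])
  moreover have "P \<cdot> Q = Q" by (rule blinfun_eqI) (simp add: eq proj_idem_apply[OF Q])
  moreover have "adj (Q \<cdot> P) = P \<cdot> Q" using P Q by (simp add: adj_compose proj_adj proj_cl)
  ultimately show ?thesis using proj_adj[OF P] by simp
qed

text \<open>Takes adjoints of an operator identity. The three adjoints are separate variables, so
  that a call can supply them in simplified form.\<close>

lemma compose_flip:
  "\<lbrakk>P \<cdot> Q = R; complex_linear P; complex_linear Q; adj P = P'; adj Q = Q'; adj R = R'\<rbrakk> \<Longrightarrow> Q' \<cdot> P' = R'"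
  using adj_compose[of P Q] by simp

lemma proj_le_iff:
  assumes P: "projection_op P" and Q: "projection_op Q"
  shows "op_le P Q \<longleftrightarrow> Q \<cdot> P = P"
proof
  assume le: "op_le P Q"
  show "Q \<cdot> P = P"
  proof (rule blinfun_eqI)
    fix x
    let ?y = "P x"
    have "(norm ?y)\<^sup>2 \<le> (norm (Q ?y))\<^sup>2"
      using op_le_qf[OF le, of ?y] by (simp add: qf_proj P Q proj_idem_apply)
    hence "norm ?y \<le> norm (blinfun_apply Q ?y)" by simp
    hence "blinfun_apply Q ?y = ?y" using norm_proj_le[OF Q, of ?y] by (intro proj_norm_eq[OF Q]) simp
    thus "blinfun_apply (Q \<cdot> P) x = blinfun_apply P x" by simp
  qed
next
  assume eq: "Q \<cdot> P = P"
  have eq': "P \<cdot> Q = P" by (rule compose_flip[OF eq]) (simp_all add: P Q proj_cl proj_adj)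
  show "op_le P Q"
  proof (rule op_leI)
    fix x
    have "norm (P x) = norm (P (Q x))"
      by (metis blinfun_apply_blinfun_compose eq')
    also have "\<dots> \<le> norm (Q x)" by (rule norm_proj_le[OF P])
    finally show "qf P x \<le> qf Q x" by (simp add: qf_proj P Q)
  qed (simp_all add: P Q proj_selfadj)
qed

lemma proj_flip:
  "projection_op P \<Longrightarrow> projection_op Q \<Longrightarrow> Q \<cdot> P = P \<Longrightarrow> P \<cdot> Q = P"
  using compose_flip[of Q P P Q P P] by (simp add: proj_cl proj_adj)

lemma proj_orth_flip:
  "projection_op P \<Longrightarrow> projection_op Q \<Longrightarrow> Q \<cdot> P = 0 \<Longrightarrow> P \<cdot> Q = 0"
  using compose_flip[of Q P 0 Q P 0] by (simp add: proj_cl proj_adj)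

lemma proj_mult: "projection_op P \<Longrightarrow> projection_op Q \<Longrightarrow> P \<cdot> Q = Q \<cdot> P \<Longrightarrow> projection_op (P \<cdot> Q)"
  by (rule projI) (auto simp: selfadj_commuting proj_selfadj, metis compose_assoc proj_idem)

lemma proj_add: "projection_op P \<Longrightarrow> projection_op Q \<Longrightarrow> P \<cdot> Q = 0 \<Longrightarrow> projection_op (P + Q)"
  using proj_orth_flip[of Q P]
  by (intro projI) (simp_all add: selfadj_add proj_selfadj compose_simps proj_idem)

lemma proj_diff: "projection_op P \<Longrightarrow> projection_op Q \<Longrightarrow> Q \<cdot> P = P \<Longrightarrow> projection_op (Q - P)"
  using proj_flip[of P Q]
  by (intro projI) (simp_all add: selfadj_diff proj_selfadj compose_simps proj_idem)

lemma proj_exists: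
  fixes S :: "'a::chilbert_space set"
  assumes S: "csubspace S" and cl: "closed S"
  shows "\<exists>P. projection_op P \<and> (\<forall>x. P x = x \<longleftrightarrow> x \<in> S)"
proof -
  obtain p where p: "\<And>x. p x \<in> S" "\<And>x z. z \<in> S \<Longrightarrow> cinner (x - p x) z = 0"
    using orthogonal_projection_exists[OF S cl] by metis
  have uniq: "p x = y" if "y \<in> S" "\<And>z. z \<in> S \<Longrightarrow> cinner (x - y) z = 0" for x y
  proof -
    have "p x - y \<in> S" by (rule csubspaceD(4)[OF S p(1) that(1)])
    hence "cinner ((x - y) - (x - p x)) (p x - y) = 0" using p(2) that(2) by (subst cinner_diff_left) simp
    thus ?thesis by (simp add: cinner_self)
  qed
  have add: "p (x + y) = p x + p y" for x y
  proof (rule uniq)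
    fix z assume z: "z \<in> S"
    have "x + y - (p x + p y) = (x - p x) + (y - p y)" by simp
    thus "cinner (x + y - (p x + p y)) z = 0"
      using p(2)[OF z, of x] p(2)[OF z, of y] by (simp only: cinner_add_left) simp
  qed (simp add: csubspaceD(2)[OF S] p(1))
  have sc: "p (c *\<^sub>C x) = c *\<^sub>C p x" for c x
  proof (rule uniq)
    fix z assume z: "z \<in> S"
    show "cinner (c *\<^sub>C x - c *\<^sub>C p x) z = 0"
      using p(2)[OF z, of x] by (simp only: scaleC_diff_right[symmetric] cinner_scaleC_left) simp
  qed (simp add: csubspaceD(3)[OF S] p(1))
  have nrm: "norm (p x) \<le> norm x" for x
  proof -
    have "cinner (x - p x) (p x) = 0" using p by simp
    from pythagoras[OF this] have "(norm x)\<^sup>2 = (norm (x - p x))\<^sup>2 + (norm (p x))\<^sup>2" by simp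
    thus ?thesis by (intro power2_le_imp_le[of "norm (p x)"], simp_all)
  qed
  have "bounded_linear p"
    by (rule bounded_linear_intro[where K = 1]) (use add sc[of "of_real _"] nrm in \<open>auto simp: scaleC_of_real\<close>)
  hence B: "blinfun_apply (Blinfun p) = p" by (rule bounded_linear_Blinfun_apply)
  have fixp: "p x = x \<longleftrightarrow> x \<in> S" for x
  proof
    show "p x = x \<Longrightarrow> x \<in> S" using p(1)[of x] by simp
    show "x \<in> S \<Longrightarrow> p x = x" by (rule uniq) simp_all
  qed
  have "projection_op (Blinfun p)"
  proof (rule projI[OF selfadjI])
    show "complex_linear (Blinfun p)" by (simp add: complex_linear_def B sc)
    show "Blinfun p \<cdot> Blinfun p = Blinfun p" by (rule blinfun_eqI) (simp add: B fixp p(1))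
    fix x y
    have "cinner (x - p x) (p y) = 0" "cinner (y - p y) (p x) = 0" using p by auto
    hence "cinner x (p y) = cinner (p x) (p y)" "cinner y (p x) = cinner (p y) (p x)"
      by (simp_all add: cinner_diff_left)
    thus "cinner (Blinfun p x) y = cinner x (Blinfun p y)"
      unfolding B by (metis cinner_commute)
  qed
  thus ?thesis using B fixp by metis
qed

lemma proj_onto_eqI:
  assumes P: "projection_op P" and r: "\<And>x. P x = x \<longleftrightarrow> x \<in> S"
  shows "proj_onto S = P"
  unfolding proj_onto_def
proof (rule the_equality)
  show "projection_op P \<and> range (blinfun_apply P) = S" using P r by (auto simp: proj_range)
  fix Q assume Q: "projection_op Q \<and> range (blinfun_apply Q) = S"
  hence Q': "projection_op Q" "S = {x. Q x = x}" using proj_range[of Q] by auto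
  show "Q = P" by (rule proj_eqI[OF Q'(1) P]) (simp add: r Q'(2))
qed

lemma csubspace_kernel: "complex_linear T \<Longrightarrow> csubspace {x. T x = 0}"
  by (auto simp: csubspace_def blinfun.bilinear_simps complex_linearD)

lemma closed_kernel: "closed {x. blinfun_apply T x = 0}"
  by (rule closed_Collect_eq) (auto intro: continuous_intros)

lemma null_proj:
  assumes "complex_linear T"
  shows "projection_op (null_proj T)" "null_proj T x = x \<longleftrightarrow> T x = 0"
  using proj_exists[OF csubspace_kernel[OF assms] closed_kernel] proj_onto_eqI[of _ "{x. T x = 0}"]
  unfolding null_proj_def by auto

lemma range_proj_selfadj:
  assumes T: "selfadj T"
  shows "range_proj T = id_blinfun - null_proj T"
  unfolding range_proj_def
proof (rule proj_onto_eqI)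
  note N = null_proj[OF selfadj_cl[OF T]]
  show "projection_op (id_blinfun - null_proj T)" by (rule proj_complement[OF N(1)])
  have sub: "csubspace (range (blinfun_apply T))"
    unfolding csubspace_def
  proof (intro conjI ballI allI)
    show "0 \<in> range (blinfun_apply T)" by (metis blinfun.zero_right rangeI)
    fix x assume "x \<in> range (blinfun_apply T)"
    then obtain u where u: "x = T u" by auto
    show "c *\<^sub>C x \<in> range (blinfun_apply T)" for c
      by (metis u complex_linearD[OF selfadj_cl[OF T]] rangeI)
    fix y assume "y \<in> range (blinfun_apply T)"
    then obtain v where v: "y = T v" by auto
    show "x + y \<in> range (blinfun_apply T)" by (metis u v blinfun.add_right rangeI)
  qed
  have TN: "T (null_proj T x) = 0" for x
    using N(2) proj_idem_apply[OF N(1)] by simp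
  have NT: "null_proj T (T x) = 0" for x
  proof (rule cinner_ext')
    fix z show "cinner z (null_proj T (T x)) = cinner z 0"
      by (metis TN T N(1) cinner_zero_left cinner_zero_right proj_selfadj selfadj_swap)
  qed
  fix x
  show "(id_blinfun - null_proj T) x = x \<longleftrightarrow> x \<in> closure (range (blinfun_apply T))"
  proof
    assume "x \<in> closure (range (blinfun_apply T))"
    moreover have "closure (range (blinfun_apply T)) \<subseteq> {x. null_proj T x = 0}"
      by (rule closure_minimal) (auto simp: NT closed_kernel)
    ultimately show "(id_blinfun - null_proj T) x = x" by (auto simp: blinfun.bilinear_simps)
  next
    assume "(id_blinfun - null_proj T) x = x"
    hence Nx: "null_proj T x = 0" by (simp add: blinfun.bilinear_simps)
    obtain y where y: "y \<in> closure (range (blinfun_apply T))"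
      "\<And>z. z \<in> closure (range (blinfun_apply T)) \<Longrightarrow> cinner (x - y) z = 0"
      using orthogonal_projection_exists[OF csubspace_closure[OF sub] closed_closure, of x] by auto
    have "cinner (T (x - y)) z = cinner 0 z" for z
      using y(2)[of "T z"] closure_subset[of "range (blinfun_apply T)"]
      by (auto simp: selfadj_swap[OF T])
    hence "T (x - y) = 0" by (rule cinner_ext)
    hence 1: "null_proj T (x - y) = x - y" using N(2) by blast
    have "closure (range (blinfun_apply T)) \<subseteq> {x. null_proj T x = 0}"
      by (rule closure_minimal) (auto simp: NT closed_kernel)
    hence "null_proj T y = 0" using y(1) by auto
    hence "x = y" using 1 Nx by (simp add: blinfun.bilinear_simps)
    thus "x \<in> closure (range (blinfun_apply T))" using y(1) by simp
  qed
qed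

subsection \<open>Sums with mutually orthogonal ranges\<close>

text \<open>The vanishing of \<open>adj (X m) \<cdot> X n\<close> says that the ranges are
  orthogonal, so by Pythagoras bounded sums of squares give Cauchy partial sums. The exact value of
  \<open>(norm (Y x))\<^sup>2\<close> is what later identifies
  \<open>adj Y \<cdot> Y\<close>.\<close>

lemma strong_sum_exists:
  fixes X :: "nat \<Rightarrow> 'h::chilbert_space oper"
  assumes cl: "\<And>n. complex_linear (X n)"
    and orth: "\<And>m n. m \<noteq> n \<Longrightarrow> adj (X m) \<cdot> X n = 0"
    and bd: "\<And>n x. (\<Sum>i<n. (norm (X i x))\<^sup>2) \<le> c\<^sup>2 * (norm x)\<^sup>2" and c: "0 \<le> c"
  shows "\<exists>Y. complex_linear Y \<and> (\<forall>x. (\<lambda>n. X n x) sums Y x)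
    \<and> (\<forall>x. (\<lambda>n. (norm (X n x))\<^sup>2) sums (norm (Y x))\<^sup>2)"
proof -
  have o: "cinner (X m x) (X n y) = 0" if "m \<noteq> n" for m n x y
  proof -
    have "(adj (X m)) (X n y) = 0"
      using orth[OF that] by (metis blinfun_apply_blinfun_compose blinfun.zero_left)
    thus ?thesis by (simp add: adj_right[OF cl])
  qed
  have pyth: "(norm (\<Sum>i\<in>I. X i x))\<^sup>2 = (\<Sum>i\<in>I. (norm (X i x))\<^sup>2)" if "finite I" for I x
    using that
  proof induction
    case (insert i I)
    have "cinner (X i x) (\<Sum>i\<in>I. X i x) = 0"
      unfolding cinner.sum_right using insert o by (intro sum.neutral ballI) metis
    thus ?case using insert by (simp add: pythagoras)
  qed simp
  define S where "S n = (\<Sum>i<n. X i)" for n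
  have Sx: "S n x = (\<Sum>i<n. X i x)" for n x
    by (simp add: S_def blinfun.sum_left)
  have summ: "summable (\<lambda>n. (norm (X n x))\<^sup>2)" for x
    by (rule bounded_imp_summable[where B = "c\<^sup>2 * (norm x)\<^sup>2"])
      (use bd[of x "Suc _"] in \<open>auto simp: lessThan_Suc_atMost\<close>)
  have conv: "convergent (\<lambda>n. S n x)" for x
  proof -
    have "Cauchy (\<lambda>n. \<Sum>i<n. (norm (X i x))\<^sup>2)"
      using summ[of x] by (simp add: summable_iff_convergent Cauchy_convergent_iff)
    have "Cauchy (\<lambda>n. S n x)"
    proof (rule metric_CauchyI)
      fix e :: real assume e: "e > 0"
      then obtain N where N: "\<And>m n. m \<ge> N \<Longrightarrow> n \<ge> N \<Longrightarrow>
        dist (\<Sum>i<m. (norm (X i x))\<^sup>2) (\<Sum>i<n. (norm (X i x))\<^sup>2) < e\<^sup>2"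
        using \<open>Cauchy (\<lambda>n. \<Sum>i<n. (norm (X i x))\<^sup>2)\<close> unfolding Cauchy_def
        by (meson zero_less_power)
      have le: "norm (S n x - S m x) < e" if "N \<le> m" "m \<le> n" for m n
      proof -
        have d: "(\<Sum>i<n. f i) - (\<Sum>i<m. f i) = (\<Sum>i\<in>{m..<n}. f i)" for f :: "nat \<Rightarrow> 'b::ab_group_add"
          using that(2) by (metis sum_diff_nat_ivl zero_le atLeast0LessThan)
        have "(norm (S n x - S m x))\<^sup>2 = (\<Sum>i\<in>{m..<n}. (norm (X i x))\<^sup>2)"
          unfolding Sx d by (rule pyth) simp
        also have "\<dots> < e\<^sup>2" using N[of n m] that unfolding dist_real_def d by simp
        finally show ?thesis using e by (meson less_eq_real_def power_less_imp_less_base)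
      qed
      show "\<exists>M. \<forall>m\<ge>M. \<forall>n\<ge>M. dist (S m x) (S n x) < e"
      proof (intro exI[of _ N] allI impI)
        fix m n assume "N \<le> m" "N \<le> n"
        thus "dist (S m x) (S n x) < e"
          using le[of m n] le[of n m] by (cases "m \<le> n") (auto simp: dist_norm norm_minus_commute)
      qed
    qed
    thus ?thesis by (simp add: Cauchy_convergent_iff)
  qed
  have nb: "norm (S n x) \<le> c * norm x" for n x
  proof -
    have "(norm (S n x))\<^sup>2 \<le> (c * norm x)\<^sup>2"
      unfolding Sx by (subst pyth) (use bd in \<open>auto simp: power_mult_distrib\<close>)
    thus ?thesis using c by (meson mult_nonneg_nonneg norm_ge_zero power2_le_imp_le)
  qed
  obtain Y where Y: "complex_linear Y" "slim S Y"
    using strong_limit_exists[of S, OF conv nb] cl_sum[of "{..<_}" X, OF cl] by (auto simp: S_def)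
  have "(\<lambda>n. (norm (X n x))\<^sup>2) sums (norm (Y x))\<^sup>2" for x
  proof -
    have "(\<lambda>n. (norm (S n x))\<^sup>2) \<longlonglongrightarrow> (norm (Y x))\<^sup>2"
      by (intro tendsto_power tendsto_norm Y(2)[rule_format])
    thus ?thesis unfolding sums_def Sx by (simp add: pyth)
  qed
  thus ?thesis using Y unfolding Sx sums_def by auto
qed

definition orth_seq :: "(nat \<Rightarrow> 'h::chilbert_space oper) \<Rightarrow> bool" where
  "orth_seq e \<longleftrightarrow> (\<forall>n. projection_op (e n)) \<and> (\<forall>m n. m \<noteq> n \<longrightarrow> e m \<cdot> e n = 0)"

lemma orth_seqD: "orth_seq e \<Longrightarrow> projection_op (e n)" "orth_seq e \<Longrightarrow> m \<noteq> n \<Longrightarrow> e m \<cdot> e n = 0"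
  by (auto simp: orth_seq_def)

definition psum :: "(nat \<Rightarrow> 'h::chilbert_space oper) \<Rightarrow> 'h oper" where
  "psum e = (THE E. \<forall>x. (\<lambda>n. blinfun_apply (e n) x) sums blinfun_apply E x)"

lemma psum_eqI: "(\<And>x. (\<lambda>n. blinfun_apply (e n) x) sums blinfun_apply E x) \<Longrightarrow> psum e = E"
  unfolding psum_def
  by (rule the_equality) (auto intro!: blinfun_eqI sums_unique2)

lemma orth_seq_partial:
  assumes e: "orth_seq e" and I: "finite I"
  shows "projection_op (\<Sum>i\<in>I. e i)"
  using I
proof induction
  case (insert i I)
  have "e i \<cdot> (\<Sum>i\<in>I. e i) = (\<Sum>j\<in>I. e i \<cdot> e j)"
    by (rule blinfun_eqI) (simp add: blinfun.bilinear_simps blinfun.sum_left blinfun.sum_right)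
  also have "\<dots> = 0" using insert e by (intro sum.neutral ballI) (metis orth_seqD(2))
  finally show ?case using insert orth_seqD(1)[OF e] by (simp add: proj_add)
qed simp

lemma
  assumes e: "orth_seq e"
  shows psum_sums: "(\<lambda>n. e n x) sums psum e x"
    and psum_proj: "projection_op (psum e)"
    and psum_norm_sums: "(\<lambda>n. (norm (e n x))\<^sup>2) sums (norm (psum e x))\<^sup>2"
    and psum_absorb: "psum e \<cdot> e n = e n"
proof -
  have cl: "complex_linear (e n)" for n using orth_seqD(1)[OF e] proj_cl by blast
  have o: "adj (e m) \<cdot> e n = 0" if "m \<noteq> n" for m n
    using orth_seqD[OF e] that by (simp add: proj_adj)
  have bd: "(\<Sum>i<n. (norm (e i x))\<^sup>2) \<le> 1\<^sup>2 * (norm x)\<^sup>2" for n x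
  proof -
    have "(\<Sum>i<n. (norm (e i x))\<^sup>2) = qf (\<Sum>i<n. e i) x"
      by (simp add: blinfun.sum_left cinner.sum_left qf_proj[OF orth_seqD(1)[OF e]])
    also have "\<dots> = (norm ((\<Sum>i<n. e i) x))\<^sup>2"
      by (rule qf_proj[OF orth_seq_partial[OF e]]) simp
    also have "\<dots> \<le> (norm x)\<^sup>2"
      by (intro power_mono norm_proj_le[OF orth_seq_partial[OF e]]) auto
    finally show ?thesis by simp
  qed
  obtain E where E: "complex_linear E" "\<And>x. (\<lambda>n. e n x) sums E x"
    "\<And>x. (\<lambda>n. (norm (e n x))\<^sup>2) sums (norm (E x))\<^sup>2"
    using strong_sum_exists[OF cl o bd] by auto
  have pE: "psum e = E" by (rule psum_eqI) (rule E(2))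
  show 1: "(\<lambda>n. e n x) sums psum e x" for x by (simp add: pE E(2))
  show "(\<lambda>n. (norm (e n x))\<^sup>2) sums (norm (psum e x))\<^sup>2" by (simp add: pE E(3))
  show ab: "psum e \<cdot> e n = e n" for n
  proof (rule blinfun_eqI)
    fix x
    have "e m (e n x) = (if m = n then e n x else 0)" for m
      using orth_seqD[OF e, of m] by (metis blinfun.zero_left blinfun_apply_blinfun_compose orth_seqD(1) e proj_idem_apply)
    hence "(\<lambda>m. blinfun_apply (e m) (blinfun_apply (e n) x)) sums blinfun_apply (e n) x"
      using sums_single[of n "\<lambda>_. blinfun_apply (e n) x"] by simp
    thus "blinfun_apply (psum e \<cdot> e n) x = blinfun_apply (e n) x"
      using 1[of "e n x"] sums_unique2 by auto
  qed
  have sl: "slim (\<lambda>n. \<Sum>i<n. e i) E" using E(2) by (simp add: sums_def blinfun.sum_left)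
  have "selfadj E" using slim_selfadj[OF sl] orth_seq_partial[OF e] proj_selfadj by blast
  moreover have "E \<cdot> E = E"
  proof (rule blinfun_eqI)
    fix x
    have "(\<lambda>n. E (e n x)) sums E (E x)"
      by (rule bounded_linear.sums[OF blinfun.bounded_linear_right E(2)])
    moreover have "E (e n x) = e n x" for n
      using ab[of n] unfolding pE by (metis blinfun_apply_blinfun_compose)
    ultimately have "(\<lambda>n. blinfun_apply (e n) x) sums blinfun_apply E (blinfun_apply E x)" by simp
    hence "blinfun_apply E x = blinfun_apply E (blinfun_apply E x)" by (rule sums_unique2[OF E(2)])
    thus "blinfun_apply (E \<cdot> E) x = blinfun_apply E x" by simp
  qed
  ultimately show "projection_op (psum e)" by (simp add: pE projI)
qed

lemma sums_compose_right:
  "(\<And>x. (\<lambda>n. blinfun_apply (F n) x) sums blinfun_apply S x) \<Longrightarrow>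
    (\<lambda>n. blinfun_apply (F n \<cdot> T) x) sums blinfun_apply (S \<cdot> T) x"
  by simp

lemma sums_compose_left:
  "(\<And>x. (\<lambda>n. blinfun_apply (F n) x) sums blinfun_apply S x) \<Longrightarrow>
    (\<lambda>n. blinfun_apply (T \<cdot> F n) x) sums blinfun_apply (T \<cdot> S) x"
  by (simp add: bounded_linear.sums[OF blinfun.bounded_linear_right])

lemma sums_op_unique:
  "(\<And>x. (\<lambda>n. blinfun_apply (F n) x) sums blinfun_apply S x) \<Longrightarrow>
   (\<And>x. (\<lambda>n. blinfun_apply (F n) x) sums blinfun_apply T x) \<Longrightarrow> S = T"
  by (rule blinfun_eqI) (metis sums_unique2)

lemma psum_orth_left:
  assumes e: "orth_seq e" and "\<And>n. T \<cdot> e n = 0"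
  shows "T \<cdot> psum e = 0"
  by (rule sums_op_unique[OF sums_compose_left[OF psum_sums[OF e]]]) (simp add: assms(2))

lemma psum_absorb_left:
  assumes e: "orth_seq e" and "\<And>n. T \<cdot> e n = e n"
  shows "T \<cdot> psum e = psum e"
  by (rule sums_op_unique[OF sums_compose_left[OF psum_sums[OF e]]]) (simp add: assms(2) psum_sums[OF e])

lemma psum_commute:
  assumes e: "orth_seq e" and "\<And>n. T \<cdot> e n = e n \<cdot> T"
  shows "T \<cdot> psum e = psum e \<cdot> T"
  by (rule sums_op_unique[OF sums_compose_left[OF psum_sums[OF e]]])
    (simp only: assms(2), rule sums_compose_right, rule psum_sums[OF e])

subsection \<open>Von Neumann algebras\<close>

locale vna =
  fixes M :: "'h::chilbert_space oper set"
  assumes vna: "von_neumann_algebra M"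
begin

lemma M_adj: "T \<in> M \<Longrightarrow> adj T \<in> M"
  using vna by (simp add: von_neumann_algebra_def)

lemma M_eq: "M = commutant (commutant M)"
  using vna by (simp add: von_neumann_algebra_def)

lemma M_cl: "T \<in> M \<Longrightarrow> complex_linear T"
  using M_eq by (auto simp: commutant_def)

lemma M_commute: "T \<in> M \<Longrightarrow> S \<in> commutant M \<Longrightarrow> T \<cdot> S = S \<cdot> T"
  by (simp add: commutant_def)

lemma M_I: "complex_linear T \<Longrightarrow> (\<And>S. S \<in> commutant M \<Longrightarrow> T \<cdot> S = S \<cdot> T) \<Longrightarrow> T \<in> M"
  by (subst M_eq) (simp add: commutant_def)

lemma commutant_cl: "S \<in> commutant M \<Longrightarrow> complex_linear S"
  by (simp add: commutant_def)

lemma commutant_adj: "S \<in> commutant M \<Longrightarrow> adj S \<in> commutant M"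
proof -
  assume S: "S \<in> commutant M"
  have "adj S \<cdot> T = T \<cdot> adj S" if T: "T \<in> M" for T
  proof -
    have "adj (adj T \<cdot> S) = adj (S \<cdot> adj T)" using M_commute[OF M_adj[OF T] S] by simp
    thus ?thesis using T S by (simp add: adj_compose adj_adj M_cl commutant_cl cl_adj)
  qed
  thus ?thesis using S by (simp add: commutant_def cl_adj)
qed

lemma M_id: "id_blinfun \<in> M" by (rule M_I) (simp_all add: compose_simps)
lemma M_0: "0 \<in> M" by (rule M_I) simp_all
lemma M_add: "S \<in> M \<Longrightarrow> T \<in> M \<Longrightarrow> S + T \<in> M"
  by (rule M_I) (simp_all add: M_cl cl_add compose_simps M_commute)
lemma M_diff: "S \<in> M \<Longrightarrow> T \<in> M \<Longrightarrow> S - T \<in> M"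
  by (rule M_I) (simp_all add: M_cl cl_diff compose_simps M_commute)
lemma M_scaleR: "T \<in> M \<Longrightarrow> r *\<^sub>R T \<in> M"
  by (rule M_I) (simp_all add: M_cl cl_scaleR compose_simps M_commute)
lemma M_compose: "S \<in> M \<Longrightarrow> T \<in> M \<Longrightarrow> S \<cdot> T \<in> M"
  by (rule M_I) (simp add: M_cl cl_compose, metis M_commute compose_assoc)

lemmas M_intros = M_id M_0 M_add M_diff M_scaleR M_compose M_adj

lemma M_sum: "(\<And>i. i \<in> I \<Longrightarrow> f i \<in> M) \<Longrightarrow> sum f I \<in> M"
  by (induction I rule: infinite_finite_induct) (auto intro: M_intros)

lemma M_slim: "slim F S \<Longrightarrow> (\<And>n. F n \<in> M) \<Longrightarrow> S \<in> M"
  by (rule M_I) (auto intro: slim_cl slim_commute simp: M_cl M_commute)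

lemma M_sums: "(\<And>x. (\<lambda>n. blinfun_apply (F n) x) sums blinfun_apply S x) \<Longrightarrow> (\<And>n. F n \<in> M) \<Longrightarrow> S \<in> M"
  by (rule M_slim[where F = "\<lambda>n. \<Sum>i<n. F i"]) (simp_all add: sums_def blinfun.sum_left M_sum)

lemma M_sqrt:
  assumes "T \<in> M" "positive_op T"
  shows "\<exists>R\<in>M. positive_op R \<and> R \<cdot> R = T \<and> (\<forall>S. T \<cdot> S = S \<cdot> T \<longrightarrow> R \<cdot> S = S \<cdot> R)"
proof -
  obtain R where R: "positive_op R" "R \<cdot> R = T" "\<And>S. T \<cdot> S = S \<cdot> T \<Longrightarrow> R \<cdot> S = S \<cdot> R"
    using sqrt_exists[OF assms(2)] by blast
  have "R \<in> M" by (rule M_I) (simp_all add: R positive_cl M_commute assms(1))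
  thus ?thesis using R by blast
qed

lemma projM: "P \<in> projections M \<longleftrightarrow> P \<in> M \<and> projection_op P"
  by (simp add: projections_def)

text \<open>Invariance of the range gives \<open>P S P = S P\<close>. The commutant is closed under
  adjoints, so the same holds for the adjoint of \<open>S\<close>, and taking adjoints once more
  gives commutation.\<close>

lemma projM_I:
  assumes P: "projection_op P"
    and inv: "\<And>S x. S \<in> commutant M \<Longrightarrow> P x = x \<Longrightarrow> P (S x) = S x"
  shows "P \<in> projections M"
proof -
  have *: "P \<cdot> (S \<cdot> P) = S \<cdot> P" if "S \<in> commutant M" for S
    by (rule blinfun_eqI) (simp add: inv that proj_idem_apply[OF P])
  have "P \<cdot> S = S \<cdot> P" if S: "S \<in> commutant M" for S
  proof -
    have "adj (P \<cdot> (adj S \<cdot> P)) = adj (adj S \<cdot> P)" using *[OF commutant_adj[OF S]] by simp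
    hence "P \<cdot> S \<cdot> P = P \<cdot> S"
      using S P by (simp add: adj_compose adj_adj commutant_cl cl_adj cl_compose proj_cl proj_adj)
    thus ?thesis using *[OF S] by (simp add: compose_assoc)
  qed
  thus ?thesis using P by (simp add: projM M_I proj_cl)
qed

lemma null_proj_M: "T \<in> M \<Longrightarrow> null_proj T \<in> projections M"
proof (rule projM_I)
  assume T: "T \<in> M"
  note N = null_proj[OF M_cl[OF T]]
  show "projection_op (null_proj T)" by (rule N)
  fix S x assume S: "S \<in> commutant M" and x: "null_proj T x = x"
  have "T (S x) = S (T x)"
    by (metis M_commute[OF T S] blinfun_apply_blinfun_compose)
  thus "null_proj T (S x) = S x"
    using x by (simp add: N(2) blinfun.bilinear_simps)
qed

lemma psum_M: "orth_seq e \<Longrightarrow> (\<And>n. e n \<in> M) \<Longrightarrow> psum e \<in> projections M"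
  by (auto simp: projM psum_proj intro: M_sums[OF psum_sums])

end

text \<open>Converts membership into commutation: whatever lies in every von Neumann algebra
  containing \<open>X\<close> commutes with each selfadjoint \<open>f\<close> that commutes with
  \<open>X\<close>. The constructions below therefore carry such a membership clause.\<close>

lemma vna_commutant_single:
  assumes f: "selfadj f"
  shows "vna (commutant {f})"
proof
  have "adj T \<in> commutant {f}" if "T \<in> commutant {f}" for T
  proof -
    have "complex_linear T" "T \<cdot> f = f \<cdot> T" using that by (auto simp: commutant_def)
    hence "adj (T \<cdot> f) = adj (f \<cdot> T)" by simp
    thus ?thesis using f \<open>complex_linear T\<close> by (simp add: commutant_def adj_compose selfadj_def cl_adj)
  qed
  moreover have "commutant (commutant (commutant {f})) = commutant {f}"
    using f by (auto simp: commutant_def selfadj_def)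
  ultimately show "von_neumann_algebra (commutant {f})" by (simp add: von_neumann_algebra_def)
qed

subsection \<open>The spectral theorem\<close>

lemma selfadj_invariant_commute:
  assumes P: "projection_op P" and T: "selfadj T" and "P \<cdot> (T \<cdot> P) = T \<cdot> P"
  shows "P \<cdot> T = T \<cdot> P"
proof -
  have "adj (P \<cdot> (T \<cdot> P)) = adj (T \<cdot> P)" by (simp add: assms(3))
  hence "P \<cdot> T \<cdot> P = P \<cdot> T"
    using P T by (simp add: adj_compose cl_compose proj_cl selfadj_cl proj_adj selfadj_adj)
  thus ?thesis using assms(3) by (simp add: compose_assoc)
qed

text \<open>\<open>z\<close> is the spectral projection of \<open>X\<close> for the open positive half line.\<close>

definition sign_proj :: "'h::chilbert_space oper \<Rightarrow> 'h oper \<Rightarrow> bool" where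
  "sign_proj X z \<longleftrightarrow> projection_op z \<and> (\<forall>M. vna M \<and> X \<in> M \<longrightarrow> z \<in> M) \<and>
    (\<forall>x. 0 \<le> qf X (z x)) \<and> (\<forall>x. qf X (x - z x) \<le> 0) \<and>
    (\<forall>x. z x = x \<and> X x = 0 \<longrightarrow> x = 0)"

lemma sign_projD:
  assumes "sign_proj X z"
  shows "projection_op z" "vna M \<Longrightarrow> X \<in> M \<Longrightarrow> z \<in> M" "0 \<le> qf X (z x)"
    "qf X (x - z x) \<le> 0" "z x = x \<Longrightarrow> X x = 0 \<Longrightarrow> x = 0"
  using assms unfolding sign_proj_def by blast+

text \<open>With \<open>R\<close> the root of \<open>X^2\<close> one has
  \<open>(R + X) (R - X) = 0\<close>. Hence \<open>X\<close> agrees with \<open>-R\<close> on the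
  kernel of \<open>R + X\<close> and with \<open>R\<close> on its complement, which is the range of
  \<open>z\<close>.\<close>

lemma sign_projection:
  fixes X :: "'h::chilbert_space oper"
  assumes X: "selfadj X"
  shows "\<exists>z. sign_proj X z"
proof -
  obtain R where R: "positive_op R" "R \<cdot> R = X \<cdot> X" "\<And>S. X \<cdot> X \<cdot> S = S \<cdot> (X \<cdot> X) \<Longrightarrow> R \<cdot> S = S \<cdot> R"
    using sqrt_exists[OF positive_square[OF X]] by blast
  have RX: "R \<cdot> X = X \<cdot> R" by (rule R(3)) (simp add: compose_assoc)
  have cRX: "complex_linear (R + X)" by (simp add: cl_add positive_cl R selfadj_cl X)
  define N where "N = null_proj (R + X)"
  note N = null_proj[OF cRX, folded N_def]
  define z where "z = id_blinfun - N"
  have z: "projection_op z" by (simp add: z_def proj_complement N)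
  have zx: "z x = x - N x" for x by (simp add: z_def blinfun.bilinear_simps)
  have NK: "X (N x) = - R (N x)" for x
  proof -
    have "(R + X) (N x) = 0" using N(2) proj_idem_apply[OF N(1)] by simp
    thus ?thesis by (simp add: blinfun.bilinear_simps eq_neg_iff_add_eq_0 add.commute)
  qed
  have "N \<cdot> (R - X) = R - X"
  proof (rule blinfun_eqI)
    fix x
    have "(R + X) \<cdot> (R - X) = 0" using RX by (simp add: compose_simps R(2))
    hence "(R + X) ((R - X) x) = 0"
      by (metis blinfun_apply_blinfun_compose blinfun.zero_left)
    hence "N ((R - X) x) = (R - X) x" using N(2) by blast
    thus "(N \<cdot> (R - X)) x = (R - X) x" by simp
  qed
  from compose_flip[OF this _ _ proj_adj[OF N(1)] selfadj_adj selfadj_adj]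
  have RXN: "(R - X) \<cdot> N = R - X"
    by (simp add: proj_cl N cl_diff positive_cl R selfadj_cl X selfadj_diff positive_selfadj)
  have ZK: "X (z x) = R (z x)" for x
  proof -
    have "(R - X) (N x) = (R - X) x"
      using RXN by (metis blinfun_apply_blinfun_compose)
    thus ?thesis unfolding zx by (simp add: blinfun.bilinear_simps algebra_simps)
  qed
  show ?thesis unfolding sign_proj_def
  proof (intro exI[of _ z] conjI allI impI)
    show "projection_op z" by (rule z)
    show "z \<in> M" if "vna M \<and> X \<in> M" for M
    proof -
      interpret vna M using that by blast
      have XM: "X \<in> M" using that by simp
      have "R \<in> M"
      proof (rule M_I[OF positive_cl[OF R(1)] R(3)])
        fix S assume "S \<in> commutant M"
        thus "X \<cdot> X \<cdot> S = S \<cdot> (X \<cdot> X)" by (intro M_commute M_compose XM)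
      qed
      hence "N \<in> M" unfolding N_def using null_proj_M[of "R + X"] XM by (simp add: projM M_add)
      thus ?thesis by (simp add: z_def M_diff M_id)
    qed
    show "0 \<le> qf X (z x)" for x by (simp add: ZK positive_qf[OF R(1)])
    show "qf X (x - z x) \<le> 0" for x
      unfolding zx by (simp add: NK cinner_simps positive_qf[OF R(1)])
    fix x assume x: "z x = x \<and> X x = 0"
    have "R x = 0" using ZK[of x] x by simp
    hence "N x = x" using N(2) x by (simp add: blinfun.bilinear_simps)
    thus "x = 0" using x by (simp add: zx)
  qed
qed

text \<open>The two projections commute because \<open>z\<close> lies in the commutant of
  \<open>P\<close>. On a vector in the range of one and the kernel of the other the form of
  \<open>X\<close> is both nonnegative and nonpositive, so \<open>X\<close> kills it, and the
  injectivity clause makes it zero.\<close>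

lemma sign_projection_unique:
  fixes X :: "'h::chilbert_space oper"
  assumes X: "selfadj X"
    and zs: "sign_proj X z"
    and P: "projection_op P" "P \<cdot> X = X \<cdot> P"
    "\<And>x. 0 \<le> qf X (P x)" "\<And>x. qf X (x - P x) \<le> 0"
    "\<And>x. P x = x \<Longrightarrow> X x = 0 \<Longrightarrow> x = 0"
  shows "P = z"
proof -
  note z = sign_projD[OF zs]
  have "z \<in> commutant {P}"
    by (rule z(2)[OF vna_commutant_single[OF proj_selfadj[OF P(1)]]]) (simp add: commutant_def selfadj_cl X P(2))
  hence zP: "z \<cdot> P = P \<cdot> z" by (simp add: commutant_def)
  have zX: "z \<cdot> X = X \<cdot> z"
    using z(2)[OF vna_commutant_single[OF X]] by (simp add: commutant_def selfadj_cl X)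
  have *: "Q \<cdot> P' = P'"
    if P: "projection_op P'" "P' \<cdot> X = X \<cdot> P'" "\<And>x. 0 \<le> qf X (P' x)"
      "\<And>x. P' x = x \<Longrightarrow> X x = 0 \<Longrightarrow> x = 0"
      and Q: "projection_op Q" "\<And>x. qf X (x - Q x) \<le> 0" "Q \<cdot> P' = P' \<cdot> Q" for P' Q
  proof (rule blinfun_eqI)
    fix x
    let ?w = "P' x - Q (P' x)"
    have QP: "Q (P' y) = P' (Q y)" for y
      using Q(3) by (metis blinfun_apply_blinfun_compose)
    have PX: "X (P' y) = P' (X y)" for y
      using P(2) by (metis blinfun_apply_blinfun_compose)
    have w: "P' ?w = ?w"
      by (simp add: blinfun.bilinear_simps QP[symmetric] proj_idem_apply[OF P(1)])
    have pos: "positive_op (adj P' \<cdot> X \<cdot> P')"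
      unfolding positive_op_iff
      using selfadj_conj[OF X proj_cl[OF P(1)]] P(3) qf_conj[OF proj_cl[OF P(1)], of X] by simp
    have "qf X ?w \<le> 0" using Q(2) by blast
    moreover have "0 \<le> qf X ?w" using P(3)[of ?w] by (simp only: w)
    ultimately have "qf (adj P' \<cdot> X \<cdot> P') ?w = 0"
      using qf_conj[OF proj_cl[OF P(1)], of X ?w] by (simp only: w)
    from positive_qf_zero[OF pos this] have "X (P' ?w) = 0"
      by (simp add: proj_adj[OF P(1)] PX[symmetric]) (simp add: PX proj_idem_apply[OF P(1)])
    hence "?w = 0" using P(4) w by metis
    thus "blinfun_apply (Q \<cdot> P') x = blinfun_apply P' x" by simp
  qed
  have 1: "z \<cdot> P = P" by (rule *[OF P(1,2,3) _ z(1,4) zP]) (rule P(5))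
  have 2: "P \<cdot> z = z" by (rule *[OF z(1) zX z(3) _ P(1,4) zP[symmetric]]) (rule z(5))
  from 1 2 zP show ?thesis by simp
qed

abbreviation spec_measure :: "(real set \<Rightarrow> 'h::chilbert_space oper) \<Rightarrow> 'h \<Rightarrow> real measure" where
  "spec_measure E x \<equiv> measure_of UNIV (sets borel) (\<lambda>S. ennreal (Re (cinner (E S x) x)))"

text \<open>\<open>E\<close> is an arbitrary spectral measure of \<open>B\<close>, so that these
  facts can serve in the proof of uniqueness, before \<open>spectral_proj\<close> is known to be
  well defined.\<close>

locale spec =
  fixes B :: "'h::chilbert_space oper" and E :: "real set \<Rightarrow> 'h oper"
  assumes B: "selfadj B" and sm: "spectral_measure_of B E"
begin

lemma E_proj: "projection_op (E S)"
  using sm by (cases "S \<in> sets borel") (auto simp: spectral_measure_of_def)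

lemma E_UNIV: "E UNIV = id_blinfun"
  using sm by (simp add: spectral_measure_of_def)

lemma E_Int: "S \<in> sets borel \<Longrightarrow> T \<in> sets borel \<Longrightarrow> E (S \<inter> T) = E S \<cdot> E T"
  using sm by (simp add: spectral_measure_of_def)

lemma E_sums:
  "range F \<subseteq> sets borel \<Longrightarrow> disjoint_family F \<Longrightarrow> (\<lambda>j. (E (F j)) x) sums (E (\<Union>j. F j)) x"
  using sm by (simp add: spectral_measure_of_def sot_sums_iff)

lemma qf_E_sums:
  assumes "range F \<subseteq> sets borel" "disjoint_family F"
  shows "(\<lambda>j. qf (E (F j)) x) sums qf (E (\<Union>j. F j)) x"
  by (rule bounded_linear.sums[OF bounded_linear_Re])
    (rule bounded_linear.sums[OF cinner.bounded_linear_left E_sums[OF assms]])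

lemma qf_E: "qf (E S) x = (norm (E S x))\<^sup>2"
  by (rule qf_proj[OF E_proj])

lemma E_empty: "E {} = 0"
proof (rule blinfun_eqI)
  fix x
  have "summable (\<lambda>_::nat. E {} x)"
    using E_sums[of "\<lambda>_. {}" x] by (auto simp: disjoint_family_on_def summable_def)
  thus "E {} x = blinfun_apply 0 x" by (simp add: summable_const_iff)
qed

lemma sets_spec [simp]: "sets (spec_measure E x) = sets borel"
  using sets.sigma_sets_eq[of "borel :: real measure"] by simp

lemma space_spec [simp]: "space (spec_measure E x) = UNIV"
  by (simp add: space_measure_of)

lemma emeasure_spec: "S \<in> sets borel \<Longrightarrow> emeasure (spec_measure E x) S = ennreal (qf (E S) x)"
proof (rule emeasure_measure_of[OF refl])
  show "countably_additive (sets (spec_measure E x)) (\<lambda>S. ennreal (qf (E S) x))"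
  proof (rule countably_additiveI)
    fix F :: "nat \<Rightarrow> real set" assume "range F \<subseteq> sets (spec_measure E x)" "disjoint_family F"
    hence "(\<lambda>j. qf (E (F j)) x) sums qf (E (\<Union>j. F j)) x" by (intro qf_E_sums) auto
    thus "(\<Sum>i. ennreal (qf (E (F i)) x)) = ennreal (qf (E (\<Union>i. F i)) x)"
      by (intro suminf_ennreal_eq) (auto simp: qf_E)
  qed
qed (auto simp: positive_def E_empty)

lemma finite_measure_spec: "finite_measure (spec_measure E x)"
  by (rule finite_measureI) (simp add: emeasure_spec)

lemma measure_spec: "S \<in> sets borel \<Longrightarrow> measure (spec_measure E x) S = qf (E S) x"
  by (simp only: measure_def emeasure_spec) (simp add: qf_E)

lemma E_additive:
  assumes "S \<in> sets borel" "T \<in> sets borel" "S \<inter> T = {}"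
  shows "E (S \<union> T) = E S + E T"
proof (rule selfadj_eqI)
  fix x
  interpret finite_measure "spec_measure E x" by (rule finite_measure_spec)
  show "qf (E (S \<union> T)) x = qf (E S + E T) x"
    using finite_measure_Union[of S T] assms by (simp add: measure_spec qf_add del: plus_blinfun.rep_eq)
qed (simp_all add: E_proj proj_selfadj selfadj_add)

lemma E_disjoint: "S \<in> sets borel \<Longrightarrow> T \<in> sets borel \<Longrightarrow> S \<inter> T = {} \<Longrightarrow> E S \<cdot> E T = 0"
  by (metis E_Int E_empty)

lemma E_mono: "S \<in> sets borel \<Longrightarrow> T \<in> sets borel \<Longrightarrow> S \<subseteq> T \<Longrightarrow> E T \<cdot> E S = E S"
  by (metis E_Int inf.absorb2)

lemma E_diff:
  assumes "S \<in> sets borel" "T \<in> sets borel" "S \<subseteq> T"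
  shows "E (T - S) = E T - E S"
proof -
  have "E (S \<union> (T - S)) = E S + E (T - S)" using assms by (intro E_additive) auto
  moreover have "S \<union> (T - S) = T" using assms(3) by auto
  ultimately show ?thesis by simp
qed

lemma E_compl: "S \<in> sets borel \<Longrightarrow> E (- S) = id_blinfun - E S"
  using E_diff[of S UNIV] by (simp add: E_UNIV Compl_eq_Diff_UNIV)

lemma E_incseq:
  assumes F: "range F \<subseteq> sets borel" "incseq F"
  shows "slim (\<lambda>n. E (F n)) (E (\<Union>n. F n))"
proof
  fix x
  let ?U = "\<Union>n. F n"
  interpret finite_measure "spec_measure E x" by (rule finite_measure_spec)
  have Fb: "F n \<in> sets borel" for n using F(1) by auto
  have U: "?U \<in> sets borel" using Fb by blast
  have 1: "(\<lambda>n. qf (E (F n)) x) \<longlonglongrightarrow> qf (E ?U) x"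
    using finite_Lim_measure_incseq[of F] F by (simp add: measure_spec Fb U)
  have 2: "(norm ((E (F n)) x - (E ?U) x))\<^sup>2 = qf (E ?U) x - qf (E (F n)) x" for n
  proof -
    have "E (?U - F n) = E ?U - E (F n)" by (intro E_diff Fb U) auto
    hence "qf (E ?U - E (F n)) x = (norm ((E ?U - E (F n)) x))\<^sup>2" by (metis qf_E)
    thus ?thesis by (simp add: blinfun.bilinear_simps cinner_simps norm_minus_commute)
  qed
  have "(\<lambda>n. (norm ((E (F n)) x - (E ?U) x))\<^sup>2) \<longlonglongrightarrow> 0"
    unfolding 2 using tendsto_diff[OF tendsto_const[of "qf (E ?U) x"] 1] by simp
  hence "(\<lambda>n. sqrt ((norm ((E (F n)) x - (E ?U) x))\<^sup>2)) \<longlonglongrightarrow> sqrt 0"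
    by (rule tendsto_real_sqrt)
  hence "(\<lambda>n. norm ((E (F n)) x - (E ?U) x)) \<longlonglongrightarrow> 0" by simp
  thus "(\<lambda>n. (E (F n)) x) \<longlonglongrightarrow> (E ?U) x"
    by (rule LIM_zero_cancel[OF tendsto_norm_zero_cancel])
qed

lemma has_integral_qf: "has_bochner_integral (spec_measure E x) (\<lambda>t. t) (qf B x)"
proof -
  have "has_bochner_integral (spec_measure E x) complex_of_real (cinner (B x) x)"
    using sm by (simp add: spectral_measure_of_def)
  from has_bochner_integral_bounded_linear[OF bounded_linear_Re this] show ?thesis by simp
qed

text \<open>The definition fixes only the quadratic form of \<open>B\<close>, so commutation has to
  be derived. For \<open>x\<close> in the range and \<open>y\<close> in the kernel of
  \<open>E S\<close> the vectors \<open>x + y\<close> and \<open>x - y\<close> have the same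
  spectral measure, hence the same value of the form, and \<open>B x\<close> is orthogonal to
  \<open>y\<close>.\<close>

lemma E_commute: "E S \<cdot> B = B \<cdot> E S"
proof (cases "S \<in> sets borel")
  case False
  hence "E S = 0" using sm by (simp add: spectral_measure_of_def)
  thus ?thesis by simp
next
  case S: True
  have orth: "cinner (B x) y = 0"
    if x: "E S x = x" and y: "E S y = 0" for x y
  proof -
    have eq: "spec_measure E (x + y) = spec_measure E (x - y)" if y: "E S y = 0" for y
    proof (rule measure_eqI)
      fix T assume "T \<in> sets (spec_measure E (x + y))"
      hence T: "T \<in> sets borel" by simp
      have "cinner (E T x) y = 0"
      proof -
        have "E T x = E S (E T x)"
          using x E_Int[OF S T] E_Int[OF T S] by (metis Int_commute blinfun_apply_blinfun_compose)
        thus ?thesis by (metis y cinner_zero_right selfadj_swap[OF proj_selfadj[OF E_proj]])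
      qed
      moreover have "cinner (E T y) x = 0"
        by (metis calculation cinner_commute complex_cnj_zero selfadj_swap[OF proj_selfadj[OF E_proj]])
      ultimately have "qf (E T) (x + y) = qf (E T) (x - y)"
        by (simp add: blinfun.bilinear_simps cinner_simps)
      thus "emeasure (spec_measure E (x + y)) T = emeasure (spec_measure E (x - y)) T"
        by (simp only: emeasure_spec[OF T])
    qed simp
    have R: "Re (cinner (B x) y) = 0" if "E S y = 0" for y
    proof -
      have "qf B (x + y) = qf B (x - y)"
        using has_integral_qf[of "x + y"] has_integral_qf[of "x - y"] unfolding eq[OF that]
        by (rule has_bochner_integral_eq)
      hence "Re (cinner (B x) y) + Re (cinner (B y) x) = 0"
        by (simp add: blinfun.bilinear_simps cinner_simps)
      thus ?thesis by (metis B Re_cinner_commute add_cancel_right_right mult_2 mult_eq_0_iff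
            selfadj_swap zero_neq_numeral)
    qed
    have "E S (\<i> *\<^sub>C y) = 0" by (simp add: complex_linearD[OF proj_cl[OF E_proj]] y)
    from R[OF this] R[OF y] show ?thesis by (simp add: cinner_simps complex_eq_iff)
  qed
  show ?thesis
  proof (rule selfadj_invariant_commute[OF E_proj B], rule blinfun_eqI)
    fix x
    let ?u = "B (E S x)"
    let ?w = "?u - E S ?u"
    have w0: "E S ?w = 0" by (simp add: blinfun.bilinear_simps proj_idem_apply[OF E_proj])
    have "cinner ?u ?w = 0" by (rule orth) (simp_all add: proj_idem_apply[OF E_proj] w0)
    moreover have "cinner (E S ?u) ?w = 0"
      by (simp only: selfadj_swap[OF proj_selfadj[OF E_proj]] w0 cinner_zero_right)
    ultimately have "cinner ?w ?w = 0" by (subst cinner_diff_left) simp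
    thus "blinfun_apply (E S \<cdot> (B \<cdot> E S)) x = blinfun_apply (B \<cdot> E S) x" by (simp add: cinner_self)
  qed
qed

lemma E_null:
  assumes S: "S \<in> sets borel"
  shows "AE t in spec_measure E (E S x). t \<in> S"
proof (rule AE_I')
  have "E (- S) \<cdot> E S = 0" using S by (intro E_disjoint) auto
  hence "(E (- S)) (E S x) = 0"
    by (metis blinfun.zero_left blinfun_apply_blinfun_compose)
  moreover have "- S \<in> sets borel" using S by auto
  ultimately show "- S \<in> null_sets (spec_measure E (E S x))"
    by (intro null_setsI) (simp_all add: emeasure_spec)
qed auto

lemma integral_const_spec:
  "has_bochner_integral (spec_measure E x) (\<lambda>_. c) (c * (norm x)\<^sup>2)"
proof -
  interpret finite_measure "spec_measure E x" by (rule finite_measure_spec)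
  have "measure (spec_measure E x) UNIV = (norm x)\<^sup>2" by (simp add: measure_spec E_UNIV)
  thus ?thesis by (simp add: has_bochner_integral_iff mult.commute)
qed

lemma E_ge:
  assumes S: "S \<in> sets borel" "S \<subseteq> {t..}"
  shows "t * (norm (E S x))\<^sup>2 \<le> qf B (E S x)"
proof -
  have "AE s in spec_measure E (E S x). t \<le> s"
    using E_null[OF S(1), of x] by eventually_elim (use S(2) in auto)
  thus ?thesis
    using integral_mono_AE[of "spec_measure E (E S x)" "\<lambda>_. t" "\<lambda>s. s"]
      integral_const_spec[of "E S x" t] has_integral_qf[of "E S x"]
    by (auto simp: has_bochner_integral_iff mult.commute)
qed

lemma E_le:
  assumes S: "S \<in> sets borel" "S \<subseteq> {..t}"
  shows "qf B (E S x) \<le> t * (norm (E S x))\<^sup>2"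
proof -
  have "AE s in spec_measure E (E S x). s \<le> t"
    using E_null[OF S(1), of x] by eventually_elim (use S(2) in auto)
  thus ?thesis
    using integral_mono_AE[of "spec_measure E (E S x)" "\<lambda>s. s" "\<lambda>_. t"]
      integral_const_spec[of "E S x" t] has_integral_qf[of "E S x"]
    by (auto simp: has_bochner_integral_iff mult.commute)
qed

lemma E_strict:
  assumes x: "E {t<..} x = x" and q: "qf B x = t * (norm x)\<^sup>2"
  shows "x = 0"
proof -
  let ?m = "spec_measure E x"
  have ae: "AE s in ?m. t < s" using E_null[of "{t<..}" x] unfolding x by simp
  have h: "has_bochner_integral ?m (\<lambda>s. s - t) 0"
    using has_bochner_integral_diff[OF has_integral_qf[of x] integral_const_spec[of x t]] q by simp
  have "AE s in ?m. 0 \<le> s - t" using ae by eventually_elim simp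
  hence "AE s in ?m. s - t = 0"
    using integral_nonneg_eq_0_iff_AE[of ?m "\<lambda>s. s - t"] h by (simp add: has_bochner_integral_iff)
  with ae have "AE s in ?m. False" by eventually_elim simp
  hence "emeasure ?m UNIV = 0" using AE_iff_null[of ?m "\<lambda>_. False"] by (simp add: null_sets_def)
  thus ?thesis by (simp add: emeasure_spec E_UNIV ennreal_eq_0_iff)
qed

text \<open>The sign projection of \<open>B - t I\<close> makes no reference to \<open>E\<close>;
  this is why a spectral measure is determined on half lines.\<close>

lemma E_unique_Ioi:
  assumes z: "sign_proj (B - t *\<^sub>R id_blinfun) z"
  shows "E {t<..} = z"
proof (rule sign_projection_unique[OF _ z])
  have q: "qf (B - t *\<^sub>R id_blinfun) x = qf B x - t * (norm x)\<^sup>2" for x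
    by (simp add: blinfun.bilinear_simps cinner_simps)
  show "selfadj (B - t *\<^sub>R id_blinfun)" by (simp add: selfadj_diff selfadj_scaleR B)
  show "projection_op (E {t<..})" by (rule E_proj)
  show "E {t<..} \<cdot> (B - t *\<^sub>R id_blinfun) = (B - t *\<^sub>R id_blinfun) \<cdot> E {t<..}"
    by (simp add: compose_simps E_commute)
  show "0 \<le> qf (B - t *\<^sub>R id_blinfun) (E {t<..} x)" for x
  proof -
    have "{t<..} \<subseteq> {t..}" by auto
    from E_ge[OF _ this, of x] show ?thesis unfolding q by simp
  qed
  show "qf (B - t *\<^sub>R id_blinfun) (x - E {t<..} x) \<le> 0" for x
  proof -
    have "E {..t} = id_blinfun - E {t<..}" using E_compl[of "{t<..}"] by (simp add: Compl_greaterThan)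
    hence "E {..t} x = x - E {t<..} x" by (simp add: blinfun.bilinear_simps)
    thus ?thesis using E_le[of "{..t}" t x] unfolding q by auto
  qed
  fix x assume "E {t<..} x = x" "(B - t *\<^sub>R id_blinfun) x = 0"
  moreover from this(2) have "B x = t *\<^sub>R x" by (simp add: blinfun.bilinear_simps)
  hence "qf B x = t * (norm x)\<^sup>2" by (simp only: cinner_scaleR_left) simp
  ultimately show "x = 0" using E_strict by blast
qed

end

text \<open>The half lines determine the finite measure of every vector, hence the quadratic form of
  each \<open>E S\<close>.\<close>

lemma spectral_measure_unique:
  assumes B: "selfadj B" and E: "spectral_measure_of B E" and F: "spectral_measure_of B F"
  shows "E = F"
proof
  interpret E: spec B E using B E by unfold_locales
  interpret F: spec B F using B F by unfold_locales
  have Ioi: "E {t<..} = F {t<..}" for t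
  proof -
    have "selfadj (B - t *\<^sub>R id_blinfun)" by (simp add: selfadj_diff selfadj_scaleR B)
    from sign_projection[OF this] obtain z where z: "sign_proj (B - t *\<^sub>R id_blinfun) z" by blast
    show ?thesis using E.E_unique_Ioi[OF z] F.E_unique_Ioi[OF z] by simp
  qed
  fix S
  show "E S = F S"
  proof (cases "S \<in> sets borel")
    case False thus ?thesis using E F by (simp add: spectral_measure_of_def)
  next
    case S: True
    show ?thesis
    proof (rule selfadj_eqI)
      fix x
      have "spec_measure E x = spec_measure F x"
        by (rule measure_eqI_lessThan)
          (simp_all add: E.emeasure_spec F.emeasure_spec Ioi del: sets_measure_of_conv)
      thus "qf (E S) x = qf (F S) x" using S by (metis E.measure_spec F.measure_spec)
    qed (simp_all add: E.E_proj F.E_proj proj_selfadj)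
  qed
qed

lemma qf_add_orth:
  assumes B: "selfadj B" and "cinner (B u) v = 0"
  shows "qf B (u + v) = qf B u + qf B v"
proof -
  have "Re (cinner (B v) u) = Re (cinner (B u) v)"
    by (metis B Re_cinner_commute selfadj_swap)
  thus ?thesis using assms(2) by (simp add: blinfun.bilinear_simps cinner_simps)
qed

text \<open>The resolution of the identity of \<open>B\<close>: \<open>P t\<close> is the spectral projection of \<open>B\<close> for \<open>(t, \<infinity>)\<close>.\<close>

locale resolution =
  fixes B :: "'h::chilbert_space oper" and P :: "real \<Rightarrow> 'h oper" and r :: real
  assumes B: "selfadj B" and P: "sign_proj (B - t *\<^sub>R id_blinfun) (P t)"
    and r_def: "r = norm B + 1"
begin

lemma qf_shift: "qf (B - t *\<^sub>R id_blinfun) x = qf B x - t * (norm x)\<^sup>2"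
  by (simp add: blinfun.bilinear_simps cinner_simps)

lemma shift_apply: "(B - t *\<^sub>R id_blinfun) x = B x - t *\<^sub>R x"
  by (simp add: blinfun.bilinear_simps)

lemma shift_selfadj: "selfadj (B - t *\<^sub>R id_blinfun)"
  by (simp add: selfadj_diff selfadj_scaleR B)

lemma Pp: "projection_op (P t)"
  by (rule sign_projD(1)[OF P])

lemma PM: "vna M \<Longrightarrow> B \<in> M \<Longrightarrow> P t \<in> M"
  by (rule sign_projD(2)[OF P]) (auto simp: vna.M_diff vna.M_scaleR vna.M_id)

lemma P_ge: "t * (norm (P t x))\<^sup>2 \<le> qf B (P t x)"
  using sign_projD(3)[OF P, of t x] unfolding qf_shift by simp

lemma P_le: "qf B (x - P t x) \<le> t * (norm (x - P t x))\<^sup>2"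
  using sign_projD(4)[OF P, of t x] unfolding qf_shift by simp

lemma P_inj: "P t x = x \<Longrightarrow> B x = t *\<^sub>R x \<Longrightarrow> x = 0"
  using sign_projD(5)[OF P, of t x] unfolding shift_apply by simp

lemma PB: "P t \<cdot> B = B \<cdot> P t"
  using PM[OF vna_commutant_single[OF B]] by (simp add: commutant_def selfadj_cl B)

lemma PP: "P s \<cdot> P t = P t \<cdot> P s"
  using PM[OF vna_commutant_single[OF proj_selfadj[OF Pp[of t]]], of s] 
  by (simp add: commutant_def selfadj_cl B PB)

text \<open>On the range of \<open>P t\<close> the form of \<open>B - t I\<close> is positive, so a
  vector where it vanishes is an eigenvector for \<open>t\<close>; \<open>P_inj\<close> excludes
  such vectors.\<close>

lemma P_zero_if: 
  assumes "P t x = x" "qf B x \<le> t * (norm x)\<^sup>2"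
  shows "x = 0"
proof -
  let ?T = "adj (P t) \<cdot> (B - t *\<^sub>R id_blinfun) \<cdot> P t"
  have pos: "positive_op ?T"
    unfolding positive_op_iff
    using selfadj_conj[OF shift_selfadj proj_cl[OF Pp]] qf_conj[OF proj_cl[OF Pp]] sign_projD(3)[OF P] by simp
  have "qf ?T x = qf (B - t *\<^sub>R id_blinfun) x"
    using qf_conj[OF proj_cl[OF Pp], of t "B - t *\<^sub>R id_blinfun" x] assms(1) by simp
  moreover have "0 \<le> qf ?T x" by (rule positive_qf[OF pos])
  ultimately have "qf ?T x = 0" using assms(2) unfolding qf_shift by simp
  from positive_qf_zero[OF pos this]
  have "P t (B x - t *\<^sub>R x) = 0"
    by (simp add: proj_adj[OF Pp] assms(1) blinfun.bilinear_simps)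
  hence "B x - t *\<^sub>R x = 0"
    using PB[of t] assms(1) by (simp add: blinfun.bilinear_simps) (metis blinfun_apply_blinfun_compose)
  thus ?thesis by (intro P_inj[OF assms(1)]) simp
qed

lemma P_mono: "s \<le> t \<Longrightarrow> P s \<cdot> P t = P t"
proof (rule blinfun_eqI)
  fix x assume st: "s \<le> t"
  let ?y = "P t x"
  let ?w = "?y - P s ?y"
  have c: "P t (P s y) = P s (P t y)" for y
    by (metis PP blinfun_apply_blinfun_compose)
  have "?w = 0"
  proof (rule P_zero_if)
    show "P t ?w = ?w" by (simp add: blinfun.bilinear_simps c proj_idem_apply[OF Pp])
    have "qf B ?w \<le> s * (norm ?w)\<^sup>2" by (rule P_le)
    also have "\<dots> \<le> t * (norm ?w)\<^sup>2" using st by (intro mult_right_mono) auto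
    finally show "qf B ?w \<le> t * (norm ?w)\<^sup>2" .
  qed
  thus "blinfun_apply (P s \<cdot> P t) x = blinfun_apply (P t) x" by simp
qed

lemma P_hi: "norm B \<le> t \<Longrightarrow> P t = 0"
proof (rule blinfun_eqI)
  fix x assume t: "norm B \<le> t"
  let ?y = "P t x"
  have "qf B ?y \<le> norm B * (norm ?y)\<^sup>2" by (rule qf_le_norm)
  also have "\<dots> \<le> t * (norm ?y)\<^sup>2" using t by (intro mult_right_mono) auto
  finally have "?y = 0" by (intro P_zero_if) (auto simp: proj_idem_apply[OF Pp])
  thus "P t x = blinfun_apply 0 x" by simp
qed

lemma P_lo: "t < - norm B \<Longrightarrow> P t = id_blinfun"
proof (rule blinfun_eqI)
  fix x assume t: "t < - norm B"
  let ?y = "x - P t x"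
  have "qf (- B) ?y \<le> norm (- B) * (norm ?y)\<^sup>2" by (rule qf_le_norm)
  hence "- norm B * (norm ?y)\<^sup>2 \<le> qf B ?y" by (simp add: blinfun.bilinear_simps cinner_simps)
  also have "\<dots> \<le> t * (norm ?y)\<^sup>2" by (rule P_le)
  finally have "(t + norm B) * (norm ?y)\<^sup>2 \<ge> 0" by (simp add: algebra_simps)
  hence "?y = 0" using t by (simp add: zero_le_mult_iff)
  thus "P t x = id_blinfun x" by simp
qed

text \<open>The distribution function of the spectral measure at \<open>x\<close>, i.e. the mass of
  \<open>{..t}\<close>; its Stieltjes measure is \<open>\<mu> x\<close>.\<close>

definition F :: "'h \<Rightarrow> real \<Rightarrow> real" where
  "F x t = (norm x)\<^sup>2 - qf (P t) x"

lemma F_mono: "s \<le> t \<Longrightarrow> F x s \<le> F x t"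
  using op_le_qf[of "P t" "P s" x] P_mono[of s t] proj_le_iff[OF Pp Pp, of t s] by (simp add: F_def)

text \<open>The strong limit \<open>Y\<close> exists by monotonicity. A vector in the range of
  \<open>P t - Y\<close> is killed by each of the approximating projections, so its form is bounded
  by every \<open>t + 1 / Suc n\<close> and hence by \<open>t\<close>, and \<open>P_zero_if\<close>
  removes it.\<close>

lemma P_right_limit: "slim (\<lambda>n. P (t + 1 / Suc n)) (P t)"
proof -
  let ?s = "\<lambda>n. t + 1 / real (Suc n)"
  have dec: "?s m \<le> ?s n" if "n \<le> m" for m n using that by (simp add: frac_le)
  have inc: "qf (P (?s n)) x \<le> qf (P (?s (Suc n))) x" for n x
    using F_mono[OF dec, of n "Suc n" x] by (simp add: F_def)
  have bd: "qf (P (?s n)) x \<le> 1 * (norm x)\<^sup>2" for n x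
    using norm_proj_le[OF Pp, of "?s n" x] by (simp add: qf_proj[OF Pp] power_mono)
  obtain Y where Y: "selfadj Y" "slim (\<lambda>n. P (?s n)) Y"
    using increasing_strong_limit[of "\<lambda>n. P (?s n)" 1, OF proj_selfadj[OF Pp] inc bd] by blast
  have 1: "P (?s n) \<cdot> Y = P (?s n)" for n
  proof (rule blinfun_eqI)
    fix x
    have "(\<lambda>m. (P (?s n)) ((P (?s m)) x)) \<longlonglongrightarrow> (P (?s n)) (Y x)"
      by (intro blinfun.tendsto tendsto_const Y(2)[rule_format])
    moreover have "(P (?s n)) ((P (?s m)) x) = (P (?s n)) x" if "m \<ge> n" for m
      using P_mono[OF dec[OF that]] PP by (metis blinfun_apply_blinfun_compose)
    hence "(\<lambda>m. (P (?s n)) ((P (?s m)) x)) \<longlonglongrightarrow> (P (?s n)) x"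
      by (intro tendsto_eventually) (auto simp: eventually_sequentially)
    ultimately have "(P (?s n)) (Y x) = (P (?s n)) x"
      by (rule LIMSEQ_unique)
    thus "(P (?s n) \<cdot> Y) x = (P (?s n)) x" by simp
  qed
  have 2: "P t \<cdot> Y = Y"
  proof (rule blinfun_eqI)
    fix x
    have "(\<lambda>m. P t ((P (?s m)) x)) \<longlonglongrightarrow> P t (Y x)"
      by (intro blinfun.tendsto tendsto_const Y(2)[rule_format])
    moreover have "P t ((P (?s m)) x) = (P (?s m)) x" for m
      using P_mono[of t "?s m"] by (metis blinfun_apply_blinfun_compose le_add_same_cancel1 of_nat_0_le_iff zero_le_divide_1_iff)
    ultimately have "(\<lambda>m. blinfun_apply (P (?s m)) x) \<longlonglongrightarrow> blinfun_apply (P t) (blinfun_apply Y x)" by simp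
    from LIMSEQ_unique[OF this Y(2)[rule_format]] show "blinfun_apply (P t \<cdot> Y) x = blinfun_apply Y x" by simp
  qed
  have "P t = Y"
  proof (rule blinfun_eqI)
    fix x
    let ?w = "P t x - Y x"
    have "?w = 0"
    proof (rule P_zero_if)
      show "P t ?w = ?w"
        using 2 by (simp add: blinfun.bilinear_simps proj_idem_apply[OF Pp]) (metis blinfun_apply_blinfun_compose)
      have "(P (?s n)) ?w = 0" for n
      proof -
        have "(P (?s n)) (P t x) = (P (?s n)) x"
          using P_mono[of t "?s n"] PP
          by (metis blinfun_apply_blinfun_compose le_add_same_cancel1 of_nat_0_le_iff zero_le_divide_1_iff)
        moreover have "(P (?s n)) (Y x) = (P (?s n)) x"
          using 1[of n] by (metis blinfun_apply_blinfun_compose)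
        ultimately show ?thesis by (simp add: blinfun.bilinear_simps)
      qed
      hence "qf B ?w \<le> ?s n * (norm ?w)\<^sup>2" for n using P_le[of ?w "?s n"] by simp
      moreover have "(\<lambda>n. ?s n * (norm ?w)\<^sup>2) \<longlonglongrightarrow> (t + 0) * (norm ?w)\<^sup>2"
        by (intro tendsto_mult tendsto_add tendsto_const LIMSEQ_Suc[OF lim_1_over_n])
      ultimately show "qf B ?w \<le> t * (norm ?w)\<^sup>2" by (simp add: LIMSEQ_le_const)
    qed
    thus "P t x = Y x" by simp
  qed
  thus ?thesis using Y(2) by simp
qed

lemma F_right_cont: "continuous (at_right t) (F x)"
proof (subst continuous_at_right_real_increasing[OF F_mono], assumption, intro allI impI)
  fix e :: real assume e: "0 < e"
  have "(\<lambda>n. F x (t + 1 / Suc n)) \<longlonglongrightarrow> F x t"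
    unfolding F_def by (intro tendsto_diff tendsto_const slim_qf P_right_limit)
  from metric_LIMSEQ_D[OF this e] obtain n where "dist (F x (t + 1 / Suc n)) (F x t) < e" by blast
  thus "\<exists>d>0. F x (t + d) - F x t < e"
    by (intro exI[of _ "1 / Suc n"]) (simp add: dist_real_def)
qed

definition \<mu> :: "'h \<Rightarrow> real measure" where
  "\<mu> x = interval_measure (F x)"

lemma sets_\<mu> [simp]: "sets (\<mu> x) = sets borel" and space_\<mu> [simp]: "space (\<mu> x) = UNIV"
  by (simp_all add: \<mu>_def)

lemma emeasure_Ioc: "a \<le> b \<Longrightarrow> emeasure (\<mu> x) {a<..b} = ennreal (qf (P a - P b) x)"
  unfolding \<mu>_def
  by (subst emeasure_interval_measure_Ioc[OF _ F_mono F_right_cont])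
    (auto simp: F_def qf_diff simp del: minus_blinfun.rep_eq)

lemma emeasure_UNIV: "emeasure (\<mu> x) UNIV = ennreal ((norm x)\<^sup>2)"
proof -
  have c: "emeasure (\<mu> x) {- (r + n)<..r + n} = ennreal ((norm x)\<^sup>2)" for n :: nat
  proof -
    have "P (- (r + n)) = id_blinfun" "P (r + n) = 0" by (auto intro!: P_lo P_hi simp: r_def)
    moreover have "- (r + n) \<le> r + n" by (simp add: r_def add_nonneg_pos)
    ultimately show ?thesis by (simp add: emeasure_Ioc)
  qed
  have "emeasure (\<mu> x) (\<Union>n::nat. {- (r + n)<..r + n}) = (SUP n::nat. emeasure (\<mu> x) {- (r + n)<..r + n})"
    by (intro SUP_emeasure_incseq[symmetric]) (auto simp: incseq_def)
  also have "\<dots> = ennreal ((norm x)\<^sup>2)" unfolding c by simp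
  also have "(\<Union>n::nat. {- (r + n)<..r + n}) = UNIV"
  proof (rule set_eqI)
    fix y :: real
    obtain n :: nat where n: "\<bar>y\<bar> < n" using reals_Archimedean2 by blast
    have "r \<ge> 0" by (simp add: r_def)
    hence "y \<in> {- (r + n)<..r + n}" using n by auto
    thus "y \<in> (\<Union>n::nat. {- (r + n)<..r + n}) \<longleftrightarrow> y \<in> UNIV" by blast
  qed
  finally show ?thesis by simp
qed

lemma finite_\<mu>: "finite_measure (\<mu> x)"
  by (rule finite_measureI) (simp add: emeasure_UNIV)

lemma measure_Ioc: "a \<le> b \<Longrightarrow> measure (\<mu> x) {a<..b} = qf (P a - P b) x"
  using F_mono[of a b x] by (simp add: measure_def emeasure_Ioc F_def qf_diff del: minus_blinfun.rep_eq)

lemma measure_UNIV: "measure (\<mu> x) UNIV = (norm x)\<^sup>2"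
  by (simp add: measure_def emeasure_UNIV)

text \<open>\<open>R\<close> is a candidate for the spectral projection of \<open>S\<close>,
  recognized by its quadratic form; the membership clause travels along in order to place it in
  every algebra containing \<open>B\<close>.\<close>

definition good :: "real set \<Rightarrow> 'h oper \<Rightarrow> bool" where
  "good S R \<longleftrightarrow> projection_op R \<and> (\<forall>M. vna M \<and> B \<in> M \<longrightarrow> R \<in> M) \<and> (\<forall>x. qf R x = measure (\<mu> x) S)"

text \<open>For \<open>x\<close> in the range of \<open>Q\<close> the set \<open>T\<close> already
  carries the whole mass of \<open>\<mu> x\<close>, so nothing is left for the disjoint
  \<open>S\<close>.\<close>

lemma good_orth:
  assumes S: "good S R" "S \<in> sets borel" and T: "good T Q" "T \<in> sets borel" and d: "S \<inter> T = {}"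
  shows "R \<cdot> Q = 0"
proof (rule blinfun_eqI)
  fix y
  have p: "projection_op R" "projection_op Q" using S T by (auto simp: good_def)
  let ?x = "Q y"
  interpret finite_measure "\<mu> ?x" by (rule finite_\<mu>)
  have "qf R ?x + qf Q ?x = measure (\<mu> ?x) (S \<union> T)"
    using finite_measure_Union[of S T] S T d by (simp add: good_def)
  also have "\<dots> \<le> measure (\<mu> ?x) UNIV" using S T by (intro finite_measure_mono) auto
  finally have "(norm (blinfun_apply R ?x))\<^sup>2 \<le> 0"
    unfolding measure_UNIV qf_proj[OF p(1)] qf_proj[OF p(2)] by (simp add: proj_idem_apply[OF p(2)])
  thus "blinfun_apply (R \<cdot> Q) y = blinfun_apply 0 y" by simp
qed

text \<open>Induction over the Dynkin system generated by the half-open intervals, which are stable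
  under intersection. For disjoint unions \<open>good_orth\<close> makes the projections orthogonal,
  so that their strong sum exists.\<close>

lemma good_exists: "S \<in> sets borel \<Longrightarrow> \<exists>R. good S R"
proof -
  assume "S \<in> sets borel"
  hence S: "S \<in> sigma_sets UNIV (range (\<lambda>(a, b). {a <.. b::real}))"
    by (simp add: borel_sigma_sets_Ioc)
  have sb: "sigma_sets UNIV (range (\<lambda>(a, b). {a <.. b::real})) = sets borel"
    by (simp add: borel_sigma_sets_Ioc)
  have st: "Int_stable (range (\<lambda>(a, b). {a <.. b::real}))"
  proof (rule Int_stableI)
    fix U V assume "U \<in> range (\<lambda>(a, b). {a <.. b::real})" "V \<in> range (\<lambda>(a, b). {a <.. b::real})"
    then obtain a b c d where "U = {a<..b}" "V = {c<..d}" by auto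
    hence "U \<inter> V = (\<lambda>(a, b). {a <.. b}) (max a c, min b d)" by auto
    thus "U \<inter> V \<in> range (\<lambda>(a, b). {a <.. b::real})" by blast
  qed
  have sub: "range (\<lambda>(a, b). {a <.. b::real}) \<subseteq> Pow UNIV" by simp
  from st sub S show "\<exists>R. good S R"
  proof (induction rule: sigma_sets_induct_disjoint)
    case (basic A)
    then obtain a b where A: "A = {a<..b}" by auto
    show ?case
    proof (cases "a \<le> b")
      case True
      show ?thesis
        by (rule exI[of _ "P a - P b"])
          (auto simp: good_def A True measure_Ioc intro!: proj_diff Pp P_mono vna.M_diff PM)
    next
      case False
      thus ?thesis by (intro exI[of _ 0]) (auto simp: good_def A vna.M_0)
    qed
  next
    case empty show ?case by (intro exI[of _ 0]) (auto simp: good_def vna.M_0)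
  next
    case (compl A)
    then obtain R where R: "good A R" by blast
    have "measure (\<mu> x) (UNIV - A) = (norm x)\<^sup>2 - measure (\<mu> x) A" for x
    proof -
      interpret finite_measure "\<mu> x" by (rule finite_\<mu>)
      show ?thesis using finite_measure_compl[of A] compl(1) sb by (simp add: measure_UNIV)
    qed
    thus ?case using R
      by (intro exI[of _ "id_blinfun - R"])
        (auto simp: good_def proj_complement vna.M_diff vna.M_id qf_diff simp del: minus_blinfun.rep_eq)
  next
    case (union A)
    then obtain R where R: "\<And>i. good (A i) (R i)" by metis
    have Ab: "A i \<in> sets borel" for i using union(2) sb by auto
    have o: "orth_seq R"
      unfolding orth_seq_def
    proof (intro conjI allI impI)
      show "projection_op (R n)" for n using R by (simp add: good_def)
      show "R m \<cdot> R n = 0" if "m \<noteq> n" for m n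
        by (rule good_orth[OF R Ab R Ab]) (use union(1) that in \<open>auto simp: disjoint_family_on_def\<close>)
    qed
    have "qf (psum R) x = measure (\<mu> x) (\<Union>i. A i)" for x
    proof -
      interpret finite_measure "\<mu> x" by (rule finite_\<mu>)
      have "(\<lambda>i. measure (\<mu> x) (A i)) sums measure (\<mu> x) (\<Union>i. A i)"
        by (rule finite_measure_UNION) (use Ab union(1) in auto)
      moreover have "measure (\<mu> x) (A i) = (norm (R i x))\<^sup>2" for i
        using R[of i] by (metis good_def qf_proj)
      ultimately show ?thesis
        using psum_norm_sums[OF o, of x] sums_unique2 unfolding qf_proj[OF psum_proj[OF o]] by simp
    qed
    moreover have "psum R \<in> M" if M: "vna M" "B \<in> M" for M
      using vna.psum_M[OF M(1) o] R M vna.projM[OF M(1)] by (auto simp: good_def)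
    ultimately show ?case using psum_proj[OF o] by (intro exI[of _ "psum R"]) (auto simp: good_def)
  qed
qed

definition EB :: "real set \<Rightarrow> 'h oper" where
  "EB S = (if S \<in> sets borel then SOME R. good S R else 0)"

lemma EB_good: "S \<in> sets borel \<Longrightarrow> good S (EB S)"
  unfolding EB_def using someI_ex[OF good_exists] by auto

lemma EB_proj: "projection_op (EB S)"
  using EB_good[of S] by (cases "S \<in> sets borel") (auto simp: good_def EB_def)

lemma EB_M: "vna M \<Longrightarrow> B \<in> M \<Longrightarrow> EB S \<in> M"
  using EB_good[of S] by (cases "S \<in> sets borel") (auto simp: good_def EB_def vna.M_0)

lemma qf_EB: "S \<in> sets borel \<Longrightarrow> qf (EB S) x = measure (\<mu> x) S"
  using EB_good[of S] by (auto simp: good_def)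

lemma EB_eqI:
  assumes "S \<in> sets borel" "selfadj R" "\<And>x. qf R x = measure (\<mu> x) S"
  shows "EB S = R"
  by (rule selfadj_eqI) (simp_all add: EB_proj proj_selfadj assms qf_EB)

lemma EB_UNIV: "EB UNIV = id_blinfun"
  by (rule EB_eqI) (simp_all add: measure_UNIV)

lemma EB_orth: "S \<in> sets borel \<Longrightarrow> T \<in> sets borel \<Longrightarrow> S \<inter> T = {} \<Longrightarrow> EB S \<cdot> EB T = 0"
  by (rule good_orth[OF EB_good _ EB_good])

lemma EB_add:
  assumes "S \<in> sets borel" "T \<in> sets borel" "S \<inter> T = {}"
  shows "EB (S \<union> T) = EB S + EB T"
proof (rule EB_eqI)
  fix x
  interpret finite_measure "\<mu> x" by (rule finite_\<mu>)
  show "qf (EB S + EB T) x = measure (\<mu> x) (S \<union> T)"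
    using finite_measure_Union[of S T] assms by (simp add: qf_EB qf_add del: plus_blinfun.rep_eq)
qed (use assms in \<open>auto simp: EB_proj proj_selfadj selfadj_add\<close>)

lemma EB_Int:
  assumes "S \<in> sets borel" "T \<in> sets borel"
  shows "EB (S \<inter> T) = EB S \<cdot> EB T"
proof -
  have split: "EB U = EB (U \<inter> W) + EB (U - W)" if "U \<in> sets borel" "W \<in> sets borel" for U W
  proof -
    have "(U \<inter> W) \<union> (U - W) = U" "(U \<inter> W) \<inter> (U - W) = {}" by auto
    thus ?thesis using EB_add[of "U \<inter> W" "U - W"] that by simp
  qed
  have "EB S = EB (S \<inter> T) + EB (S - T)" "EB T = EB (S \<inter> T) + EB (T - S)"
    using split[OF assms] split[OF assms(2,1)] by (simp_all add: Int_commute)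
  moreover have "EB (S \<inter> T) \<cdot> EB (T - S) = 0" "EB (S - T) \<cdot> EB (S \<inter> T) = 0" "EB (S - T) \<cdot> EB (T - S) = 0"
    using assms by (auto intro!: EB_orth)
  ultimately have "EB S \<cdot> EB T = EB (S \<inter> T) \<cdot> EB (S \<inter> T)"
    by (simp only: compose_add_left compose_add_right) simp
  thus ?thesis by (simp add: proj_idem[OF EB_proj])
qed

lemma EB_sums:
  assumes "range A \<subseteq> sets borel" "disjoint_family A"
  shows "sot_sums (\<lambda>j. EB (A j)) (EB (\<Union>j. A j))"
proof -
  have Ab: "A i \<in> sets borel" for i using assms(1) by auto
  have o: "orth_seq (\<lambda>j. EB (A j))"
    unfolding orth_seq_def using assms(2) by (auto simp: EB_proj disjoint_family_on_def intro!: EB_orth Ab)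
  have "EB (\<Union>j. A j) = psum (\<lambda>j. EB (A j))"
  proof (rule EB_eqI)
    show "\<Union> (range A) \<in> sets borel" using Ab by auto
    show "selfadj (psum (\<lambda>j. EB (A j)))" by (rule proj_selfadj[OF psum_proj[OF o]])
    fix x
    interpret finite_measure "\<mu> x" by (rule finite_\<mu>)
    have "(\<lambda>i. measure (\<mu> x) (A i)) sums measure (\<mu> x) (\<Union>i. A i)"
      by (rule finite_measure_UNION) (use Ab assms in auto)
    moreover have "measure (\<mu> x) (A i) = (norm ((EB (A i)) x))\<^sup>2" for i
      using qf_EB[OF Ab, of i x] qf_proj[OF EB_proj, of "A i" x] by simp
    ultimately show "qf (psum (\<lambda>j. EB (A j))) x = measure (\<mu> x) (\<Union> (range A))"
      using psum_norm_sums[OF o, of x] sums_unique2 unfolding qf_proj[OF psum_proj[OF o]] by simp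
  qed
  thus ?thesis using psum_sums[OF o] by (simp add: sot_sums_iff)
qed

lemma measure_slab: "measure (\<mu> x) {-r<..r} = (norm x)\<^sup>2"
proof -
  \<comment> \<open>\<open>r\<close> exceeds \<open>norm B\<close> strictly, as \<open>P_lo\<close>
    requires.\<close>
  have "P (- r) = id_blinfun" "P r = 0" by (auto intro!: P_lo P_hi simp: r_def)
  moreover have "- r \<le> r" by (simp add: r_def add_nonneg_pos)
  ultimately show ?thesis by (simp add: measure_Ioc)
qed

lemma AE_slab: "AE t in \<mu> x. t \<in> {-r<..r}"
proof -
  interpret finite_measure "\<mu> x" by (rule finite_\<mu>)
  have "measure (\<mu> x) (space (\<mu> x) - {-r<..r}) = 0"
    by (subst finite_measure_compl) (simp_all add: measure_slab measure_UNIV)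
  hence "UNIV - {-r<..r} \<in> null_sets (\<mu> x)"
    by (intro null_setsI) (simp_all add: emeasure_eq_measure)
  thus ?thesis by (rule AE_I') auto
qed

lemma integrable_\<mu>: "integrable (\<mu> x) (\<lambda>t. t)"
proof -
  interpret finite_measure "\<mu> x" by (rule finite_\<mu>)
  have "AE t in \<mu> x. norm t \<le> r" using AE_slab[of x] by eventually_elim auto
  thus ?thesis by (intro integrable_const_bound[of _ r]) (auto intro: measurable_ident_sets)
qed

lemma integrable_Ioc: "integrable (\<mu> x) (\<lambda>t. indicator {a<..b} t * t)"
  using integrable_real_mult_indicator[OF _ integrable_\<mu>, of "{a<..b}" x] by (simp add: mult.commute)

text \<open>The error of \<open>B\<close> as an integral over \<open>{a<..b}\<close>. It is additive
  in the interval and bounded by length times mass, so repeated bisection forces it to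
  vanish.\<close>

definition defect :: "'h \<Rightarrow> real \<Rightarrow> real \<Rightarrow> real" where
  "defect x a b = (LINT t|\<mu> x. indicator {a<..b} t * t) - qf B ((P a - P b) x)"

lemma Ioc_proj: "a \<le> b \<Longrightarrow> projection_op (P a - P b)"
  by (intro proj_diff Pp P_mono)

lemma defect_bound:
  assumes ab: "a \<le> b"
  shows "\<bar>defect x a b\<bar> \<le> (b - a) * qf (P a - P b) x"
proof -
  interpret finite_measure "\<mu> x" by (rule finite_\<mu>)
  let ?u = "(P a - P b) x"
  have m: "qf (P a - P b) x = (norm ?u)\<^sup>2" by (rule qf_proj[OF Ioc_proj[OF ab]])
  have i: "integrable (\<mu> x) (\<lambda>t. indicator {a<..b} t * c)" 
    and e: "(LINT t|\<mu> x. indicator {a<..b} t * c) = c * (norm ?u)\<^sup>2" for c :: real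
    using measure_Ioc[OF ab, of x] m by (simp_all add: less_top[symmetric])
  have "(LINT t|\<mu> x. indicator {a<..b} t * a) \<le> (LINT t|\<mu> x. indicator {a<..b} t * t)"
    by (rule integral_mono[OF i integrable_Ioc]) (auto simp: indicator_def)
  moreover have "(LINT t|\<mu> x. indicator {a<..b} t * t) \<le> (LINT t|\<mu> x. indicator {a<..b} t * b)"
    by (rule integral_mono[OF integrable_Ioc i]) (auto simp: indicator_def)
  moreover have "P a ?u = ?u" "P b ?u = 0"
    using P_mono[OF ab] PP[of a b]
    by (simp_all add: blinfun.bilinear_simps proj_idem_apply[OF Pp]) (metis blinfun_apply_blinfun_compose)+
  hence "a * (norm ?u)\<^sup>2 \<le> qf B ?u" "qf B ?u \<le> b * (norm ?u)\<^sup>2"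
    using P_ge[of a ?u] P_le[of ?u b] by simp_all
  ultimately show ?thesis unfolding defect_def e m by (auto simp: abs_le_iff algebra_simps)
qed

lemma defect_add:
  assumes "a \<le> b" "b \<le> c"
  shows "defect x a c = defect x a b + defect x b c"
proof -
  have "indicator {a<..c} t * t = indicator {a<..b} t * t + indicator {b<..c} t * t" for t :: real
    using assms by (auto simp: indicator_def)
  hence 1: "(LINT t|\<mu> x. indicator {a<..c} t * t) = (LINT t|\<mu> x. indicator {a<..b} t * t) + (LINT t|\<mu> x. indicator {b<..c} t * t)"
    by (simp add: Bochner_Integration.integral_add integrable_Ioc)
  let ?u = "(P a - P b) x" and ?v = "(P b - P c) x"
  have bu: "P b ?u = 0" and bv: "P b ?v = ?v"
    using P_mono[OF assms(1)] P_mono[OF assms(2)] PP[of a b]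
    by (simp_all add: blinfun.bilinear_simps proj_idem_apply[OF Pp]) (metis blinfun_apply_blinfun_compose)+
  have "cinner (B ?u) ?v = cinner (P b (B ?u)) ?v"
    by (metis bv selfadj_swap[OF proj_selfadj[OF Pp]])
  also have "P b (B ?u) = B (P b ?u)"
    by (metis PB blinfun_apply_blinfun_compose)
  finally have "cinner (B ?u) ?v = 0" by (simp only: bu) simp
  from qf_add_orth[OF B this] have "qf B (?u + ?v) = qf B ?u + qf B ?v" .
  moreover have "?u + ?v = (P a - P c) x" by (simp add: blinfun.bilinear_simps)
  ultimately show ?thesis unfolding defect_def 1 by simp
qed

lemma defect_small: "a \<le> b \<Longrightarrow> \<bar>defect x a b\<bar> \<le> (b - a) / 2 ^ n * qf (P a - P b) x"
proof (induction n arbitrary: a b)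
  case 0 thus ?case using defect_bound by simp
next
  case (Suc n)
  let ?m = "(a + b) / 2"
  have m: "a \<le> ?m" "?m \<le> b" using Suc.prems by auto
  have "\<bar>defect x a b\<bar> \<le> \<bar>defect x a ?m\<bar> + \<bar>defect x ?m b\<bar>" unfolding defect_add[OF m] by (rule abs_triangle_ineq)
  also have "\<dots> \<le> (?m - a) / 2 ^ n * qf (P a - P ?m) x + (b - ?m) / 2 ^ n * qf (P ?m - P b) x"
    by (intro add_mono Suc.IH m)
  also have "\<dots> = (b - a) / 2 ^ Suc n * (qf (P a - P ?m) x + qf (P ?m - P b) x)"
  proof -
    have "(?m - a) / 2 ^ n = (b - a) / 2 ^ Suc n" "(b - ?m) / 2 ^ n = (b - a) / 2 ^ Suc n"
      by (simp_all add: field_simps)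
    thus ?thesis by (simp only: distrib_left)
  qed
  also have "qf (P a - P ?m) x + qf (P ?m - P b) x = qf (P a - P b) x"
    by (simp add: qf_diff del: minus_blinfun.rep_eq)
  finally show ?case .
qed

lemma integral_\<mu>: "(LINT t|\<mu> x. t) = qf B x"
proof -
  have P: "P (- r) = id_blinfun" "P r = 0" by (auto intro!: P_lo P_hi simp: r_def)
  have rr: "- r \<le> r" by (simp add: r_def add_nonneg_pos)
  have "\<bar>defect x (-r) r\<bar> \<le> (r - - r) / 2 ^ n * qf (P (- r) - P r) x" for n
    by (rule defect_small[OF rr])
  moreover have "(\<lambda>n. (r - - r) / 2 ^ n * qf (P (- r) - P r) x) \<longlonglongrightarrow> 0"
    by (intro tendsto_mult_left_zero LIMSEQ_divide_realpow_zero) simp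
  ultimately have "\<bar>defect x (-r) r\<bar> \<le> 0" by (intro LIMSEQ_le_const) auto
  hence "(LINT t|\<mu> x. indicator {-r<..r} t * t) = qf B x" by (simp add: defect_def P)
  moreover have "(LINT t|\<mu> x. indicator {-r<..r} t * t) = (LINT t|\<mu> x. t)"
  proof (rule integral_cong_AE)
    show "AE t in \<mu> x. indicator {-r<..r} t * t = t" using AE_slab[of x] by eventually_elim simp
  qed (use integrable_Ioc integrable_\<mu> borel_measurable_integrable in blast)+
  ultimately show ?thesis by simp
qed

lemma spec_measure_EB: "spec_measure EB x = \<mu> x"
proof -
  interpret finite_measure "\<mu> x" by (rule finite_\<mu>)
  have "spec_measure EB x = measure_of UNIV (sets borel) (emeasure (\<mu> x))"
  proof (rule measure_of_eq)
    fix S :: "real set" assume "S \<in> sigma_sets UNIV (sets borel)"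
    hence "S \<in> sets borel" using sets.sigma_sets_eq[of "borel :: real measure"] by simp
    thus "ennreal (qf (EB S) x) = emeasure (\<mu> x) S" by (simp add: qf_EB emeasure_eq_measure)
  qed simp
  also have "\<dots> = \<mu> x" using measure_of_of_measure[of "\<mu> x"] by simp
  finally show ?thesis .
qed

lemma EB_spectral: "spectral_measure_of B EB"
  unfolding spectral_measure_of_def
proof (intro conjI ballI allI impI)
  show "projection_op (EB S)" for S by (rule EB_proj)
  show "EB S = 0" if "S \<notin> sets borel" for S using that by (simp add: EB_def)
  show "EB UNIV = id_blinfun" by (rule EB_UNIV)
  show "EB (S \<inter> T) = EB S \<cdot> EB T" if "S \<in> sets borel" "T \<in> sets borel" for S T by (rule EB_Int[OF that])
  show "sot_sums (\<lambda>j. EB (A j)) (EB (\<Union>j. A j))" if "range A \<subseteq> sets borel \<and> disjoint_family A" for A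
    using that by (intro EB_sums) auto
  show "\<exists>r. EB {- r..r} = id_blinfun"
  proof (intro exI[of _ r] EB_eqI)
    fix x
    interpret finite_measure "\<mu> x" by (rule finite_\<mu>)
    have "measure (\<mu> x) {-r<..r} \<le> measure (\<mu> x) {-r..r}" by (intro finite_measure_mono) auto
    moreover have "measure (\<mu> x) {-r..r} \<le> measure (\<mu> x) UNIV" by (intro finite_measure_mono) auto
    ultimately show "qf id_blinfun x = measure (\<mu> x) {-r..r}" by (simp add: measure_slab measure_UNIV)
  qed auto
  fix x
  have "has_bochner_integral (\<mu> x) (\<lambda>t. t) (qf B x)"
    using integrable_\<mu> integral_\<mu> by (simp add: has_bochner_integral_iff)
  from has_bochner_integral_bounded_linear[OF bounded_linear_of_real this]
  have "has_bochner_integral (\<mu> x) complex_of_real (of_real (qf B x))" .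
  thus "has_bochner_integral (spec_measure EB x) complex_of_real (cinner (B x) x)"
    unfolding spec_measure_EB using selfadj_real[OF B, of x] by simp
qed

end

lemma spectral_measure_exists:
  assumes B: "selfadj B"
  shows "\<exists>E. spectral_measure_of B E \<and> (\<forall>M S. vna M \<and> B \<in> M \<longrightarrow> E S \<in> M)"
proof -
  have "\<exists>z. sign_proj (B - t *\<^sub>R id_blinfun) z" for t
    by (rule sign_projection) (simp add: selfadj_diff selfadj_scaleR B)
  then obtain P where P: "\<And>t. sign_proj (B - t *\<^sub>R id_blinfun) (P t)" by metis
  interpret resolution B P "norm B + 1" using B P by unfold_locales auto
  show ?thesis using EB_spectral EB_M by blast
qed

lemma spectral_proj_spec:
  assumes B: "selfadj B"
  shows "spec B (spectral_proj B)" and "vna M \<Longrightarrow> B \<in> M \<Longrightarrow> spectral_proj B S \<in> M"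
proof -
  obtain E where E: "spectral_measure_of B E" "\<And>M S. vna M \<Longrightarrow> B \<in> M \<Longrightarrow> E S \<in> M"
    using spectral_measure_exists[OF B] by blast
  have "spectral_proj B = E" unfolding spectral_proj_def
    by (rule the_equality) (auto intro: spectral_measure_unique[OF B] E(1))
  thus "spec B (spectral_proj B)" "vna M \<Longrightarrow> B \<in> M \<Longrightarrow> spectral_proj B S \<in> M"
    using E B by (auto intro: spec.intro)
qed

subsection \<open>Inverses and inverse square roots\<close>

text \<open>The lower bound makes \<open>G\<close> injective with closed range; a vector orthogonal
  to the range is killed by the selfadjoint \<open>G\<close>, so the range is everything.\<close>

lemma coercive_inverse:
  fixes G :: "'h::chilbert_space oper"
  assumes G: "selfadj G" and t: "t > 0" and ge: "\<And>x. t * (norm x)\<^sup>2 \<le> qf G x"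
  shows "\<exists>K. positive_op K \<and> G \<cdot> K = id_blinfun \<and> K \<cdot> G = id_blinfun \<and> (\<forall>x. norm (K x) \<le> norm x / t)"
proof -
  have below: "t * norm x \<le> norm (G x)" for x
  proof (cases "x = 0")
    case False
    have "t * norm x * norm x \<le> norm (G x) * norm x"
      using ge[of x] Re_cauchy_schwarz[of "G x" x] by (simp add: power2_eq_square mult.assoc)
    thus ?thesis using False by (simp add: mult_le_cancel_right)
  qed simp
  have sub: "csubspace (range (blinfun_apply G))"
    unfolding csubspace_def
  proof (intro conjI ballI allI)
    show "0 \<in> range (blinfun_apply G)" by (metis blinfun.zero_right rangeI)
    fix x assume "x \<in> range (blinfun_apply G)"
    then obtain u where u: "x = G u" by auto
    show "c *\<^sub>C x \<in> range (blinfun_apply G)" for c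
      by (metis u complex_linearD[OF selfadj_cl[OF G]] rangeI)
    fix y assume "y \<in> range (blinfun_apply G)"
    then obtain v where v: "y = G v" by auto
    show "x + y \<in> range (blinfun_apply G)" by (metis u v blinfun.add_right rangeI)
  qed
  have "complete (blinfun_apply G ` UNIV)"
    by (rule complete_isometric_image[OF t subspace_UNIV blinfun.bounded_linear_right])
      (use below in \<open>auto simp: complete_UNIV mult.commute\<close>)
  hence cl: "closed (range (blinfun_apply G))" by (simp add: complete_eq_closed)
  have surj: "\<exists>x. G x = y" for y
  proof -
    obtain z where z: "z \<in> range (blinfun_apply G)" "\<And>w. w \<in> range (blinfun_apply G) \<Longrightarrow> cinner (y - z) w = 0"
      using orthogonal_projection_exists[OF sub cl, of y] by blast
    have "cinner (G (y - z)) w = cinner 0 w" for w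
      using z(2)[of "G w"] by (simp add: selfadj_swap[OF G])
    hence "G (y - z) = 0" by (rule cinner_ext)
    hence "y - z = 0" using below[of "y - z"] t by (simp add: mult_le_0_iff)
    thus ?thesis using z(1) by auto
  qed
  have inj: "x = y" if "G x = G y" for x y
    using below[of "x - y"] that t by (simp add: blinfun.bilinear_simps mult_le_0_iff)
  obtain k where k: "\<And>y. G (k y) = y" using surj by metis
  have kG: "k (G x) = x" for x by (rule inj) (rule k)
  have nk: "norm (k y) \<le> norm y / t" for y
    using below[of "k y"] t by (simp add: k field_simps)
  have "bounded_linear k"
  proof (rule bounded_linear_intro[where K = "1 / t"])
    show "k (x + y) = k x + k y" for x y by (rule inj) (simp add: k blinfun.bilinear_simps)
    show "k (r *\<^sub>R x) = r *\<^sub>R k x" for r x by (rule inj) (simp add: k blinfun.bilinear_simps)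
    show "norm (k x) \<le> norm x * (1 / t)" for x using nk by simp
  qed
  hence K: "blinfun_apply (Blinfun k) = k" by (rule bounded_linear_Blinfun_apply)
  have "positive_op (Blinfun k)"
    unfolding positive_op_iff
  proof (intro conjI allI selfadjI)
    show "complex_linear (Blinfun k)"
      unfolding complex_linear_def K by (intro allI, rule inj) (simp add: k complex_linearD[OF selfadj_cl[OF G]])
    show "cinner (Blinfun k x) y = cinner x (Blinfun k y)" for x y
      unfolding K by (metis k selfadj_swap[OF G])
    show "0 \<le> qf (Blinfun k) x" for x
    proof -
      have "0 \<le> t * (norm (k x))\<^sup>2" using t by simp
      also have "\<dots> \<le> qf G (k x)" by (rule ge)
      also have "\<dots> = qf (Blinfun k) x" unfolding K k by (rule Re_cinner_commute)
      finally show ?thesis .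
    qed
  qed
  moreover have "G \<cdot> Blinfun k = id_blinfun" "Blinfun k \<cdot> G = id_blinfun"
    by (rule blinfun_eqI, simp add: K k kG)+
  ultimately show ?thesis using nk K by metis
qed

lemma inverse_commute:
  assumes "G \<cdot> K = id_blinfun" "K \<cdot> G = id_blinfun" "G \<cdot> S = S \<cdot> G"
  shows "K \<cdot> S = S \<cdot> K"
proof -
  have "K \<cdot> S = K \<cdot> (S \<cdot> (G \<cdot> K))" by (simp add: assms(1) compose_simps)
  also have "\<dots> = (K \<cdot> G) \<cdot> S \<cdot> K" using assms(3) by (metis compose_assoc)
  finally show ?thesis by (simp add: assms(2) compose_simps)
qed

lemma eq_applyD: "S = T \<Longrightarrow> blinfun_apply S x = blinfun_apply T x" by simp

context vna
begin

text \<open>\<open>D\<close> is the inverse square root of \<open>A\<close> cut down to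
  \<open>e\<close>. Off \<open>e\<close> the operator \<open>A\<close> may fail to be invertible, so
  it is replaced there by \<open>t\<close>: the operator \<open>G\<close> is coercive on the whole
  space, and the root of its inverse is restricted to \<open>e\<close>.\<close>

lemma inverse_root:
  assumes A: "A \<in> M" "positive_op A" and e: "e \<in> projections M" and eA: "e \<cdot> A = A \<cdot> e" and t: "t > 0"
    and ge: "\<And>x. t * (norm (e x))\<^sup>2 \<le> qf A (e x)"
  shows "\<exists>D\<in>M. selfadj D \<and> D \<cdot> e = D \<and> e \<cdot> D = D \<and> D \<cdot> A \<cdot> D = e \<and> D \<cdot> A = A \<cdot> D
    \<and> (\<forall>x. t * (norm (D x))\<^sup>2 \<le> (norm (e x))\<^sup>2)"
proof -
  have eM: "e \<in> M" and ep: "projection_op e" using e by (auto simp: projM)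
  define G where "G = A \<cdot> e + t *\<^sub>R (id_blinfun - e)"
  have sAe: "selfadj (A \<cdot> e)" by (rule selfadj_commuting) (simp_all add: A positive_selfadj ep proj_selfadj eA)
  have G: "selfadj G" "G \<in> M"
    by (simp_all add: G_def selfadj_add sAe selfadj_scaleR proj_selfadj proj_complement ep M_add M_compose A eM M_scaleR M_diff M_id)
  have Ge: "G \<cdot> e = A \<cdot> e" by (simp add: G_def compose_simps compose_assoc proj_idem[OF ep])
  have eG: "G \<cdot> e = e \<cdot> G"
    unfolding Ge by (simp add: G_def compose_simps proj_idem[OF ep])
      (metis compose_assoc eA proj_idem[OF ep])
  have AG: "G \<cdot> A = A \<cdot> G"
    by (simp add: G_def compose_simps eA) (metis compose_assoc eA)
  have "t * (norm x)\<^sup>2 \<le> qf G x" for x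
  proof -
    have "qf (A \<cdot> e) x = qf A (blinfun_apply e x)"
    proof -
      have "blinfun_apply (A \<cdot> e) x = blinfun_apply e (blinfun_apply A (blinfun_apply e x))"
        using eA proj_idem_apply[OF ep] by (metis blinfun_apply_blinfun_compose)
      hence "cinner (blinfun_apply (A \<cdot> e) x) x = cinner (blinfun_apply A (blinfun_apply e x)) (blinfun_apply e x)"
        by (metis selfadj_swap[OF proj_selfadj[OF ep]])
      thus ?thesis by simp
    qed
    moreover have "qf (id_blinfun - e) x = (norm (x - e x))\<^sup>2"
      using qf_proj[OF proj_complement[OF ep], of x] by (simp add: blinfun.bilinear_simps)
    ultimately have "qf G x = qf A (e x) + t * (norm (x - e x))\<^sup>2"
      unfolding G_def qf_add qf_scaleR by (simp only:)
    thus ?thesis using ge[of x] proj_split_norm[OF ep, of x] by (simp add: distrib_left)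
  qed
  from coercive_inverse[OF G(1) t this] obtain K where K: "positive_op K" "G \<cdot> K = id_blinfun" "K \<cdot> G = id_blinfun"
    "\<And>x. norm (K x) \<le> norm x / t" by blast
  have KS: "K \<cdot> S = S \<cdot> K" if "G \<cdot> S = S \<cdot> G" for S by (rule inverse_commute[OF K(2,3) that])
  have "K \<in> M" by (rule M_I[OF positive_cl[OF K(1)] KS]) (rule M_commute[OF G(2)])
  from M_sqrt[OF this K(1)] obtain R where R: "R \<in> M" "positive_op R" "R \<cdot> R = K"
    "\<And>S. K \<cdot> S = S \<cdot> K \<Longrightarrow> R \<cdot> S = S \<cdot> R" by blast
  have Re: "R \<cdot> e = e \<cdot> R" by (rule R(4)[OF KS[OF eG]])
  have RA: "R \<cdot> A = A \<cdot> R" by (rule R(4)[OF KS[OF AG]])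
  define D where "D = R \<cdot> e"
  have "D \<in> M" by (simp add: D_def M_compose R eM)
  moreover have "selfadj D" unfolding D_def
    by (rule selfadj_commuting) (simp_all add: R positive_selfadj ep proj_selfadj Re)
  moreover have "D \<cdot> e = D" by (simp add: D_def compose_assoc proj_idem[OF ep])
  moreover have "e \<cdot> D = D" by (metis D_def Re compose_assoc proj_idem[OF ep])
  moreover have "D \<cdot> A = A \<cdot> D" by (metis D_def RA compose_assoc eA)
  moreover have "D \<cdot> A \<cdot> D = e"
  proof -
    have "D \<cdot> A \<cdot> D = R \<cdot> (R \<cdot> (A \<cdot> (e \<cdot> e)))"
      unfolding D_def by (metis RA Re compose_assoc eA)
    also have "\<dots> = K \<cdot> (G \<cdot> e)" by (simp add: proj_idem[OF ep] Ge R(3)[symmetric] compose_assoc)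
    also have "\<dots> = e" by (metis K(3) compose_assoc compose_id_left)
    finally show ?thesis .
  qed
  moreover have "t * (norm (D x))\<^sup>2 \<le> (norm (e x))\<^sup>2" for x
  proof -
    let ?u = "e x"
    have "(norm (D x))\<^sup>2 = qf K ?u"
      using norm_adj_apply[OF positive_cl[OF R(2)], of ?u] eq_applyD[OF R(3), of ?u]
      by (simp add: D_def selfadj_adj[OF positive_selfadj[OF R(2)]])
    also have "\<dots> \<le> norm (K ?u) * norm ?u" by (rule Re_cauchy_schwarz)
    also have "\<dots> \<le> norm ?u / t * norm ?u" by (intro mult_right_mono K(4)) auto
    finally show ?thesis using t by (simp add: field_simps power2_eq_square)
  qed
  ultimately show ?thesis by blast
qed

subsection \<open>Partial isometries and subequivalence\<close>

text \<open>Murray-von Neumann subequivalence; the final projection \<open>v \<cdot> adj v\<close>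
  stays implicit in \<open>f \<cdot> v = v\<close>.\<close>

definition sub :: "'h oper \<Rightarrow> 'h oper \<Rightarrow> bool" where
  "sub e f \<longleftrightarrow> (\<exists>v\<in>M. adj v \<cdot> v = e \<and> f \<cdot> v = v)"

lemma norm_pi: "v \<in> M \<Longrightarrow> adj v \<cdot> v = e \<Longrightarrow> projection_op e \<Longrightarrow> norm (v x) = norm (e x)"
proof -
  assume v: "v \<in> M" "adj v \<cdot> v = e" "projection_op e"
  have "(norm (v x))\<^sup>2 = (norm (e x))\<^sup>2"
    using qf_gram[OF M_cl[OF v(1)], of x] v qf_proj by metis
  thus ?thesis by simp
qed

lemma pi_right: "v \<in> M \<Longrightarrow> adj v \<cdot> v = e \<Longrightarrow> projection_op e \<Longrightarrow> v \<cdot> e = v"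
proof (rule blinfun_eqI)
  fix x assume v: "v \<in> M" "adj v \<cdot> v = e" "projection_op e"
  have "norm (v (x - e x)) = norm (e (x - e x))"
    by (rule norm_pi[OF v])
  also have "\<dots> = 0" by (simp add: blinfun.bilinear_simps proj_idem_apply[OF v(3)])
  finally have "blinfun_apply v (x - blinfun_apply e x) = 0" by simp
  thus "blinfun_apply (v \<cdot> e) x = blinfun_apply v x" by (simp add: blinfun.bilinear_simps)
qed

lemma pi_final: "v \<in> M \<Longrightarrow> adj v \<cdot> v = e \<Longrightarrow> projection_op e \<Longrightarrow> v \<cdot> adj v \<in> projections M"
proof -
  assume v: "v \<in> M" "adj v \<cdot> v = e" "projection_op e"
  have "(v \<cdot> adj v) \<cdot> (v \<cdot> adj v) = v \<cdot> adj v"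
    by (metis compose_assoc v(2) pi_right[OF v])
  thus ?thesis unfolding projM using v
    by (auto intro!: projI M_compose M_adj positive_selfadj[OF positive_gram'] M_cl)
qed

lemma adj_left_absorb: "f \<cdot> v = v \<Longrightarrow> projection_op f \<Longrightarrow> v \<in> M \<Longrightarrow> adj v \<cdot> f = adj v"
  using compose_flip[of f v v f "adj v" "adj v"] by (simp add: proj_cl proj_adj M_cl)

lemma sub_refl: "e \<in> projections M \<Longrightarrow> sub e e"
  unfolding sub_def projM by (intro bexI[of _ e]) (simp_all add: proj_adj proj_idem)

lemma sub_trans:
  assumes "sub e f" "sub f g" "projection_op f"
  shows "sub e g"
proof -
  obtain v w where v: "v \<in> M" "adj v \<cdot> v = e" "f \<cdot> v = v" and w: "w \<in> M" "adj w \<cdot> w = f" "g \<cdot> w = w"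
    using assms by (auto simp: sub_def)
  have "adj (w \<cdot> v) \<cdot> (w \<cdot> v) = adj v \<cdot> ((adj w \<cdot> w) \<cdot> v)"
    by (simp add: adj_compose M_cl v(1) w(1) compose_assoc)
  also have "\<dots> = e" by (simp only: w v)
  finally show ?thesis unfolding sub_def
    by (intro bexI[of _ "w \<cdot> v"]) (simp_all add: M_compose v w compose_assoc[symmetric])
qed

lemma sub_mono: "sub e f \<Longrightarrow> g \<cdot> f = f \<Longrightarrow> sub e g"
  unfolding sub_def by (metis compose_assoc)

lemma sub_of_le: "e \<in> projections M \<Longrightarrow> f \<cdot> e = e \<Longrightarrow> sub e f"
  by (rule sub_mono[OF sub_refl])

lemma sub_final: "v \<in> M \<Longrightarrow> adj v \<cdot> v = e \<Longrightarrow> projection_op e \<Longrightarrow> sub e (v \<cdot> adj v)"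
  unfolding sub_def by (rule bexI[of _ v]) (simp_all add: compose_assoc pi_right)

lemma sub_final': "v \<in> M \<Longrightarrow> adj v \<cdot> v = e \<Longrightarrow> projection_op e \<Longrightarrow> sub (v \<cdot> adj v) e"
  unfolding sub_def
proof (rule bexI[of _ "adj v"])
  assume v: "v \<in> M" "adj v \<cdot> v = e" "projection_op e"
  show "adj (adj v) \<cdot> adj v = v \<cdot> adj v \<and> e \<cdot> adj v = adj v"
    using compose_flip[OF pi_right[OF v]] v by (simp add: adj_adj M_cl proj_cl proj_adj)
qed (rule M_adj)

lemma subequivalent_sub:
  assumes "subequivalent_in M P Q" "projection_op P" "projection_op Q"
  shows "sub P Q"
proof -
  obtain Q' X where Q': "Q' \<in> projections M" "op_le Q' Q" and X: "X \<in> M" "P = X \<cdot> adj X" "Q' = adj X \<cdot> X"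
    using assms by (auto simp: subequivalent_in_def equivalent_in_def)
  have Q'p: "projection_op Q'" using Q' by (simp add: projM)
  have "sub P Q'" using sub_final'[OF X(1) X(3)[symmetric] Q'p] X(2) by simp
  thus ?thesis using sub_mono proj_le_iff[OF Q'p assms(3)] Q'(2) by blast
qed

text \<open>Orthogonal final ranges make norms add up, and the orthogonal initial projections bound
  the total by \<open>norm x\<close>, so \<open>strong_sum_exists\<close> applies.\<close>

lemma sum_pi:
  assumes v: "\<And>n. v n \<in> M" "\<And>n. projection_op (adj (v n) \<cdot> v n)"
    and o1: "\<And>m n. m \<noteq> n \<Longrightarrow> adj (v m) \<cdot> v n = 0" and o2: "\<And>m n. m \<noteq> n \<Longrightarrow> v m \<cdot> adj (v n) = 0"
  shows "orth_seq (\<lambda>n. adj (v n) \<cdot> v n)"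
    and "\<exists>W\<in>M. adj W \<cdot> W = psum (\<lambda>n. adj (v n) \<cdot> v n) \<and> (\<forall>n. W \<cdot> (adj (v n) \<cdot> v n) = v n)
      \<and> (\<forall>x. (\<lambda>n. v n x) sums W x)"
proof -
  let ?e = "\<lambda>n. adj (v n) \<cdot> v n"
  show o: "orth_seq ?e"
    unfolding orth_seq_def using v(2) o2 by (auto simp: compose_assoc) (metis (no_types, lifting) blinfun_compose_zero compose_assoc)
  have nv: "norm (v n x) = norm ((?e n) x)" for n x
    by (rule norm_pi[OF v(1) refl v(2)])
  have bd: "(\<Sum>i<n. (norm (v i x))\<^sup>2) \<le> 1\<^sup>2 * (norm x)\<^sup>2" for n x
  proof -
    have "(\<Sum>i<n. (norm (v i x))\<^sup>2) \<le> (norm ((psum ?e) x))\<^sup>2"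
      unfolding nv by (rule sum_le_suminf[of "\<lambda>i. (norm ((?e i) x))\<^sup>2", THEN order_trans])
        (use psum_norm_sums[OF o, of x] in \<open>auto simp: sums_iff\<close>)
    also have "\<dots> \<le> (norm x)\<^sup>2" by (intro power_mono norm_proj_le psum_proj[OF o]) auto
    finally show ?thesis by simp
  qed
  obtain W where W: "complex_linear W" "\<And>x. (\<lambda>n. v n x) sums W x"
    "\<And>x. (\<lambda>n. (norm (v n x))\<^sup>2) sums (norm (W x))\<^sup>2"
    using strong_sum_exists[OF M_cl[OF v(1)] o1 bd] by auto
  have WM: "W \<in> M" by (rule M_sums[OF W(2) v(1)])
  have "adj W \<cdot> W = psum ?e"
  proof (rule selfadj_eqI)
    show "selfadj (adj W \<cdot> W)" by (rule positive_selfadj[OF positive_gram[OF W(1)]])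
    show "selfadj (psum ?e)" by (rule proj_selfadj[OF psum_proj[OF o]])
    fix x
    have "(norm (W x))\<^sup>2 = (norm ((psum ?e) x))\<^sup>2"
      using W(3)[of x] psum_norm_sums[OF o, of x] unfolding nv by (rule sums_unique2)
    thus "qf (adj W \<cdot> W) x = qf (psum ?e) x"
      by (simp only: qf_gram[OF W(1)] qf_proj[OF psum_proj[OF o]])
  qed
  moreover have "W \<cdot> ?e n = v n" for n
  proof (rule sums_op_unique[OF sums_compose_right[OF W(2)]])
    fix x
    have "(v m \<cdot> ?e n) x = (if m = n then v n x else 0)" for m
    proof (cases "m = n")
      case True thus ?thesis using pi_right[OF v(1) refl v(2), of n] by simp
    next
      case False
      hence "v m \<cdot> ?e n = 0" using o2[OF False] by (metis blinfun_compose_zero(1) compose_assoc)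
      thus ?thesis using False by simp
    qed
    thus "(\<lambda>m. (v m \<cdot> ?e n) x) sums v n x"
      using sums_single[of n "\<lambda>_. v n x"] by (simp cong: if_cong)
  qed
  ultimately show "\<exists>W\<in>M. adj W \<cdot> W = psum ?e \<and> (\<forall>n. W \<cdot> ?e n = v n)
    \<and> (\<forall>x. (\<lambda>n. v n x) sums W x)"
    using WM W(2) by blast
qed

lemma sub_psum:
  assumes e: "orth_seq e" and f: "\<And>m n. m \<noteq> n \<Longrightarrow> f m \<cdot> f n = 0" "\<And>n. projection_op (f n)"
    and s: "\<And>n. sub (e n) (f n)" and g: "\<And>n. g \<cdot> f n = f n"
  shows "sub (psum e) g"
proof -
  obtain v where v: "\<And>n. v n \<in> M" "\<And>n. adj (v n) \<cdot> v n = e n" "\<And>n. f n \<cdot> v n = v n"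
    using s unfolding sub_def by metis
  have vp: "projection_op (adj (v n) \<cdot> v n)" for n using v(2) orth_seqD(1)[OF e] by simp
  have o1: "adj (v m) \<cdot> v n = 0" if "m \<noteq> n" for m n
    using adj_left_absorb[OF v(3) f(2) v(1)] f(1)[OF that]
    by (metis blinfun_compose_zero(1) blinfun_compose_zero(2) compose_assoc v(3))
  have ve: "v n \<cdot> e n = v n" for n by (rule pi_right[OF v(1,2) orth_seqD(1)[OF e]])
  have o2: "v m \<cdot> adj (v n) = 0" if "m \<noteq> n" for m n
  proof -
    have "e n \<cdot> adj (v n) = adj (v n)"
      using compose_flip[OF ve[of n]] by (simp add: M_cl v proj_cl proj_adj orth_seqD(1)[OF e])
    thus ?thesis using orth_seqD(2)[OF e that] ve
      by (metis blinfun_compose_zero(1) blinfun_compose_zero(2) compose_assoc)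
  qed
  obtain W where W: "W \<in> M" "adj W \<cdot> W = psum e" "\<And>x. (\<lambda>n. v n x) sums W x"
    using sum_pi(2)[of v, OF v(1) vp o1 o2] unfolding v(2) by blast
  have "g \<cdot> W = W"
  proof (rule sums_op_unique[OF sums_compose_left[OF W(3)]])
    fix x
    have "g \<cdot> v n = v n" for n by (metis compose_assoc g v(3))
    thus "(\<lambda>n. blinfun_apply (g \<cdot> v n) x) sums blinfun_apply W x" using W(3) by simp
  qed
  thus ?thesis using W by (auto simp: sub_def)
qed

text \<open>Otherwise continuity along the sets \<open>{1 / Suc n<..}\<close> would kill the
  projection for \<open>{0<..}\<close>, and \<open>T\<close> would be at most
  \<open>0\<close>.\<close>

lemma nonzero_spectral:
  assumes T: "T \<in> M" "positive_op T" "T \<noteq> 0"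
  shows "\<exists>\<epsilon>>0. spectral_proj T {\<epsilon><..} \<noteq> 0"
proof (rule ccontr)
  interpret spec T "spectral_proj T" by (rule spectral_proj_spec(1)[OF positive_selfadj[OF T(2)]])
  assume "\<not> ?thesis"
  hence z: "spectral_proj T {1 / Suc n<..} = 0" for n by (metis divide_pos_pos of_nat_0_less_iff zero_less_Suc zero_less_one)
  have "slim (\<lambda>n. spectral_proj T {1 / real (Suc n)<..}) (spectral_proj T (\<Union>n. {1 / real (Suc n)<..}))"
    by (rule E_incseq) (auto simp: incseq_def frac_le intro: order.strict_trans1)
  moreover have "(\<Union>n. {1 / real (Suc n)<..}) = {0<..}"
  proof (rule set_eqI)
    fix y :: real
    have "\<exists>n. 1 / real (Suc n) < y" if "0 < y" using that reals_Archimedean by (auto simp: inverse_eq_divide)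
    moreover have "0 < y" if "1 / real (Suc n) < y" for n
      by (rule less_trans[OF _ that]) simp
    ultimately show "y \<in> (\<Union>n. {1 / real (Suc n)<..}) \<longleftrightarrow> y \<in> {0<..}" by blast
  qed
  ultimately have "slim (\<lambda>n. 0) (spectral_proj T {0<..})" unfolding z by simp
  moreover have "slim (\<lambda>n. 0) (0::'h oper)" by simp
  ultimately have "spectral_proj T {0<..} = 0" by (rule slim_unique)
  hence "spectral_proj T {..0} = id_blinfun" using E_compl[of "{0<..}"] by (simp add: Compl_greaterThan)
  hence "qf T x \<le> 0" for x using E_le[of "{..0}" 0 x] by simp
  hence "qf T x = 0" for x using positive_qf[OF T(2), of x] by (meson antisym)
  hence "T = 0" by (intro blinfun_eqI) (simp add: positive_qf_zero[OF T(2)])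
  thus False using T by simp
qed

text \<open>A piece of the polar decomposition: on a spectral projection \<open>p\<close> where
  \<open>adj T \<cdot> T\<close> is bounded below, \<open>T\<close> times the inverse root of
  \<open>adj T \<cdot> T\<close> is a partial isometry with initial projection
  \<open>p\<close>.\<close>

lemma nonzero_pi:
  assumes T: "T \<in> M" "T \<noteq> 0" and e: "projection_op e" "T \<cdot> e = T" and f: "f \<cdot> T = T"
  shows "\<exists>v\<in>M. v \<noteq> 0 \<and> projection_op (adj v \<cdot> v) \<and> e \<cdot> (adj v \<cdot> v) = adj v \<cdot> v \<and> f \<cdot> v = v"
proof -
  let ?S = "adj T \<cdot> T"
  have S: "?S \<in> M" "positive_op ?S" using T by (auto intro: M_intros positive_gram M_cl)
  have "?S \<noteq> 0"
  proof
    assume "?S = 0"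
    hence "norm (T x) = 0" for x using qf_gram[OF M_cl[OF T(1)], of x] by simp
    hence "T = 0" by (intro blinfun_eqI) simp
    thus False using T by simp
  qed
  from nonzero_spectral[OF S this] obtain \<epsilon> where \<epsilon>: "\<epsilon> > 0" "spectral_proj ?S {\<epsilon><..} \<noteq> 0" by blast
  interpret spec ?S "spectral_proj ?S" by (rule spectral_proj_spec(1)[OF positive_selfadj[OF S(2)]])
  define p where "p = spectral_proj ?S {\<epsilon><..}"
  have p: "p \<in> projections M"
    unfolding p_def projM using E_proj spectral_proj_spec(2)[OF positive_selfadj[OF S(2)] vna_axioms S(1)] by blast
  have "\<epsilon> * (norm (p x))\<^sup>2 \<le> qf ?S (p x)" for x
    unfolding p_def by (rule E_ge) auto
  from inverse_root[OF S p _ \<epsilon>(1) this] obtain D where D: "D \<in> M" "selfadj D" "D \<cdot> p = D" "D \<cdot> ?S \<cdot> D = p" "D \<cdot> ?S = ?S \<cdot> D"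
    using E_commute unfolding p_def by blast
  define v where "v = T \<cdot> D"
  have "adj v \<cdot> v = D \<cdot> ?S \<cdot> D"
    unfolding v_def by (simp add: adj_compose M_cl T(1) D(1) selfadj_adj[OF D(2)] compose_assoc)
  hence vv: "adj v \<cdot> v = p" by (simp only: D(4))
  have eS: "e \<cdot> ?S = ?S"
    using compose_flip[OF e(2)] T e by (metis M_cl compose_assoc proj_adj proj_cl)
  have "e \<cdot> p = p" by (metis D(4) D(5) compose_assoc eS)
  moreover have "v \<noteq> 0" using vv \<epsilon>(2) p_def by auto
  ultimately show ?thesis using vv p T D f
    by (intro bexI[of _ v]) (auto simp: projM v_def M_compose compose_assoc[symmetric])
qed

end

subsection \<open>Comparison of projections in a factor\<close>

lemma zero_absorb_left: "a \<cdot> b = 0 \<Longrightarrow> b \<cdot> c = c \<Longrightarrow> a \<cdot> c = 0"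
  using compose_assoc[of a b c] by simp

lemma zero_absorb_right: "a \<cdot> b = a \<Longrightarrow> b \<cdot> c = 0 \<Longrightarrow> a \<cdot> c = 0"
  using compose_assoc[of a b c] by simp

lemma maximal_related_family:
  assumes sym: "\<And>v w. R v w \<Longrightarrow> R w v"
  shows "\<exists>F\<subseteq>S. (\<forall>v\<in>F. \<forall>w\<in>F. v \<noteq> w \<longrightarrow> R v w) \<and> (\<forall>v\<in>S. (\<forall>w\<in>F. R v w) \<longrightarrow> v \<in> F)"
proof -
  define \<A> where "\<A> = {F. F \<subseteq> S \<and> (\<forall>v\<in>F. \<forall>w\<in>F. v \<noteq> w \<longrightarrow> R v w)}"
  have "\<exists>F\<in>\<A>. \<forall>X\<in>\<A>. F \<subseteq> X \<longrightarrow> X = F"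
  proof (rule subset_Zorn')
    fix C assume C: "subset.chain \<A> C"
    have "R v w" if vw: "v \<in> X" "X \<in> C" "w \<in> Y" "Y \<in> C" "v \<noteq> w" for v w X Y
    proof -
      have "X \<subseteq> Y \<or> Y \<subseteq> X" using C vw by (auto simp: subset.chain_def)
      then obtain Z where "Z \<in> C" "v \<in> Z" "w \<in> Z" using vw by blast
      moreover have "Z \<in> \<A>" using C \<open>Z \<in> C\<close> by (auto simp: subset.chain_def)
      ultimately show ?thesis using vw(5) by (simp add: \<A>_def)
    qed
    thus "\<Union>C \<in> \<A>" using C by (auto simp: subset.chain_def \<A>_def)
  qed
  then obtain F where F: "F \<in> \<A>" "\<And>X. X \<in> \<A> \<Longrightarrow> F \<subseteq> X \<Longrightarrow> X = F" by blast
  have "v \<in> F" if v: "v \<in> S" "\<forall>w\<in>F. R v w" for v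
  proof -
    have "insert v F \<in> \<A>" using F(1) v sym by (auto simp: \<A>_def)
    from F(2)[OF this] show ?thesis by blast
  qed
  thus ?thesis using F(1) by (auto simp: \<A>_def)
qed

locale sfactor = vna M for M :: "'h::chilbert_space oper set" +
  assumes factor: "factor M" and sigma_finite: "sigma_finite_vna M"
begin

lemma center_scalar: "T \<in> M \<Longrightarrow> T \<in> commutant M \<Longrightarrow> \<exists>c. \<forall>x. T x = c *\<^sub>C x"
  using factor by (simp add: factor_def center_def)

text \<open>The vectors annihilated by every \<open>e \<cdot> T\<close> form a closed subspace
  invariant under \<open>M\<close> and its commutant, so its projection is central and hence scalar.
  If all products vanished it would contain the range of \<open>f\<close>, so it would be the whole
  space and \<open>e\<close> would be \<open>0\<close>.\<close>

lemma factor_nonzero_product: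
  assumes e: "e \<in> projections M" "e \<noteq> 0" and f: "f \<in> projections M" "f \<noteq> 0"
  shows "\<exists>T\<in>M. e \<cdot> T \<cdot> f \<noteq> 0"
proof (rule ccontr)
  assume "\<not> ?thesis"
  hence z: "e (T (f x)) = 0" if "T \<in> M" for T x
    using that by (metis blinfun.zero_left blinfun_apply_blinfun_compose)
  define S where "S = {x. \<forall>T\<in>M. e (T x) = 0}"
  have eM: "e \<in> M" using e by (simp add: projM)
  have "csubspace S"
    unfolding S_def csubspace_def by (auto simp: blinfun.bilinear_simps complex_linearD M_cl eM)
  moreover have "closed S"
  proof -
    have "S = (\<Inter>T\<in>M. {x. blinfun_apply (e \<cdot> T) x = 0})" by (auto simp: S_def)
    also have "closed \<dots>" by (intro closed_INT ballI closed_kernel)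
    finally show ?thesis .
  qed
  ultimately obtain p where p: "projection_op p" "\<And>x. p x = x \<longleftrightarrow> x \<in> S"
    using proj_exists by blast
  have "p \<in> projections M"
  proof (rule projM_I[OF p(1)])
    fix Q x assume Q: "Q \<in> commutant M" and x: "p x = x"
    have "e (T (Q x)) = Q (e (T x))" if "T \<in> M" for T
      using M_commute[OF that Q] M_commute[OF eM Q] by (metis blinfun_apply_blinfun_compose)
    thus "p (Q x) = Q x"
      using x unfolding p(2) S_def by (simp add: blinfun.bilinear_simps)
  qed
  hence pM: "p \<in> M" by (simp add: projM)
  have inv: "p \<cdot> (T \<cdot> p) = T \<cdot> p" if T: "T \<in> M" for T
  proof (rule blinfun_eqI)
    fix x
    have "p x \<in> S" using p proj_idem_apply by blast
    hence "T (p x) \<in> S"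
      using T M_compose unfolding S_def by (auto simp del: blinfun_apply_blinfun_compose simp flip: blinfun_apply_blinfun_compose)
        (metis blinfun_apply_blinfun_compose compose_assoc)
    thus "blinfun_apply (p \<cdot> (T \<cdot> p)) x = blinfun_apply (T \<cdot> p) x" using p(2) by simp
  qed
  have "p \<in> commutant M"
    unfolding commutant_def
  proof (intro CollectI conjI ballI)
    fix T assume T: "T \<in> M"
    have "adj (p \<cdot> (adj T \<cdot> p)) = adj (adj T \<cdot> p)" by (simp add: inv[OF M_adj[OF T]])
    hence "p \<cdot> T \<cdot> p = p \<cdot> T"
      using T p by (simp add: adj_compose adj_adj M_cl cl_adj cl_compose proj_cl proj_adj)
    thus "p \<cdot> T = T \<cdot> p" using inv[OF T] by (simp add: compose_assoc)
  qed (rule proj_cl[OF p(1)])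
  from center_scalar[OF pM this] obtain c where c: "\<And>x. p x = c *\<^sub>C x" by blast
  obtain x where x: "f x \<noteq> 0" using f(2) by (metis blinfun.zero_left blinfun_eqI)
  have "p (f x) = f x" using z by (simp add: p(2) S_def)
  hence "(c - 1) *\<^sub>C f x = 0"
    using c scaleC_add_left[of "c - 1" 1 "f x"] by simp
  hence "norm ((c - 1) *\<^sub>C f x) = 0" by simp
  hence "c = 1" using x by (simp add: norm_scaleC)
  hence "y \<in> S" for y using p(2) c by simp
  hence "e y = 0" for y using M_id unfolding S_def by force
  hence "e = 0" by (intro blinfun_eqI) simp
  thus False using e by simp
qed

lemma factor_nonzero_pi:
  assumes e: "e \<in> projections M" "e \<noteq> 0" and f: "f \<in> projections M" "f \<noteq> 0"
  shows "\<exists>v\<in>M. v \<noteq> 0 \<and> projection_op (adj v \<cdot> v) \<and> e \<cdot> (adj v \<cdot> v) = adj v \<cdot> v \<and> f \<cdot> v = v"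
proof -
  obtain T where T: "T \<in> M" "f \<cdot> T \<cdot> e \<noteq> 0" using factor_nonzero_product[OF f e] by blast
  show ?thesis
    by (rule nonzero_pi[of "f \<cdot> T \<cdot> e"])
      (use T e f in \<open>auto simp: projM M_compose compose_assoc proj_idem, simp_all add: compose_assoc[symmetric] proj_idem\<close>)
qed

text \<open>A maximal \<open>R\<close>-related family has orthogonal nonzero final projections,
  hence is countable by sigma-finiteness. Enumerating it and filling up with \<open>0\<close> gives
  a sequence; the last clause records maximality.\<close>

lemma family_sequence:
  assumes S: "\<And>v. v \<in> S \<Longrightarrow> v \<in> M \<and> v \<noteq> 0 \<and> v \<cdot> adj v \<in> projections M"
    and R: "\<And>v w. v \<in> S \<Longrightarrow> w \<in> S \<Longrightarrow> R v w \<Longrightarrow> (v \<cdot> adj v) \<cdot> (w \<cdot> adj w) = 0" and sym: "\<And>v w. R v w \<Longrightarrow> R w v"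
  shows "\<exists>V::nat \<Rightarrow> 'h oper. (\<forall>n. V n \<in> S \<or> V n = 0) \<and> (\<forall>m n. m \<noteq> n \<longrightarrow> V m \<noteq> 0 \<longrightarrow> V n \<noteq> 0 \<longrightarrow> R (V m) (V n))
    \<and> \<not> (\<exists>v\<in>S. \<forall>n. V n \<noteq> 0 \<longrightarrow> R v (V n))"
proof -
  obtain F where F: "F \<subseteq> S" "\<And>v w. v \<in> F \<Longrightarrow> w \<in> F \<Longrightarrow> v \<noteq> w \<Longrightarrow> R v w" "\<And>v. v \<in> S \<Longrightarrow> \<forall>w\<in>F. R v w \<Longrightarrow> v \<in> F"
    using maximal_related_family[of R S, OF sym] by metis
  have nz: "v \<cdot> adj v \<noteq> 0" if "v \<in> S" for v
  proof
    assume "v \<cdot> adj v = 0"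
    hence "norm (adj v x) = 0" for x
      using qf_gram'[of v x] S[OF that] by (simp add: M_cl)
    hence "adj v = 0" by (intro blinfun_eqI) simp
    hence "v = 0" using adj_adj[of v] S[OF that] by (simp add: M_cl)
    thus False using S[OF that] by simp
  qed
  have inj: "inj_on (\<lambda>v. v \<cdot> adj v) F"
  proof (rule inj_onI, rule ccontr)
    fix v w assume vw: "v \<in> F" "w \<in> F" "v \<cdot> adj v = w \<cdot> adj w" "v \<noteq> w"
    have "(v \<cdot> adj v) \<cdot> (w \<cdot> adj w) = 0" using R F vw by blast
    moreover have "projection_op (w \<cdot> adj w)" using S F vw by (auto simp: projM)
    ultimately have "w \<cdot> adj w = 0" using proj_idem vw(3) by metis
    thus False using nz F vw by blast
  qed
  have "countable ((\<lambda>v. v \<cdot> adj v) ` F)"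
  proof (rule sigma_finite[unfolded sigma_finite_vna_def, rule_format])
    show "(\<lambda>v. v \<cdot> adj v) ` F \<subseteq> projections M - {0} \<and>
      (\<forall>P\<in>(\<lambda>v. v \<cdot> adj v) ` F. \<forall>Q\<in>(\<lambda>v. v \<cdot> adj v) ` F. P \<noteq> Q \<longrightarrow> P \<cdot> Q = 0)"
    proof (intro conjI ballI impI)
      show "(\<lambda>v. v \<cdot> adj v) ` F \<subseteq> projections M - {0}"
      proof
        fix Q assume "Q \<in> (\<lambda>v. v \<cdot> adj v) ` F"
        then obtain v where "v \<in> S" "Q = v \<cdot> adj v" using F(1) by blast
        thus "Q \<in> projections M - {0}" using S nz by simp
      qed
      fix P Q assume "P \<in> (\<lambda>v. v \<cdot> adj v) ` F" "Q \<in> (\<lambda>v. v \<cdot> adj v) ` F" "P \<noteq> Q"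
      then obtain v w where "v \<in> F" "w \<in> F" "v \<noteq> w" "P = v \<cdot> adj v" "Q = w \<cdot> adj w" by blast
      moreover from this have "R v w" by (intro F(2))
      moreover have "v \<in> S" "w \<in> S" using F(1) \<open>v \<in> F\<close> \<open>w \<in> F\<close> by auto
      ultimately have "(v \<cdot> adj v) \<cdot> (w \<cdot> adj w) = 0" by (intro R)
      thus "P \<cdot> Q = 0" using \<open>P = v \<cdot> adj v\<close> \<open>Q = w \<cdot> adj w\<close> by (simp only:)
    qed
  qed
  hence cF: "countable F" using countable_image_inj_on[OF _ inj] by blast
  define V where "V n = (if n \<in> to_nat_on F ` F then from_nat_into F n else 0)" for n
  have V: "V n \<in> F \<or> V n = 0" for n using cF by (auto simp: V_def)
  have VF: "v \<in> range V" if "v \<in> F" for v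
    using that cF by (intro range_eqI[of _ _ "to_nat_on F v"]) (auto simp: V_def)
  have Vinj: "m = n" if "V m = V n" "V m \<noteq> 0" for m n
    using that cF by (auto simp: V_def split: if_splits)
  show ?thesis
  proof (intro exI[of _ V] conjI allI impI notI)
    show "V n \<in> S \<or> V n = 0" for n using V F(1) by blast
    show "R (V m) (V n)" if "m \<noteq> n" "V m \<noteq> 0" "V n \<noteq> 0" for m n
      using that V[of m] V[of n] Vinj F(2) by metis
    assume "\<exists>v\<in>S. \<forall>n. V n \<noteq> 0 \<longrightarrow> R v (V n)"
    then obtain v where v: "v \<in> S" "\<And>n. V n \<noteq> 0 \<Longrightarrow> R v (V n)" by blast
    have "R v w" if w: "w \<in> F" for w
    proof -
      obtain n where "w = V n" using VF[OF w] by blast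
      moreover have "w \<noteq> 0" using S F(1) w by blast
      ultimately show ?thesis using v(2) by blast
    qed
    hence "v \<in> F" using F(3) v(1) by blast
    hence "R v v" using \<open>\<And>w. w \<in> F \<Longrightarrow> R v w\<close> by blast
    hence "(v \<cdot> adj v) \<cdot> (v \<cdot> adj v) = 0" using R v(1) by blast
    moreover have "projection_op (v \<cdot> adj v)" using S[OF v(1)] by (simp add: projM)
    ultimately have "v \<cdot> adj v = 0" using proj_idem[of "v \<cdot> adj v"] by simp
    thus False using nz v(1) by blast
  qed
qed

text \<open>A maximal orthogonal family of partial isometries from parts of \<open>e\<close> onto
  parts of \<open>f\<close> must exhaust one of the two, since \<open>factor_nonzero_pi\<close>
  would connect two nonzero remainders and enlarge it.\<close>

lemma comparison:
  assumes e: "e \<in> projections M" and f: "f \<in> projections M"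
  shows "sub e f \<or> sub f e"
proof -
  define S where "S = {v\<in>M. v \<noteq> 0 \<and> projection_op (adj v \<cdot> v) \<and> e \<cdot> (adj v \<cdot> v) = adj v \<cdot> v \<and> f \<cdot> v = v}"
  define R where "R v w \<longleftrightarrow> adj v \<cdot> w = 0 \<and> adj w \<cdot> v = 0 \<and> v \<cdot> adj w = 0 \<and> w \<cdot> adj v = 0" for v w :: "'h oper"
  have "\<exists>V::nat \<Rightarrow> 'h oper. (\<forall>n. V n \<in> S \<or> V n = 0) \<and> (\<forall>m n. m \<noteq> n \<longrightarrow> V m \<noteq> 0 \<longrightarrow> V n \<noteq> 0 \<longrightarrow> R (V m) (V n))
    \<and> \<not> (\<exists>v\<in>S. \<forall>n. V n \<noteq> 0 \<longrightarrow> R v (V n))"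
  proof (rule family_sequence)
    show "v \<in> M \<and> v \<noteq> 0 \<and> v \<cdot> adj v \<in> projections M" if "v \<in> S" for v
      using that pi_final[OF _ refl] by (auto simp: S_def)
    show "(v \<cdot> adj v) \<cdot> (w \<cdot> adj w) = 0" if "R v w" for v w
      using that unfolding R_def by (metis blinfun_compose_zero(1,2) compose_assoc)
    show "R w v" if "R v w" for v w using that by (auto simp: R_def)
  qed
  then obtain V :: "nat \<Rightarrow> 'h oper" where V': "(\<forall>n. V n \<in> S \<or> V n = 0) \<and>
    (\<forall>m n. m \<noteq> n \<longrightarrow> V m \<noteq> 0 \<longrightarrow> V n \<noteq> 0 \<longrightarrow> R (V m) (V n)) \<and> \<not> (\<exists>v\<in>S. \<forall>n. V n \<noteq> 0 \<longrightarrow> R v (V n))"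
    by (rule exE)
  note V = V'[THEN conjunct1, rule_format] V'[THEN conjunct2, THEN conjunct1, rule_format] V'[THEN conjunct2, THEN conjunct2]
  have VM: "V n \<in> M" and Vp: "projection_op (adj (V n) \<cdot> V n)" and Ve: "e \<cdot> (adj (V n) \<cdot> V n) = adj (V n) \<cdot> V n"
    and Vf: "f \<cdot> V n = V n" for n
    using V(1)[of n] M_0 by (auto simp: S_def)
  have o1: "adj (V m) \<cdot> V n = 0" and o2: "V m \<cdot> adj (V n) = 0" if "m \<noteq> n" for m n
    using V(2)[OF that] unfolding R_def by (cases "V m = 0"; cases "V n = 0"; simp)+
  let ?p = "psum (\<lambda>n. adj (V n) \<cdot> V n)"
  note o = sum_pi(1)[of V, OF VM Vp o1 o2]
  from sum_pi(2)[of V, OF VM Vp o1 o2] obtain W where W: "W \<in> M" "adj W \<cdot> W = ?p" "\<And>n. W \<cdot> (adj (V n) \<cdot> V n) = V n"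
    "\<And>x. (\<lambda>n. V n x) sums W x" by blast
  have pp: "projection_op ?p" by (rule psum_proj[OF o])
  have pM: "?p \<in> projections M" by (intro psum_M o M_compose M_adj VM)
  define q where "q = W \<cdot> adj W"
  have qM: "q \<in> projections M" unfolding q_def by (rule pi_final[OF W(1,2) pp])
  have ep: "e \<cdot> ?p = ?p" by (rule psum_absorb_left[OF o Ve])
  have fW: "f \<cdot> W = W"
    by (rule sums_op_unique[OF sums_compose_left[OF W(4)]]) (simp only: Vf W(4))
  have fq: "f \<cdot> q = q" unfolding q_def by (metis compose_assoc fW)
  have qV: "q \<cdot> V n = V n" for n
    using pi_right[OF W(1,2) pp] unfolding q_def by (metis W(2) W(3) compose_assoc)
  have pV: "V n \<cdot> ?p = V n" for n
  proof -
    have "V n \<cdot> (adj (V n) \<cdot> V n) = V n" by (rule pi_right[OF VM refl Vp])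
    moreover have "(adj (V n) \<cdot> V n) \<cdot> ?p = adj (V n) \<cdot> V n"
      by (rule proj_flip[OF Vp pp psum_absorb[OF o]])
    ultimately show ?thesis by (metis compose_assoc)
  qed
  show ?thesis
  proof (cases "e = ?p")
    case True thus ?thesis using W fW by (auto simp: sub_def)
  next
    case e1: False
    show ?thesis
    proof (cases "f = q")
      case True
      thus ?thesis using sub_mono[OF sub_final'[OF W(1,2) pp] ep] by (simp add: q_def)
    next
      case False
      have 1: "e - ?p \<in> projections M" using e pM ep by (auto simp: projM M_diff intro: proj_diff)
      have 2: "f - q \<in> projections M" using f qM fq by (auto simp: projM M_diff intro: proj_diff)
      obtain v where v: "v \<in> M" "v \<noteq> 0" "projection_op (adj v \<cdot> v)" "(e - ?p) \<cdot> (adj v \<cdot> v) = adj v \<cdot> v"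
        "(f - q) \<cdot> v = v" using factor_nonzero_pi[OF 1 _ 2] e1 False by auto
      have "q \<cdot> f = q" using proj_flip fq qM f by (auto simp: projM)
      hence "q \<cdot> (f - q) = 0" using qM by (simp add: compose_diff_right proj_idem projM)
      hence qv: "q \<cdot> v = 0" by (rule zero_absorb_left[OF _ v(5)])
      have fv: "f \<cdot> v = v" using v(5) qv by (simp add: compose_diff_left)
      have pe: "?p \<cdot> e = ?p" using proj_flip ep pM e by (auto simp: projM)
      hence "?p \<cdot> (e - ?p) = 0" by (simp add: compose_diff_right proj_idem[OF pp])
      hence "?p \<cdot> (adj v \<cdot> v) = 0" by (rule zero_absorb_left[OF _ v(4)])
      hence ev: "e \<cdot> (adj v \<cdot> v) = adj v \<cdot> v" and "(adj v \<cdot> v) \<cdot> ?p = 0"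
        using v(4) proj_orth_flip[OF v(3) pp] by (simp_all add: compose_diff_left)
      hence vp: "v \<cdot> ?p = 0" by (intro zero_absorb_right[OF pi_right[OF v(1) refl v(3)]])
      have pv: "?p \<cdot> adj v = 0" using compose_flip[OF vp] by (simp add: M_cl v proj_cl pp proj_adj)
      have vq: "adj v \<cdot> q = 0" using compose_flip[OF qv] qM by (simp add: M_cl v projM proj_cl proj_adj)
      have "R v (V n)" for n
        unfolding R_def
      proof (intro conjI)
        show a: "adj v \<cdot> V n = 0" by (rule zero_absorb_left[OF vq qV])
        show b: "V n \<cdot> adj v = 0" by (rule zero_absorb_right[OF pV pv])
        show "adj (V n) \<cdot> v = 0" using compose_flip[OF a] by (simp add: M_cl v VM adj_adj cl_adj)
        show "v \<cdot> adj (V n) = 0" using compose_flip[OF b] by (simp add: M_cl v VM adj_adj cl_adj)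
      qed
      moreover have "v \<in> S" using v ev fv by (simp add: S_def)
      ultimately show ?thesis using V(3) by blast
    qed
  qed
qed

text \<open>A maximal family of orthogonal copies of \<open>P\<close> is taken out of
  \<open>F\<close>. The remainder contains no further copy, so by comparison it is itself
  subequivalent to \<open>P\<close>; it becomes the term with index \<open>0\<close>, which the last
  clause therefore exempts.\<close>

lemma decomposition:
  assumes P: "P \<in> projections M" "P \<noteq> 0" and F: "F \<in> projections M"
  shows "\<exists>e. orth_seq e \<and> (\<forall>n. e n \<in> projections M) \<and> psum e = F \<and> (\<forall>n. sub (e n) P)
    \<and> (\<forall>n. e (Suc n) = 0 \<or> sub P (e (Suc n)))"
proof -
  define S where "S = {v\<in>M. adj v \<cdot> v = P \<and> F \<cdot> v = v}"
  define R where "R v w \<longleftrightarrow> adj v \<cdot> w = 0 \<and> adj w \<cdot> v = 0" for v w :: "'h oper"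
  have Pp: "projection_op P" and Fp: "projection_op F" using P F by (auto simp: projM)
  have "\<exists>V::nat \<Rightarrow> 'h oper. (\<forall>n. V n \<in> S \<or> V n = 0) \<and> (\<forall>m n. m \<noteq> n \<longrightarrow> V m \<noteq> 0 \<longrightarrow> V n \<noteq> 0 \<longrightarrow> R (V m) (V n))
    \<and> \<not> (\<exists>v\<in>S. \<forall>n. V n \<noteq> 0 \<longrightarrow> R v (V n))"
  proof (rule family_sequence)
    show "v \<in> M \<and> v \<noteq> 0 \<and> v \<cdot> adj v \<in> projections M" if "v \<in> S" for v
      using that pi_final[OF _ _ Pp] P(2) by (auto simp: S_def)
    show "(v \<cdot> adj v) \<cdot> (w \<cdot> adj w) = 0" if "R v w" for v w
      using that unfolding R_def by (metis blinfun_compose_zero(1,2) compose_assoc)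
    show "R w v" if "R v w" for v w using that by (auto simp: R_def)
  qed
  then obtain V :: "nat \<Rightarrow> 'h oper" where V': "(\<forall>n. V n \<in> S \<or> V n = 0) \<and>
    (\<forall>m n. m \<noteq> n \<longrightarrow> V m \<noteq> 0 \<longrightarrow> V n \<noteq> 0 \<longrightarrow> R (V m) (V n)) \<and> \<not> (\<exists>v\<in>S. \<forall>n. V n \<noteq> 0 \<longrightarrow> R v (V n))"
    by (rule exE)
  note V = V'[THEN conjunct1, rule_format] V'[THEN conjunct2, THEN conjunct1, rule_format] V'[THEN conjunct2, THEN conjunct2]
  define c where "c n = V n \<cdot> adj (V n)" for n
  have cM: "c n \<in> projections M" for n
    using V(1)[of n] pi_final[OF _ _ Pp] by (auto simp: S_def c_def projM M_0)
  have co: "orth_seq c"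
    unfolding orth_seq_def
  proof (intro conjI allI impI)
    show "projection_op (c n)" for n using cM by (simp add: projM)
    fix m n :: nat assume mn: "m \<noteq> n"
    have "adj (V m) \<cdot> V n = 0" using V(2)[OF mn] unfolding R_def by (cases "V m = 0"; cases "V n = 0"; simp)
    thus "c m \<cdot> c n = 0" unfolding c_def by (metis blinfun_compose_zero(1,2) compose_assoc)
  qed
  have VM: "V n \<in> M" for n using V(1)[of n] M_0 by (auto simp: S_def)
  have Fc: "F \<cdot> c n = c n" for n using V(1)[of n] unfolding c_def S_def
    by (metis (mono_tags, lifting) blinfun_compose_zero(1,2) compose_assoc mem_Collect_eq)
  have cV: "c n \<cdot> V n = V n" for n using V(1)[of n] pi_right[of "V n" P] Pp
    by (auto simp: c_def S_def compose_assoc)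
  have pM: "psum c \<in> projections M" using cM by (intro psum_M[OF co]) (simp add: projM)
  have Fp': "F \<cdot> psum c = psum c" by (rule psum_absorb_left[OF co Fc])
  define r where "r = F - psum c"
  have rM: "r \<in> projections M" unfolding r_def using F pM Fp' by (auto simp: projM M_diff intro: proj_diff)
  have rp: "projection_op r" using rM by (simp add: projM)
  have "\<not> sub P r"
  proof
    assume "sub P r"
    then obtain v where v: "v \<in> M" "adj v \<cdot> v = P" "r \<cdot> v = v" by (auto simp: sub_def)
    have "F \<cdot> r = r" unfolding r_def by (simp add: compose_diff_right proj_idem[OF Fp] Fp')
    hence "F \<cdot> v = v" using v(3) compose_assoc[of F r v] by simp
    hence "v \<in> S" using v(1,2) by (simp add: S_def)
    moreover have "R v (V n)" for n
    proof -
      have "r \<cdot> c n = 0" unfolding r_def by (simp add: compose_diff_left Fc psum_absorb[OF co])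
      hence "r \<cdot> V n = 0" using compose_assoc[of r "c n" "V n"] by (simp add: cV)
      hence a: "adj v \<cdot> V n = 0"
        using adj_left_absorb[OF v(3) rp v(1)] compose_assoc[of "adj v" r "V n"] by simp
      thus ?thesis unfolding R_def using compose_flip[OF a] by (simp add: M_cl v VM adj_adj cl_adj)
    qed
    ultimately show False using V(3) by blast
  qed
  hence sr: "sub r P" using comparison[OF P(1) rM] by blast
  define e where "e n = (case n of 0 \<Rightarrow> r | Suc k \<Rightarrow> c k)" for n
  have rc: "r \<cdot> c n = 0" for n unfolding r_def by (simp add: compose_diff_left Fc psum_absorb[OF co])
  have cr: "c n \<cdot> r = 0" for n using proj_orth_flip[OF _ rp rc] orth_seqD(1)[OF co] by blast
  have s: "sub (e n) P" for n
  proof (cases n)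
    case (Suc k)
    show ?thesis
    proof (cases "V k = 0")
      case True
      have "sub 0 P" unfolding sub_def by (intro bexI[of _ 0]) (simp_all add: M_0)
      thus ?thesis by (simp add: e_def Suc c_def True)
    next
      case False
      thus ?thesis using V(1)[of k] sub_final'[of "V k" P] Pp by (auto simp: e_def Suc c_def S_def)
    qed
  qed (simp add: e_def sr)
  have "e (Suc n) = 0 \<or> sub P (e (Suc n))" for n
    using V(1)[of n] sub_final[of "V n" P] Pp by (auto simp: e_def c_def S_def)
  moreover have "orth_seq e"
    unfolding orth_seq_def
    by (auto simp: e_def rp orth_seqD[OF co] rc cr split: nat.splits)
  moreover have "psum e = F"
  proof (rule psum_eqI)
    fix x
    have "(\<lambda>n. (e (Suc n)) x) sums (F x - e 0 x)"
      using psum_sums[OF co, of x] by (simp add: e_def r_def blinfun.bilinear_simps)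
    from sums_Suc[OF this] show "(\<lambda>n. e n x) sums F x" by simp
  qed
  moreover have "e n \<in> projections M" for n by (cases n) (simp_all add: e_def rM cM)
  ultimately show ?thesis using s by blast
qed

subsection \<open>Projections equivalent to the identity\<close>

text \<open>Equivalence to \<open>I\<close>, stated from one side only because that is easier to
  establish; \<open>big_equivalent\<close> supplies the other side.\<close>

definition big :: "'h oper \<Rightarrow> bool" where
  "big r \<longleftrightarrow> r \<in> projections M \<and> sub id_blinfun r"

lemma big_mono: "big r \<Longrightarrow> s \<in> projections M \<Longrightarrow> s \<cdot> r = r \<Longrightarrow> big s"
  unfolding big_def using sub_mono by blast

lemma sub_id: "e \<in> projections M \<Longrightarrow> sub e id_blinfun"
  by (rule sub_of_le) (simp_all add: compose_simps)

lemma big_sub: "big r \<Longrightarrow> e \<in> projections M \<Longrightarrow> sub e r"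
  using sub_trans[OF sub_id] proj_id unfolding big_def by blast

text \<open>The identity decomposes into pieces subequivalent to \<open>P\<close>, and each piece
  fits into its own copy.\<close>

lemma big_of_copies:
  assumes P: "P \<in> projections M" "P \<noteq> 0" and f: "orth_seq f" "\<And>n. sub P (f n)"
    and r: "r \<in> projections M" "\<And>n. r \<cdot> f n = f n"
  shows "big r"
proof -
  have "id_blinfun \<in> projections M" by (simp add: projM M_id)
  from decomposition[OF P this] obtain e where e: "orth_seq e" "psum e = id_blinfun" "\<And>n. sub (e n) P" by blast
  have "sub (psum e) r"
  proof (rule sub_psum[OF e(1)])
    show "sub (e n) (f n)" for n using sub_trans[OF e(3) f(2)] P by (simp add: projM)
  qed (use f r orth_seqD in auto)
  thus ?thesis using e(2) r by (simp add: big_def)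
qed

text \<open>The ranges of the powers of an isometry on the complement of its range.\<close>

lemma shift_orthogonal:
  assumes d: "d \<in> projections M" and X: "X \<in> M" and p: "adj X \<cdot> X = p" "p \<cdot> X = X" "p \<cdot> d = d"
    and dX: "d \<cdot> X = 0"
  defines "v \<equiv> rec_nat d (\<lambda>_. (\<cdot>) X)"
  shows "v n \<in> M" "adj (v n) \<cdot> v n = d" "m \<noteq> n \<Longrightarrow> adj (v m) \<cdot> v n = 0" "p \<cdot> v n = v n"
proof -
  have v0: "v 0 = d" and vS: "\<And>n. v (Suc n) = X \<cdot> v n" by (simp_all add: v_def)
  have dp: "projection_op d" using d by (simp add: projM)
  show vM: "v n \<in> M" for n by (induction n) (use d X in \<open>auto simp: v0 vS projM M_compose\<close>)
  show pv: "p \<cdot> v n = v n" for n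
    by (cases n) (use p in \<open>auto simp: v0 vS compose_assoc[symmetric]\<close>)
  have S: "adj (v (Suc m)) \<cdot> v (Suc n) = adj (v m) \<cdot> v n" for m n
  proof -
    have "adj (v (Suc m)) \<cdot> v (Suc n) = adj (v m) \<cdot> ((adj X \<cdot> X) \<cdot> v n)"
      by (simp add: vS adj_compose M_cl X vM compose_assoc)
    thus ?thesis by (simp only: p(1) pv)
  qed
  show "adj (v n) \<cdot> v n = d" for n
    by (induction n) (simp_all add: S, simp add: v0 proj_adj[OF dp] proj_idem[OF dp])
  have z: "adj (v 0) \<cdot> v (Suc n) = 0" for n
    by (simp add: v0 vS proj_adj[OF dp] compose_assoc[symmetric] dX)
  have z': "adj (v (Suc n)) \<cdot> v 0 = 0" for n
    using compose_flip[OF z[of n]] by (simp add: adj_adj M_cl vM cl_adj)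
  show "m \<noteq> n \<Longrightarrow> adj (v m) \<cdot> v n = 0" for m n
  proof (induction m arbitrary: n)
    case 0 thus ?case using z by (cases n) auto
  next
    case (Suc m) thus ?case using z' S by (cases n) auto
  qed
qed

lemma orth_ranges:
  assumes "\<And>n. v n \<in> M" "\<And>n. projection_op (adj (v n) \<cdot> v n)" "\<And>m n. m \<noteq> n \<Longrightarrow> adj (v m) \<cdot> v n = 0"
  shows "orth_seq (\<lambda>n. v n \<cdot> adj (v n))"
  unfolding orth_seq_def
proof (intro conjI allI impI)
  show "projection_op (v n \<cdot> adj (v n))" for n using pi_final[OF assms(1) refl assms(2)] by (simp add: projM)
  show "(v m \<cdot> adj (v m)) \<cdot> (v n \<cdot> adj (v n)) = 0" if "m \<noteq> n" for m n
    using assms(3)[OF that] by (metis blinfun_compose_zero(1,2) compose_assoc)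
qed

text \<open>A Schroeder-Bernstein argument. With \<open>d = I - r\<close>, the ranges of
  \<open>u^n d\<close> are orthogonal; let \<open>D\<close> project onto their sum. The operator
  acting as \<open>u\<close> on \<open>D\<close> and as the identity on its complement is an
  isometry whose range misses exactly \<open>d\<close>.\<close>

lemma big_equivalent:
  assumes "big r"
  shows "equivalent_in M r id_blinfun"
proof -
  obtain u where u: "u \<in> M" "adj u \<cdot> u = id_blinfun" "r \<cdot> u = u" and r: "r \<in> projections M"
    using assms by (auto simp: big_def sub_def)
  have rp: "projection_op r" using r by (simp add: projM)
  define d where "d = id_blinfun - r"
  have d: "d \<in> projections M" using r by (simp add: d_def projM M_diff M_id proj_complement)
  have dp: "projection_op d" using d by (simp add: projM)
  have du: "d \<cdot> u = 0" by (simp add: d_def compose_simps u)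
  define v where "v = rec_nat d (\<lambda>_. (\<cdot>) u)"
  note v = shift_orthogonal[OF d u(1,2) _ _ du, folded v_def, simplified compose_simps]
  have vS: "v (Suc n) = u \<cdot> v n" and v0: "v 0 = d" for n by (simp_all add: v_def)
  have vp: "projection_op (adj (v n) \<cdot> v n)" for n using v(2) dp by simp
  define c where "c n = v n \<cdot> adj (v n)" for n
  have co: "orth_seq c" unfolding c_def by (rule orth_ranges) (use v vp in auto)
  have c0: "c 0 = d" by (simp add: c_def v0 proj_adj[OF dp] proj_idem[OF dp])
  define D where "D = psum c"
  have cM: "c n \<in> M" for n by (simp add: c_def M_compose M_adj v(1))
  have D: "projection_op D" "D \<in> M" unfolding D_def using psum_M[OF co cM] by (simp_all add: projM)
  have ucu: "u \<cdot> c n \<cdot> adj u = c (Suc n)" for n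
    by (simp add: c_def vS adj_compose M_cl u(1) v(1) compose_assoc)
  have uDu: "u \<cdot> D \<cdot> adj u = D - d"
  proof (rule sums_op_unique)
    show "(\<lambda>n. blinfun_apply (u \<cdot> c n \<cdot> adj u) x) sums blinfun_apply (u \<cdot> D \<cdot> adj u) x" for x
      by (rule sums_compose_right, rule sums_compose_left, unfold D_def, rule psum_sums[OF co])
    show "(\<lambda>n. blinfun_apply (u \<cdot> c n \<cdot> adj u) x) sums blinfun_apply (D - d) x" for x
      unfolding ucu using psum_sums[OF co, of x]
        sums_Suc_iff[of "\<lambda>n. c n x" "psum c x - d x"]
      by (simp add: D_def c0 blinfun.bilinear_simps)
  qed
  have "D \<cdot> u \<cdot> D = u \<cdot> D"
  proof -
    have "(D \<cdot> u) \<cdot> c n = u \<cdot> c n" for n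
    proof -
      have "u \<cdot> c n = c (Suc n) \<cdot> u" unfolding ucu[symmetric] by (simp add: compose_assoc u compose_simps)
      thus ?thesis using psum_absorb[OF co, of "Suc n"] by (simp add: D_def compose_assoc) (simp add: compose_assoc[symmetric])
    qed
    thus ?thesis unfolding D_def
      by (intro sums_op_unique[OF sums_compose_left[OF psum_sums[OF co]]])
        (simp only:, rule sums_compose_left, rule psum_sums[OF co])
  qed
  hence 1: "(id_blinfun - D) \<cdot> (u \<cdot> D) = 0" by (simp add: compose_simps compose_assoc)
  define N where "N = id_blinfun - D"
  have N: "projection_op N" "N \<in> M" by (simp_all add: N_def proj_complement D M_diff M_id)
  have NuD: "N \<cdot> (u \<cdot> D) = 0" using 1 by (simp add: N_def)
  have DuN: "D \<cdot> (adj u \<cdot> N) = 0"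
    using compose_flip[OF NuD _ _ refl refl refl]
    by (simp add: M_cl u(1) D N M_compose adj_compose proj_adj compose_assoc)
  have DN: "D \<cdot> N = 0" by (simp add: N_def compose_simps proj_idem[OF D(1)])
  define X where "X = u \<cdot> D + N"
  have aX: "adj X = D \<cdot> adj u + N"
    by (simp add: X_def adj_add adj_compose cl_compose M_cl u D N proj_adj)
  have XX: "adj X \<cdot> X = id_blinfun"
  proof -
    have "D \<cdot> adj u \<cdot> (u \<cdot> D) = D" 
      by (metis D(1) compose_assoc compose_id_left proj_idem u(2))
    thus ?thesis unfolding aX by (simp add: X_def compose_simps compose_assoc NuD DuN proj_idem[OF N(1)])
       (simp add: N_def)
  qed
  have "X \<cdot> adj X = r"
  proof -
    have "u \<cdot> D \<cdot> (D \<cdot> adj u) = D - d" by (metis uDu D(1) compose_assoc proj_idem)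
    moreover have "u \<cdot> D \<cdot> N = 0" by (simp add: compose_assoc DN)
    moreover have "N \<cdot> (D \<cdot> adj u) = 0" 
      using proj_orth_flip[OF N(1) D(1) DN] by (simp add: compose_assoc[symmetric])
    ultimately show ?thesis unfolding aX by (simp add: X_def compose_simps proj_idem[OF N(1)])
      (simp add: N_def d_def)
  qed
  thus ?thesis unfolding equivalent_in_def
    using XX by (intro bexI[of _ X]) (auto simp: X_def M_add M_compose u D N)
qed

text \<open>If \<open>X\<close> maps \<open>p\<close> isometrically onto a proper subprojection
  \<open>q\<close>, then the powers of \<open>X\<close> carry \<open>p - q\<close> onto infinitely
  many orthogonal copies of itself.\<close>

lemma infinite_copies:
  assumes p: "p \<in> projections M" and inf: "\<not> finite_projection M p"
  shows "\<exists>d f. d \<in> projections M \<and> d \<noteq> 0 \<and> orth_seq f \<and> (\<forall>n. f n \<in> projections M \<and> sub d (f n) \<and> p \<cdot> f n = f n)"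
proof -
  have pp: "projection_op p" using p by (simp add: projM)
  obtain q X where q: "q \<in> projections M" "op_le q p" "q \<noteq> p" and X: "X \<in> M" "q = X \<cdot> adj X" "p = adj X \<cdot> X"
    using p inf by (auto simp: finite_projection_def equivalent_in_def)
  have qp: "projection_op q" using q by (simp add: projM)
  have pq: "p \<cdot> q = q" using q(2) proj_le_iff[OF qp pp] by simp
  have Xp: "X \<cdot> p = X" by (rule pi_right[OF X(1) X(3)[symmetric] pp])
  have qX: "q \<cdot> X = X" unfolding X(2) compose_assoc X(3)[symmetric] by (rule Xp)
  have pX: "p \<cdot> X = X" using pq qX by (metis compose_assoc)
  define d where "d = p - q"
  have d: "d \<in> projections M" using p q pq by (auto simp: d_def projM M_diff intro: proj_diff)
  have dp: "projection_op d" using d by (simp add: projM)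
  have pd: "p \<cdot> d = d" by (simp add: d_def compose_diff_right proj_idem[OF pp] pq)
  have dX: "d \<cdot> X = 0" by (simp add: d_def compose_diff_left pX qX)
  define v where "v = rec_nat d (\<lambda>_. (\<cdot>) X)"
  note v = shift_orthogonal[OF d X(1) X(3)[symmetric] pX pd dX, folded v_def]
  have vp: "projection_op (adj (v n) \<cdot> v n)" for n using v(2) dp by simp
  show ?thesis
  proof (intro exI[of _ d] exI[of _ "\<lambda>n. v n \<cdot> adj (v n)"] conjI allI)
    show "d \<noteq> 0" using q(3) by (simp add: d_def)
    show "orth_seq (\<lambda>n. v n \<cdot> adj (v n))" by (rule orth_ranges) (use v vp in auto)
    show "v n \<cdot> adj (v n) \<in> projections M" for n by (rule pi_final[OF v(1) refl vp])
    show "sub d (v n \<cdot> adj (v n))" for n by (rule sub_final[OF v(1) v(2) dp])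
    show "p \<cdot> (v n \<cdot> adj (v n)) = v n \<cdot> adj (v n)" for n by (simp add: compose_assoc[symmetric] v(4))
  qed (rule d)
qed

text \<open>In type III this makes every nonzero projection equivalent to \<open>I\<close>; in the
  semifinite case it links the essential norm to equivalence with \<open>I\<close>.\<close>

lemma nonfinite_big: "p \<in> projections M \<Longrightarrow> \<not> finite_projection M p \<Longrightarrow> big p"
  using infinite_copies big_of_copies by metis

end

subsection \<open>Divergent series\<close>

text \<open>The series is cut into consecutive chunks of sum at least \<open>1\<close>, and the
  pairing function hands infinitely many chunks to each \<open>i\<close>.\<close>

lemma divergent_fibres:
  fixes a :: "nat \<Rightarrow> real"
  assumes nn: "\<And>n. 0 \<le> a n" and div: "\<not> summable a"
  shows "\<exists>f::nat \<Rightarrow> nat. \<forall>i. \<not> summable (\<lambda>n. if f n = i then a n else 0)"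
proof -
  have ex: "\<exists>n>m. 1 \<le> (\<Sum>i\<in>{m..<n}. a i)" for m
  proof (rule ccontr)
    assume "\<not> ?thesis"
    hence lt: "(\<Sum>i\<in>{m..<n}. a i) < 1" if "m < n" for n using that by force
    have "(\<Sum>i\<le>n. a i) \<le> (\<Sum>i<m. a i) + 1" for n
    proof -
      have "(\<Sum>i\<le>n. a i) \<le> (\<Sum>i\<in>{..<m} \<union> {m..<m + n + 1}. a i)" by (intro sum_mono2) (auto simp: nn)
      also have "\<dots> = (\<Sum>i<m. a i) + (\<Sum>i\<in>{m..<m + n + 1}. a i)" by (intro sum.union_disjoint) auto
      also have "\<dots> \<le> (\<Sum>i<m. a i) + 1" using lt[of "m + n + 1"] by simp
      finally show ?thesis .
    qed
    hence "summable a" by (rule bounded_imp_summable[OF nn])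
    thus False using div by simp
  qed
  have "\<exists>N::nat \<Rightarrow> nat. \<forall>n. True \<and> N n < N (Suc n) \<and> 1 \<le> (\<Sum>i\<in>{N n..<N (Suc n)}. a i)"
    using dependent_nat_choice[of "\<lambda>_ _. True" "\<lambda>_ m n. m < n \<and> 1 \<le> (\<Sum>i\<in>{m..<n}. a i)"] ex by auto
  then obtain N :: "nat \<Rightarrow> nat" where N: "\<And>n. N n < N (Suc n)" "\<And>n. 1 \<le> (\<Sum>i\<in>{N n..<N (Suc n)}. a i)" by blast
  have mono: "strict_mono N" using N(1) by (simp add: strict_mono_Suc_iff)
  define b where "b n = (LEAST k. n < N (Suc k))" for n
  have b: "b n = k" if "N k \<le> n" "n < N (Suc k)" for n k
    unfolding b_def
  proof (rule Least_equality)
    show "k \<le> j" if j: "n < N (Suc j)" for j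
    proof (rule ccontr)
      assume "\<not> k \<le> j"
      hence "N (Suc j) \<le> N k" using mono by (simp add: strict_mono_less_eq)
      thus False using j \<open>N k \<le> n\<close> by simp
    qed
  qed (rule that)
  show ?thesis
  proof (intro exI[of _ "\<lambda>n. fst (prod_decode (b n))"] allI notI)
    fix i
    let ?c = "\<lambda>n. if fst (prod_decode (b n)) = i then a n else 0"
    assume "summable ?c"
    then obtain M where M: "\<And>m n. m \<ge> M \<Longrightarrow> norm (\<Sum>j\<in>{m..<n}. ?c j) < 1"
      unfolding summable_Cauchy by (metis zero_less_one)
    \<comment> \<open>A chunk of the fibre \<open>i\<close> whose number is at least
      \<open>M\<close>, hence lying beyond the Cauchy index.\<close>
    define k where "k = prod_encode (i, M)"
    have "M \<le> k" unfolding k_def by (rule le_prod_encode_2)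
    also have "k \<le> N k" using mono by (rule strict_mono_imp_increasing)
    finally have "norm (\<Sum>j\<in>{N k..<N (Suc k)}. ?c j) < 1" by (rule M)
    moreover have "(\<Sum>j\<in>{N k..<N (Suc k)}. ?c j) = (\<Sum>j\<in>{N k..<N (Suc k)}. a j)"
      by (rule sum.cong) (auto simp: b k_def)
    ultimately show False using N(2)[of k] by simp
  qed
qed

subsection \<open>Exhausting the identity\<close>

context vna
begin

text \<open>\<open>L\<close> maps the range of \<open>S i\<close> into that of \<open>q i\<close> and is normalized by \<open>A\<^sup>-\<^sup>1\<^sup>/\<^sup>2\<close>; a larger \<open>c i\<close>
  makes it smaller.\<close>

lemma block_embedding:
  assumes S: "orth_seq S" "psum S = id_blinfun"
    and q: "\<And>i. q i \<in> projections M" "\<And>i j. i \<noteq> j \<Longrightarrow> q i \<cdot> q j = 0" "\<And>i. q i \<cdot> A = A \<cdot> q i"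
    and s: "\<And>i. sub (S i) (q i)" and A: "A \<in> M" "positive_op A" and t: "0 < t" "\<And>i. t \<le> c i"
    and ge: "\<And>i x. c i * (norm (q i x))\<^sup>2 \<le> qf A (q i x)"
    and G: "\<And>i. G \<cdot> q i = q i"
  shows "\<exists>L\<in>M. adj L \<cdot> A \<cdot> L = id_blinfun \<and> G \<cdot> L = L \<and>
    (\<forall>i x. c i * (norm (S i (adj L x)))\<^sup>2 \<le> (norm (q i x))\<^sup>2)"
proof -
  have c: "c i > 0" for i using t by (rule less_le_trans)
  have "\<forall>i. \<exists>D. D \<in> M \<and> selfadj D \<and> D \<cdot> q i = D \<and> q i \<cdot> D = D \<and> D \<cdot> A \<cdot> D = q i \<and> D \<cdot> A = A \<cdot> D
    \<and> (\<forall>x. c i * (norm (D x))\<^sup>2 \<le> (norm (q i x))\<^sup>2)"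
    using inverse_root[OF A q(1) q(3) c ge] by (simp only: Bex_def) blast
  from choice[OF this] obtain D where D0: "\<forall>i. D i \<in> M \<and> selfadj (D i) \<and> D i \<cdot> q i = D i \<and> q i \<cdot> D i = D i
    \<and> D i \<cdot> A \<cdot> D i = q i \<and> D i \<cdot> A = A \<cdot> D i
    \<and> (\<forall>x. c i * (norm (D i x))\<^sup>2 \<le> (norm (q i x))\<^sup>2)" by (rule exE)
  note D = D0[THEN spec, THEN conjunct1]
    D0[THEN spec, THEN conjunct2, THEN conjunct1]
    D0[THEN spec, THEN conjunct2, THEN conjunct2, THEN conjunct1]
    D0[THEN spec, THEN conjunct2, THEN conjunct2, THEN conjunct2, THEN conjunct1]
    D0[THEN spec, THEN conjunct2, THEN conjunct2, THEN conjunct2, THEN conjunct2, THEN conjunct1]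
    D0[THEN spec, THEN conjunct2, THEN conjunct2, THEN conjunct2, THEN conjunct2, THEN conjunct2, THEN conjunct1]
    D0[THEN spec, THEN conjunct2, THEN conjunct2, THEN conjunct2, THEN conjunct2, THEN conjunct2, THEN conjunct2, rule_format]
  obtain U where U: "\<And>i. U i \<in> M" "\<And>i. adj (U i) \<cdot> U i = S i" "\<And>i. q i \<cdot> U i = U i"
    using s unfolding sub_def by metis
  have Sp: "projection_op (S i)" for i using orth_seqD(1)[OF S(1)] .
  have US: "U i \<cdot> S i = U i" for i by (rule pi_right[OF U(1,2) Sp])
  define X where "X i = D i \<cdot> U i" for i
  have XM: "X i \<in> M" for i by (simp add: X_def M_compose D U)
  have XS: "X i \<cdot> S i = X i" for i by (simp add: X_def compose_assoc US)
  have aX: "adj (X i) = adj (U i) \<cdot> D i" for i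
    by (simp add: X_def adj_compose M_cl D(1) U(1) selfadj_adj[OF D(2)])
  have DD: "D i \<cdot> D j = 0" if "i \<noteq> j" for i j
  proof -
    have "D i \<cdot> q j = 0" by (rule zero_absorb_right[OF D(3) q(2)[OF that]])
    thus ?thesis by (rule zero_absorb_left[OF _ D(4)])
  qed
  have o: "adj (X i) \<cdot> X j = 0" if "i \<noteq> j" for i j
  proof -
    have "adj (X i) \<cdot> X j = adj (U i) \<cdot> ((D i \<cdot> D j) \<cdot> U j)" unfolding aX unfolding X_def by (simp add: compose_assoc)
    thus ?thesis by (simp add: DD[OF that])
  qed
  have XAX: "adj (X i) \<cdot> A \<cdot> X j = (if i = j then S i else 0)" for i j
  proof (cases "i = j")
    case True
    have "adj (X i) \<cdot> A \<cdot> X i = adj (U i) \<cdot> ((D i \<cdot> A \<cdot> D i) \<cdot> U i)" unfolding aX unfolding X_def by (simp add: compose_assoc)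
    thus ?thesis using True by (simp add: D(5) U(2,3))
  next
    case False
    have "adj (X i) \<cdot> A \<cdot> X j = adj (U i) \<cdot> ((D i \<cdot> A) \<cdot> (D j \<cdot> U j))" unfolding aX unfolding X_def by (simp add: compose_assoc)
    also have "\<dots> = adj (U i) \<cdot> (A \<cdot> ((D i \<cdot> D j) \<cdot> U j))" unfolding D(6) by (simp add: compose_assoc)
    finally show ?thesis using False by (simp add: DD[OF False])
  qed
  have nX: "t * (norm (X i x))\<^sup>2 \<le> (norm (S i x))\<^sup>2" for i x
  proof -
    have "t * (norm (X i x))\<^sup>2 \<le> c i * (norm (D i (U i x)))\<^sup>2"
      unfolding X_def by (simp add: mult_right_mono t)
    also have "\<dots> \<le> (norm (q i (U i x)))\<^sup>2" by (rule D(7))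
    also have "q i (U i x) = U i x"
      using eq_applyD[OF U(3), of i x] by simp
    also have "norm (U i x) = norm (S i x)" by (rule norm_pi[OF U(1,2) Sp])
    finally show ?thesis .
  qed
  \<comment> \<open>Boundedness comes from the uniform lower bound \<open>t\<close> alone; the
    individual \<open>c i\<close> are kept for the final estimate.\<close>
  have bd: "(\<Sum>i<n. (norm (X i x))\<^sup>2) \<le> (sqrt (1 / t))\<^sup>2 * (norm x)\<^sup>2" for n x
  proof -
    have sm: "(\<lambda>i. (norm (S i x))\<^sup>2) sums (norm x)\<^sup>2"
      using psum_norm_sums[OF S(1), of x] by (simp add: S(2))
    have "t * (\<Sum>i<n. (norm (X i x))\<^sup>2) \<le> (\<Sum>i<n. (norm (S i x))\<^sup>2)"
      unfolding sum_distrib_left by (intro sum_mono nX)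
    also have "\<dots> \<le> (norm x)\<^sup>2"
      using sum_le_suminf[of "\<lambda>i. (norm (S i x))\<^sup>2" "{..<n}"] sm by (auto simp: sums_iff)
    finally show ?thesis using t by (simp add: field_simps)
  qed
  obtain L where L: "complex_linear L" "\<And>x. (\<lambda>n. X n x) sums L x"
    using strong_sum_exists[of X, OF M_cl[OF XM] o bd] t by auto
  have LM: "L \<in> M" by (rule M_sums[OF L(2) XM])
  have LS: "L \<cdot> S i = X i" for i
  proof (rule sums_op_unique[OF sums_compose_right[OF L(2)]])
    fix x
    have "blinfun_apply (X m \<cdot> S i) x = (if m = i then blinfun_apply (X i) x else 0)" for m
    proof (cases "m = i")
      case False
      have "X m \<cdot> S i = 0" by (rule zero_absorb_right[OF XS orth_seqD(2)[OF S(1) False]])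
      thus ?thesis using False by simp
    qed (simp add: XS)
    thus "(\<lambda>m. blinfun_apply (X m \<cdot> S i) x) sums blinfun_apply (X i) x"
      using sums_single[of i "\<lambda>_. X i x"] by (simp cong: if_cong)
  qed
  have XAL: "adj (X i) \<cdot> A \<cdot> L = S i" for i
  proof (rule sums_op_unique[OF sums_compose_left[OF L(2)]])
    fix x
    show "(\<lambda>m. blinfun_apply (adj (X i) \<cdot> A \<cdot> X m) x) sums blinfun_apply (S i) x"
      unfolding XAX using sums_single[of i "\<lambda>_. blinfun_apply (S i) x"]
      by (simp add: if_distrib[of "\<lambda>T. blinfun_apply T x"] eq_commute[of i] cong: if_cong)
  qed
  have LAX: "adj L \<cdot> A \<cdot> X i = S i" for i
  proof -
    have "adj L \<cdot> (A \<cdot> X i) = S i"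
      using compose_flip[OF XAL[of i] _ _ refl refl proj_adj[OF Sp]] 
      by (simp add: cl_compose M_cl LM XM A(1) M_adj adj_compose adj_adj selfadj_adj[OF positive_selfadj[OF A(2)]])
    thus ?thesis by (simp add: compose_assoc)
  qed
  have "adj L \<cdot> A \<cdot> L = psum S"
    by (rule sums_op_unique[OF sums_compose_left[OF L(2)]]) (simp only: LAX, rule psum_sums[OF S(1)])
  hence 1: "adj L \<cdot> A \<cdot> L = id_blinfun" by (simp add: S(2))
  have GX: "G \<cdot> X i = X i" for i
    using compose_assoc[of G "q i" "X i"] compose_assoc[of "q i" "D i" "U i"] by (simp add: G D(4) X_def)
  have 2: "G \<cdot> L = L"
    by (rule sums_op_unique[OF sums_compose_left[OF L(2)]]) (simp only: GX, rule L(2))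
  have 3: "c i * (norm (S i (adj L x)))\<^sup>2 \<le> (norm (q i x))\<^sup>2" for i x
  proof -
    have "S i \<cdot> adj L = adj (X i)" using compose_flip[OF LS[of i] _ _ refl proj_adj[OF Sp] refl] by (simp add: L proj_cl[OF Sp])
    hence e: "S i (adj L x) = (adj (U i)) (D i x)"
      unfolding aX by (metis blinfun_apply_blinfun_compose)
    have "(norm ((adj (U i)) y))\<^sup>2 \<le> (norm y)\<^sup>2" for y
    proof -
      have p: "projection_op (U i \<cdot> adj (U i))" using pi_final[OF U(1,2) Sp] by (simp add: projM)
      have "(norm ((adj (U i)) y))\<^sup>2 = (norm ((U i \<cdot> adj (U i)) y))\<^sup>2"
        by (simp only: qf_gram'[OF M_cl[OF U(1)], symmetric] qf_proj[OF p])
      also have "\<dots> \<le> (norm y)\<^sup>2" by (intro power_mono norm_proj_le[OF p]) simp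
      finally show ?thesis .
    qed
    hence "c i * (norm (S i (adj L x)))\<^sup>2 \<le> c i * (norm (D i x))\<^sup>2"
      unfolding e using c by (intro mult_left_mono) (auto intro: less_imp_le)
    thus ?thesis using D(7)[of i x] by linarith
  qed
  show ?thesis using LM 1 2 3 by blast
qed

text \<open>\<open>Y = (s K w* + L H) B\<^sup>1\<^sup>/\<^sup>2\<close> with a partial isometry \<open>w\<close> from \<open>R\<close> into \<open>P\<close>, where \<open>H\<close> is
  \<open>I - P + (P - s\<^sup>2 w K A K w*)\<^sup>1\<^sup>/\<^sup>2\<close>. The cross terms of \<open>Y* A Y\<close> vanish because \<open>G\<close> commutes with
  \<open>A\<close> and \<open>w K G = w G = 0\<close>, and \<open>iface\<close> is \<open>Y Y* \<le> K\<close> in disguise.\<close>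

lemma exhaustion_step:
  assumes A: "A \<in> M" "positive_op A" and B: "B \<in> M" "positive_op B"
    and K: "K \<in> M" "positive_op K" "\<And>x. qf K x \<le> (norm x)\<^sup>2" and G: "G \<in> projections M" "G \<cdot> A = A \<cdot> G" "K \<cdot> G = G"
    and L: "L \<in> M" "G \<cdot> L = L" "adj L \<cdot> A \<cdot> L = id_blinfun"
    and P: "P \<in> projections M" "\<And>x. \<beta> * (norm (P x))\<^sup>2 \<le> qf B x"
    and s: "0 \<le> s" "s\<^sup>2 * norm A \<le> 1" and R: "R \<in> projections M" "sub R P" "R \<cdot> G = 0"
    and iface: "\<And>H x y. H \<cdot> P = P \<cdot> H \<Longrightarrow> H \<cdot> (id_blinfun - P) = id_blinfun - P \<Longrightarrow>
      (\<And>x. norm (H x) \<le> norm x) \<Longrightarrow> P y = y \<Longrightarrow>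
      qf B (s *\<^sub>R y + H (adj L x)) \<le> (norm y)\<^sup>2 + (norm x)\<^sup>2"
  shows "\<exists>Y\<in>M. adj Y \<cdot> A \<cdot> Y = B \<and> (\<forall>x. (norm (adj Y x))\<^sup>2 \<le> qf K x) \<and>
    (\<forall>T. K \<cdot> T = T \<longrightarrow> R \<cdot> T = 0 \<longrightarrow> G \<cdot> T = 0 \<longrightarrow> adj Y \<cdot> T = 0) \<and>
    (\<forall>x. G x = 0 \<longrightarrow> s\<^sup>2 * \<beta> * (norm (R (K x)))\<^sup>2 \<le> (norm (adj Y x))\<^sup>2)"
proof -
  have Gp: "projection_op G" and Pp: "projection_op P" and Rp: "projection_op R" and PM: "P \<in> M" and GM: "G \<in> M"
    using G P R by (auto simp: projM)
  have sK: "adj K = K" by (rule selfadj_adj[OF positive_selfadj[OF K(2)]])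
  have sA: "adj A = A" by (rule selfadj_adj[OF positive_selfadj[OF A(2)]])
  obtain w where w: "w \<in> M" "adj w \<cdot> w = R" "P \<cdot> w = w" using R(2) by (auto simp: sub_def)
  have wR: "w \<cdot> R = w" by (rule pi_right[OF w(1,2) Rp])
  have nw: "norm (w x) = norm (R x)" for x by (rule norm_pi[OF w(1,2) Rp])
  have wP: "adj w \<cdot> P = adj w" by (rule adj_left_absorb[OF w(3) Pp w(1)])
  have wG: "w \<cdot> G = 0" by (rule zero_absorb_right[OF wR R(3)])
  define a where "a = w \<cdot> K \<cdot> A \<cdot> K \<cdot> adj w"
  have aM: "a \<in> M" by (simp add: a_def M_compose M_adj w K A)
  have a_conj: "a = adj (K \<cdot> adj w) \<cdot> A \<cdot> (K \<cdot> adj w)"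
    by (simp add: a_def adj_compose M_cl K M_adj w adj_adj sK compose_assoc)
  have apos: "positive_op a" unfolding a_conj by (rule positive_conj[OF A(2)]) (simp add: M_cl M_compose K M_adj w)
  have qa: "s\<^sup>2 * qf a x \<le> (norm (P x))\<^sup>2" for x
  proof -
    let ?u = "K (adj w x)"
    have Kn: "norm (K y) \<le> norm y" for y
    proof -
      have "norm K \<le> 1" by (rule positive_norm_le[OF K(2)]) (use K(3) in auto)
      thus ?thesis by (metis mult_1 mult_right_mono norm_blinfun norm_ge_zero order_trans)
    qed
    have "s\<^sup>2 * qf a x = s\<^sup>2 * qf A ?u"
      unfolding a_conj by (subst qf_conj) (simp_all add: M_cl M_compose K M_adj w)
    also have "\<dots> \<le> s\<^sup>2 * (norm A * (norm ?u)\<^sup>2)" by (intro mult_left_mono qf_le_norm) simp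
    also have "\<dots> \<le> 1 * (norm ?u)\<^sup>2" unfolding mult.assoc[symmetric] by (intro mult_right_mono s) simp
    also have "\<dots> \<le> (norm (adj w x))\<^sup>2" using Kn by (simp add: power_mono)
    also have "\<dots> = (norm (adj w (P x)))\<^sup>2"
      using eq_applyD[OF wP, of x] by simp
    also have "\<dots> \<le> (norm (P x))\<^sup>2"
    proof -
      have p: "projection_op (w \<cdot> adj w)" using pi_final[OF w(1,2) Rp] by (simp add: projM)
      have "(norm (blinfun_apply (adj w) y))\<^sup>2 = (norm (blinfun_apply (w \<cdot> adj w) y))\<^sup>2" for y
        by (simp only: qf_gram'[OF M_cl[OF w(1)], symmetric] qf_proj[OF p])
      thus ?thesis using norm_proj_le[OF p] by (simp add: power_mono)
    qed
    finally show ?thesis .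
  qed
  \<comment> \<open>Positive by \<open>qa\<close>, where the bound on
    \<open>s\<^sup>2 * norm A\<close> enters. Its root \<open>T\<close> completes
    \<open>s\<^sup>2 *\<^sub>R a\<close> on \<open>P\<close>, so that \<open>H \<cdot> H\<close>
    cancels the contribution of the first term of \<open>Z\<close>.\<close>
  define g where "g = P - s\<^sup>2 *\<^sub>R a"
  have g: "g \<in> M" "positive_op g"
    using qa by (auto simp: g_def M_diff M_scaleR PM aM positive_op_iff selfadj_diff selfadj_scaleR proj_selfadj Pp
        positive_selfadj[OF apos] qf_diff qf_scaleR qf_proj[OF Pp] simp del: minus_blinfun.rep_eq scaleR_blinfun.rep_eq)
  have aP: "a \<cdot> P = a" by (simp add: a_def compose_assoc wP)
  have gP: "g \<cdot> P = g" by (simp add: g_def compose_simps proj_idem[OF Pp] aP)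
  have Pg: "P \<cdot> g = g"
    using compose_flip[OF gP] by (simp add: proj_cl Pp proj_adj positive_cl g selfadj_adj positive_selfadj)
  obtain T where T: "T \<in> M" "positive_op T" "T \<cdot> T = g" "\<And>S. g \<cdot> S = S \<cdot> g \<Longrightarrow> T \<cdot> S = S \<cdot> T"
    using M_sqrt[OF g] by blast
  have TP: "T \<cdot> P = P \<cdot> T" by (rule T(4)) (simp add: gP Pg)
  have sT: "adj T = T" by (rule selfadj_adj[OF positive_selfadj[OF T(2)]])
  define N where "N = id_blinfun - P"
  have N: "projection_op N" "N \<in> M" by (simp_all add: N_def proj_complement Pp M_diff M_id PM)
  \<comment> \<open>\<open>T\<close> has the same kernel as its square \<open>g\<close>.\<close>
  have TN: "T \<cdot> N = 0"
  proof (rule blinfun_eqI)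
    fix x
    have "g \<cdot> N = 0" by (simp add: N_def compose_simps gP)
    have "(norm (blinfun_apply T (blinfun_apply N x)))\<^sup>2 = Re (cinner (blinfun_apply (T \<cdot> T) (blinfun_apply N x)) (blinfun_apply N x))"
      using norm_adj_apply[OF M_cl[OF T(1)], of "blinfun_apply N x"] by (simp add: sT)
    also have "\<dots> = 0" unfolding T(3) using eq_applyD[OF \<open>g \<cdot> N = 0\<close>, of x] by simp
    finally show "blinfun_apply (T \<cdot> N) x = blinfun_apply 0 x" by simp
  qed
  have TPT: "T \<cdot> P = T" using TN by (simp add: N_def compose_simps)
  define H where "H = N + T"
  have HM: "H \<in> M" by (simp add: H_def M_add N T)
  have NT: "N \<cdot> T = 0" using TPT TP by (simp add: N_def compose_simps)
  have sH: "adj H = H" by (simp add: H_def adj_add proj_cl N M_cl T proj_adj sT)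
  have HH: "H \<cdot> H = id_blinfun - s\<^sup>2 *\<^sub>R a"
    by (simp add: H_def compose_simps TN NT proj_idem[OF N(1)] T(3)) (simp add: N_def g_def)
  have HP: "H \<cdot> P = P \<cdot> H" by (simp add: H_def compose_simps TP) (simp add: N_def compose_simps)
  have HN: "H \<cdot> (id_blinfun - P) = id_blinfun - P"
    unfolding N_def[symmetric] by (simp add: H_def compose_simps TN proj_idem[OF N(1)])
  have Hn: "norm (H x) \<le> norm x" for x
  proof -
    have "(norm (H x))\<^sup>2 = qf (H \<cdot> H) x"
      using norm_adj_apply[OF M_cl[OF HM], of x] by (simp add: sH)
    also have "\<dots> = (norm x)\<^sup>2 - s\<^sup>2 * qf a x" unfolding HH by (simp add: blinfun.bilinear_simps cinner_simps)
    also have "\<dots> \<le> (norm x)\<^sup>2" using positive_qf[OF apos, of x] by simp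
    finally show ?thesis by simp
  qed
  obtain b where b: "b \<in> M" "positive_op b" "b \<cdot> b = B" using M_sqrt[OF B] by blast
  have sb: "adj b = b" by (rule selfadj_adj[OF positive_selfadj[OF b(2)]])
  define Z where "Z = s *\<^sub>R (K \<cdot> adj w) + L \<cdot> H"
  have ZM: "Z \<in> M" by (simp add: Z_def M_add M_scaleR M_compose M_adj K w L HM)
  have aZ: "adj Z = s *\<^sub>R (w \<cdot> K) + H \<cdot> adj L"
    by (simp add: Z_def adj_add adj_scaleR adj_compose cl_scaleR M_cl M_compose M_adj K w L HM adj_adj sK sH)
  have wKAL: "w \<cdot> K \<cdot> A \<cdot> L = 0"
  proof -
    have "w \<cdot> K \<cdot> A \<cdot> L = w \<cdot> K \<cdot> (A \<cdot> G) \<cdot> L" by (simp add: compose_assoc L(2))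
    also have "\<dots> = w \<cdot> (K \<cdot> G) \<cdot> A \<cdot> L" by (simp add: G(2)[symmetric] compose_assoc)
    also have "\<dots> = 0" by (simp add: G(3) wG)
    finally show ?thesis .
  qed
  have LAKw: "adj L \<cdot> A \<cdot> (K \<cdot> adj w) = 0"
    using compose_flip[OF wKAL _ _ refl refl refl]
    by (simp add: M_cl M_compose w K A L adj_compose sK sA compose_assoc)
  have ZAZ: "adj Z \<cdot> A \<cdot> Z = id_blinfun"
  proof -
    have "adj Z \<cdot> A \<cdot> Z = (s * s) *\<^sub>R a + s *\<^sub>R ((w \<cdot> K \<cdot> A \<cdot> L) \<cdot> H) + s *\<^sub>R (H \<cdot> (adj L \<cdot> A \<cdot> (K \<cdot> adj w)))
        + H \<cdot> (adj L \<cdot> A \<cdot> L) \<cdot> H"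
      unfolding aZ unfolding Z_def a_def by (simp add: compose_simps compose_assoc scaleR_add_right)
    also have "\<dots> = id_blinfun"
      unfolding wKAL LAKw L(3) by (simp add: compose_simps HH power2_eq_square)
    finally show ?thesis .
  qed
  define Y where "Y = Z \<cdot> b"
  have YM: "Y \<in> M" by (simp add: Y_def M_compose ZM b)
  have aY: "adj Y = b \<cdot> adj Z" by (simp add: Y_def adj_compose M_cl ZM b sb)
  have YAY: "adj Y \<cdot> A \<cdot> Y = B"
  proof -
    have "adj Y \<cdot> A \<cdot> Y = b \<cdot> (adj Z \<cdot> A \<cdot> Z) \<cdot> b" unfolding aY unfolding Y_def by (simp add: compose_assoc)
    thus ?thesis unfolding ZAZ by (simp add: compose_simps b)
  qed
  have nY: "(norm (adj Y x))\<^sup>2 = qf B (adj Z x)" for x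
    using norm_adj_apply[OF M_cl[OF b(1)], of "adj Z x"] eq_applyD[OF b(3), of "adj Z x"]
    by (simp add: aY sb)
  have Zx: "adj Z x = s *\<^sub>R w (K x) + H (adj L x)" for x
    unfolding aZ by (simp add: blinfun.bilinear_simps)
  have LG: "adj L (G x) = adj L x" for x
    using eq_applyD[OF adj_left_absorb[OF L(2) Gp L(1)], of x] by simp
  have Pw: "P (w x) = w x" for x using eq_applyD[OF w(3), of x] by simp
  have GK: "G \<cdot> K = G"
    using compose_flip[OF G(3)] by (simp add: M_cl K proj_cl Gp proj_adj sK)
  \<comment> \<open>\<open>iface\<close> is used with \<open>y = w (K x)\<close> and with
    \<open>G x\<close> for \<open>x\<close>. On the range of \<open>G\<close> the operator
    \<open>K\<close> is the identity and \<open>w\<close> vanishes, so the two terms see only the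
    orthogonal parts \<open>x - G x\<close> and \<open>G x\<close>; for the first of these
    \<open>K^2 <= K\<close> suffices.\<close>
  have up: "(norm (adj Y x))\<^sup>2 \<le> qf K x" for x
  proof -
    let ?g = "G x" and ?x' = "x - G x"
    have KG: "K ?g = ?g" using eq_applyD[OF G(3), of x] by simp
    have wKg: "w (K x) = w (K ?x')"
      using eq_applyD[OF wG, of x] by (simp add: blinfun.bilinear_simps KG)
    have "(norm (adj Y x))\<^sup>2 \<le> (norm (w (K x)))\<^sup>2 + (norm ?g)\<^sup>2"
      unfolding nY Zx using iface[OF HP HN Hn Pw, of "K x" ?g] by (simp add: LG)
    also have "(norm (w (K x)))\<^sup>2 \<le> (norm (K ?x'))\<^sup>2"
      unfolding wKg nw by (intro power_mono norm_proj_le[OF Rp]) simp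
    also have "\<dots> \<le> 1 * qf K ?x'" by (rule positive_norm_square_le[OF K(2)]) (use K(3) in simp)
    finally have "(norm (adj Y x))\<^sup>2 \<le> qf K ?x' + (norm ?g)\<^sup>2" by simp
    also have "\<dots> = qf K x"
    proof -
      have "cinner (K ?g) ?x' = 0"
        unfolding KG by (simp add: selfadj_swap[OF proj_selfadj[OF Gp]] blinfun.bilinear_simps proj_idem_apply[OF Gp])
      from qf_add_orth[OF positive_selfadj[OF K(2)] this] have "qf K x = qf K ?g + qf K ?x'" by simp
      thus ?thesis by (simp only: KG Re_cinner_self)
    qed
    finally show ?thesis .
  qed
  have low: "s\<^sup>2 * \<beta> * (norm (R (K x)))\<^sup>2 \<le> (norm (adj Y x))\<^sup>2"
    if "G x = 0" for x
  proof -
    have "adj L x = 0" using LG[of x] that by simp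
    hence "(norm (adj Y x))\<^sup>2 = s\<^sup>2 * qf B (w (K x))"
      unfolding nY Zx by (simp add: qf_scale_arg)
    moreover have "\<beta> * (norm (R (K x)))\<^sup>2 \<le> qf B (w (K x))"
      using P(2)[of "w (K x)"] by (simp add: Pw nw)
    ultimately show ?thesis by (simp add: mult_left_mono mult.assoc)
  qed
  have van: "adj Y \<cdot> U = 0" if U: "K \<cdot> U = U" "R \<cdot> U = 0" "G \<cdot> U = 0" for U
  proof -
    have "w \<cdot> U = 0" by (rule zero_absorb_right[OF wR U(2)])
    moreover have "adj L \<cdot> U = 0" by (rule zero_absorb_right[OF adj_left_absorb[OF L(2) Gp L(1)] U(3)])
    ultimately show ?thesis unfolding aY aZ by (simp add: compose_simps compose_assoc U(1))
  qed
  show ?thesis using YM YAY up low van by blast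
qed

end

section \<open>Sums over subfamilies of an orthogonal sequence, and the exhaustion of the
  identity\<close>

definition bsum :: "(nat \<Rightarrow> 'h::chilbert_space oper) \<Rightarrow> nat set \<Rightarrow> 'h oper" where
  "bsum f I = psum (\<lambda>k. if k \<in> I then f k else 0)"

lemma bsum_seq: "orth_seq f \<Longrightarrow> orth_seq (\<lambda>k. if k \<in> I then f k else 0)"
  by (auto simp: orth_seq_def)

lemma bsum_proj: "orth_seq f \<Longrightarrow> projection_op (bsum f I)"
  unfolding bsum_def by (rule psum_proj[OF bsum_seq])

lemma bsum_absorb: "orth_seq f \<Longrightarrow> k \<in> I \<Longrightarrow> bsum f I \<cdot> f k = f k"
  using psum_absorb[OF bsum_seq, of f I k] by (simp add: bsum_def)

lemma bsum_orth_left: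
  assumes "orth_seq f" "\<And>k. k \<in> I \<Longrightarrow> T \<cdot> f k = 0"
  shows "T \<cdot> bsum f I = 0"
  unfolding bsum_def by (rule psum_orth_left[OF bsum_seq[OF assms(1)]]) (simp add: assms(2))

lemma bsum_absorb_left:
  assumes "orth_seq f" "\<And>k. k \<in> I \<Longrightarrow> T \<cdot> f k = f k"
  shows "T \<cdot> bsum f I = bsum f I"
  unfolding bsum_def by (rule psum_absorb_left[OF bsum_seq[OF assms(1)]]) (simp add: assms(2))

lemma bsum_orth: "orth_seq f \<Longrightarrow> I \<inter> J = {} \<Longrightarrow> bsum f I \<cdot> bsum f J = 0"
proof (rule bsum_orth_left)
  fix k assume f: "orth_seq f" and d: "I \<inter> J = {}" and k: "k \<in> J"
  have "f k \<cdot> bsum f I = 0" by (rule bsum_orth_left[OF f], rule orth_seqD(2)[OF f]) (use d k in auto)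
  thus "bsum f I \<cdot> f k = 0" by (rule proj_orth_flip[OF bsum_proj[OF f] orth_seqD(1)[OF f]])
qed

lemma bsum_mono: "orth_seq f \<Longrightarrow> I \<subseteq> J \<Longrightarrow> bsum f J \<cdot> bsum f I = bsum f I"
  by (rule bsum_absorb_left) (auto intro: bsum_absorb)

lemma bsum_commute:
  assumes f: "orth_seq f" and "\<And>k. k \<in> I \<Longrightarrow> T \<cdot> f k = f k \<cdot> T"
  shows "T \<cdot> bsum f I = bsum f I \<cdot> T"
  unfolding bsum_def by (rule psum_commute[OF bsum_seq[OF f]]) (simp add: assms(2))

lemma bsum_tail_limit:
  assumes f: "orth_seq f"
  shows "slim (\<lambda>m. bsum f {m..}) 0"
proof
  fix x
  have "bsum f {m..} x = psum f x - (\<Sum>k<m. f k x)" for m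
  proof -
    have "(\<lambda>k. if k \<in> {..<m} then f k x else 0) sums (\<Sum>k<m. f k x)"
      by (rule sums_If_finite_set) simp
    from sums_diff[OF psum_sums[OF f, of x] this]
    have "(\<lambda>k. (if k \<in> {m..} then f k else 0) x) sums (psum f x - (\<Sum>k<m. f k x))"
      by (rule sums_cong[THEN iffD1, rotated]) auto
    from sums_unique2[OF this psum_sums[OF bsum_seq[OF f], of "{m..}" x]] show ?thesis by (simp add: bsum_def)
  qed
  moreover have "(\<lambda>m. psum f x - (\<Sum>k<m. f k x)) \<longlonglongrightarrow> psum f x - psum f x"
    using psum_sums[OF f, of x] by (intro tendsto_diff tendsto_const) (simp add: sums_def)
  ultimately show "(\<lambda>m. bsum f {m..} x) \<longlonglongrightarrow> blinfun_apply 0 x" by simp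
qed

context sfactor
begin

lemma bsum_M: "orth_seq f \<Longrightarrow> (\<And>k. f k \<in> M) \<Longrightarrow> bsum f I \<in> projections M"
  unfolding bsum_def by (rule psum_M[OF bsum_seq]) (auto simp: M_0)

lemma big_bsum:
  assumes P: "P \<in> projections M" "P \<noteq> 0" and f: "orth_seq f" "\<And>k. f k \<in> M" and I: "infinite {k\<in>I. sub P (f k)}"
  shows "big (bsum f I)"
proof -
  define g where "g = enumerate {k\<in>I. sub P (f k)}"
  have g: "g n \<in> I" "sub P (f (g n))" for n using enumerate_in_set[OF I, of n] by (auto simp: g_def)
  have "inj g" unfolding g_def using strict_mono_enumerate[OF I] by (rule strict_mono_imp_inj_on)
  hence "orth_seq (\<lambda>n. f (g n))" using f(1) by (auto simp: orth_seq_def inj_eq)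
  thus ?thesis
    by (rule big_of_copies[OF P]) (auto intro: g bsum_M bsum_absorb f)
qed

text \<open>The remainders decrease to a strong limit \<open>Kl\<close>. If a piece still saw
  \<open>Kl x\<close>, every step devoted to that piece would remove from \<open>x\<close> at least
  a fixed multiple of \<open>(s j)\<^sup>2\<close>; those steps have divergent sum, while the total
  removed is at most \<open>(norm x)\<^sup>2\<close>.\<close>

theorem exhaustion:
  assumes A: "A \<in> M" "positive_op A" and B: "\<And>j. B j \<in> M" "\<And>j. positive_op (B j)"
    and P0: "P0 \<in> projections M" "P0 \<noteq> 0"
    and G: "orth_seq G" "\<And>j. G j \<in> M" "\<And>j. G j \<cdot> A = A \<cdot> G j"
    and L: "\<And>j. L j \<in> M" "\<And>j. G j \<cdot> L j = L j" "\<And>j. adj (L j) \<cdot> A \<cdot> L j = id_blinfun"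
    and P: "\<And>j. P j \<in> projections M" "\<And>j x. \<beta> * (norm (P j x))\<^sup>2 \<le> qf (B j) x" and \<beta>: "0 < \<beta>"
    and s: "\<And>j. 0 \<le> s j" "\<And>j. (s j)\<^sup>2 * norm A \<le> 1" "\<And>j. 0 < s j \<Longrightarrow> sub P0 (P j)"
    and iface: "\<And>j H x y. H \<cdot> P j = P j \<cdot> H \<Longrightarrow> H \<cdot> (id_blinfun - P j) = id_blinfun - P j \<Longrightarrow>
      (\<And>x. norm (H x) \<le> norm x) \<Longrightarrow> P j y = y \<Longrightarrow>
      qf (B j) (s j *\<^sub>R y + H ((adj (L j)) x)) \<le> (norm y)\<^sup>2 + (norm x)\<^sup>2"
    and div: "\<not> summable (\<lambda>j. (s j)\<^sup>2)"
  shows "\<exists>Y. (\<forall>j. Y j \<in> M \<and> adj (Y j) \<cdot> A \<cdot> Y j = B j) \<and> sot_sums (\<lambda>j. Y j \<cdot> adj (Y j)) id_blinfun"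
proof -
  have Gp: "projection_op (G j)" and GP: "G j \<in> projections M" for j
    using orth_seqD(1)[OF G(1)] G(2) by (auto simp: projM)
  have P0p: "projection_op P0" using P0 by (simp add: projM)
  obtain f :: "nat \<Rightarrow> nat" where f: "\<And>i. \<not> summable (\<lambda>n. if f n = i then (s n)\<^sup>2 else 0)"
    using divergent_fibres[of "\<lambda>j. (s j)\<^sup>2"] div by auto
  \<comment> \<open>The loss in step \<open>j\<close> is bounded below only on the kernel of
    \<open>G j\<close>. So the projections \<open>F m\<close>, orthogonal to all blocks from
    \<open>m\<close> on, are decomposed in place of \<open>I\<close>, which they approximate
    strongly.\<close>
  define F where "F m = id_blinfun - bsum G {m..}" for m
  have FP: "F m \<in> projections M" for m
    using bsum_M[OF G(1,2), of "{m..}"] by (auto simp: F_def projM M_diff M_id proj_complement)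
  hence Fp: "projection_op (F m)" for m by (simp add: projM)
  have FG: "F m \<cdot> G k = 0" if "m \<le> k" for m k
    using bsum_absorb[OF G(1), of k "{m..}"] that by (simp add: F_def compose_simps)
  have GF: "G k \<cdot> F m = 0" if "m \<le> k" for m k by (rule proj_orth_flip[OF Gp Fp FG[OF that]])
  have Flim: "(\<lambda>m. F m x) \<longlonglongrightarrow> x" for x
  proof -
    have "(\<lambda>m. x - bsum G {m..} x) \<longlonglongrightarrow> x - blinfun_apply 0 x"
      by (intro tendsto_diff tendsto_const bsum_tail_limit[OF G(1), rule_format])
    thus ?thesis by (simp add: F_def blinfun.bilinear_simps)
  qed
  have "\<forall>m. \<exists>e. orth_seq e \<and> (\<forall>n. e n \<in> projections M) \<and> psum e = F m \<and> (\<forall>n. sub (e n) P0)"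
    using decomposition[OF P0 FP] by blast
  from choice[OF this] obtain e where e0: "\<forall>m. orth_seq (e m) \<and> (\<forall>n. e m n \<in> projections M) \<and> psum (e m) = F m \<and> (\<forall>n. sub (e m n) P0)"
    by (rule exE)
  have e: "orth_seq (e m)" "e m n \<in> projections M" "psum (e m) = F m" "sub (e m n) P0" for m n using e0 by blast+
  have eF: "e m n \<cdot> F m = e m n" for m n
    using proj_flip[OF _ Fp, of "e m n" m] psum_absorb[OF e(1), of m n] e(2) by (simp add: e(3) projM)
  have eG: "e m n \<cdot> G k = 0" if "m \<le> k" for m n k by (rule zero_absorb_right[OF eF FG[OF that]])
  define ix where "ix j = prod_decode (f j)" for j
  \<comment> \<open>\<open>ix j = (m, n)\<close> selects the piece \<open>e m n\<close> of
    \<open>F m\<close>, used only from \<open>j = m\<close> on: it is then orthogonal to all blocks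
    still reserved. The delay costs each fibre finitely many indices.\<close>
  define R where "R j = (if 0 < s j \<and> fst (ix j) \<le> j then e (fst (ix j)) (snd (ix j)) else 0)" for j
  have RP: "R j \<in> projections M" for j using e(2) by (auto simp: R_def projM M_0)
  have Rs: "sub (R j) (P j)" for j
  proof (cases "0 < s j \<and> fst (ix j) \<le> j")
    case True thus ?thesis using sub_trans[OF e(4) s(3) P0p] by (simp add: R_def)
  next
    case False
    hence "R j = 0" by (auto simp: R_def)
    thus ?thesis unfolding sub_def by (intro bexI[of _ 0]) (simp_all add: M_0)
  qed
  have RG: "R j \<cdot> G k = 0" if "j \<le> k" for j k
    using eG[of "fst (ix j)" k] that by (simp add: R_def)
  \<comment> \<open>The choice principle for sequences prescribes no initial value, so the invariant
    itself fixes \<open>K 0\<close>.\<close>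
  define inv where "inv j K \<longleftrightarrow> (j = 0 \<longrightarrow> K = id_blinfun) \<and> K \<in> M \<and> positive_op K \<and> (\<forall>x. qf K x \<le> (norm x)\<^sup>2) \<and> (\<forall>k\<ge>j. K \<cdot> G k = G k)" for j K
  define step where "step j K K' \<longleftrightarrow> (\<exists>Y\<in>M. adj Y \<cdot> A \<cdot> Y = B j \<and> K' = K - Y \<cdot> adj Y \<and>
    (\<forall>x. G j x = 0 \<longrightarrow> (s j)\<^sup>2 * \<beta> * (norm (R j (K x)))\<^sup>2 \<le> (norm (adj Y x))\<^sup>2))" for j K K'
  have "\<exists>K. \<forall>j. inv j (K j) \<and> step j (K j) (K (Suc j))"
  proof (rule dependent_nat_choice)
    show "\<exists>K. inv 0 K" by (rule exI[of _ id_blinfun]) (simp add: inv_def M_id compose_simps)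
  next
    fix K j assume "inv j K"
    hence K: "K \<in> M" "positive_op K" "\<And>x. qf K x \<le> (norm x)\<^sup>2" "\<And>k. j \<le> k \<Longrightarrow> K \<cdot> G k = G k"
      by (auto simp: inv_def)
    obtain Y where Y: "Y \<in> M" "adj Y \<cdot> A \<cdot> Y = B j" "\<forall>x. (norm (adj Y x))\<^sup>2 \<le> qf K x"
      "\<forall>T. K \<cdot> T = T \<longrightarrow> R j \<cdot> T = 0 \<longrightarrow> G j \<cdot> T = 0 \<longrightarrow> adj Y \<cdot> T = 0"
      "\<forall>x. G j x = 0 \<longrightarrow> (s j)\<^sup>2 * \<beta> * (norm (R j (K x)))\<^sup>2 \<le> (norm (adj Y x))\<^sup>2"
      using exhaustion_step[OF A B K(1,2,3) GP G(3) K(4)[OF order_refl] L P s(1,2) RP Rs RG[OF order_refl] iface]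
      by blast
    let ?K = "K - Y \<cdot> adj Y"
    have q: "qf ?K x = qf K x - (norm (adj Y x))\<^sup>2" for x
      by (simp only: qf_diff qf_gram'[OF M_cl[OF Y(1)]])
    have "?K \<in> M" by (simp add: M_diff M_compose M_adj K Y)
    moreover have "positive_op ?K"
      unfolding positive_op_iff
    proof (intro conjI allI)
      show "selfadj ?K" by (intro selfadj_diff positive_selfadj K(2) positive_gram' M_cl Y(1))
      show "0 \<le> qf ?K x" for x unfolding q using Y(3) by simp
    qed
    moreover have "qf ?K x \<le> (norm x)\<^sup>2" for x
      unfolding q using K(3)[of x] by (meson diff_le_eq le_add_same_cancel1 order_trans zero_le_power2)
    moreover have "?K \<cdot> G k = G k" if "Suc j \<le> k" for k
    proof -
      have "adj Y \<cdot> G k = 0"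
        using Y(4)[rule_format, of "G k"] K(4)[of k] RG[of j k] orth_seqD(2)[OF G(1), of j k] that by simp
      thus ?thesis using K(4)[of k] that by (simp add: compose_simps compose_assoc)
    qed
    ultimately have "inv (Suc j) ?K" by (simp add: inv_def)
    moreover have "step j K ?K" unfolding step_def using Y by blast
    ultimately show "\<exists>K'. inv (Suc j) K' \<and> step j K K'" by blast
  qed
  then obtain K where K: "\<And>j. inv j (K j)" "\<And>j. step j (K j) (K (Suc j))" by blast
  have K0: "K 0 = id_blinfun" using K(1)[of 0] by (simp add: inv_def)
  have Kq: "positive_op (K j)" "qf (K j) x \<le> (norm x)\<^sup>2" for j x using K(1)[of j] by (auto simp: inv_def)
  have "\<forall>j. \<exists>Y. Y \<in> M \<and> adj Y \<cdot> A \<cdot> Y = B j \<and> K (Suc j) = K j - Y \<cdot> adj Y \<and>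
    (\<forall>x. G j x = 0 \<longrightarrow> (s j)\<^sup>2 * \<beta> * (norm (R j (K j x)))\<^sup>2 \<le> (norm (adj Y x))\<^sup>2)"
    using K(2) unfolding step_def by blast
  from choice[OF this] obtain Y where Y0: "\<forall>j. Y j \<in> M \<and> adj (Y j) \<cdot> A \<cdot> Y j = B j \<and> K (Suc j) = K j - Y j \<cdot> adj (Y j) \<and>
    (\<forall>x. G j x = 0 \<longrightarrow> (s j)\<^sup>2 * \<beta> * (norm (R j (K j x)))\<^sup>2 \<le> (norm ((adj (Y j)) x))\<^sup>2)"
    by (rule exE)
  note Y = Y0[THEN spec, THEN conjunct1] Y0[THEN spec, THEN conjunct2, THEN conjunct1]
    Y0[THEN spec, THEN conjunct2, THEN conjunct2, THEN conjunct1]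
    Y0[THEN spec, THEN conjunct2, THEN conjunct2, THEN conjunct2, rule_format]
  have Ksum: "id_blinfun - K n = (\<Sum>j<n. Y j \<cdot> adj (Y j))" for n
    by (induction n) (simp_all add: K0 Y(3))
  have nY: "qf (K (Suc j)) x = qf (K j) x - (norm ((adj (Y j)) x))\<^sup>2" for j x
    by (simp only: Y(3) qf_diff qf_gram'[OF M_cl[OF Y(1)]])
  have nYsum: "summable (\<lambda>j. (norm ((adj (Y j)) x))\<^sup>2)" for x
  proof (rule bounded_imp_summable)
    fix n
    have "(\<Sum>j<n. (norm ((adj (Y j)) x))\<^sup>2) = (norm x)\<^sup>2 - qf (K n) x" for n
      by (induction n) (simp_all add: K0 nY)
    thus "(\<Sum>j\<le>n. (norm ((adj (Y j)) x))\<^sup>2) \<le> (norm x)\<^sup>2"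
      using positive_qf[OF Kq(1), of "Suc n" x] by (simp add: lessThan_Suc_atMost[symmetric])
  qed simp
  have "\<exists>S. selfadj S \<and> slim (\<lambda>n. id_blinfun - K n) S \<and> (\<forall>n x. qf (id_blinfun - K n) x \<le> qf S x)"
  proof (rule increasing_strong_limit)
    show "selfadj (id_blinfun - K n)" for n by (intro selfadj_diff positive_selfadj Kq) simp
    show "qf (id_blinfun - K n) x \<le> qf (id_blinfun - K (Suc n)) x" for n x
      by (simp add: qf_diff nY del: minus_blinfun.rep_eq)
    show "qf (id_blinfun - K n) x \<le> 1 * (norm x)\<^sup>2" for n x
      using positive_qf[OF Kq(1), of n x] by (simp add: qf_diff del: minus_blinfun.rep_eq)
  qed
  then obtain S where S: "slim (\<lambda>n. id_blinfun - K n) S" by blast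
  define Kl where "Kl = id_blinfun - S"
  have Kl: "(\<lambda>n. K n x) \<longlonglongrightarrow> Kl x" for x
  proof -
    have "(\<lambda>n. x - (id_blinfun - K n) x) \<longlonglongrightarrow> x - S x"
      by (intro tendsto_diff tendsto_const S[rule_format])
    thus ?thesis by (simp add: Kl_def blinfun.bilinear_simps)
  qed
  \<comment> \<open>From some index on, the piece \<open>e m' l\<close> sees more than
    \<open>c\<close> of \<open>K n x\<close>, so each step of its fibre with positive
    \<open>s j\<close> takes at least \<open>(s j)\<^sup>2 * \<beta> * c\<^sup>2\<close> from the
    form at \<open>x\<close>. Summability of these losses contradicts the divergence of the
    fibre.\<close>
  have eK: "e m' l (Kl x) = 0" if x: "F m x = x" for m m' l x
  proof (rule ccontr)
    assume nz: "e m' l (Kl x) \<noteq> 0"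
    define c where "c = norm (e m' l (Kl x)) / 2"
    have c: "0 < c" using nz by (simp add: c_def)
    have "(\<lambda>n. norm (e m' l (K n x))) \<longlonglongrightarrow> 2 * c"
      unfolding c_def using tendsto_norm[OF bounded_linear.tendsto[OF blinfun.bounded_linear_right Kl[of x]], of "e m' l"] by simp
    from order_tendstoD(1)[OF this, of c] obtain N where N: "\<And>n. N \<le> n \<Longrightarrow> c < norm (e m' l (K n x))"
      using c by (auto simp: eventually_sequentially)
    define i where "i = prod_encode (m', l)"
    have "summable (\<lambda>n. if f n = i then (s n)\<^sup>2 else 0)"
    proof (rule summable_comparison_test'[where N = "max N (max m m')"])
      show "summable (\<lambda>j. (norm ((adj (Y j)) x))\<^sup>2 / (\<beta> * c\<^sup>2))" by (rule summable_divide[OF nYsum])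
      fix j assume j: "max N (max m m') \<le> j"
      show "norm (if f j = i then (s j)\<^sup>2 else 0) \<le> (norm ((adj (Y j)) x))\<^sup>2 / (\<beta> * c\<^sup>2)"
      proof (cases "f j = i \<and> 0 < s j")
        case False
        hence "(if f j = i then (s j)\<^sup>2 else 0) = 0" using s(1)[of j] by auto
        thus ?thesis using \<beta> by simp
      next
        case True
        hence Rj: "R j = e m' l" using j by (simp add: R_def ix_def i_def)
        have "G j x = 0"
          using eq_applyD[OF GF[of m j], of x] j x by simp
        from Y(4)[OF this] have "(s j)\<^sup>2 * \<beta> * (norm (e m' l (K j x)))\<^sup>2 \<le> (norm ((adj (Y j)) x))\<^sup>2"
          by (simp only: Rj)
        moreover have "(s j)\<^sup>2 * \<beta> * c\<^sup>2 \<le> (s j)\<^sup>2 * \<beta> * (norm (e m' l (K j x)))\<^sup>2"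
          using N[of j] j c \<beta> by (intro mult_left_mono power_mono) auto
        ultimately have "(s j)\<^sup>2 * (\<beta> * c\<^sup>2) \<le> (norm ((adj (Y j)) x))\<^sup>2" by (simp add: mult.assoc)
        thus ?thesis using True \<beta> c by (simp add: pos_le_divide_eq)
      qed
    qed
    thus False using f by blast
  qed
  have FKl: "F m' (Kl x) = 0" if "F m x = x" for m m' x
  proof -
    have "(\<lambda>l. e m' l (Kl x)) sums F m' (Kl x)"
      using psum_sums[OF e(1)[of m']] by (simp add: e(3))
    moreover have "(\<lambda>l. e m' l (Kl x)) = (\<lambda>l. 0)" using eK[OF that] by simp
    ultimately show ?thesis using sums_unique2[OF sums_zero] by simp
  qed
  have KlF: "Kl x = 0" if "F m x = x" for m x
    using LIMSEQ_unique[OF Flim[of "Kl x"], of 0] FKl[OF that] by simp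
  have "Kl = 0"
  proof (rule blinfun_eqI)
    fix x
    have "Kl (F m x) = 0" for m by (rule KlF[OF proj_idem_apply[OF Fp]])
    moreover have "(\<lambda>m. Kl (F m x)) \<longlonglongrightarrow> Kl x"
      by (rule bounded_linear.tendsto[OF blinfun.bounded_linear_right Flim])
    ultimately show "Kl x = blinfun_apply 0 x" using LIMSEQ_unique[of "\<lambda>_. 0" 0] by simp
  qed
  hence "S = id_blinfun" by (simp add: Kl_def)
  hence "sot_sums (\<lambda>j. Y j \<cdot> adj (Y j)) id_blinfun"
    using S unfolding sot_sums_def limitin_sot Ksum by simp
  thus ?thesis using Y(1,2) by blast
qed

end

subsection \<open>Compressions from a decomposition of the identity\<close>

context sfactor
begin

text \<open>Infinitely many orthogonal copies of one projection are regrouped by the pairing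
  function into infinitely many infinite groups, each with room for a copy of \<open>I\<close>. What
  these copies leave over is added to the copy with index \<open>0\<close>, which stays equivalent
  to \<open>I\<close>; this makes the ranges sum to \<open>I\<close> exactly.\<close>

lemma isometry_sequence:
  assumes inf: "\<not> finite_projection M id_blinfun"
  shows "\<exists>S. (\<forall>j. S j \<in> M \<and> adj (S j) \<cdot> S j = id_blinfun) \<and> (\<forall>i j. i \<noteq> j \<longrightarrow> adj (S i) \<cdot> S j = 0)
    \<and> sot_sums (\<lambda>j. S j \<cdot> adj (S j)) id_blinfun"
proof -
  have idP: "id_blinfun \<in> projections M" by (simp add: projM M_id)
  obtain d f where d: "d \<in> projections M" "d \<noteq> 0" and f: "orth_seq f" "\<And>n. f n \<in> projections M" "\<And>n. sub d (f n)"
    using infinite_copies[OF idP inf] by blast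
  have fM: "f n \<in> M" for n using f(2) by (simp add: projM)
  define e where "e n = bsum f {k. fst (prod_decode k) = n}" for n
  have ep: "projection_op (e n)" for n unfolding e_def by (rule bsum_proj[OF f(1)])
  have eo: "e m \<cdot> e n = 0" if "m \<noteq> n" for m n unfolding e_def by (rule bsum_orth[OF f(1)]) (use that in auto)
  have "big (e n)" for n
    unfolding e_def
  proof (rule big_bsum[OF d f(1) fM])
    have "range (\<lambda>k. prod_encode (n, k)) \<subseteq> {k \<in> {k. fst (prod_decode k) = n}. sub d (f k)}" using f(3) by auto
    moreover have "infinite (range (\<lambda>k. prod_encode (n, k)))" by (rule range_inj_infinite) (auto simp: inj_on_def)
    ultimately show "infinite {k \<in> {k. fst (prod_decode k) = n}. sub d (f k)}" using infinite_super by blast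
  qed
  hence "\<forall>n. \<exists>w. w \<in> M \<and> adj w \<cdot> w = id_blinfun \<and> e n \<cdot> w = w" unfolding big_def sub_def by blast
  from choice[OF this] obtain w where "\<forall>n. w n \<in> M \<and> adj (w n) \<cdot> w n = id_blinfun \<and> e n \<cdot> w n = w n" by (rule exE)
  hence w: "w n \<in> M" "adj (w n) \<cdot> w n = id_blinfun" "e n \<cdot> w n = w n" for n by blast+
  have wo: "adj (w m) \<cdot> w n = 0" if "m \<noteq> n" for m n
  proof -
    have "adj (w m) \<cdot> e n = 0"
      using zero_absorb_right[OF adj_left_absorb[OF w(3) ep w(1)] eo[OF that]] .
    thus ?thesis by (rule zero_absorb_left[OF _ w(3)])
  qed
  have wp: "projection_op (adj (w n) \<cdot> w n)" for n by (simp add: w(2))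
  define c where "c n = w n \<cdot> adj (w n)" for n
  have c: "orth_seq c" unfolding c_def by (rule orth_ranges[OF w(1) wp wo])
  have cP: "c n \<in> projections M" for n unfolding c_def by (rule pi_final[OF w(1) refl wp])
  have cw: "c n \<cdot> w n = w n" for n by (simp add: c_def compose_assoc w(2) compose_simps)
  have EP: "psum c \<in> projections M" by (rule psum_M[OF c]) (use cP in \<open>simp add: projM\<close>)
  define r where "r = c 0 + (id_blinfun - psum c)"
  have pc: "(id_blinfun - psum c) \<cdot> c n = 0" for n by (simp add: compose_simps psum_absorb[OF c])
  have cp: "c n \<cdot> (id_blinfun - psum c) = 0" for n
    by (rule proj_orth_flip[OF orth_seqD(1)[OF c] proj_complement[OF psum_proj[OF c]] pc])
  have rP: "r \<in> projections M"
    unfolding projM r_def using cP EP cp[of 0]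
    by (intro conjI M_add M_diff M_id proj_add proj_complement) (auto simp: projM)
  have "big r"
  proof -
    have "sub id_blinfun (c 0)" unfolding c_def by (rule sub_final[OF w(1,2)]) simp
    moreover have "r \<cdot> c 0 = c 0" using pc[of 0] cP[of 0] by (simp add: r_def compose_add_left projM proj_idem)
    ultimately show ?thesis unfolding big_def using rP sub_mono by blast
  qed
  from big_equivalent[OF this] obtain X where X: "X \<in> M" "r = X \<cdot> adj X" "id_blinfun = adj X \<cdot> X"
    by (auto simp: equivalent_in_def)
  have rX: "r \<cdot> X = X" by (simp add: X(2) compose_assoc X(3)[symmetric] compose_simps)
  define S where "S n = (case n of 0 \<Rightarrow> X | Suc k \<Rightarrow> w (Suc k))" for n
  have SM: "S n \<in> M" for n by (cases n) (simp_all add: S_def X(1) w(1))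
  have SS: "adj (S n) \<cdot> S n = id_blinfun" for n
    by (cases n) (simp_all add: S_def w(2) X(3)[symmetric])
  have Xw: "adj X \<cdot> w (Suc n) = 0" for n
  proof -
    have "r \<cdot> c (Suc n) = 0" using pc[of "Suc n"] orth_seqD(2)[OF c, of 0 "Suc n"] by (simp add: r_def compose_add_left)
    hence 1: "r \<cdot> w (Suc n) = 0" by (rule zero_absorb_left[OF _ cw])
    have "projection_op r" using rP by (simp add: projM)
    from zero_absorb_right[OF adj_left_absorb[OF rX this X(1)] 1] show ?thesis .
  qed
  have wX: "adj (w (Suc n)) \<cdot> X = 0" for n
    using compose_flip[OF Xw[of n]] by (simp add: M_cl X(1) w(1) adj_adj cl_adj)
  have So: "adj (S i) \<cdot> S j = 0" if "i \<noteq> j" for i j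
    using that by (cases i; cases j) (simp_all add: S_def Xw wX wo)
  have "(\<lambda>n. (S n \<cdot> adj (S n)) x) sums id_blinfun x" for x
  proof -
    have "(\<lambda>n. (c (Suc n)) x) sums (psum c x - c 0 x)"
      using psum_sums[OF c, of x] sums_Suc_iff[of "\<lambda>n. c n x" "psum c x - c 0 x"] by simp
    hence "(\<lambda>n. (S (Suc n) \<cdot> adj (S (Suc n))) x) sums (psum c x - c 0 x)"
      by (simp add: S_def c_def)
    from sums_Suc[OF this] show ?thesis
      by (simp add: S_def flip: blinfun_apply_blinfun_compose) (simp add: X(2)[symmetric] r_def blinfun.bilinear_simps)
  qed
  thus ?thesis using SM SS So by (intro exI[of _ S]) (simp add: sot_sums_iff)
qed

text \<open>Only the restriction of \<open>V\<close> to the complement \<open>R\<close> of the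
  kernel matters, as \<open>A = R A R\<close>. The complement of the range of \<open>V R\<close>
  contains the copy \<open>V N\<close> of \<open>N\<close>, so both it and \<open>N\<close> are
  equivalent to \<open>I\<close>; a partial isometry \<open>W\<close> between them completes
  \<open>V R\<close> to a unitary.\<close>

lemma unitary_extension:
  assumes A: "A \<in> M" "selfadj A" and V: "V \<in> M" "adj V \<cdot> V = id_blinfun"
    and N: "equivalent_in M (null_proj A) id_blinfun"
  shows "\<exists>U\<in>M. adj U \<cdot> U = id_blinfun \<and> U \<cdot> adj U = id_blinfun \<and> U \<cdot> A \<cdot> adj U = V \<cdot> A \<cdot> adj V"
proof -
  define N where "N = null_proj A"
  have Np: "projection_op N" and NP: "N \<in> projections M" and NM: "N \<in> M"
    using null_proj(1)[OF M_cl[OF A(1)]] null_proj_M[OF A(1)] by (auto simp: N_def projM)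
  obtain X where X: "X \<in> M" "N = X \<cdot> adj X" "id_blinfun = adj X \<cdot> X"
    using N by (auto simp: equivalent_in_def N_def)
  define R where "R = id_blinfun - N"
  have Rp: "projection_op R" and RM: "R \<in> M" by (simp_all add: R_def proj_complement Np M_diff M_id NM)
  have RN: "R \<cdot> N = 0" by (simp add: R_def compose_simps proj_idem[OF Np])
  have NR: "N \<cdot> R = 0" by (simp add: R_def compose_simps proj_idem[OF Np])
  have AN: "A \<cdot> N = 0"
    by (rule blinfun_eqI) (use null_proj(2)[OF M_cl[OF A(1)]] proj_idem_apply[OF Np] in \<open>simp add: N_def\<close>)
  have AR: "A \<cdot> R = A" by (simp add: R_def compose_simps AN)
  have RA: "R \<cdot> A = A" using compose_flip[OF AR] by (simp add: selfadj_cl A selfadj_adj proj_cl Rp proj_adj)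
  have vv: "adj (V \<cdot> R) \<cdot> (V \<cdot> R) = R"
  proof -
    have "adj (V \<cdot> R) \<cdot> (V \<cdot> R) = R \<cdot> ((adj V \<cdot> V) \<cdot> R)"
      by (simp add: adj_compose M_cl V(1) RM proj_adj[OF Rp] compose_assoc)
    thus ?thesis by (simp add: V(2) compose_simps proj_idem[OF Rp])
  qed
  define p where "p = (V \<cdot> R) \<cdot> adj (V \<cdot> R)"
  have VRM: "V \<cdot> R \<in> M" by (simp add: M_compose V RM)
  have pP: "p \<in> projections M" unfolding p_def by (rule pi_final[OF VRM vv Rp])
  have pp: "projection_op p" using pP by (simp add: projM)
  have pVR: "p \<cdot> (V \<cdot> R) = V \<cdot> R"
    unfolding p_def compose_assoc[of "V \<cdot> R"] vv by (simp add: compose_assoc proj_idem[OF Rp])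
  define p' where "p' = id_blinfun - p"
  have p'P: "p' \<in> projections M" using pP by (auto simp: p'_def projM M_diff M_id proj_complement)
  have p'p: "projection_op p'" using p'P by (simp add: projM)
  have "sub N p'"
    unfolding sub_def
  proof (rule bexI[of _ "V \<cdot> N"], intro conjI)
    have "adj (V \<cdot> N) \<cdot> (V \<cdot> N) = N \<cdot> ((adj V \<cdot> V) \<cdot> N)"
      by (simp add: adj_compose M_cl V(1) NM proj_adj[OF Np] compose_assoc)
    thus "adj (V \<cdot> N) \<cdot> (V \<cdot> N) = N" by (simp add: V(2) compose_simps proj_idem[OF Np])
    have "p \<cdot> (V \<cdot> N) = V \<cdot> R \<cdot> (R \<cdot> ((adj V \<cdot> V) \<cdot> N))"
      by (simp add: p_def adj_compose M_cl V(1) RM proj_adj[OF Rp] compose_assoc)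
    also have "\<dots> = 0" by (simp add: V(2) compose_simps RN)
    finally show "p' \<cdot> (V \<cdot> N) = V \<cdot> N" by (simp add: p'_def compose_simps)
  qed (simp add: M_compose V NM)
  moreover have "sub id_blinfun N" unfolding X(2) by (rule sub_final[OF X(1) X(3)[symmetric]]) simp
  ultimately have "big p'" unfolding big_def using p'P sub_trans Np by blast
  from big_equivalent[OF this] obtain Z where Z: "Z \<in> M" "p' = Z \<cdot> adj Z" "id_blinfun = adj Z \<cdot> Z"
    by (auto simp: equivalent_in_def)
  define W where "W = Z \<cdot> adj X"
  have WM: "W \<in> M" by (simp add: W_def M_compose M_adj Z X)
  have aW: "adj W = X \<cdot> adj Z" by (simp add: W_def adj_compose adj_adj M_cl M_adj Z(1) X(1))
  have WW: "adj W \<cdot> W = N"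
  proof -
    have "adj W \<cdot> W = X \<cdot> ((adj Z \<cdot> Z) \<cdot> adj X)" unfolding aW unfolding W_def by (simp add: compose_assoc)
    thus ?thesis by (simp add: Z(3)[symmetric] X(2) compose_simps)
  qed
  have WW': "W \<cdot> adj W = p'"
  proof -
    have "W \<cdot> adj W = Z \<cdot> ((adj X \<cdot> X) \<cdot> adj Z)" unfolding aW unfolding W_def by (simp add: compose_assoc)
    thus ?thesis by (simp add: X(3)[symmetric] Z(2) compose_simps)
  qed
  have WN: "W \<cdot> N = W" by (rule pi_right[OF WM WW Np])
  have WR: "W \<cdot> R = 0" by (simp add: R_def compose_simps WN)
  have RW: "R \<cdot> adj W = 0" using compose_flip[OF WR] by (simp add: M_cl WM RM proj_adj[OF Rp])
  have pW: "p' \<cdot> W = W" by (simp add: WW'[symmetric] compose_assoc WW WN)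
  have "p \<cdot> p' = 0" by (simp add: p'_def compose_simps proj_idem[OF pp])
  hence pW0: "p \<cdot> W = 0" by (rule zero_absorb_left[OF _ pW])
  have aVR: "adj (V \<cdot> R) = R \<cdot> adj V" by (simp add: adj_compose M_cl V(1) RM proj_adj[OF Rp])
  have VRW: "adj (V \<cdot> R) \<cdot> W = 0"
    by (rule zero_absorb_right[OF adj_left_absorb[OF pVR pp VRM] pW0])
  have WVR: "adj W \<cdot> (V \<cdot> R) = 0" using compose_flip[OF VRW] by (simp add: M_cl WM VRM adj_adj cl_adj)
  define U where "U = V \<cdot> R + W"
  have UM: "U \<in> M" by (simp add: U_def M_add VRM WM)
  have aU: "adj U = adj (V \<cdot> R) + adj W" by (simp add: U_def adj_add M_cl VRM WM)
  have 1: "adj U \<cdot> U = id_blinfun"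
    unfolding aU unfolding U_def compose_add_left compose_add_right vv WW VRW WVR by (simp add: R_def)
  have 2: "U \<cdot> adj U = id_blinfun"
  proof -
    have "V \<cdot> R \<cdot> adj W = 0" by (simp add: compose_assoc RW)
    moreover have "W \<cdot> adj (V \<cdot> R) = 0" unfolding aVR by (simp add: compose_assoc[symmetric] WR)
    ultimately show ?thesis
      unfolding aU unfolding U_def compose_add_left compose_add_right WW' p_def[symmetric] by (simp add: p'_def)
  qed
  have UR: "U \<cdot> R = V \<cdot> R" by (simp add: U_def compose_add_left WR compose_assoc proj_idem[OF Rp])
  have RU: "R \<cdot> adj U = R \<cdot> adj V"
    using compose_flip[OF UR _ _ refl proj_adj[OF Rp] aVR] by (simp add: M_cl UM RM)
  have "U \<cdot> A \<cdot> adj U = (U \<cdot> R) \<cdot> A \<cdot> (R \<cdot> adj U)"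
    by (metis AR RA compose_assoc)
  also have "\<dots> = (V \<cdot> R) \<cdot> A \<cdot> (R \<cdot> adj V)" unfolding UR RU by simp
  also have "\<dots> = V \<cdot> A \<cdot> adj V" by (metis AR RA compose_assoc)
  finally show ?thesis using UM 1 2 by blast
qed

lemma compression_of_decomposition:
  assumes inf: "\<not> finite_projection M id_blinfun" and A: "A \<in> M" "selfadj A"
    and B: "\<And>j. B j \<in> M" "\<And>j. positive_op (B j)"
    and Y: "\<And>j. Y j \<in> M" "\<And>j. adj (Y j) \<cdot> A \<cdot> Y j = B j" "sot_sums (\<lambda>j. Y j \<cdot> adj (Y j)) id_blinfun"
  shows "\<exists>(E :: nat \<Rightarrow> 'h oper) V.
            (\<forall>j. E j \<in> projections M) \<and> (\<forall>i j. i \<noteq> j \<longrightarrow> E i \<cdot> E j = 0) \<and> sot_sums E id_blinfun \<and>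
            (\<forall>j. equivalent_in M (E j) id_blinfun) \<and> V \<in> M \<and> partial_isometry V \<and>
            op_le (range_proj A) (adj V \<cdot> V) \<and>
            (\<forall>j. equivalent_in M (E j \<cdot> V \<cdot> A \<cdot> adj V \<cdot> E j) (B j)) \<and>
            (equivalent_in M (null_proj A) id_blinfun \<longrightarrow> V = id_blinfun)"
proof -
  obtain S where S: "\<And>j. S j \<in> M" "\<And>j. adj (S j) \<cdot> S j = id_blinfun" "\<And>i j. i \<noteq> j \<Longrightarrow> adj (S i) \<cdot> S j = 0"
    "sot_sums (\<lambda>j. S j \<cdot> adj (S j)) id_blinfun" using isometry_sequence[OF inf] by blast
  define X where "X j = S j \<cdot> adj (Y j)" for j
  have XM: "X j \<in> M" for j by (simp add: X_def M_compose M_adj S Y)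
  have aX: "adj (X j) = Y j \<cdot> adj (S j)" for j by (simp add: X_def adj_compose M_cl M_adj S(1) Y(1) adj_adj)
  have o: "adj (X m) \<cdot> X n = 0" if "m \<noteq> n" for m n
  proof -
    have "adj (X m) \<cdot> X n = Y m \<cdot> ((adj (S m) \<cdot> S n) \<cdot> adj (Y n))" unfolding aX unfolding X_def by (simp add: compose_assoc)
    thus ?thesis by (simp add: S(3)[OF that])
  qed
  have nX: "(norm (X j x))\<^sup>2 = qf (Y j \<cdot> adj (Y j)) x" for j x
    using norm_pi[OF S(1,2), of j "(adj (Y j)) x"] qf_gram'[OF M_cl[OF Y(1)], of j x] by (simp add: X_def)
  have sX: "(\<lambda>j. (norm (X j x))\<^sup>2) sums (norm x)\<^sup>2" for x
  proof -
    have "(\<lambda>j. (Y j \<cdot> adj (Y j)) x) sums x" using Y(3) by (simp add: sot_sums_iff)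
    from bounded_linear.sums[OF bounded_linear_Re bounded_linear.sums[OF cinner.bounded_linear_left this, of x]]
    show ?thesis unfolding nX by simp
  qed
  have bd: "(\<Sum>i<n. (norm (X i x))\<^sup>2) \<le> 1\<^sup>2 * (norm x)\<^sup>2" for n x
    using sum_le_suminf[of "\<lambda>i. (norm (X i x))\<^sup>2" "{..<n}"] sX[of x] by (auto simp: sums_iff)
  obtain V where V: "complex_linear V" "\<And>x. (\<lambda>n. X n x) sums V x"
    "\<And>x. (\<lambda>n. (norm (X n x))\<^sup>2) sums (norm (V x))\<^sup>2"
    using strong_sum_exists[of X, OF M_cl[OF XM] o bd] by auto
  have VM: "V \<in> M" by (rule M_sums[OF V(2) XM])
  have VV: "adj V \<cdot> V = id_blinfun"
  proof (rule selfadj_eqI)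
    show "qf (adj V \<cdot> V) x = qf id_blinfun x" for x
      unfolding qf_gram[OF V(1)] using sums_unique2[OF V(3) sX] by simp
  qed (simp_all add: positive_selfadj positive_gram V(1))
  have SV: "adj (S j) \<cdot> V = adj (Y j)" for j
  proof (rule sums_op_unique[OF sums_compose_left[OF V(2)]])
    fix x
    have "(adj (S j) \<cdot> X m) x = (if m = j then (adj (Y j)) x else 0)" for m
    proof -
      have "adj (S j) \<cdot> X m = (adj (S j) \<cdot> S m) \<cdot> adj (Y m)" by (simp add: X_def compose_assoc)
      thus ?thesis using S(2)[of j] S(3)[of j m] by (cases "m = j") (simp_all add: compose_simps)
    qed
    thus "(\<lambda>m. (adj (S j) \<cdot> X m) x) sums (adj (Y j)) x"
      using sums_single[of j "\<lambda>_. (adj (Y j)) x"] by (simp cong: if_cong)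
  qed
  have VS: "adj V \<cdot> S j = Y j" for j
    using compose_flip[OF SV[of j]] by (simp add: M_cl VM S(1) Y(1) adj_adj cl_adj)
  define E where "E j = S j \<cdot> adj (S j)" for j
  have Sp: "projection_op (adj (S j) \<cdot> S j)" for j by (simp add: S(2))
  have E: "E j \<in> projections M" for j unfolding E_def by (rule pi_final[OF S(1) refl Sp])
  have Eo: "E i \<cdot> E j = 0" if "i \<noteq> j" for i j
    using orth_seqD(2)[OF orth_ranges[OF S(1) Sp S(3)] that] by (simp add: E_def)
  have Es: "sot_sums E id_blinfun" using S(4) by (simp add: E_def[abs_def])
  have EB: "E j \<cdot> V \<cdot> A \<cdot> adj V \<cdot> E j = S j \<cdot> B j \<cdot> adj (S j)" for j
  proof -
    have "E j \<cdot> V \<cdot> A \<cdot> adj V \<cdot> E j = S j \<cdot> (adj (S j) \<cdot> V) \<cdot> A \<cdot> (adj V \<cdot> S j) \<cdot> adj (S j)"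
      by (simp add: E_def compose_assoc)
    also have "\<dots> = S j \<cdot> (adj (Y j) \<cdot> A \<cdot> Y j) \<cdot> adj (S j)" unfolding SV VS by (simp add: compose_assoc)
    finally show ?thesis by (simp add: Y(2))
  qed
  \<comment> \<open>With \<open>b\<close> the root of \<open>B j\<close>, the element
    \<open>T \<cdot> S j \<cdot> b\<close> implements the equivalence. \<open>T\<close> is the
    identity when \<open>V\<close> is kept and \<open>adj U\<close> when the ranges are
    conjugated.\<close>
  have equiv: "equivalent_in M (T \<cdot> S j \<cdot> B j \<cdot> adj (S j) \<cdot> adj T) (B j)" if T: "T \<in> M" "adj T \<cdot> T = id_blinfun" for T j
  proof -
    obtain b where b: "b \<in> M" "positive_op b" "b \<cdot> b = B j" using M_sqrt[OF B] by blast
    have sb: "adj b = b" by (rule selfadj_adj[OF positive_selfadj[OF b(2)]])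
    let ?X = "T \<cdot> S j \<cdot> b"
    have aX: "adj ?X = b \<cdot> adj (S j) \<cdot> adj T"
      by (simp add: adj_compose cl_compose M_cl T S(1) b(1) sb compose_assoc)
    have "?X \<cdot> adj ?X = T \<cdot> S j \<cdot> (b \<cdot> b) \<cdot> adj (S j) \<cdot> adj T" unfolding aX by (simp add: compose_assoc)
    moreover have "adj ?X \<cdot> ?X = b \<cdot> (adj (S j) \<cdot> ((adj T \<cdot> T) \<cdot> S j)) \<cdot> b" unfolding aX by (simp add: compose_assoc)
    moreover have "?X \<in> M" by (simp add: M_compose T S b)
    ultimately show ?thesis unfolding equivalent_in_def
      by (intro bexI[of _ ?X]) (simp_all add: T(2) S(2) b(3) compose_simps)
  qed
  have rle: "op_le (range_proj A) id_blinfun"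
  proof -
    have p: "projection_op (null_proj A)" by (rule null_proj(1)[OF selfadj_cl[OF A(2)]])
    hence r: "projection_op (range_proj A)" unfolding range_proj_selfadj[OF A(2)] by (rule proj_complement)
    show ?thesis using proj_le_iff[OF r proj_id] by (simp add: compose_simps)
  qed
  show ?thesis
  proof (cases "equivalent_in M (null_proj A) id_blinfun")
    case False
    show ?thesis
    proof (intro exI[of _ E] exI[of _ V] conjI allI impI)
      show "equivalent_in M (E j) id_blinfun" for j
        unfolding equivalent_in_def E_def by (rule bexI[of _ "S j"]) (simp_all add: S)
      show "equivalent_in M (E j \<cdot> V \<cdot> A \<cdot> adj V \<cdot> E j) (B j)" for j
        unfolding EB using equiv[OF M_id, of j] by (simp add: compose_simps)
    qed (use E Eo Es VM False rle in \<open>auto simp: VV partial_isometry_def V(1)\<close>)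
  next
    case True
    from unitary_extension[OF A VM VV True] obtain U where U: "U \<in> M" "adj U \<cdot> U = id_blinfun" "U \<cdot> adj U = id_blinfun"
      "U \<cdot> A \<cdot> adj U = V \<cdot> A \<cdot> adj V" by blast
    have U': "adj U \<in> M" "adj (adj U) = U" by (simp_all add: M_adj U(1) adj_adj M_cl)
    define F where "F j = adj U \<cdot> E j \<cdot> U" for j
    have aUS: "adj (adj U \<cdot> S j) = adj (S j) \<cdot> U" for j by (simp add: adj_compose M_cl U' U(1) S(1) cl_adj)
    have F1: "F j = (adj U \<cdot> S j) \<cdot> adj (adj U \<cdot> S j)" for j unfolding aUS by (simp add: F_def E_def compose_assoc)
    have F2: "adj (adj U \<cdot> S j) \<cdot> (adj U \<cdot> S j) = id_blinfun" for j
    proof -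
      have "adj (adj U \<cdot> S j) \<cdot> (adj U \<cdot> S j) = adj (S j) \<cdot> ((U \<cdot> adj U) \<cdot> S j)" unfolding aUS by (simp add: compose_assoc)
      thus ?thesis by (simp add: U(3) S(2) compose_simps)
    qed
    have USM: "adj U \<cdot> S j \<in> M" for j by (simp add: M_compose U' S)
    have FA: "F j \<cdot> id_blinfun \<cdot> A \<cdot> adj id_blinfun \<cdot> F j = adj U \<cdot> S j \<cdot> B j \<cdot> adj (S j) \<cdot> adj (adj U)" for j
    proof -
      have "F j \<cdot> id_blinfun \<cdot> A \<cdot> adj id_blinfun \<cdot> F j = adj U \<cdot> (E j \<cdot> (U \<cdot> A \<cdot> adj U) \<cdot> E j) \<cdot> U"
        by (simp add: F_def compose_simps compose_assoc)
      also have "E j \<cdot> (U \<cdot> A \<cdot> adj U) \<cdot> E j = S j \<cdot> B j \<cdot> adj (S j)"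
        unfolding U(4) EB[symmetric] by (simp add: compose_assoc)
      finally show ?thesis by (simp add: U'(2) compose_assoc)
    qed
    show ?thesis
    proof (intro exI[of _ F] exI[of _ id_blinfun] conjI allI impI)
      show "F j \<in> projections M" for j
        unfolding F1 by (rule pi_final[OF USM F2]) simp
      show "F i \<cdot> F j = 0" if "i \<noteq> j" for i j
      proof -
        have "F i \<cdot> F j = adj U \<cdot> (E i \<cdot> ((U \<cdot> adj U) \<cdot> E j)) \<cdot> U" by (simp add: F_def compose_assoc)
        thus ?thesis by (simp add: U(3) compose_simps Eo[OF that])
      qed
      show "sot_sums F id_blinfun"
        unfolding sot_sums_iff
      proof
        fix x
        have "(\<lambda>j. (adj U \<cdot> E j \<cdot> U) x) sums (adj U \<cdot> id_blinfun \<cdot> U) x"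
          using Es unfolding sot_sums_iff by (intro sums_compose_right sums_compose_left) auto
        thus "(\<lambda>j. F j x) sums id_blinfun x"
          by (simp add: F_def compose_simps U(2) flip: blinfun_apply_blinfun_compose)
      qed
      show "equivalent_in M (F j) id_blinfun" for j
        unfolding equivalent_in_def using F1 F2 USM by (intro bexI[of _ "adj U \<cdot> S j"]) simp_all
      show "equivalent_in M (F j \<cdot> id_blinfun \<cdot> A \<cdot> adj id_blinfun \<cdot> F j) (B j)" for j
        unfolding FA by (rule equiv) (simp_all add: U' U(3))
    qed (use rle in \<open>auto simp: M_id partial_isometry_def compose_simps\<close>)
  qed
qed

end

subsection \<open>Decompositions from blocks\<close>

lemma psum_qf_sums:
  assumes e: "orth_seq e" and A: "selfadj A" and c: "\<And>k. e k \<cdot> A = A \<cdot> e k"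
  shows "(\<lambda>k. qf A (e k x)) sums qf A (psum e x)"
proof -
  let ?y = "psum e x"
  have ey: "e k ?y = e k x" for k
    using proj_flip[OF orth_seqD(1)[OF e] psum_proj[OF e] psum_absorb[OF e], of k] by (metis blinfun_apply_blinfun_compose)
  have "cinner (A ?y) (e k x) = cinner (A (e k x)) (e k x)" for k
  proof -
    have p: "projection_op (e k)" by (rule orth_seqD(1)[OF e])
    have "cinner (A ?y) (e k x) = cinner (A ?y) (e k (e k x))"
      by (simp add: proj_idem_apply[OF p])
    also have "\<dots> = cinner (e k (A ?y)) (e k x)"
      by (simp add: selfadj_swap[OF proj_selfadj[OF p]])
    also have "e k (A ?y) = A (e k ?y)"
      by (metis c blinfun_apply_blinfun_compose)
    finally show ?thesis by (simp only: ey)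
  qed
  moreover have "(\<lambda>k. Re (cinner (A ?y) (e k x))) sums qf A ?y"
    by (intro bounded_linear.sums[OF bounded_linear_Re] bounded_linear.sums[OF cinner.bounded_linear_right] psum_sums[OF e])
  ultimately show ?thesis by simp
qed

lemma bsum_ge:
  assumes e: "orth_seq e" and A: "selfadj A" and c: "\<And>k. k \<in> I \<Longrightarrow> e k \<cdot> A = A \<cdot> e k"
    and ge: "\<And>k x. k \<in> I \<Longrightarrow> t * (norm (e k x))\<^sup>2 \<le> qf A (e k x)"
  shows "t * (norm (bsum e I x))\<^sup>2 \<le> qf A (bsum e I x)"
proof -
  let ?e = "\<lambda>k. if k \<in> I then e k else 0"
  note o = bsum_seq[OF e, of I]
  have "(\<lambda>k. t * (norm ((?e k) x))\<^sup>2) sums (t * (norm (bsum e I x))\<^sup>2)"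
    unfolding bsum_def by (intro sums_mult psum_norm_sums o)
  moreover have "(\<lambda>k. qf A ((?e k) x)) sums qf A (bsum e I x)"
    unfolding bsum_def by (rule psum_qf_sums[OF o A]) (simp add: c)
  ultimately show ?thesis by (rule sums_le[rotated]) (simp add: ge)
qed

text \<open>The weighted inequality \<open>(s a + b)^2 <= (s^2 + 1/c) (a^2 + c b^2)\<close> shows
  where the room is spent: if \<open>B\<close> is at most \<gamma> and \<open>A\<close> at least
  \<open>c\<close> on matching parts, \<open>s^2\<close> may be as large as
  \<open>1/\<gamma> - 1/c\<close>. Since \<open>H\<close> is the identity off \<open>P\<close>,
  everything orthogonal to \<open>S\<close> only sees \<open>z\<close>.\<close>

lemma interface_bound:
  fixes z :: "'h::chilbert_space"
  assumes S: "projection_op S" and P: "projection_op P" and SP: "S \<cdot> P = P"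
    and H: "H \<cdot> P = P \<cdot> H" "H \<cdot> (id_blinfun - P) = id_blinfun - P" "\<And>x. norm (H x) \<le> norm x"
    and y: "P y = y" and c: "0 < c" and s: "0 \<le> s" and g: "0 \<le> \<gamma>" "\<gamma> * (s\<^sup>2 + 1 / c) \<le> 1"
  defines "u \<equiv> s *\<^sub>R y + H z"
  shows "\<gamma> * (norm (S u))\<^sup>2 \<le> (norm y)\<^sup>2 + c * (norm (S z))\<^sup>2"
    and "T \<cdot> S = 0 \<Longrightarrow> T u = T z"
proof -
  have H2: "H = H \<cdot> P + (id_blinfun - P)" using H(2) by (simp add: compose_simps algebra_simps)
  have PS: "P \<cdot> S = P" by (rule proj_flip[OF P S SP])
  have SHP: "S \<cdot> (H \<cdot> P) = H \<cdot> P" unfolding H(1) using compose_assoc[of S P H] by (simp add: SP)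
  have "S \<cdot> H = S \<cdot> (H \<cdot> P) + (S - P)" by (subst H2) (simp add: compose_simps SP)
  moreover have "H \<cdot> S = H \<cdot> (P \<cdot> S) + (S - P)" by (subst H2) (simp add: compose_simps compose_assoc PS)
  ultimately have SH: "S \<cdot> H = H \<cdot> S" by (simp add: SHP PS)
  have Sy: "S y = y" using eq_applyD[OF SP, of y] by (simp add: y)
  have Su: "S u = s *\<^sub>R y + H (S z)"
    using eq_applyD[OF SH, of z] by (simp add: u_def blinfun.bilinear_simps Sy)
  let ?a = "norm y" and ?b = "norm (S z)"
  have "norm (S u) \<le> s * ?a + ?b"
    unfolding Su using norm_triangle_ineq[of "s *\<^sub>R y" "H (S z)"] H(3)[of "S z"] s by simp
  hence "(norm (S u))\<^sup>2 \<le> (s * ?a + ?b)\<^sup>2" by (intro power_mono) auto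
  also have "\<dots> \<le> (s\<^sup>2 + 1 / c) * (?a\<^sup>2 + c * ?b\<^sup>2)"
  proof -
    have "(s\<^sup>2 + 1 / c) * (?a\<^sup>2 + c * ?b\<^sup>2) - (s * ?a + ?b)\<^sup>2 = (?a - s * c * ?b)\<^sup>2 / c"
      using c by (simp add: field_simps power2_eq_square)
    moreover have "0 \<le> (?a - s * c * ?b)\<^sup>2 / c" using c by simp
    ultimately show ?thesis by linarith
  qed
  finally have "\<gamma> * (norm (S u))\<^sup>2 \<le> \<gamma> * ((s\<^sup>2 + 1 / c) * (?a\<^sup>2 + c * ?b\<^sup>2))"
    by (intro mult_left_mono g)
  also have "\<dots> \<le> 1 * (?a\<^sup>2 + c * ?b\<^sup>2)"
    unfolding mult.assoc[symmetric] using c g by (intro mult_right_mono) auto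
  finally show "\<gamma> * (norm (S u))\<^sup>2 \<le> (norm y)\<^sup>2 + c * (norm (S z))\<^sup>2" by simp
  assume T: "T \<cdot> S = 0"
  have TP: "T \<cdot> P = 0" by (rule zero_absorb_left[OF T SP])
  have Ty: "T y = 0" using eq_applyD[OF TP, of y] by (simp add: y)
  have "T \<cdot> H = T"
  proof -
    have "T \<cdot> H = (T \<cdot> P) \<cdot> H + (T - T \<cdot> P)" by (subst H2, subst H(1)) (simp add: compose_simps compose_assoc)
    thus ?thesis by (simp add: TP)
  qed
  from eq_applyD[OF this, of z] show "T u = T z"
    by (simp add: u_def blinfun.bilinear_simps Ty)
qed

context sfactor
begin

lemma sub_zero: "sub 0 e"
  unfolding sub_def by (intro bexI[of _ 0]) (simp_all add: M_0)

text \<open>Moves \<open>P0\<close> into the spectral subspace. \<open>B\<close> is reduced by that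
  subspace, is at least \<beta> on it and nonnegative on the rest, which gives the lower bound for
  all \<open>x\<close> and not just on the range of \<open>P\<close>.\<close>

lemma spectral_subprojection:
  assumes B: "B \<in> M" "positive_op B" and T: "T \<in> sets borel" "T \<subseteq> {\<beta>..}" and P0: "projection_op P0"
    and s: "sub P0 (spectral_proj B T)"
  shows "\<exists>P. P \<in> projections M \<and> sub P0 P \<and> sub P P0 \<and> spectral_proj B T \<cdot> P = P \<and>
    (0 \<le> \<beta> \<longrightarrow> (\<forall>x. \<beta> * (norm (P x))\<^sup>2 \<le> qf B x))"
proof -
  interpret spec B "spectral_proj B" by (rule spectral_proj_spec(1)[OF positive_selfadj[OF B(2)]])
  let ?E = "spectral_proj B T"
  obtain v where v: "v \<in> M" "adj v \<cdot> v = P0" "?E \<cdot> v = v" using s by (auto simp: sub_def)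
  define P where "P = v \<cdot> adj v"
  have PP: "P \<in> projections M" unfolding P_def by (rule pi_final[OF v(1,2) P0])
  have EP: "?E \<cdot> P = P" unfolding P_def compose_assoc[symmetric] v(3) ..
  have Pp: "projection_op P" using PP by (simp add: projM)
  have "\<beta> * (norm (P x))\<^sup>2 \<le> qf B x" if "0 \<le> \<beta>" for x
  proof -
    let ?u = "?E x" and ?w = "x - ?E x"
    have "cinner (B ?u) ?w = 0"
    proof -
      have "B ?u = ?E (B x)" using eq_applyD[OF E_commute, of T x] by simp
      thus ?thesis
        by (simp add: selfadj_swap[OF proj_selfadj[OF E_proj]] blinfun.bilinear_simps proj_idem_apply[OF E_proj])
    qed
    from qf_add_orth[OF B this] have "qf B x = qf B ?u + qf B ?w" by simp
    moreover have "0 \<le> qf B ?w" by (rule positive_qf[OF assms(2)])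
    moreover have "\<beta> * (norm ?u)\<^sup>2 \<le> qf B ?u" by (rule E_ge[OF T])
    moreover have "norm (P x) \<le> norm ?u"
      using eq_applyD[OF proj_flip[OF Pp E_proj EP], of x] norm_proj_le[OF Pp, of ?u] by simp
    hence "\<beta> * (norm (P x))\<^sup>2 \<le> \<beta> * (norm ?u)\<^sup>2" using that by (intro mult_left_mono power_mono) auto
    ultimately show ?thesis by linarith
  qed
  thus ?thesis using PP EP sub_final[OF v(1,2) P0] sub_final'[OF v(1,2) P0] unfolding P_def[symmetric] by blast
qed

text \<open>The divergent sum of the \<epsilon> has to pay twice, so it is split into divergent
  fibres. Fibre \<open>0\<close> provides the rooms, distributed injectively by \<open>g\<close>
  over the indices where \<open>B j\<close> has a copy of \<open>P0\<close> above \<beta>; fibre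
  \<open>Suc j\<close> provides an infinite reservoir of blocks for the rest of
  \<open>B j\<close>.\<close>

theorem decomposition_i:
  assumes A: "A \<in> M" "positive_op A" and B: "\<And>j. B j \<in> M" "\<And>j. positive_op (B j)" "\<And>j. norm (B j) \<le> \<alpha>"
    and P0: "P0 \<in> projections M" "P0 \<noteq> 0" and \<alpha>: "0 < \<alpha>" and \<beta>: "0 < \<beta>"
    and J: "infinite {j. sub P0 (spectral_proj (B j) {\<beta><..})}"
    and b: "orth_seq b" "\<And>k. b k \<in> M" "\<And>k. b k \<cdot> A = A \<cdot> b k"
    and \<epsilon>: "\<And>k. 0 \<le> \<epsilon> k" "\<And>k. \<epsilon> k \<le> C" "\<not> summable \<epsilon>" "\<And>k. 0 < \<epsilon> k \<Longrightarrow> sub P0 (b k)"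
      "\<And>k x. 0 < \<epsilon> k \<Longrightarrow> (\<alpha> + \<epsilon> k) * (norm (b k x))\<^sup>2 \<le> qf A (b k x)"
  shows "\<exists>Y. (\<forall>j. Y j \<in> M \<and> adj (Y j) \<cdot> A \<cdot> Y j = B j) \<and> sot_sums (\<lambda>j. Y j \<cdot> adj (Y j)) id_blinfun"
proof -
  have P0p: "projection_op P0" using P0 by (simp add: projM)
  have sA: "selfadj A" by (rule positive_selfadj[OF A(2)])
  have C: "0 \<le> C" using \<epsilon>(1)[of 0] \<epsilon>(2)[of 0] by simp
  obtain f :: "nat \<Rightarrow> nat" where f: "\<And>i. \<not> summable (\<lambda>n. if f n = i then \<epsilon> n else 0)"
    using divergent_fibres[of \<epsilon>, OF \<epsilon>(1,3)] by blast
  define g where "g = enumerate {j. sub P0 (spectral_proj (B j) {\<beta><..})}"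
  have gJ: "sub P0 (spectral_proj (B (g k)) {\<beta><..})" for k using enumerate_in_set[OF J, of k] by (simp add: g_def)
  have g: "inj g" unfolding g_def using strict_mono_enumerate[OF J] by (rule strict_mono_imp_inj_on)
  \<comment> \<open>The block (at most one) in \<open>I0 j\<close> gives \<open>P\<close> the room \<open>\<epsilon>\<close>; those in \<open>I1 j\<close> carry the rest of \<open>B j\<close>.\<close>
  define I0 where "I0 j = {k. g k = j \<and> f k = 0 \<and> 0 < \<epsilon> k}" for j
  define I1 where "I1 j = {k. f k = Suc j \<and> 0 < \<epsilon> k}" for j
  define e where "e j = (if I0 j = {} then 0 else \<epsilon> (inv g j))" for j
  have I0: "k = inv g j \<and> e j = \<epsilon> k \<and> 0 < \<epsilon> k" if "k \<in> I0 j" for k j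
    using that g by (auto simp: I0_def e_def inv_f_f)
  have e: "0 \<le> e j" "e j \<le> C" for j using \<epsilon>(1,2) C by (auto simp: e_def)
  have epos: "\<exists>k. k \<in> I0 j \<and> j = g k" if "0 < e j" for j using that by (auto simp: e_def I0_def split: if_splits)
  have eg: "e (g k) = (if f k = 0 then \<epsilon> k else 0)" for k
  proof (cases "f k = 0 \<and> 0 < \<epsilon> k")
    case True
    hence "k \<in> I0 (g k)" by (simp add: I0_def)
    thus ?thesis using I0 True by auto
  next
    case False
    hence "I0 (g k) = {}" using g by (auto simp: I0_def inj_eq)
    thus ?thesis using False \<epsilon>(1)[of k] by (auto simp: e_def)
  qed
  define q where "q j i = bsum b (if i = 0 then I0 j else if i = 1 then I1 j else {})" for j and i :: nat
  define G where "G j = bsum b (I0 j \<union> I1 j)" for j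
  have disj: "(I0 i \<union> I1 i) \<inter> (I0 j \<union> I1 j) = {}" if "i \<noteq> j" for i j using that by (auto simp: I0_def I1_def)
  have Go: "orth_seq G" unfolding orth_seq_def G_def using bsum_proj[OF b(1)] bsum_orth[OF b(1) disj] by blast
  have qP: "q j i \<in> projections M" for i j unfolding q_def by (rule bsum_M[OF b(1,2)])
  have GM: "G j \<in> M" for j using bsum_M[OF b(1,2)] by (simp add: G_def projM)
  have GA: "G j \<cdot> A = A \<cdot> G j" and qA: "q j i \<cdot> A = A \<cdot> q j i" for j i
    unfolding G_def q_def using bsum_commute[OF b(1), of _ A] b(3) by auto
  have Gq: "G j \<cdot> q j i = q j i" for i j unfolding G_def q_def by (rule bsum_mono[OF b(1)]) auto
  have qo: "q j i \<cdot> q j i' = 0" if "i \<noteq> i'" for j i i'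
    unfolding q_def by (rule bsum_orth[OF b(1)]) (use that in \<open>auto simp: I0_def I1_def\<close>)
  have q0: "sub P0 (q j 0)" if ej: "0 < e j" for j
  proof -
    obtain k where k: "k \<in> I0 j" using epos[OF ej] by blast
    have "sub P0 (b k)" using \<epsilon>(4) k by (simp add: I0_def)
    thus ?thesis unfolding q_def by (rule sub_mono) (simp add: bsum_absorb[OF b(1)] k)
  qed
  have q1: "big (q j 1)" for j
  proof -
    \<comment> \<open>A fibre with divergent sum has infinitely many positive terms, and each of
      them is a block containing a copy of \<open>P0\<close>.\<close>
    have "infinite {k \<in> I1 j. sub P0 (b k)}"
    proof
      assume fin: "finite {k \<in> I1 j. sub P0 (b k)}"
      have "summable (\<lambda>n. if f n = Suc j then \<epsilon> n else 0)"
      proof (rule summable_finite[OF fin])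
        fix n assume "n \<notin> {k \<in> I1 j. sub P0 (b k)}"
        thus "(if f n = Suc j then \<epsilon> n else 0) = 0" using \<epsilon>(4)[of n] \<epsilon>(1)[of n] by (auto simp: I1_def less_le)
      qed
      thus False using f by blast
    qed
    from big_bsum[OF P0 b(1,2) this] show ?thesis by (simp add: q_def)
  qed
  define c where "c j i = (if i = 0 then \<alpha> + e j else \<alpha>)" for j and i :: nat
  have c\<alpha>: "\<alpha> \<le> c j i" for j i using e by (simp add: c_def)
  have qge: "c j i * (norm (q j i x))\<^sup>2 \<le> qf A (q j i x)" for j i x
    unfolding q_def
  proof (rule bsum_ge[OF b(1) sA b(3)])
    fix k x assume k: "k \<in> (if i = 0 then I0 j else if i = 1 then I1 j else {})"
    hence ek: "0 < \<epsilon> k" by (auto simp: I0_def I1_def split: if_splits)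
    have "c j i \<le> \<alpha> + \<epsilon> k" using k I0[of k j] ek by (auto simp: c_def split: if_splits)
    hence "c j i * (norm (b k x))\<^sup>2 \<le> (\<alpha> + \<epsilon> k) * (norm (b k x))\<^sup>2" by (intro mult_right_mono) auto
    thus "c j i * (norm (b k x))\<^sup>2 \<le> qf A (b k x)" using \<epsilon>(5)[OF ek, of x] by linarith
  qed
  have "\<forall>j. \<exists>P. P \<in> projections M \<and> (0 < e j \<longrightarrow> sub P0 P) \<and> (0 < e j \<longrightarrow> sub P P0) \<and> (e j = 0 \<longrightarrow> P = 0) \<and>
    (\<forall>x. \<beta> * (norm (P x))\<^sup>2 \<le> qf (B j) x)"
  proof
    fix j
    show "\<exists>P. P \<in> projections M \<and> (0 < e j \<longrightarrow> sub P0 P) \<and> (0 < e j \<longrightarrow> sub P P0) \<and> (e j = 0 \<longrightarrow> P = 0) \<and>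
      (\<forall>x. \<beta> * (norm (P x))\<^sup>2 \<le> qf (B j) x)"
    proof (cases "0 < e j")
      case True
      then obtain k where "j = g k" using epos by blast
      hence "sub P0 (spectral_proj (B j) {\<beta><..})" using gJ by simp
      from spectral_subprojection[OF B(1,2) _ _ P0p this, of \<beta>] show ?thesis using True \<beta> by (auto simp: less_imp_le subset_eq)
    next
      case False
      thus ?thesis using positive_qf[OF B(2)] by (intro exI[of _ 0]) (auto simp: projM M_0)
    qed
  qed
  from choice[OF this] obtain P where P': "\<forall>j. P j \<in> projections M \<and> (0 < e j \<longrightarrow> sub P0 (P j)) \<and> (0 < e j \<longrightarrow> sub (P j) P0) \<and> (e j = 0 \<longrightarrow> P j = 0) \<and>
    (\<forall>x. \<beta> * (norm (P j x))\<^sup>2 \<le> qf (B j) x)" by (rule exE)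
  have P: "P j \<in> projections M" "0 < e j \<Longrightarrow> sub P0 (P j)" "0 < e j \<Longrightarrow> sub (P j) P0" "e j = 0 \<Longrightarrow> P j = 0"
    "\<beta> * (norm (P j x))\<^sup>2 \<le> qf (B j) x" for j x using P' by blast+
  have Pp: "projection_op (P j)" and PM: "P j \<in> M" for j using P(1) by (auto simp: projM)
  \<comment> \<open>Only two pieces: \<open>P j\<close>, matched with the single block that has
    room, and its complement, matched with the reservoir. When \<open>e j = 0\<close> the first
    piece is \<open>0\<close>.\<close>
  define S where "S j i = (if i = 0 then P j else if i = 1 then id_blinfun - P j else 0)" for j and i :: nat
  have So: "orth_seq (S j)" for j
    unfolding orth_seq_def S_def by (auto simp: Pp proj_complement compose_simps proj_idem[OF Pp])
  have Ssum: "psum (S j) = id_blinfun" for j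
  proof (rule psum_eqI)
    fix x
    have "(\<lambda>n. S j n x) sums (\<Sum>n<2. S j n x)"
      by (rule sums_finite) (auto simp: S_def)
    thus "(\<lambda>n. S j n x) sums id_blinfun x"
      by (simp add: S_def numeral_2_eq_2 blinfun.bilinear_simps)
  qed
  have Ssub: "sub (S j i) (q j i)" for j i
  proof -
    consider "i = 0" | "i = 1" | "2 \<le> i" by linarith
    thus ?thesis
    proof cases
      case 1
      show ?thesis
      proof (cases "0 < e j")
        case True
        thus ?thesis using sub_trans[OF P(3)[OF True] q0[OF True] P0p] by (simp add: S_def 1)
      next
        case False
        hence "e j = 0" using e(1)[of j] by simp
        thus ?thesis using P(4) by (simp add: S_def 1 sub_zero)
      qed
    next
      case 2
      have "id_blinfun - P j \<in> projections M" by (simp add: projM M_diff M_id PM proj_complement Pp)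
      thus ?thesis using big_sub[OF q1] by (simp add: S_def 2)
    next
      case 3 thus ?thesis by (simp add: S_def sub_zero)
    qed
  qed
  have "\<exists>L\<in>M. adj L \<cdot> A \<cdot> L = id_blinfun \<and> G j \<cdot> L = L \<and>
    (\<forall>i x. c j i * (norm (S j i (adj L x)))\<^sup>2 \<le> (norm (q j i x))\<^sup>2)" for j
    by (rule block_embedding[OF So Ssum qP qo qA Ssub A \<alpha> c\<alpha> qge Gq])
  hence "\<forall>j. \<exists>L. L \<in> M \<and> adj L \<cdot> A \<cdot> L = id_blinfun \<and> G j \<cdot> L = L \<and>
    (\<forall>i x. c j i * (norm (S j i (adj L x)))\<^sup>2 \<le> (norm (q j i x))\<^sup>2)" by blast
  from choice[OF this] obtain L where L': "\<forall>j. L j \<in> M \<and> adj (L j) \<cdot> A \<cdot> L j = id_blinfun \<and> G j \<cdot> L j = L j \<and>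
    (\<forall>i x. c j i * (norm (S j i ((adj (L j)) x)))\<^sup>2 \<le> (norm (q j i x))\<^sup>2)" by (rule exE)
  have L: "L j \<in> M" "adj (L j) \<cdot> A \<cdot> L j = id_blinfun" "G j \<cdot> L j = L j"
    "c j i * (norm (S j i ((adj (L j)) x)))\<^sup>2 \<le> (norm (q j i x))\<^sup>2" for j i x
    using L' by blast+
  \<comment> \<open>The first entry gives
    \<open>\<kappa> * e <= 1/\<alpha> - 1/(\<alpha> + e)\<close> for all \<open>e\<close> between
    \<open>0\<close> and \<open>C\<close>; the second keeps \<open>(s j)\<^sup>2 * norm A\<close> at
    most \<open>1\<close>.\<close>
  define \<kappa> where "\<kappa> = min (1 / (\<alpha> * (\<alpha> + C))) (1 / (C * norm A + 1))"
  have \<alpha>C: "0 < \<alpha> * (\<alpha> + C)" and CA: "0 < C * norm A + 1" using \<alpha> C by (simp_all add: add_pos_nonneg add_nonneg_pos)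
  have \<kappa>: "0 < \<kappa>" using \<alpha>C CA by (simp add: \<kappa>_def)
  define s where "s j = sqrt (\<kappa> * e j)" for j
  have s0: "0 \<le> s j" and s2: "(s j)\<^sup>2 = \<kappa> * e j" for j using \<kappa> e by (simp_all add: s_def)
  have spos: "0 < e j" if "0 < s j" for j using that \<kappa> by (simp add: s_def zero_less_mult_iff)
  have sle: "\<alpha> * ((s j)\<^sup>2 + 1 / c j 0) \<le> 1" for j
  proof -
    have "\<kappa> * e j \<le> 1 / (\<alpha> * (\<alpha> + C)) * e j" unfolding \<kappa>_def by (intro mult_right_mono e) auto
    also have "\<dots> \<le> 1 / (\<alpha> * (\<alpha> + e j)) * e j"
      using \<alpha> e[of j] by (intro mult_right_mono divide_left_mono mult_left_mono mult_pos_pos) auto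
    also have "\<dots> = 1 / \<alpha> - 1 / (\<alpha> + e j)" using \<alpha> e[of j] by (simp add: field_simps)
    finally have "(s j)\<^sup>2 + 1 / c j 0 \<le> 1 / \<alpha>" unfolding s2 by (simp add: c_def)
    thus ?thesis using \<alpha> by (simp add: field_simps)
  qed
  show ?thesis
  proof (rule exhaustion[OF A B(1,2) P0 Go GM GA L(1,3,2) P(1,5) \<beta> s0])
    show "(s j)\<^sup>2 * norm A \<le> 1" for j
    proof -
      have "\<kappa> * e j * norm A \<le> 1 / (C * norm A + 1) * C * norm A"
        unfolding \<kappa>_def using e[of j] CA C by (intro mult_right_mono mult_mono) auto
      also have "\<dots> \<le> 1" using CA by (simp add: field_simps)
      finally show ?thesis by (simp add: s2)
    qed
    show "sub P0 (P j)" if "0 < s j" for j by (rule P(2)[OF spos[OF that]])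
    show "\<not> summable (\<lambda>j. (s j)\<^sup>2)"
    proof
      assume "summable (\<lambda>j. (s j)\<^sup>2)"
      hence "summable (\<lambda>j. (1 / \<kappa>) * (s j)\<^sup>2)" by (rule summable_mult)
      hence "summable e" using \<kappa> by (simp add: s2)
      from summable_reindex[OF this g] e(1) have "summable (e \<circ> g)" by blast
      hence "summable (\<lambda>k. if f k = 0 then \<epsilon> k else 0)" by (simp add: o_def eg)
      thus False using f by blast
    qed
    fix j H x y
    assume H: "H \<cdot> P j = P j \<cdot> H" "H \<cdot> (id_blinfun - P j) = id_blinfun - P j"
      "\<And>x. norm (H x) \<le> norm x" "P j y = y"
    let ?z = "(adj (L j)) x"
    let ?u = "s j *\<^sub>R y + H ?z"
    have c0: "0 < c j 0" using c\<alpha>[of j 0] \<alpha> by simp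
    \<comment> \<open>On \<open>P j\<close> the bound \<open>c j 0\<close>, which is \<alpha> +
      \<open>e j\<close>, absorbs the additional vector \<open>s j *\<^sub>R y\<close>. Off
      \<open>P j\<close> only \<open>?z\<close> is left, and there \<open>A\<close> being at least
      \<alpha> on the reservoir is enough.\<close>
    note ib = interface_bound[OF Pp Pp proj_idem[OF Pp] H c0 s0 less_imp_le[OF \<alpha>] sle, where z = ?z]
    have "(id_blinfun - P j) ?u = (id_blinfun - P j) ?z"
      by (rule ib(2)) (simp add: compose_simps proj_idem[OF Pp])
    hence 2: "?u - P j ?u = ?z - P j ?z"
      by (simp only: blinfun.diff_left id_blinfun.rep_eq)
    have z0: "c j 0 * (norm (P j ?z))\<^sup>2 \<le> (norm (q j 0 x))\<^sup>2"
      using L(4)[of j 0 x] by (simp add: S_def)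
    have z1: "\<alpha> * (norm (?z - P j ?z))\<^sup>2 \<le> (norm (q j 1 x))\<^sup>2"
      using L(4)[of j 1 x] by (simp add: S_def c_def blinfun.bilinear_simps)
    have "qf (B j) ?u \<le> norm (B j) * (norm ?u)\<^sup>2" by (rule qf_le_norm)
    also have "\<dots> \<le> \<alpha> * (norm ?u)\<^sup>2" by (intro mult_right_mono B) simp
    also have "\<dots> = \<alpha> * (norm (P j ?u))\<^sup>2 + \<alpha> * (norm (?z - P j ?z))\<^sup>2"
      unfolding proj_split_norm[OF Pp, of ?u j] 2 by (simp add: distrib_left)
    also have "\<dots> \<le> (norm y)\<^sup>2 + ((norm (q j 0 x))\<^sup>2 + (norm (q j 1 x))\<^sup>2)"
      using ib(1) z0 z1 by linarith
    also have "(norm (q j 0 x))\<^sup>2 + (norm (q j 1 x))\<^sup>2 \<le> (norm x)\<^sup>2"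
    proof -
      have p: "projection_op (q j 0)" "projection_op (q j 1)" using qP by (auto simp: projM)
      have pp: "projection_op (q j 0 + q j 1)" by (rule proj_add[OF p qo]) simp
      have "(norm (q j 0 x))\<^sup>2 + (norm (q j 1 x))\<^sup>2 = (norm ((q j 0 + q j 1) x))\<^sup>2"
        by (simp only: qf_proj[OF p(1), symmetric] qf_proj[OF p(2), symmetric] qf_proj[OF pp, symmetric] qf_add)
      also have "\<dots> \<le> (norm x)\<^sup>2" by (intro power_mono norm_proj_le[OF pp]) simp
      finally show ?thesis .
    qed
    finally show "qf (B j) ?u \<le> (norm y)\<^sup>2 + (norm x)\<^sup>2" by simp
  qed
qed

text \<open>\<open>A\<close> need not exceed \<alpha> anywhere, so the bound of \<open>B j\<close>
  by \<alpha> is too coarse. As \<alpha> is no eigenvalue of \<open>B j\<close>, its spectral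
  subspaces below the \<open>c i\<close> exhaust the space, and each slice can be matched with
  blocks where \<open>A\<close> dominates. The room between \<gamma> and \<open>c 0\<close> does not
  depend on \<open>j\<close>, so the divergence needs only infinitely many good indices.\<close>

theorem decomposition_ii:
  assumes A: "A \<in> M" "positive_op A" and B: "\<And>j. B j \<in> M" "\<And>j. positive_op (B j)" "\<And>j. norm (B j) \<le> \<alpha>"
    and B\<alpha>: "\<And>j. spectral_proj (B j) {\<alpha>} = 0"
    and P0: "P0 \<in> projections M" "P0 \<noteq> 0" and \<beta>: "0 < \<beta>" "\<beta> < \<gamma>" "\<gamma> < c 0"
    and c: "incseq c" "c \<longlonglongrightarrow> \<alpha>" "\<And>i. c i < \<alpha>"
    and J: "infinite {j. sub P0 (spectral_proj (B j) {\<beta><..\<gamma>})}"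
    and b: "orth_seq b" "\<And>k. b k \<in> M" "\<And>k. b k \<cdot> A = A \<cdot> b k" "\<And>k. sub P0 (b k)"
      "\<And>k x. c k * (norm (b k x))\<^sup>2 \<le> qf A (b k x)"
  shows "\<exists>Y. (\<forall>j. Y j \<in> M \<and> adj (Y j) \<cdot> A \<cdot> Y j = B j) \<and> sot_sums (\<lambda>j. Y j \<cdot> adj (Y j)) id_blinfun"
proof -
  have P0p: "projection_op P0" using P0 by (simp add: projM)
  have sA: "selfadj A" by (rule positive_selfadj[OF A(2)])
  have cmono: "c i \<le> c k" if "i \<le> k" for i k using c(1) that by (simp add: incseq_def)
  have c0: "0 < c 0" using \<beta> by linarith
  have cpos: "0 < c i" for i using c0 cmono[of 0 i] by simp
  \<comment> \<open>Infinite index sets, disjoint for different pairs \<open>(j, i)\<close>. Encoded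
    in this way every member \<open>k\<close> is at least \<open>i\<close>, so the lower bound
    \<open>c k\<close> of its block is at least \<open>c i\<close>.\<close>
  define I where "I j i = range (\<lambda>l. prod_encode (j, prod_encode (i, l)))" for j i :: nat
  have Idisj: "I j i \<inter> I j' i' = {}" if "j \<noteq> j' \<or> i \<noteq> i'" for j i j' i'
    using that by (auto simp: I_def)
  have Ile: "i \<le> k" if "k \<in> I j i" for k j i
    using that le_prod_encode_1[of i] le_prod_encode_2[of _ j] unfolding I_def by (auto intro: order_trans)
  define q where "q j i = bsum b (I j i)" for j i
  define G where "G j = bsum b (\<Union>i. I j i)" for j
  have Go: "orth_seq G"
    unfolding orth_seq_def G_def
  proof (intro conjI allI impI)
    show "bsum b (\<Union>i. I m i) \<cdot> bsum b (\<Union>i. I n i) = 0" if "m \<noteq> n" for m n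
      by (rule bsum_orth[OF b(1)]) (use that Idisj in blast)
  qed (rule bsum_proj[OF b(1)])
  have qP: "q j i \<in> projections M" for i j unfolding q_def by (rule bsum_M[OF b(1,2)])
  have GM: "G j \<in> M" for j using bsum_M[OF b(1,2)] by (simp add: G_def projM)
  have GA: "G j \<cdot> A = A \<cdot> G j" and qA: "q j i \<cdot> A = A \<cdot> q j i" for j i
    unfolding G_def q_def using bsum_commute[OF b(1), of _ A] b(3) by auto
  have Gq: "G j \<cdot> q j i = q j i" for i j unfolding G_def q_def by (rule bsum_mono[OF b(1)]) auto
  have qo: "q j i \<cdot> q j i' = 0" if "i \<noteq> i'" for j i i'
    unfolding q_def by (rule bsum_orth[OF b(1)]) (use that Idisj in blast)
  have qseq: "orth_seq (q j)" for j unfolding orth_seq_def using qP qo by (auto simp: projM)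
  have qbig: "big (q j i)" for j i
  proof -
    have "infinite (I j i)" unfolding I_def by (rule range_inj_infinite) (auto simp: inj_on_def)
    hence "infinite {k \<in> I j i. sub P0 (b k)}" by (simp add: b(4))
    from big_bsum[OF P0 b(1,2) this] show ?thesis by (simp add: q_def)
  qed
  have qge: "c i * (norm (q j i x))\<^sup>2 \<le> qf A (q j i x)" for j i x
    unfolding q_def
  proof (rule bsum_ge[OF b(1) sA b(3)])
    fix k x assume "k \<in> I j i"
    hence "c i * (norm (b k x))\<^sup>2 \<le> c k * (norm (b k x))\<^sup>2"
      by (intro mult_right_mono cmono Ile) auto
    thus "c i * (norm (b k x))\<^sup>2 \<le> qf A (b k x)" using b(5)[of k x] by linarith
  qed
  \<comment> \<open>\<open>B j \<le> c i\<close> on the slice \<open>T i\<close> of its spectrum, which is matched with blocks where \<open>A \<ge> c i\<close>;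
    the room is \<open>c 0 - \<gamma>\<close> on the slice \<open>T 0\<close>.\<close>
  define T where "T i = (case i of 0 \<Rightarrow> {\<beta><..\<gamma>} | Suc 0 \<Rightarrow> {..c 1} - {\<beta><..\<gamma>} | Suc (Suc k) \<Rightarrow> {c (Suc k)<..c (Suc (Suc k))})" for i
  have Tb: "T i \<in> sets borel" for i by (auto simp: T_def split: nat.splits)
  have Tle: "T i \<subseteq> {..c i}" for i using \<beta> by (auto simp: T_def split: nat.splits)
  have \<gamma>1: "\<gamma> \<le> c i" for i using \<beta>(3) cmono[of 0 i] by simp
  have Tlow: "T i \<subseteq> {c (i - 1)<..}" if "2 \<le> i" for i
    using that by (auto simp: T_def split: nat.splits)
  have Tdisj: "T i \<inter> T k = {}" if "i < k" for i k
  proof (cases "2 \<le> k")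
    case True
    have "T i \<subseteq> {..c (k - 1)}" using Tle[of i] cmono[of i "k - 1"] that by force
    thus ?thesis using Tlow[OF True] by force
  next
    case False
    hence "i = 0" "k = 1" using that by auto
    thus ?thesis by (auto simp: T_def)
  qed
  have Tfam: "disjoint_family T"
    unfolding disjoint_family_on_def using Tdisj by (metis Int_commute nat_neq_iff)
  have TU: "(\<Union>i. T i) = {..<\<alpha>}"
  proof
    show "(\<Union>i. T i) \<subseteq> {..<\<alpha>}" using Tle c(3) by (force intro: le_less_trans)
    show "{..<\<alpha>} \<subseteq> (\<Union>i. T i)"
    proof
      fix t assume "t \<in> {..<\<alpha>}"
      hence "t < \<alpha>" by simp
      from order_tendstoD(1)[OF c(2) this] obtain n0 where n0: "t < c n0" by (auto simp: eventually_sequentially)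
      define n where "n = (LEAST n. t \<le> c n)"
      have n: "t \<le> c n" unfolding n_def by (rule LeastI[of _ n0]) (use n0 in simp)
      have nm: "\<not> t \<le> c m" if "m < n" for m using not_less_Least[of m "\<lambda>n. t \<le> c n"] that by (simp add: n_def)
      show "t \<in> (\<Union>i. T i)"
      proof (cases "2 \<le> n")
        case True
        hence k: "n = Suc (Suc (n - 2))" by simp
        have "\<not> t \<le> c (Suc (n - 2))" using k by (intro nm) linarith
        moreover have "t \<le> c (Suc (Suc (n - 2)))" using n k by metis
        ultimately have "t \<in> T (Suc (Suc (n - 2)))" by (simp add: T_def)
        thus ?thesis by blast
      next
        case False
        hence "t \<le> c 1" using n cmono[of n 1] by simp
        hence "t \<in> T 0 \<union> T 1" by (auto simp: T_def)
        thus ?thesis by blast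
      qed
    qed
  qed
  define S where "S j i = spectral_proj (B j) (T i)" for j i
  have sp: "spec (B j) (spectral_proj (B j))" for j by (rule spectral_proj_spec(1)[OF positive_selfadj[OF B(2)]])
  have SM: "S j i \<in> projections M" for j i
    using spectral_proj_spec(2)[OF positive_selfadj[OF B(2)] vna_axioms B(1)] spec.E_proj[OF sp] by (simp add: S_def projM)
  have SB: "S j i \<cdot> B j = B j \<cdot> S j i" for j i unfolding S_def by (rule spec.E_commute[OF sp])
  have So: "orth_seq (S j)" for j
    unfolding orth_seq_def
  proof (intro conjI allI impI)
    show "projection_op (S j n)" for n using SM by (simp add: projM)
    show "S j m \<cdot> S j n = 0" if "m \<noteq> n" for m n
      unfolding S_def by (rule spec.E_disjoint[OF sp Tb Tb]) (use Tfam that in \<open>auto simp: disjoint_family_on_def\<close>)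
  qed
  \<comment> \<open>The norm bound excludes spectrum above \<alpha>, and \<open>B\<alpha>\<close>
    excludes an atom at \<alpha> itself.\<close>
  have Stop: "spectral_proj (B j) {..<\<alpha>} = id_blinfun" for j
  proof -
    interpret spec "B j" "spectral_proj (B j)" by (rule sp)
    have "spectral_proj (B j) {\<alpha><..} = 0"
    proof (rule blinfun_eqI)
      fix x
      let ?x = "(spectral_proj (B j) {\<alpha><..}) x"
      have "qf (B j) ?x \<le> norm (B j) * (norm ?x)\<^sup>2" by (rule qf_le_norm)
      also have "\<dots> \<le> \<alpha> * (norm ?x)\<^sup>2" by (intro mult_right_mono assms(5)) simp
      finally have "qf (B j) ?x \<le> \<alpha> * (norm ?x)\<^sup>2" .
      moreover have "\<alpha> * (norm ?x)\<^sup>2 \<le> qf (B j) ?x" by (rule E_ge) auto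
      ultimately have "?x = 0" by (intro E_strict[of \<alpha>]) (auto simp: proj_idem_apply[OF E_proj])
      thus "?x = blinfun_apply 0 x" by simp
    qed
    moreover have "spectral_proj (B j) ({\<alpha>} \<union> {\<alpha><..}) = spectral_proj (B j) {\<alpha>} + spectral_proj (B j) {\<alpha><..}"
      by (rule E_additive) auto
    moreover have "- ({\<alpha>} \<union> {\<alpha><..}) = {..<\<alpha>}" by auto
    ultimately show ?thesis using E_compl[of "{\<alpha>} \<union> {\<alpha><..}"] B\<alpha>[of j] by simp
  qed
  have Ssum: "psum (S j) = id_blinfun" for j
  proof (rule psum_eqI)
    fix x
    have "(\<lambda>i. S j i x) sums (spectral_proj (B j) (\<Union>i. T i)) x"
      unfolding S_def by (rule spec.E_sums[OF sp _ Tfam]) (use Tb in auto)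
    thus "(\<lambda>i. S j i x) sums id_blinfun x" by (simp add: TU Stop)
  qed
  have "\<exists>L\<in>M. adj L \<cdot> A \<cdot> L = id_blinfun \<and> G j \<cdot> L = L \<and>
    (\<forall>i x. c i * (norm (S j i (adj L x)))\<^sup>2 \<le> (norm (q j i x))\<^sup>2)" for j
    by (rule block_embedding[OF So Ssum qP qo qA big_sub[OF qbig SM] A c0 cmono[OF le0] qge Gq])
  hence "\<forall>j. \<exists>L. L \<in> M \<and> adj L \<cdot> A \<cdot> L = id_blinfun \<and> G j \<cdot> L = L \<and>
    (\<forall>i x. c i * (norm (S j i (adj L x)))\<^sup>2 \<le> (norm (q j i x))\<^sup>2)" by blast
  from choice[OF this] obtain L where L': "\<forall>j. L j \<in> M \<and> adj (L j) \<cdot> A \<cdot> L j = id_blinfun \<and> G j \<cdot> L j = L j \<and>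
    (\<forall>i x. c i * (norm (S j i ((adj (L j)) x)))\<^sup>2 \<le> (norm (q j i x))\<^sup>2)" by (rule exE)
  have L: "L j \<in> M" "adj (L j) \<cdot> A \<cdot> L j = id_blinfun" "G j \<cdot> L j = L j"
    "c i * (norm (S j i ((adj (L j)) x)))\<^sup>2 \<le> (norm (q j i x))\<^sup>2" for j i x
    using L' by blast+
  let ?J = "{j. sub P0 (spectral_proj (B j) {\<beta><..\<gamma>})}"
  have "\<forall>j. \<exists>P. P \<in> projections M \<and> (j \<in> ?J \<longrightarrow> sub P0 P) \<and> S j 0 \<cdot> P = P \<and> (\<forall>x. \<beta> * (norm (P x))\<^sup>2 \<le> qf (B j) x)"
  proof
    fix j
    show "\<exists>P. P \<in> projections M \<and> (j \<in> ?J \<longrightarrow> sub P0 P) \<and> S j 0 \<cdot> P = P \<and> (\<forall>x. \<beta> * (norm (P x))\<^sup>2 \<le> qf (B j) x)"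
    proof (cases "j \<in> ?J")
      case True
      hence "sub P0 (spectral_proj (B j) {\<beta><..\<gamma>})" by simp
      from spectral_subprojection[OF B(1,2) _ _ P0p this, of \<beta>] show ?thesis using \<beta> by (auto simp: S_def T_def subset_eq)
    next
      case False
      thus ?thesis using positive_qf[OF B(2)] by (intro exI[of _ 0]) (auto simp: projM M_0)
    qed
  qed
  from choice[OF this] obtain P where P': "\<forall>j. P j \<in> projections M \<and> (j \<in> ?J \<longrightarrow> sub P0 (P j)) \<and> S j 0 \<cdot> P j = P j \<and>
    (\<forall>x. \<beta> * (norm (P j x))\<^sup>2 \<le> qf (B j) x)" by (rule exE)
  have P: "P j \<in> projections M" "j \<in> ?J \<Longrightarrow> sub P0 (P j)" "S j 0 \<cdot> P j = P j"
    "\<beta> * (norm (P j x))\<^sup>2 \<le> qf (B j) x" for j x using P' by blast+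
  have Pp: "projection_op (P j)" for j using P(1) by (simp add: projM)
  have \<gamma>0: "0 < \<gamma>" using \<beta> by linarith
  \<comment> \<open>The first entry is the room between \<gamma> and \<open>c 0\<close>; the second
    keeps \<open>(s j)\<^sup>2 * norm A\<close> at most \<open>1\<close>.\<close>
  define \<sigma> where "\<sigma> = min (1 / \<gamma> - 1 / c 0) (1 / (norm A + 1))"
  have \<sigma>: "0 < \<sigma>"
    using \<beta>(3) \<gamma>0 c0 by (auto simp: \<sigma>_def add_nonneg_pos frac_less2)
  define s where "s j = (if j \<in> ?J then sqrt \<sigma> else 0)" for j
  have s0: "0 \<le> s j" and s2: "(s j)\<^sup>2 = (if j \<in> ?J then \<sigma> else 0)" for j using \<sigma> by (simp_all add: s_def)
  have s2le: "(s j)\<^sup>2 \<le> \<sigma>" for j using \<sigma> by (simp add: s2)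
  have sle: "\<gamma> * ((s j)\<^sup>2 + 1 / c 0) \<le> 1" for j
  proof -
    have "(s j)\<^sup>2 + 1 / c 0 \<le> 1 / \<gamma>" using s2le[of j] by (simp add: \<sigma>_def)
    hence "\<gamma> * ((s j)\<^sup>2 + 1 / c 0) \<le> \<gamma> * (1 / \<gamma>)" using \<gamma>0 by (intro mult_left_mono) auto
    thus ?thesis using \<gamma>0 by simp
  qed
  show ?thesis
  proof (rule exhaustion[OF A B(1,2) P0 Go GM GA L(1,3,2) P(1,4) \<beta>(1) s0])
    show "(s j)\<^sup>2 * norm A \<le> 1" for j
    proof -
      have "(s j)\<^sup>2 * norm A \<le> (1 / (norm A + 1)) * norm A"
        using s2le[of j] by (intro mult_right_mono) (auto simp: \<sigma>_def)
      also have "\<dots> \<le> 1" by (simp add: divide_le_eq add_nonneg_pos)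
      finally show ?thesis .
    qed
    show "sub P0 (P j)" if "0 < s j" for j using that P(2)[of j] by (auto simp: s_def split: if_splits)
    show "\<not> summable (\<lambda>j. (s j)\<^sup>2)"
    proof
      assume "summable (\<lambda>j. (s j)\<^sup>2)"
      from order_tendstoD(2)[OF summable_LIMSEQ_zero[OF this] \<sigma>] obtain N where N: "\<And>n. N \<le> n \<Longrightarrow> (s n)\<^sup>2 < \<sigma>"
        by (auto simp: eventually_sequentially)
      obtain j where "N \<le> j" "j \<in> ?J" using J unfolding infinite_nat_iff_unbounded_le by blast
      thus False using N[of j] by (simp add: s2)
    qed
    fix j H x y
    assume H: "H \<cdot> P j = P j \<cdot> H" "H \<cdot> (id_blinfun - P j) = id_blinfun - P j"
      "\<And>x. norm (H x) \<le> norm x" "P j y = y"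
    let ?z = "(adj (L j)) x"
    let ?u = "s j *\<^sub>R y + H ?z"
    have S0: "projection_op (S j 0)" using SM by (simp add: projM)
    note ib = interface_bound[OF S0 Pp P(3) H c0 s0 less_imp_le[OF \<gamma>0] sle, where z = ?z]
    \<comment> \<open>Only slice \<open>0\<close> contains \<open>P j\<close>. There the bound
      \<gamma> of \<open>B j\<close> leaves room for \<open>y\<close>; on the other slices
      \<open>?u\<close> and \<open>?z\<close> agree and the bounds \<open>c i\<close> match without
      any room.\<close>
    have le: "qf (B j) (S j i ?u) \<le> (norm (q j i x))\<^sup>2 + (if i = 0 then (norm y)\<^sup>2 else 0)" for i
    proof (cases "i = 0")
      case True
      have "qf (B j) (S j 0 ?u) \<le> \<gamma> * (norm (S j 0 ?u))\<^sup>2"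
        unfolding S_def by (rule spec.E_le[OF sp Tb]) (simp add: T_def subset_eq)
      thus ?thesis using True ib(1)[of j] L(4)[of 0 j x] by simp
    next
      case False
      have "S j i ?u = S j i ?z"
        by (rule ib(2)) (rule orth_seqD(2)[OF So False])
      moreover have "qf (B j) (S j i ?z) \<le> c i * (norm (S j i ?z))\<^sup>2"
        unfolding S_def by (rule spec.E_le[OF sp Tb Tle])
      ultimately show ?thesis using False L(4)[of i j x] by simp
    qed
    have "(\<lambda>i. qf (B j) (S j i ?u)) sums qf (B j) ?u"
      using psum_qf_sums[OF So positive_selfadj[OF B(2)] SB, of j ?u] by (simp add: Ssum)
    moreover have "(\<lambda>i. (norm (q j i x))\<^sup>2 + (if i = 0 then (norm y)\<^sup>2 else 0)) sums ((norm ((psum (q j)) x))\<^sup>2 + (norm y)\<^sup>2)"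
      using sums_single[of 0 "\<lambda>_. (norm y)\<^sup>2"] by (intro sums_add psum_norm_sums qseq) simp
    ultimately have "qf (B j) ?u \<le> (norm ((psum (q j)) x))\<^sup>2 + (norm y)\<^sup>2"
      by (rule sums_le[OF le])
    also have "(norm ((psum (q j)) x))\<^sup>2 \<le> (norm x)\<^sup>2"
      by (intro power_mono norm_proj_le psum_proj qseq) simp
    finally show "qf (B j) ?u \<le> (norm y)\<^sup>2 + (norm x)\<^sup>2" by simp
  qed
qed

end

subsection \<open>Splitting off spectral blocks\<close>

context sfactor
begin

text \<open>What the finite nonzero projections of the semifinite case (for the trace) and all nonzero
  projections of the type III case have in common.\<close>

definition splitting_unit :: "'h oper \<Rightarrow> bool" where
  "splitting_unit P \<longleftrightarrow> P \<in> projections M \<and> P \<noteq> 0 \<and>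
    (\<forall>e f. e \<in> projections M \<longrightarrow> f \<in> projections M \<longrightarrow> e \<cdot> f = 0 \<longrightarrow> big (e + f) \<longrightarrow> big e \<or> big f) \<and>
    (\<forall>r R. (\<forall>n. r n \<in> projections M) \<longrightarrow> (\<forall>n. r (Suc n) \<cdot> r n = r n) \<longrightarrow> slim r R \<longrightarrow> big R \<longrightarrow> (\<exists>n. sub P (r n)))"

lemma splitting_unit_proj: "splitting_unit P \<Longrightarrow> P \<in> projections M" "splitting_unit P \<Longrightarrow> P \<noteq> 0"
  by (auto simp: splitting_unit_def)

lemma spectral_M: "A \<in> M \<Longrightarrow> positive_op A \<Longrightarrow> spectral_proj A S \<in> projections M"
  using spectral_proj_spec(2)[OF positive_selfadj vna_axioms, of A S] spec.E_proj[OF spectral_proj_spec(1)[OF positive_selfadj], of A S]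
  by (simp add: projM)

lemma spectral_neg:
  assumes A: "positive_op A" and t: "t < 0"
  shows "spectral_proj A {t<..} = id_blinfun"
proof -
  interpret spec A "spectral_proj A" by (rule spectral_proj_spec(1)[OF positive_selfadj[OF A]])
  have "spectral_proj A {..t} x = 0" for x
  proof -
    let ?y = "spectral_proj A {..t} x"
    have "qf A ?y \<le> t * (norm ?y)\<^sup>2" by (rule E_le) auto
    hence "0 \<le> t * (norm ?y)\<^sup>2" using positive_qf[OF A, of ?y] by linarith
    thus ?thesis using t by (simp add: zero_le_mult_iff)
  qed
  hence "spectral_proj A {..t} = 0" by (intro blinfun_eqI) simp
  moreover have "- {..t} = {t<..}" by auto
  ultimately show ?thesis using E_compl[of "{..t}"] by simp
qed

lemma not_big_zero:
  assumes inf: "\<not> finite_projection M id_blinfun"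
  shows "\<not> big 0"
proof
  assume "big 0"
  then obtain v where "v \<in> M" "adj v \<cdot> v = id_blinfun" "0 \<cdot> v = v" by (auto simp: big_def sub_def)
  hence "v = 0" "adj v \<cdot> v = id_blinfun" by simp_all
  hence id0: "id_blinfun = (0::'h oper)" by simp
  have z: "Q = 0" for Q :: "'h oper" using compose_id_left[of Q] unfolding id0 by simp
  have "Q = id_blinfun" for Q :: "'h oper" by (rule trans[OF z id0[symmetric]])
  hence "finite_projection M id_blinfun" by (auto simp: finite_projection_def projM M_id)
  thus False using inf by simp
qed

context
  fixes A P0 :: "'h oper"
  assumes inf: "\<not> finite_projection M id_blinfun" and A: "A \<in> M" "positive_op A" and P0: "splitting_unit P0"
begin

interpretation spec A "spectral_proj A"
  by (rule spectral_proj_spec(1)[OF positive_selfadj[OF A(2)]])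

abbreviation EA :: "real set \<Rightarrow> 'h oper" where "EA \<equiv> spectral_proj A"

lemma EA_M: "EA S \<in> projections M"
  by (rule spectral_M[OF A])

lemma big_cases:
  assumes "S \<in> sets borel" "T \<in> sets borel" "S \<inter> T = {}" "big (EA (S \<union> T))"
  shows "big (EA S) \<or> big (EA T)"
  using P0[unfolded splitting_unit_def, THEN conjunct2, THEN conjunct2, THEN conjunct1, rule_format,
      OF EA_M EA_M E_disjoint[OF assms(1-3)]] assms(4) E_additive[OF assms(1-3)] by simp

lemma big_incseq:
  assumes F: "range F \<subseteq> sets borel" "incseq F" and "big (EA (\<Union>n::nat. F n))"
  shows "\<exists>n. sub P0 (EA (F n))"
proof -
  have "EA (F (Suc n)) \<cdot> EA (F n) = EA (F n)" for n
    by (rule E_mono) (use F in \<open>auto simp: incseq_Suc_iff\<close>)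
  thus ?thesis
    using P0[unfolded splitting_unit_def, THEN conjunct2, THEN conjunct2, THEN conjunct2, rule_format,
      of "\<lambda>n. EA (F n)" "EA (\<Union>n. F n)", OF EA_M _ E_incseq[OF F, rule_format] assms(3)] by blast
qed

lemma EA_mono_big: "big (EA S) \<Longrightarrow> S \<in> sets borel \<Longrightarrow> T \<in> sets borel \<Longrightarrow> S \<subseteq> T \<Longrightarrow> big (EA T)"
  by (rule big_mono[OF _ EA_M E_mono])

lemma EA_top: "norm A \<le> t \<Longrightarrow> EA {t<..} = 0"
proof (rule blinfun_eqI)
  fix x assume t: "norm A \<le> t"
  let ?x = "(EA {t<..}) x"
  have "qf A ?x \<le> norm A * (norm ?x)\<^sup>2" by (rule qf_le_norm)
  also have "\<dots> \<le> t * (norm ?x)\<^sup>2" by (intro mult_right_mono t) simp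
  finally have "qf A ?x \<le> t * (norm ?x)\<^sup>2" .
  moreover have "t * (norm ?x)\<^sup>2 \<le> qf A ?x" by (rule E_ge) auto
  ultimately have "?x = 0" by (intro E_strict[of t]) (auto simp: proj_idem_apply[OF E_proj])
  thus "?x = blinfun_apply 0 x" by simp
qed

definition blocks :: "(nat \<Rightarrow> real) \<Rightarrow> (nat \<Rightarrow> 'h oper) \<Rightarrow> bool" where
  "blocks a b \<longleftrightarrow> orth_seq b \<and> (\<forall>k. b k \<in> M \<and> b k \<cdot> A = A \<cdot> b k \<and> sub P0 (b k)) \<and>
    (\<forall>k x. a k * (norm (b k x))\<^sup>2 \<le> qf A (b k x))"

lemma interval_blocks:
  assumes I: "\<And>k. I k \<in> sets borel" "disjoint_family I" "\<And>k. I k \<subseteq> {a k..}" "\<And>k. sub P0 (EA (I k))"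
  shows "blocks a (\<lambda>k. EA (I k))"
  unfolding blocks_def orth_seq_def
proof (intro conjI allI impI)
  show "EA (I m) \<cdot> EA (I n) = 0" if "m \<noteq> n" for m n
    by (rule E_disjoint) (use I that in \<open>auto simp: disjoint_family_on_def\<close>)
  show "a k * (norm ((EA (I k)) x))\<^sup>2 \<le> qf A ((EA (I k)) x)" for k x
    by (rule E_ge[OF I(1,3)])
  show "EA (I k) \<in> M" for k using EA_M by (simp add: projM)
qed (rule E_proj E_commute I(4))+

lemma scalar_on_point: "A \<cdot> EA {t} = t *\<^sub>R EA {t}"
proof -
  have s: "selfadj (A \<cdot> EA {t})"
    by (rule selfadj_commuting) (simp_all add: positive_selfadj A proj_selfadj E_proj E_commute)
  show ?thesis
  proof (rule selfadj_eqI[OF s])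
    fix x
    have "cinner (blinfun_apply (A \<cdot> EA {t}) x) x = cinner (blinfun_apply (EA {t}) (blinfun_apply A (blinfun_apply (EA {t}) x))) x"
      by (metis E_commute E_proj blinfun_apply_blinfun_compose proj_idem_apply)
    hence "qf (A \<cdot> EA {t}) x = qf A ((EA {t}) x)"
      by (simp add: selfadj_swap[OF proj_selfadj[OF E_proj]])
    moreover have "qf A ((EA {t}) x) = t * (norm ((EA {t}) x))\<^sup>2"
      using E_ge[of "{t}" t x] E_le[of "{t}" t x] by (intro antisym) auto
    ultimately show "qf (A \<cdot> EA {t}) x = qf (t *\<^sub>R EA {t}) x" by (simp only: qf_scaleR qf_E)
  qed (simp add: selfadj_scaleR proj_selfadj E_proj)
qed

lemma commute_below_point:
  assumes b: "projection_op b" "EA {t} \<cdot> b = b"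
  shows "A \<cdot> b = t *\<^sub>R b" "b \<cdot> A = A \<cdot> b"
proof -
  show 1: "A \<cdot> b = t *\<^sub>R b" using compose_assoc[of A "EA {t}" b] by (simp add: b(2) scalar_on_point compose_scaleR_left)
  have "b \<cdot> A = t *\<^sub>R b"
    using compose_flip[OF 1] A b by (simp add: M_cl proj_cl adj_scaleR proj_adj selfadj_adj positive_selfadj)
  thus "b \<cdot> A = A \<cdot> b" using 1 by simp
qed

text \<open>On an eigenspace every projection of \<open>M\<close> commutes with \<open>A\<close>, so
  the blocks need not be spectral: any infinite orthogonal family of copies of \<open>I\<close>
  inside it will do.\<close>

lemma point_blocks:
  assumes "big (EA {t})" and a: "\<And>k. a k \<le> t"
  shows "\<exists>b. blocks a b"
proof -
  obtain v where v: "v \<in> M" "adj v \<cdot> v = id_blinfun" "EA {t} \<cdot> v = v" using assms(1) by (auto simp: big_def sub_def)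
  from isometry_sequence[OF inf] obtain S where S': "(\<forall>j. S j \<in> M \<and> adj (S j) \<cdot> S j = id_blinfun) \<and>
    (\<forall>i j. i \<noteq> j \<longrightarrow> adj (S i) \<cdot> S j = 0) \<and> sot_sums (\<lambda>j. S j \<cdot> adj (S j)) id_blinfun" by (rule exE)
  note S = S'[THEN conjunct1, rule_format, THEN conjunct1] S'[THEN conjunct1, rule_format, THEN conjunct2]
    S'[THEN conjunct2, THEN conjunct1, rule_format]
  define w where "w j = v \<cdot> S j" for j
  have wM: "w j \<in> M" for j by (simp add: w_def M_compose v S)
  have ww: "adj (w i) \<cdot> w j = adj (S i) \<cdot> S j" for i j
  proof -
    have "adj (w i) \<cdot> w j = adj (S i) \<cdot> ((adj v \<cdot> v) \<cdot> S j)"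
      unfolding w_def by (simp add: adj_compose M_cl v(1) S(1) compose_assoc)
    thus ?thesis by (simp add: v(2) compose_simps)
  qed
  define b where "b j = w j \<cdot> adj (w j)" for j
  have wp: "projection_op (adj (w j) \<cdot> w j)" for j by (simp add: ww S(2))
  have bo: "orth_seq b" unfolding b_def by (rule orth_ranges[OF wM wp]) (simp add: ww S(3))
  have bM: "b j \<in> M" for j by (simp add: b_def M_compose M_adj wM)
  have Eb: "EA {t} \<cdot> b j = b j" for j by (simp add: b_def w_def compose_assoc[symmetric] v(3))
  have s1: "sub id_blinfun (b j)" for j
    unfolding b_def by (rule sub_final[OF wM]) (simp_all add: ww S(2))
  have sb: "sub P0 (b j)" for j by (rule sub_trans[OF sub_id[OF splitting_unit_proj(1)[OF P0]] s1 proj_id])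
  note c = commute_below_point[OF orth_seqD(1)[OF bo] Eb]
  have ge: "a k * (norm (b k x))\<^sup>2 \<le> qf A (b k x)" for k x
  proof -
    have p: "projection_op (b k)" by (rule orth_seqD(1)[OF bo])
    have "A (b k x) = t *\<^sub>R b k x"
      using eq_applyD[OF c(1), of k x] by (simp add: blinfun.bilinear_simps)
    hence "qf A (b k x) = t * (norm (b k x))\<^sup>2"
      by (simp only: cinner_scaleR_left) simp
    thus ?thesis using a[of k] by (simp add: mult_right_mono)
  qed
  show ?thesis using bo bM c(2) sb ge unfolding blocks_def by blast
qed

text \<open>As \<open>{u<..}\<close> is not big, \<open>{t0<..u}\<close> is. It is an increasing
  union of intervals \<open>{u'<..u}\<close> with \<open>u'\<close> above \<open>t0\<close>, so one
  of these already contains a copy of \<open>P0\<close>; repeating this with \<open>u'\<close> for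
  \<open>u\<close> gives disjoint intervals.\<close>

lemma blocks_above:
  assumes big: "big (EA {t0<..})" and nb: "\<And>u. t0 < u \<Longrightarrow> \<not> big (EA {u<..})" and a: "\<And>k. a k \<le> t0"
  shows "\<exists>b. blocks a b"
proof -
  have step: "\<exists>u'. t0 < u' \<and> u' < u \<and> sub P0 (EA {u'<..u})" if u: "t0 < u" for u
  proof -
    define d where "d = u - t0"
    have d: "0 < d" using u by (simp add: d_def)
    \<comment> \<open>\<open>n + 2\<close> makes the left endpoint strictly smaller than
      \<open>u\<close> also for \<open>n = 0\<close>.\<close>
    define F where "F n = {t0 + d / real (n + 2)<..u}" for n :: nat
    have small: "d / real (n + 2) < d" for n using d by (simp add: field_simps add_pos_nonneg)
    have U: "(\<Union>n. F n) = {t0<..u}"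
    proof
      have *: "t0 < t0 + d / real (n + 2)" for n using d by simp
      show "(\<Union>n. F n) \<subseteq> {t0<..u}" unfolding F_def by (rule UN_least) (use less_trans[OF *] in \<open>auto simp del: of_nat_add\<close>)
      show "{t0<..u} \<subseteq> (\<Union>n. F n)"
      proof
        fix y assume y: "y \<in> {t0<..u}"
        hence "0 < (y - t0) / d" using d by simp
        then obtain n where "inverse (real (Suc n)) < (y - t0) / d" using reals_Archimedean by blast
        hence "d / real (Suc n) < y - t0" using d by (simp add: field_simps)
        moreover have "d / real (n + 2) \<le> d / real (Suc n)" using d by (intro divide_left_mono) auto
        ultimately have "y \<in> F n" using y by (simp add: F_def)
        thus "y \<in> (\<Union>n. F n)" by blast
      qed
    qed
    have "{t0<..u} \<union> {u<..} = {t0<..}" "{t0<..u} \<inter> {u<..} = {}" using u by auto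
    hence "big (EA {t0<..u}) \<or> big (EA {u<..})" using big by (intro big_cases) simp_all
    hence "big (EA {t0<..u})" using nb[OF u] by blast
    hence "\<exists>n. sub P0 (EA (F n))"
    proof (intro big_incseq)
      show "incseq F"
        unfolding incseq_Suc_iff
      proof
        fix n
        have "d / real (Suc n + 2) \<le> d / real (n + 2)" using d by (intro divide_left_mono) auto
        thus "F n \<subseteq> F (Suc n)" by (auto simp: F_def)
      qed
    qed (simp_all only: U, auto simp: F_def)
    then obtain n where n: "sub P0 (EA (F n))" by blast
    show ?thesis
      by (rule exI[of _ "t0 + d / real (n + 2)"]) (use n small[of n] d in \<open>auto simp: F_def d_def\<close>)
  qed
  have "\<exists>u. \<forall>n::nat. t0 < u n \<and> (u (Suc n) < u n \<and> sub P0 (EA {u (Suc n)<..u n}))"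
    by (rule dependent_nat_choice) (use step in \<open>auto intro: exI[of _ "t0 + 1"]\<close>)
  then obtain u where u: "\<And>n::nat. t0 < u n" "\<And>n. u (Suc n) < u n" "\<And>n. sub P0 (EA {u (Suc n)<..u n})" by blast
  have dec: "u n \<le> u m" if "m \<le> n" for m n using lift_Suc_antimono_le[of u, OF less_imp_le[OF u(2)] that] .
  have "disjoint_family (\<lambda>n. {u (Suc n)<..u n})"
  proof -
    have "{u (Suc m)<..u m} \<inter> {u (Suc n)<..u n} = {}" if "m < n" for m n
      using dec[of "Suc m" n] that by auto
    thus ?thesis unfolding disjoint_family_on_def by (metis Int_commute nat_neq_iff)
  qed
  moreover have "{u (Suc k)<..u k} \<subseteq> {a k..}" for k
    using a[of k] u(1)[of "Suc k"] by auto
  ultimately have "blocks a (\<lambda>k. EA {u (Suc k)<..u k})" using u(3) by (intro interval_blocks) auto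
  thus ?thesis by blast
qed

text \<open>The mirror image of \<open>blocks_above\<close>: \<open>{t0..}\<close> is not big, hence
  \<open>{u<..<t0}\<close> is, and intervals are cut off while moving up towards
  \<open>t0\<close>.\<close>

lemma blocks_below:
  assumes big: "\<And>u. u < t0 \<Longrightarrow> big (EA {u<..})" and nb: "\<not> big (EA {t0..})" and a: "\<And>k. a k < t0"
  shows "\<exists>b. blocks a b"
proof -
  have step: "\<exists>u'. u < u' \<and> u' < t0 \<and> sub P0 (EA {u<..u'})" if u: "u < t0" for u
  proof -
    define d where "d = t0 - u"
    have d: "0 < d" using u by (simp add: d_def)
    define F where "F n = {u<..t0 - d / real (n + 2)}" for n :: nat
    have small: "d / real (n + 2) < d" for n using d by (simp add: field_simps add_pos_nonneg)
    have U: "(\<Union>n. F n) = {u<..<t0}"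
    proof
      have *: "t0 - d / real (n + 2) < t0" for n using d by simp
      show "(\<Union>n. F n) \<subseteq> {u<..<t0}" unfolding F_def by (rule UN_least) (use le_less_trans[OF _ *] in \<open>auto simp del: of_nat_add\<close>)
      show "{u<..<t0} \<subseteq> (\<Union>n. F n)"
      proof
        fix y assume y: "y \<in> {u<..<t0}"
        hence "0 < (t0 - y) / d" using d by simp
        then obtain n where "inverse (real (Suc n)) < (t0 - y) / d" using reals_Archimedean by blast
        hence "d / real (Suc n) < t0 - y" using d by (simp add: field_simps)
        moreover have "d / real (n + 2) \<le> d / real (Suc n)" using d by (intro divide_left_mono) auto
        ultimately have "y \<in> F n" using y by (simp add: F_def)
        thus "y \<in> (\<Union>n. F n)" by blast
      qed
    qed
    have "{u<..<t0} \<union> {t0..} = {u<..}" "{u<..<t0} \<inter> {t0..} = {}" using u by auto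
    hence "big (EA {u<..<t0}) \<or> big (EA {t0..})" using big[OF u] by (intro big_cases) simp_all
    hence "big (EA {u<..<t0})" using nb by blast
    hence "\<exists>n. sub P0 (EA (F n))"
    proof (intro big_incseq)
      show "incseq F"
        unfolding incseq_Suc_iff
      proof
        fix n
        have "d / real (Suc n + 2) \<le> d / real (n + 2)" using d by (intro divide_left_mono) auto
        thus "F n \<subseteq> F (Suc n)" by (auto simp: F_def)
      qed
    qed (simp_all only: U, auto simp: F_def)
    then obtain n where n: "sub P0 (EA (F n))" by blast
    show ?thesis
      by (rule exI[of _ "t0 - d / real (n + 2)"]) (use n small[of n] d in \<open>auto simp: F_def d_def\<close>)
  qed
  \<comment> \<open>Starting the interval at \<open>max (u n) (a n)\<close> secures the lower bound
    \<open>a n\<close> without disturbing disjointness.\<close>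
  have "\<exists>u. \<forall>n::nat. u n < t0 \<and> (u n < u (Suc n) \<and> sub P0 (EA {max (u n) (a n)<..u (Suc n)}))"
  proof (rule dependent_nat_choice)
    show "\<exists>x. x < t0" by (rule exI[of _ "t0 - 1"]) simp
    fix x n assume "x < t0"
    hence "max x (a n) < t0" using a by simp
    from step[OF this] show "\<exists>y. y < t0 \<and> x < y \<and> sub P0 (EA {max x (a n)<..y})" by auto
  qed
  then obtain u where u: "\<And>n::nat. u n < t0" "\<And>n. u n < u (Suc n)" "\<And>n. sub P0 (EA {max (u n) (a n)<..u (Suc n)})" by blast
  have inc: "u m \<le> u n" if "m \<le> n" for m n using lift_Suc_mono_le[of u, OF less_imp_le[OF u(2)] that] .
  have "disjoint_family (\<lambda>n. {max (u n) (a n)<..u (Suc n)})"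
  proof -
    have "{max (u m) (a m)<..u (Suc m)} \<inter> {max (u n) (a n)<..u (Suc n)} = {}" if "m < n" for m n
      using inc[of "Suc m" n] that by auto
    thus ?thesis unfolding disjoint_family_on_def by (metis Int_commute nat_neq_iff)
  qed
  hence "blocks a (\<lambda>k. EA {max (u k) (a k)<..u (Suc k)})" using u(3) by (intro interval_blocks) auto
  thus ?thesis by blast
qed

text \<open>The blocks are found at the largest \<open>t0\<close> below which all upper spectral projections are big,
  i.e. at the essential norm of \<open>A\<close>: at the eigenvalue \<open>t0\<close>, accumulating at \<open>t0\<close> from above, or
  accumulating at \<open>t0\<close> from below.\<close>

lemma blocks_exist:
  assumes big: "\<And>t. t < lam \<Longrightarrow> big (EA {t<..})" and a: "\<And>k. a k < lam"
  shows "\<exists>b. blocks a b"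
proof -
  define W where "W = {t. big (EA {t<..})}"
  have W: "W \<noteq> {}" "bdd_above W"
  proof -
    have "lam - 1 \<in> W" using big by (simp add: W_def)
    thus "W \<noteq> {}" by blast
    have "t \<le> norm A" if "t \<in> W" for t
      using that EA_top[of t] not_big_zero[OF inf] by (force simp: W_def)
    thus "bdd_above W" by (auto simp: bdd_above_def)
  qed
  define t0 where "t0 = Sup W"
  have above: "\<not> big (EA {u<..})" if "t0 < u" for u
    using cSup_upper[OF _ W(2), of u] that by (auto simp: t0_def W_def)
  have below: "big (EA {u<..})" if u: "u < t0" for u
  proof -
    obtain t where "t \<in> W" "u < t" using less_cSupD[OF W(1), of u] u by (auto simp: t0_def)
    thus ?thesis using EA_mono_big[of "{t<..}" "{u<..}"] by (auto simp: W_def)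
  qed
  have le: "lam \<le> t0"
    by (rule dense_le) (use big cSup_upper[OF _ W(2)] in \<open>auto simp: t0_def W_def\<close>)
  consider "big (EA {t0})" | "big (EA {t0<..})" | "\<not> big (EA {t0})" "\<not> big (EA {t0<..})" by blast
  thus ?thesis
  proof cases
    case 1 thus ?thesis using a le by (intro point_blocks[of t0]) (auto intro: less_imp_le less_le_trans)
  next
    case 2 thus ?thesis using a le above by (intro blocks_above[of t0]) (auto intro: less_imp_le less_le_trans)
  next
    case 3
    have "{t0} \<union> {t0<..} = {t0..}" "{t0} \<inter> {t0<..} = {}" by auto
    hence "big (EA {t0..}) \<Longrightarrow> big (EA {t0}) \<or> big (EA {t0<..})" by (intro big_cases) simp_all
    hence "\<not> big (EA {t0..})" using 3 by blast
    thus ?thesis using a le below by (intro blocks_below[of t0]) (auto intro: less_le_trans)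
  qed
qed

end

end

text \<open>For every decomposition \<open>X = Q - R\<close> of this kind the sign projection
  \<open>z\<close> of \<open>X\<close> fixes the range of \<open>Q\<close> and kills that of
  \<open>R\<close>. So \<open>Q = z \<cdot> X\<close>, which depends on \<open>X\<close> alone, and
  the definite description in \<open>pos_part\<close> is resolved.\<close>

lemma pos_part_eqI:
  assumes P: "positive_op P" and N: "positive_op N" and PN: "P \<cdot> N = 0"
  shows "pos_part (P - N) = P"
proof -
  define X where "X = P - N"
  have X: "selfadj X" by (simp add: X_def selfadj_diff positive_selfadj P N)
  obtain z where z: "sign_proj X z" using sign_projection[OF X] by blast
  have zp: "projection_op z" by (rule sign_projD(1)[OF z])
  have "Q = z \<cdot> X" if Q: "positive_op Q" and R: "positive_op R" and XQ: "X = Q - R" and QR: "Q \<cdot> R = 0" for Q R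
  proof -
    note sQ = positive_selfadj[OF Q] and sR = positive_selfadj[OF R]
    have RQ: "R \<cdot> Q = 0" using compose_flip[OF QR] by (simp add: selfadj_cl sQ sR selfadj_adj)
    have "X \<in> commutant {Q}"
      by (simp add: commutant_def selfadj_cl X) (simp add: XQ compose_simps QR RQ)
    from sign_projD(2)[OF z vna_commutant_single[OF sQ] this] have zQ: "z \<cdot> Q = Q \<cdot> z" by (simp add: commutant_def)
    have "X \<in> commutant {R}"
      by (simp add: commutant_def selfadj_cl X) (simp add: XQ compose_simps QR RQ)
    from sign_projD(2)[OF z vna_commutant_single[OF sR] this] have zR: "z \<cdot> R = R \<cdot> z" by (simp add: commutant_def)
    have a: "z (R y) = 0" for y
    proof -
      let ?u = "blinfun_apply z (blinfun_apply R y)"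
      have "blinfun_apply Q ?u = blinfun_apply z (blinfun_apply (Q \<cdot> R) y)" using eq_applyD[OF zQ, of "blinfun_apply R y"] by simp
      hence "qf Q ?u = 0" by (simp add: QR)
      hence "qf R ?u \<le> 0" using sign_projD(3)[OF z, of "R y"] by (simp add: XQ blinfun.bilinear_simps cinner_simps)
      hence Ru: "R ?u = 0" using positive_qf[OF R, of ?u] by (intro positive_qf_zero[OF R]) simp
      have "(norm ?u)\<^sup>2 = Re (cinner ?u (R y))"
        using selfadj_swap[OF proj_selfadj[OF zp], of ?u "R y"] proj_idem_apply[OF zp] by (metis Re_cinner_self)
      also have "\<dots> = Re (cinner (R ?u) y)" by (simp add: selfadj_swap[OF sR])
      finally show ?thesis by (simp add: Ru)
    qed
    have b: "Q y - z (Q y) = 0" for y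
    proof -
      let ?u = "blinfun_apply Q y - blinfun_apply z (blinfun_apply Q y)"
      have "blinfun_apply R ?u = blinfun_apply (R \<cdot> Q) y - blinfun_apply z (blinfun_apply (R \<cdot> Q) y)"
        using eq_applyD[OF zR, of "Q y"] by (simp add: blinfun.bilinear_simps)
      hence "qf R ?u = 0" by (simp add: RQ)
      hence "qf Q ?u \<le> 0" using sign_projD(4)[OF z, of "Q y"] by (simp add: XQ blinfun.bilinear_simps cinner_simps)
      hence Qu: "Q ?u = 0" using positive_qf[OF Q, of ?u] by (intro positive_qf_zero[OF Q]) simp
      have "cinner ?u (z (Q y)) = 0"
        by (simp add: selfadj_swap[OF proj_selfadj[OF zp], symmetric] blinfun.bilinear_simps proj_idem_apply[OF zp])
      hence "cinner ?u ?u = cinner ?u (Q y)" by (metis cinner_diff_right diff_zero)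
      also have "\<dots> = cinner (Q ?u) y" by (simp add: selfadj_swap[OF sQ])
      finally show ?thesis by (simp add: Qu cinner_self)
    qed
    show ?thesis by (rule blinfun_eqI) (use a b in \<open>simp add: XQ blinfun.bilinear_simps\<close>)
  qed
  hence "Q = P" if "\<exists>R. positive_op Q \<and> positive_op R \<and> X = Q - R \<and> Q \<cdot> R = 0" for Q
    using that P N PN X_def by metis
  thus ?thesis unfolding pos_part_def X_def[symmetric] using P N PN X_def by (intro the_equality) blast+
qed

subsection \<open>Traces\<close>

locale tfactor = sfactor M for M :: "'h::chilbert_space oper set" +
  fixes \<tau> :: "'h oper \<Rightarrow> ennreal" and P0 :: "'h oper"
  assumes trace: "normalized_fns_trace M \<tau>" and inf: "\<not> finite_projection M id_blinfun"
    and P0: "P0 \<in> projections M" "P0 \<noteq> 0" "\<tau> P0 < \<infinity>"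
begin

lemma posM: "T \<in> positives M \<longleftrightarrow> T \<in> M \<and> positive_op T"
  by (simp add: positives_def)

lemma proj_posM: "P \<in> projections M \<Longrightarrow> P \<in> positives M"
  by (simp add: posM projM proj_positive)

lemma tau_add: "S \<in> positives M \<Longrightarrow> T \<in> positives M \<Longrightarrow> \<tau> (S + T) = \<tau> S + \<tau> T"
  and tau_scaleR: "T \<in> positives M \<Longrightarrow> 0 \<le> r \<Longrightarrow> \<tau> (r *\<^sub>R T) = ennreal r * \<tau> T"
  and tau_swap: "X \<in> M \<Longrightarrow> \<tau> (adj X \<cdot> X) = \<tau> (X \<cdot> adj X)"
  using trace by (simp_all add: normalized_fns_trace_def trace_on_def)

lemma tau_0: "\<tau> 0 = 0"
  using tau_scaleR[of 0 0] by (simp add: posM M_0)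

lemma tau_pos: "T \<in> positives M \<Longrightarrow> T \<noteq> 0 \<Longrightarrow> 0 < \<tau> T"
  using trace by (auto simp: normalized_fns_trace_def faithful_on_def zero_less_iff_neq_zero)

lemma tau_mono:
  assumes "S \<in> positives M" "T \<in> positives M" "\<And>x. qf S x \<le> qf T x"
  shows "\<tau> S \<le> \<tau> T"
proof -
  have "T - S \<in> positives M"
    using assms by (simp add: posM M_diff positive_op_iff selfadj_diff qf_diff del: minus_blinfun.rep_eq)
  from tau_add[OF assms(1) this] show ?thesis by (simp add: le_iff_add)
qed

lemma tau_proj_mono: "e \<in> projections M \<Longrightarrow> f \<in> projections M \<Longrightarrow> f \<cdot> e = e \<Longrightarrow> \<tau> e \<le> \<tau> f"
  by (rule tau_mono) (auto simp: proj_posM projM intro!: op_le_qf simp: proj_le_iff)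

lemma tau_sub:
  assumes "sub e f" "e \<in> projections M" "f \<in> projections M"
  shows "\<tau> e \<le> \<tau> f"
proof -
  obtain v where v: "v \<in> M" "adj v \<cdot> v = e" "f \<cdot> v = v" using assms by (auto simp: sub_def)
  have "\<tau> e = \<tau> (v \<cdot> adj v)" using tau_swap[OF v(1)] v(2) by simp
  also have "\<dots> \<le> \<tau> f"
    by (rule tau_proj_mono[OF pi_final[OF v(1,2)] assms(3)]) (use assms v in \<open>auto simp: projM compose_assoc[symmetric]\<close>)
  finally show ?thesis .
qed

lemma tau_diff: "e \<in> projections M \<Longrightarrow> f \<in> projections M \<Longrightarrow> f \<cdot> e = e \<Longrightarrow> \<tau> f = \<tau> e + \<tau> (f - e)"
  using tau_add[of e "f - e"] by (simp add: posM projM proj_positive M_diff proj_diff)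

text \<open>Normality speaks of suprema of directed sets; the strong limit of an increasing sequence
  is the supremum of its range.\<close>

lemma tau_increasing:
  assumes T: "\<And>n. T n \<in> positives M" "\<And>n x. qf (T n) x \<le> qf (T (Suc n)) x" and R: "slim T R"
  shows "\<tau> R = (SUP n. \<tau> (T n))"
proof -
  have mono: "qf (T m) x \<le> qf (T n) x" if "m \<le> n" for m n x
    using lift_Suc_mono_le[of "\<lambda>n. qf (T n) x", OF T(2) that] .
  have sT: "selfadj (T n)" for n using T(1) by (simp add: posM positive_selfadj)
  have Rp: "R \<in> positives M"
    using M_slim[OF R] slim_positive[OF R] T(1) by (auto simp: posM)
  have up: "qf (T n) x \<le> qf R x" for n x
    by (rule LIMSEQ_le_const[OF slim_qf[OF R]]) (auto intro!: exI[of _ n] mono)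
  have "op_directed (range T)"
    unfolding op_directed_def
  proof (intro conjI ballI)
    fix S U assume "S \<in> range T" "U \<in> range T"
    then obtain m n where "S = T m" "U = T n" by blast
    thus "\<exists>W\<in>range T. op_le S W \<and> op_le U W"
      by (intro bexI[of _ "T (max m n)"]) (auto intro!: op_leI sT mono)
  qed simp
  moreover have "is_sup_in M (range T) R"
    unfolding is_sup_in_def
  proof (intro conjI ballI impI)
    show "op_le S R" if "S \<in> range T" for S
      using that Rp by (auto intro!: op_leI sT up simp: posM positive_selfadj)
    fix U assume U: "U \<in> positives M" "\<forall>S\<in>range T. op_le S U"
    show "op_le R U"
    proof (rule op_leI)
      fix x
      have "qf (T n) x \<le> qf U x" for n using U(2) by (intro op_le_qf) auto
      thus "qf R x \<le> qf U x" by (intro LIMSEQ_le_const2[OF slim_qf[OF R]]) auto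
    qed (use Rp U in \<open>auto simp: posM positive_selfadj\<close>)
  qed (rule Rp)
  moreover have "range T \<subseteq> positives M" using T(1) by auto
  moreover have "normal_on M \<tau>" using trace by (simp add: normalized_fns_trace_def)
  ultimately have "\<tau> R = (SUP S\<in>range T. \<tau> S)" unfolding normal_on_def by blast
  thus ?thesis by (simp add: image_image)
qed

lemma tau_incr_proj:
  assumes "\<And>n. r n \<in> projections M" "\<And>n. r (Suc n) \<cdot> r n = r n" "slim r R"
  shows "\<tau> R = (SUP n. \<tau> (r n))"
  by (rule tau_increasing[OF proj_posM[OF assms(1)] op_le_qf assms(3)])
    (use assms(1,2) in \<open>simp add: proj_le_iff projM\<close>)

lemma positives_sum: "(\<And>i. i \<in> I \<Longrightarrow> f i \<in> positives M) \<Longrightarrow> sum f I \<in> positives M"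
  by (induction I rule: infinite_finite_induct) (simp_all add: posM M_0 M_add positive_add)

lemma tau_sum: "(\<And>i::nat. f i \<in> positives M) \<Longrightarrow> \<tau> (\<Sum>i<n. f i) = (\<Sum>i<n. \<tau> (f i))"
  by (induction n) (simp_all add: tau_0 tau_add positives_sum)

lemma tau_sums:
  assumes f: "\<And>i. f i \<in> positives M" and R: "\<And>x. (\<lambda>n. blinfun_apply (f n) x) sums blinfun_apply R x"
  shows "\<tau> R = (\<Sum>i. \<tau> (f i))"
proof -
  have "\<tau> R = (SUP n. \<tau> (\<Sum>i<n. f i))"
  proof (rule tau_increasing)
    show "(\<Sum>i<n. f i) \<in> positives M" for n using f by (rule positives_sum)
    show "qf (\<Sum>i<n. f i) x \<le> qf (\<Sum>i<Suc n. f i) x" for n x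
      using positive_qf[of "f n" x] f[of n] unfolding sum.lessThan_Suc qf_add posM by simp
    show "slim (\<lambda>n. \<Sum>i<n. f i) R" using R by (simp add: sums_def blinfun.sum_left)
  qed
  thus ?thesis by (simp add: tau_sum[OF f] suminf_eq_SUP)
qed

lemma tau_psum:
  assumes "orth_seq f" "\<And>n. f n \<in> M"
  shows "\<tau> (psum f) = (\<Sum>i. \<tau> (f i))"
  by (rule tau_sums[OF _ psum_sums[OF assms(1)]]) (simp add: posM assms(2) proj_positive orth_seqD(1)[OF assms(1)])

text \<open>The identity contains infinitely many orthogonal copies of one nonzero projection, whose
  trace is positive by faithfulness.\<close>

lemma tau_id: "\<tau> id_blinfun = \<infinity>"
proof (rule ccontr)
  have idP: "id_blinfun \<in> projections M" by (simp add: projM M_id)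
  assume fin: "\<tau> id_blinfun \<noteq> \<infinity>"
  obtain d f where d: "d \<in> projections M" "d \<noteq> 0" and f: "orth_seq f" "\<And>n. f n \<in> projections M" "\<And>n. sub d (f n)"
    using infinite_copies[OF idP inf] by blast
  have fM: "f n \<in> M" for n using f(2) by (simp add: projM)
  have le: "of_nat n * \<tau> d \<le> \<tau> id_blinfun" for n
  proof -
    have "of_nat n * \<tau> d = (\<Sum>i<n. \<tau> d)" by simp
    also have "\<dots> \<le> (\<Sum>i<n. \<tau> (f i))" by (intro sum_mono tau_sub f d)
    also have "\<dots> = \<tau> (\<Sum>i<n. f i)" by (rule tau_sum[OF proj_posM[OF f(2)], symmetric])
    also have "\<dots> \<le> \<tau> id_blinfun"
      by (rule tau_proj_mono[OF _ idP]) (simp_all add: projM M_sum fM orth_seq_partial[OF f(1)] compose_simps)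
    finally show ?thesis .
  qed
  obtain r where r: "\<tau> id_blinfun = ennreal r" "0 \<le> r" using fin by (cases "\<tau> id_blinfun") auto
  have "\<tau> d \<noteq> \<infinity>" using le[of 1] fin by (auto simp: top_unique)
  then obtain s where s: "\<tau> d = ennreal s" "0 \<le> s" by (cases "\<tau> d") auto
  have "0 < s" using tau_pos[OF proj_posM[OF d(1)] d(2)] s by simp
  then obtain n where "r < real n * s" using ex_less_of_nat_mult[of s r] by blast
  moreover have "ennreal (real n * s) \<le> ennreal r" using le[of n] s r by (simp add: ennreal_mult ennreal_of_nat_eq_real_of_nat)
  hence "real n * s \<le> r" using r by (simp add: ennreal_le_iff)
  ultimately show False by simp
qed

lemma big_tau: "big r \<Longrightarrow> \<tau> r = \<infinity>"
  using tau_sub[of id_blinfun r] tau_id by (auto simp: big_def projM M_id top_unique)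

text \<open>In a decomposition of \<open>r\<close> into parts subequivalent to \<open>P0\<close>,
  finitely many copies of \<open>P0\<close> would leave only finitely many nonzero terms and thus a
  finite trace. Infinitely many copies make \<open>r\<close> big.\<close>

lemma tau_big:
  assumes r: "r \<in> projections M" "\<tau> r = \<infinity>"
  shows "big r"
proof -
  obtain e where e: "orth_seq e" "\<And>n. e n \<in> projections M" "psum e = r" "\<And>n. sub (e n) P0"
    "\<And>n. e (Suc n) = 0 \<or> sub P0 (e (Suc n))" using decomposition[OF P0(1,2) r(1)] by blast
  have eM: "e n \<in> M" for n using e(2) by (simp add: projM)
  have "infinite {n \<in> UNIV. sub P0 (e n)}"
  proof
    assume "finite {n \<in> UNIV. sub P0 (e n)}"
    then obtain N where N: "\<And>n. sub P0 (e n) \<Longrightarrow> n < N" using finite_nat_set_iff_bounded by auto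
    have z: "e n = 0" if "Suc N \<le> n" for n
      using e(5)[of "n - 1"] N[of n] that by (cases n) auto
    have "(\<Sum>i<n. \<tau> (e i)) \<le> of_nat (Suc N) * \<tau> P0" for n
    proof -
      have "(\<Sum>i<n. \<tau> (e i)) = (\<Sum>i\<in>{..<n} \<inter> {..<Suc N}. \<tau> (e i))"
      proof (intro sum.mono_neutral_right ballI)
        fix i assume "i \<in> {..<n} - {..<n} \<inter> {..<Suc N}"
        thus "\<tau> (e i) = 0" using z[of i] by (auto simp: tau_0)
      qed auto
      also have "\<dots> \<le> (\<Sum>i<Suc N. \<tau> (e i))" by (rule sum_mono2) auto
      also have "\<dots> \<le> (\<Sum>i<Suc N. \<tau> P0)" by (intro sum_mono tau_sub e P0)
      finally show ?thesis by simp
    qed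
    hence "\<tau> r \<le> of_nat (Suc N) * \<tau> P0" unfolding e(3)[symmetric] tau_psum[OF e(1) eM] suminf_eq_SUP by (rule SUP_least)
    also have "\<dots> < \<infinity>" using P0(3) by (simp add: ennreal_mult_less_top of_nat_less_top del: of_nat_Suc)
    finally show False using r by simp
  qed
  from big_bsum[OF P0(1,2) e(1) eM this] have "big (psum e)" by (simp add: bsum_def)
  thus ?thesis by (simp add: e(3))
qed

text \<open>By comparison only the case that \<open>r\<close> embeds into \<open>P0\<close> is open.
  The trace then leaves nothing for the complement of the image, since \<open>\<tau> P0\<close> is
  finite, and faithfulness turns the embedding into an equivalence.\<close>

lemma sub_of_tau:
  assumes r: "r \<in> projections M" "\<tau> P0 \<le> \<tau> r"
  shows "sub P0 r"
proof -
  have "sub P0 r" if s: "sub r P0"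
  proof -
    obtain v where v: "v \<in> M" "adj v \<cdot> v = r" "P0 \<cdot> v = v" using s by (auto simp: sub_def)
    have rp: "projection_op r" using r by (simp add: projM)
    define e where "e = v \<cdot> adj v"
    have e: "e \<in> projections M" unfolding e_def by (rule pi_final[OF v(1,2) rp])
    have "\<tau> e = \<tau> r" using tau_swap[OF v(1)] v(2) by (simp add: e_def)
    moreover have "P0 \<cdot> e = e" by (simp add: e_def compose_assoc[symmetric] v(3))
    from tau_diff[OF e P0(1) this] have "\<tau> P0 = \<tau> e + \<tau> (P0 - e)" .
    ultimately have "\<tau> P0 + \<tau> (P0 - e) \<le> \<tau> P0 + 0"
      using r(2) by (metis add.right_neutral add_right_mono)
    hence "\<tau> (P0 - e) \<le> 0" using P0(3) by (subst (asm) ennreal_add_left_cancel_le) auto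
    moreover have "P0 - e \<in> positives M"
      using P0 e \<open>P0 \<cdot> e = e\<close> by (simp add: posM projM M_diff proj_positive proj_diff)
    ultimately have "P0 - e = 0" using tau_pos by fastforce
    hence "P0 = v \<cdot> adj v" by (simp add: e_def)
    thus ?thesis using sub_final'[OF v(1,2) rp] by simp
  qed
  thus ?thesis using comparison[OF P0(1) r(1)] by blast
qed

text \<open>Being big is the same as having infinite trace, so the two clauses reduce to additivity
  and to normality of the trace.\<close>

lemma splitting_unit_P0: "splitting_unit P0"
  unfolding splitting_unit_def
proof (intro conjI allI impI)
  fix e f assume ef: "e \<in> projections M" "f \<in> projections M" "e \<cdot> f = 0" "big (e + f)"
  have "\<tau> e + \<tau> f = \<infinity>" using big_tau[OF ef(4)] tau_add[OF proj_posM[OF ef(1)] proj_posM[OF ef(2)]] by simp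
  hence "\<tau> e = \<infinity> \<or> \<tau> f = \<infinity>" by (simp add: ennreal_add_eq_top)
  thus "big e \<or> big f" using tau_big ef by blast
next
  fix r R assume r: "\<forall>n. r n \<in> projections M" "\<forall>n. r (Suc n) \<cdot> r n = r n" "slim r R" "big R"
  have "\<tau> R = (SUP n. \<tau> (r n))" by (rule tau_incr_proj) (use r in auto)
  hence "\<tau> P0 < (SUP n. \<tau> (r n))" using big_tau[OF r(4)] P0(3) by simp
  then obtain n where "\<tau> P0 < \<tau> (r n)" unfolding less_SUP_iff by blast
  thus "\<exists>n. sub P0 (r n)" using sub_of_tau r(1) less_imp_le by blast
qed (rule P0)+

end

section \<open>Blocks obtained from an infinite trace of the positive part\<close>

lemma commuting_proj:
  assumes X: "selfadj X" and e: "projection_op e" "e \<cdot> X = X \<cdot> e"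
  shows "selfadj (X \<cdot> e)" "qf (X \<cdot> e) x = qf X (e x)"
proof -
  show "selfadj (X \<cdot> e)" by (rule selfadj_commuting[OF X proj_selfadj[OF e(1)] e(2)[symmetric]])
  have "X (e x) = e (X (e x))"
    using eq_applyD[OF e(2), of "e x"] by (simp add: proj_idem_apply[OF e(1)])
  hence "cinner (X (e x)) x = cinner (X (e x)) (e x)"
    using selfadj_swap[OF proj_selfadj[OF e(1)], of "X (e x)" x] by simp
  thus "qf (X \<cdot> e) x = qf X (e x)" by simp
qed

context tfactor
begin

context
  fixes A :: "'h oper"
  assumes A: "A \<in> M" "positive_op A"
begin

interpretation spec A "spectral_proj A"
  by (rule spectral_proj_spec(1)[OF positive_selfadj[OF A(2)]])

text \<open>The projections that may serve as blocks for \<open>A\<close>, or as parts of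
  blocks.\<close>

definition compart :: "'h oper \<Rightarrow> bool" where
  "compart f \<longleftrightarrow> f \<in> projections M \<and> f \<cdot> A = A \<cdot> f"

lemma compartD: "compart f \<Longrightarrow> f \<in> M" "compart f \<Longrightarrow> projection_op f" "compart f \<Longrightarrow> f \<cdot> A = A \<cdot> f"
    "compart f \<Longrightarrow> f \<in> projections M" "compart f \<Longrightarrow> f \<in> positives M"
  by (auto simp: compart_def projM proj_posM)

lemma compart_E: "compart (spectral_proj A S)"
  by (simp add: compart_def spectral_M[OF A] E_commute)

lemma compart_diff: "compart e \<Longrightarrow> compart f \<Longrightarrow> f \<cdot> e = e \<Longrightarrow> compart (f - e)"
  by (simp add: compart_def projM M_diff proj_diff compose_simps)

lemma compart_E_commute:
  assumes f: "compart f"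
  shows "spectral_proj A S \<cdot> f = f \<cdot> spectral_proj A S"
proof -
  have s: "selfadj f" by (rule proj_selfadj[OF compartD(2)[OF f]])
  have "A \<in> commutant {f}" using f A by (simp add: commutant_def M_cl compart_def)
  from spectral_proj_spec(2)[OF positive_selfadj[OF A(2)] vna_commutant_single[OF s] this]
  show ?thesis by (simp add: commutant_def)
qed

lemma compart_mult:
  assumes f: "compart f"
  shows "compart (spectral_proj A S \<cdot> f)"
proof -
  note c = compart_E_commute[OF f, of S]
  have "spectral_proj A S \<cdot> f \<cdot> A = A \<cdot> (spectral_proj A S \<cdot> f)"
    by (simp add: compose_assoc compartD(3)[OF f]) (simp add: compose_assoc[symmetric] E_commute)
  moreover have "projection_op (spectral_proj A S \<cdot> f)" by (rule proj_mult[OF E_proj compartD(2)[OF f] c])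
  ultimately show ?thesis using f spectral_M[OF A] by (simp add: compart_def projM M_compose)
qed

text \<open>If all parts of \<open>f\<close> had trace above \<open>\<tau> P0\<close>, the spectral measure of \<open>A\<close> restricted to \<open>f\<close>
  would have an atom at its upper bound, and the parts of an eigenspace can be chosen freely.\<close>

lemma small_part:
  assumes f: "compart f" "f \<noteq> 0" "\<tau> f < \<infinity>"
  shows "\<exists>g. compart g \<and> g \<noteq> 0 \<and> f \<cdot> g = g \<and> \<tau> g \<le> \<tau> P0"
proof (rule ccontr)
  assume no: "\<nexists>g. compart g \<and> g \<noteq> 0 \<and> f \<cdot> g = g \<and> \<tau> g \<le> \<tau> P0"
  note fp = compartD(2)[OF f(1)]
  have gt: "\<tau> P0 < \<tau> g" if "compart g" "g \<noteq> 0" "f \<cdot> g = g" for g using no that not_le by blast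
  have Ef: "f \<cdot> (spectral_proj A S \<cdot> f) = spectral_proj A S \<cdot> f" for S
    by (metis compart_E_commute[OF f(1)] compose_assoc proj_idem[OF fp])
  define W where "W = {t. spectral_proj A {t<..} \<cdot> f = 0}"
  have "norm A \<in> W" using E_strict[of "norm A"] EA_top[OF inf A splitting_unit_P0] by (simp add: W_def)
  have "-1 \<le> t" if "t \<in> W" for t
  proof (rule ccontr)
    assume "\<not> -1 \<le> t"
    hence "spectral_proj A {t<..} = id_blinfun" by (intro spectral_neg[OF A(2)]) simp
    thus False using that f(2) by (simp add: W_def compose_simps)
  qed
  hence W: "W \<noteq> {}" "bdd_below W" using \<open>norm A \<in> W\<close> by (auto simp: bdd_below_def)
  \<comment> \<open>The top of the spectrum of \<open>A\<close> on \<open>f\<close>: no part of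
    \<open>f\<close> lies above \<open>c + h n\<close>, while every interval \<open>J n\<close>
    around \<open>c\<close> carries a nonzero one, of trace above \<open>\<tau> P0\<close> by
    \<open>gt\<close>.\<close>
  define c where "c = Inf W"
  define h where "h n = 1 / real (Suc n)" for n
  have h: "0 < h n" "h (Suc n) \<le> h n" for n by (auto simp: h_def field_simps)
  define J where "J n = {c - h n<..c + h n}" for n
  have top: "spectral_proj A {c + h n<..} \<cdot> f = 0" for n
  proof -
    obtain t where t: "t \<in> W" "t < c + h n" using cInf_lessD[OF W(1), of "c + h n"] h by (auto simp: c_def)
    have "spectral_proj A {c + h n<..} \<cdot> spectral_proj A {t<..} = spectral_proj A {c + h n<..}"
      using t by (intro proj_flip E_proj E_mono) auto
    thus ?thesis using t(1) by (auto simp: W_def intro: zero_absorb_right)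
  qed
  have nz: "spectral_proj A (J n) \<cdot> f \<noteq> 0" for n
  proof
    assume z: "spectral_proj A (J n) \<cdot> f = 0"
    have "J n \<union> {c + h n<..} = {c - h n<..}" "J n \<inter> {c + h n<..} = {}" using h[of n] by (auto simp: J_def)
    hence "spectral_proj A {c - h n<..} \<cdot> f = 0"
      using E_additive[of "J n" "{c + h n<..}"] z top[of n] by (simp add: J_def compose_simps)
    hence "c \<le> c - h n" unfolding c_def by (intro cInf_lower W) (simp add: W_def)
    thus False using h[of n] by simp
  qed
  have U: "(\<Union>n. - J n) = - {c}"
  proof
    show "(\<Union>n. - J n) \<subseteq> - {c}" using less_imp_le[OF h(1)] h(1) by (auto simp: J_def)
    show "- {c} \<subseteq> (\<Union>n. - J n)"
    proof
      fix t assume "t \<in> - {c}"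
      hence "0 < \<bar>t - c\<bar>" by simp
      then obtain n where "h n < \<bar>t - c\<bar>" using reals_Archimedean[of "\<bar>t - c\<bar>"] by (auto simp: h_def inverse_eq_divide)
      hence "t \<in> - J n" by (auto simp: J_def)
      thus "t \<in> (\<Union>n. - J n)" by blast
    qed
  qed
  have Jb: "J n \<in> sets borel" for n by (simp add: J_def)
  have inc: "incseq (\<lambda>n. - J n)"
  proof (rule incseq_SucI)
    show "- J n \<subseteq> - J (Suc n)" for n using h[of n] by (auto simp: J_def)
  qed
  have lim: "slim (\<lambda>n. spectral_proj A (- J n)) (spectral_proj A (- {c}))"
    using E_incseq[of "\<lambda>n. - J n", OF _ inc] Jb unfolding U by (simp add: image_subset_iff)
  define r where "r n = spectral_proj A (- J n) \<cdot> f" for n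
  have r: "compart (r n)" for n unfolding r_def by (rule compart_mult[OF f(1)])
  have rs: "r (Suc n) \<cdot> r n = r n" for n
  proof -
    have "spectral_proj A (- J (Suc n)) \<cdot> spectral_proj A (- J n) = spectral_proj A (- J n)"
      using Jb incseqD[OF inc, of n "Suc n"] by (intro E_mono) auto
    moreover have "r (Suc n) \<cdot> r n = spectral_proj A (- J (Suc n)) \<cdot> (f \<cdot> (spectral_proj A (- J n) \<cdot> f))"
      by (simp add: r_def compose_assoc)
    ultimately show ?thesis unfolding Ef by (simp add: r_def compose_assoc[symmetric])
  qed
  define z where "z = spectral_proj A {c} \<cdot> f"
  have z: "compart z" unfolding z_def by (rule compart_mult[OF f(1)])
  \<comment> \<open>Without an atom at \<open>c\<close> the parts \<open>r n\<close> of
    \<open>f\<close> off \<open>J n\<close> would increase to \<open>f\<close>, although each of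
    them misses at least \<open>\<tau> P0\<close>. Normality and the finiteness of
    \<open>\<tau> f\<close> exclude this.\<close>
  have "z \<noteq> 0"
  proof
    assume "z = 0"
    hence "spectral_proj A (- {c}) \<cdot> f = f" using E_compl[of "{c}"] by (simp add: z_def compose_simps)
    from eq_applyD[OF this] have "(spectral_proj A (- {c})) (f x) = f x" for x
      by simp
    with lim[rule_format, of "blinfun_apply f _"] have lim': "slim r f" by (simp add: r_def)
    have "\<tau> f = (SUP n. \<tau> (r n))"
      by (rule tau_incr_proj[OF compartD(4)[OF r] rs lim'])
    moreover have "\<tau> (r n) + \<tau> P0 \<le> \<tau> f" for n
    proof -
      have "r n + spectral_proj A (J n) \<cdot> f = f"
        using E_compl[OF Jb[of n]] by (simp add: r_def compose_simps)
      hence "\<tau> f = \<tau> (r n) + \<tau> (spectral_proj A (J n) \<cdot> f)"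
        using tau_add[OF compartD(5)[OF r] compartD(5)[OF compart_mult[OF f(1)]], of n "J n"] by simp
      also have "\<dots> \<ge> \<tau> (r n) + \<tau> P0"
        using gt[OF compart_mult[OF f(1)] nz Ef, of n] by (intro add_left_mono) simp
      finally show ?thesis .
    qed
    hence "(SUP n. \<tau> (r n) + \<tau> P0) \<le> \<tau> f" by (rule SUP_least)
    hence "(SUP n. \<tau> (r n)) + \<tau> P0 \<le> \<tau> f" by (simp add: ennreal_SUP_add_left)
    ultimately have "\<tau> f + \<tau> P0 \<le> \<tau> f + 0" by simp
    hence "\<tau> P0 \<le> 0" using f(3) by (subst (asm) ennreal_add_left_cancel_le) auto
    thus False using tau_pos[OF proj_posM[OF P0(1)] P0(2)] by simp
  qed
  \<comment> \<open>The initial projection \<open>g\<close> of this \<open>v\<close> lies inside the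
    eigenspace, hence commutes with \<open>A\<close>, and is subequivalent to
    \<open>P0\<close>.\<close>
  from factor_nonzero_pi[OF compartD(4)[OF z] this P0(1,2)] obtain v where
    v: "v \<in> M" "v \<noteq> 0" "projection_op (adj v \<cdot> v)" "z \<cdot> (adj v \<cdot> v) = adj v \<cdot> v" "P0 \<cdot> v = v" by blast
  define g where "g = adj v \<cdot> v"
  have gM: "g \<in> projections M" using v by (simp add: g_def projM M_compose M_adj)
  have "z \<cdot> f = z" "f \<cdot> z = z" "spectral_proj A {c} \<cdot> z = z"
    using Ef[of "{c}"] proj_idem[OF E_proj, of "{c}"] proj_idem[OF fp]
    by (simp_all add: z_def compose_assoc) (simp add: compose_assoc[symmetric])
  hence fg: "f \<cdot> g = g" and Eg: "spectral_proj A {c} \<cdot> g = g"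
    using v(4) by (metis g_def compose_assoc)+
  have "compart g"
    using commute_below_point(2)[OF inf A splitting_unit_P0 _ Eg] v(3) gM by (simp add: g_def compart_def)
  moreover have "g \<noteq> 0"
  proof
    assume "g = 0"
    hence "v = 0" using pi_right[OF v(1) refl v(3)] by (simp add: g_def)
    thus False using v(2) by simp
  qed
  moreover have "sub g P0" using v(1,5) by (auto simp: sub_def g_def)
  from tau_sub[OF this gM P0(1)] have "\<tau> g \<le> \<tau> P0" .
  ultimately show False using no fg by blast
qed

lemma maximal_parts:
  assumes C: "\<And>v. C v \<Longrightarrow> compart v \<and> v \<noteq> 0"
  shows "\<exists>V::nat \<Rightarrow> 'h oper. orth_seq V \<and> (\<forall>n. V n \<noteq> 0 \<longrightarrow> C (V n)) \<and> (\<forall>n. compart (V n)) \<and>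
    (\<forall>v. C v \<longrightarrow> (\<exists>n. v \<cdot> V n \<noteq> 0))"
proof -
  have "\<exists>V::nat \<Rightarrow> 'h oper. (\<forall>n. V n \<in> Collect C \<or> V n = 0) \<and>
    (\<forall>m n. m \<noteq> n \<longrightarrow> V m \<noteq> 0 \<longrightarrow> V n \<noteq> 0 \<longrightarrow> V m \<cdot> V n = 0 \<and> V n \<cdot> V m = 0)
    \<and> \<not> (\<exists>v\<in>Collect C. \<forall>n. V n \<noteq> 0 \<longrightarrow> v \<cdot> V n = 0 \<and> V n \<cdot> v = 0)"
    by (rule family_sequence)
      (auto dest!: C simp: compartD(1,2,4) proj_adj proj_idem)
  then obtain V :: "nat \<Rightarrow> 'h oper" where V': "(\<forall>n. V n \<in> Collect C \<or> V n = 0) \<and>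
    (\<forall>m n. m \<noteq> n \<longrightarrow> V m \<noteq> 0 \<longrightarrow> V n \<noteq> 0 \<longrightarrow> V m \<cdot> V n = 0 \<and> V n \<cdot> V m = 0)
    \<and> \<not> (\<exists>v\<in>Collect C. \<forall>n. V n \<noteq> 0 \<longrightarrow> v \<cdot> V n = 0 \<and> V n \<cdot> v = 0)" by (rule exE)
  note V = V'[THEN conjunct1, rule_format, unfolded mem_Collect_eq]
    V'[THEN conjunct2, THEN conjunct1, rule_format, THEN conjunct1]
    V'[THEN conjunct2, THEN conjunct2]
  have c: "compart (V n)" for n using V(1)[of n] C by (auto simp: compart_def projM M_0)
  have "\<exists>n. v \<cdot> V n \<noteq> 0" if "C v" for v
  proof (rule ccontr)
    assume "\<nexists>n. v \<cdot> V n \<noteq> 0"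
    hence "v \<cdot> V n = 0 \<and> V n \<cdot> v = 0" for n
      using proj_orth_flip[OF compartD(2)[OF c]] C[OF that] compartD(2) by blast
    thus False using V(3) that by blast
  qed
  moreover have "V m \<cdot> V n = 0" if "m \<noteq> n" for m n
    using V(2)[OF that] by (cases "V m = 0"; cases "V n = 0") simp_all
  hence "orth_seq V" unfolding orth_seq_def using compartD(2)[OF c] by blast
  ultimately show ?thesis using V(1) c by blast
qed

text \<open>By \<open>small_part\<close> a maximal orthogonal family of parts of trace at most
  \<open>\<tau> P0\<close> exhausts \<open>f\<close>. The traces of its partial sums grow in steps
  of at most \<open>\<tau> P0\<close>, so the first one above \<open>\<tau> P0\<close> is still at
  most \<open>2 * \<tau> P0\<close>.\<close>

lemma unit_part:
  assumes f: "compart f" "\<tau> P0 \<le> \<tau> f" "\<tau> f < \<infinity>"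
  shows "\<exists>g. compart g \<and> f \<cdot> g = g \<and> \<tau> P0 \<le> \<tau> g \<and> \<tau> g \<le> 2 * \<tau> P0"
proof (cases "\<tau> f \<le> 2 * \<tau> P0")
  case True
  thus ?thesis using f proj_idem[OF compartD(2)[OF f(1)]] by blast
next
  case False
  define C where "C v \<longleftrightarrow> compart v \<and> v \<noteq> 0 \<and> f \<cdot> v = v \<and> \<tau> v \<le> \<tau> P0" for v
  obtain V where V: "orth_seq V" "\<And>n. V n \<noteq> 0 \<Longrightarrow> C (V n)" "\<And>n. compart (V n)" "\<And>v. C v \<Longrightarrow> \<exists>n. v \<cdot> V n \<noteq> 0"
    using maximal_parts[of C] by (auto simp: C_def)
  have VC: "f \<cdot> V n = V n" "\<tau> (V n) \<le> \<tau> P0" for n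
    using V(2)[of n] by (cases "V n = 0"; simp add: C_def tau_0)+
  note VM = compartD(1)[OF V(3)]
  define q where "q = psum V"
  have q: "q \<in> projections M" unfolding q_def by (rule psum_M[OF V(1) VM])
  have fq: "f \<cdot> q = q" unfolding q_def by (rule psum_absorb_left[OF V(1) VC(1)])
  have "compart q"
    using q psum_commute[OF V(1) compartD(3)[OF V(3), symmetric]] by (simp add: compart_def q_def)
  from compart_diff[OF this f(1) fq] have r: "compart (f - q)" .
  have "f - q = 0"
  proof (rule ccontr)
    assume nz: "f - q \<noteq> 0"
    have fr: "f \<cdot> (f - q) = f - q" using proj_idem[OF compartD(2)[OF f(1)]] fq by (simp add: compose_simps)
    have "\<tau> (f - q) \<le> \<tau> f" by (rule tau_proj_mono[OF compartD(4)[OF r] compartD(4)[OF f(1)] fr])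
    hence "\<tau> (f - q) < \<infinity>" using f(3) by simp
    from small_part[OF r nz this] obtain g where g: "compart g" "g \<noteq> 0" "(f - q) \<cdot> g = g" "\<tau> g \<le> \<tau> P0" by blast
    have "f \<cdot> g = g" using fr g(3) by (metis compose_assoc)
    hence "C g" using g by (simp add: C_def)
    moreover have "g \<cdot> V n = 0" for n
    proof (rule zero_absorb_right)
      show "g \<cdot> (f - q) = g" by (rule proj_flip[OF compartD(2)[OF g(1)] compartD(2)[OF r] g(3)])
      show "(f - q) \<cdot> V n = 0" using VC(1) psum_absorb[OF V(1)] by (simp add: q_def compose_simps)
    qed
    ultimately show False using V(4) by blast
  qed
  hence "\<tau> f = (SUP n. \<tau> (\<Sum>i<n. V i))"
    using tau_psum[OF V(1) VM] by (simp add: q_def suminf_eq_SUP tau_sum[OF compartD(5)[OF V(3)]])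
  moreover have "\<tau> P0 < \<tau> f"
    by (rule le_less_trans[of _ "2 * \<tau> P0"]) (use False in \<open>simp_all add: mult_2 not_le\<close>)
  ultimately have "\<exists>n. \<tau> P0 < \<tau> (\<Sum>i<n. V i)" by (simp add: less_SUP_iff)
  define n where "n = (LEAST n. \<tau> P0 < \<tau> (\<Sum>i<n. V i))"
  have n: "\<tau> P0 < \<tau> (\<Sum>i<n. V i)" unfolding n_def by (rule LeastI_ex) fact
  then obtain m where m: "n = Suc m" by (cases n) (auto simp: tau_0)
  have "\<not> \<tau> P0 < \<tau> (\<Sum>i<m. V i)" unfolding m using m by (intro not_less_Least[of m "\<lambda>n. \<tau> P0 < \<tau> (\<Sum>i<n. V i)"]) (simp add: n_def)
  hence "\<tau> (\<Sum>i<n. V i) \<le> 2 * \<tau> P0"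
    using VC(2)[of m] unfolding m mult_2
    by (simp add: tau_add positives_sum compartD(5)[OF V(3)] add_mono not_less)
  moreover have "compart (\<Sum>i<n. V i)"
  proof -
    have "(\<Sum>i<n. V i) \<cdot> A = A \<cdot> (\<Sum>i<n. V i)"
      by (induction n) (simp_all add: compose_simps compartD(3)[OF V(3)])
    thus ?thesis using orth_seq_partial[OF V(1), of "{..<n}"] by (simp add: compart_def projM M_sum VM)
  qed
  moreover have "f \<cdot> (\<Sum>i<n. V i) = (\<Sum>i<n. V i)"
    by (induction n) (simp_all add: compose_simps VC(1))
  ultimately show ?thesis using n by (intro exI[of _ "\<Sum>i<n. V i"]) simp
qed

text \<open>\<open>(A - \<alpha>)\<^sub>+\<close> is compared with its dyadic layers \<open>e k\<close>, on which it is at most \<open>\<delta> k\<close>; all but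
  a bounded part of each layer is filled by a maximal family of blocks of trace between \<open>\<tau> P0\<close> and
  \<open>2 * \<tau> P0\<close>.\<close>

lemma trace_blocks:
  assumes al: "\<tau> (pos_part (A - \<alpha> *\<^sub>R id_blinfun)) = \<infinity>"
    and fin: "\<And>t. \<alpha> < t \<Longrightarrow> \<tau> (spectral_proj A {t<..}) < \<infinity>"
  shows "\<exists>b \<epsilon> C. orth_seq b \<and> (\<forall>k. b k \<in> M \<and> b k \<cdot> A = A \<cdot> b k) \<and> (\<forall>k. 0 \<le> \<epsilon> k \<and> \<epsilon> k \<le> C) \<and> \<not> summable \<epsilon> \<and>
    (\<forall>k. 0 < \<epsilon> k \<longrightarrow> sub P0 (b k) \<and>
      (\<forall>x. (\<alpha> + \<epsilon> k) * (norm (b k x))\<^sup>2 \<le> qf A (b k x)))"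
proof -
  define X where "X = A - \<alpha> *\<^sub>R id_blinfun"
  have X: "selfadj X" "X \<in> M" using A by (simp_all add: X_def selfadj_diff selfadj_scaleR positive_selfadj M_diff M_scaleR M_id)
  have qX: "qf X x = qf A x - \<alpha> * (norm x)\<^sup>2" for x unfolding X_def qf_diff qf_scaleR qf_id by simp
  have EX: "spectral_proj A S \<cdot> X = X \<cdot> spectral_proj A S" for S by (simp add: X_def compose_simps E_commute)
  note XE = commuting_proj[OF X(1) E_proj EX]
  \<comment> \<open>\<open>\<delta> 0\<close> is large enough for the layers to cover all spectrum
    above \<alpha>. Halving makes the lower bound of \<open>A\<close> minus \<alpha> on a layer half
    of its upper bound, so both have comparable sums.\<close>
  define \<delta> where "\<delta> k = (\<bar>norm A - \<alpha>\<bar> + 1) / 2 ^ k" for k :: nat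
  have \<delta>: "0 < \<delta> k" "\<delta> (Suc k) = \<delta> k / 2" for k by (simp_all add: \<delta>_def)
  have dec: "\<delta> n \<le> \<delta> m" if "m \<le> n" for m n
  proof (rule lift_Suc_antimono_le[of \<delta>, OF _ that])
    show "\<delta> (Suc k) \<le> \<delta> k" for k using \<delta>[of k] by linarith
  qed
  have \<delta>_le: "\<delta> k \<le> \<delta> 0" for k by (rule dec) simp
  define I where "I k = {\<alpha> + \<delta> (Suc k)<..\<alpha> + \<delta> k}" for k
  have Ib: "I k \<in> sets borel" for k by (simp add: I_def)
  define e where "e k = spectral_proj A (I k)" for k
  have e: "compart (e k)" for k unfolding e_def by (rule compart_E)
  have dj: "disjoint_family I"
  proof -
    have "I m \<inter> I n = {}" if "m < n" for m n using dec[of "Suc m" n] that by (auto simp: I_def)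
    thus ?thesis unfolding disjoint_family_on_def by (metis Int_commute nat_neq_iff)
  qed
  have eo: "e m \<cdot> e n = 0" if "m \<noteq> n" for m n
    unfolding e_def by (rule E_disjoint) (use dj that Ib in \<open>auto simp: disjoint_family_on_def\<close>)
  have efin: "\<tau> (e k) < \<infinity>" for k
  proof -
    have "\<tau> (e k) \<le> \<tau> (spectral_proj A {\<alpha> + \<delta> (Suc k)<..})"
      unfolding e_def by (rule tau_proj_mono[OF spectral_M[OF A] spectral_M[OF A] E_mono]) (auto simp: I_def)
    thus ?thesis using fin[of "\<alpha> + \<delta> (Suc k)"] \<delta>(1)[of "Suc k"] by simp
  qed

  define D where "D = X \<cdot> spectral_proj A {\<alpha><..}"
  have Dge: "0 \<le> qf X (spectral_proj A S x)" if "S \<in> sets borel" "S \<subseteq> {\<alpha>..}" for S x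
    using E_ge[OF that, of x] by (simp add: qX)
  have Dp: "positive_op D"
    unfolding positive_op_iff D_def XE(2)
  proof (intro conjI allI XE(1))
    show "0 \<le> qf X (spectral_proj A {\<alpha><..} x)" for x by (rule Dge) auto
  qed
  \<comment> \<open>The negative part of \<open>X\<close>: it is \<open>- X\<close> on the spectral
    subspace for \<open>{..\<alpha>}\<close>.\<close>
  define N where "N = X \<cdot> (spectral_proj A {\<alpha><..} - id_blinfun)"
  have "pos_part X = D"
  proof -
    have cm: "{..\<alpha>} = - {\<alpha><..}" by auto
    have N': "N = (-1) *\<^sub>R (X \<cdot> spectral_proj A {..\<alpha>})"
      unfolding cm using E_compl[of "{\<alpha><..}"] by (simp add: N_def compose_simps)
    have "qf X (spectral_proj A {..\<alpha>} x) \<le> 0" for x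
      using E_le[of "{..\<alpha>}" \<alpha> x] by (simp add: qX)
    hence Np: "positive_op N"
      unfolding N' positive_op_iff qf_scaleR XE(2) by (intro conjI allI selfadj_scaleR XE(1)) simp
    have "D \<cdot> N = X \<cdot> (X \<cdot> (spectral_proj A {\<alpha><..} \<cdot> (spectral_proj A {\<alpha><..} - id_blinfun)))"
      unfolding D_def N_def by (simp add: compose_assoc) (simp add: compose_assoc[symmetric] EX)
    hence "D \<cdot> N = 0" by (simp add: compose_simps proj_idem[OF E_proj])
    from pos_part_eqI[OF Dp Np this] show ?thesis by (simp add: D_def N_def compose_simps)
  qed
  hence Dinf: "\<tau> D = \<infinity>" using al by (simp add: X_def)

  have top0: "spectral_proj A {\<alpha> + \<delta> 0<..} = 0"
    by (rule EA_top[OF inf A splitting_unit_P0]) (simp add: \<delta>_def)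
  have U: "(\<Union>k. I k) = {\<alpha><..\<alpha> + \<delta> 0}"
  proof
    have "\<alpha> < \<alpha> + \<delta> k" for k using \<delta>(1) by simp
    note less_trans[OF this]
    moreover have "\<alpha> + \<delta> k \<le> \<alpha> + \<delta> 0" for k using \<delta>_le[of k] by simp
    note order.trans[OF _ this]
    ultimately show "(\<Union>k. I k) \<subseteq> {\<alpha><..\<alpha> + \<delta> 0}" unfolding I_def by (intro UN_least subsetI) (simp; blast)
    show "{\<alpha><..\<alpha> + \<delta> 0} \<subseteq> (\<Union>k. I k)"
    proof
      fix t assume t: "t \<in> {\<alpha><..\<alpha> + \<delta> 0}"
      have "(\<lambda>n. (\<bar>norm A - \<alpha>\<bar> + 1) * (1 / 2) ^ n) \<longlonglongrightarrow> (\<bar>norm A - \<alpha>\<bar> + 1) * 0"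
        by (intro tendsto_mult tendsto_const LIMSEQ_realpow_zero) auto
      hence "\<delta> \<longlonglongrightarrow> 0" by (simp add: \<delta>_def[abs_def] power_divide)
      hence "eventually (\<lambda>n. \<delta> n < t - \<alpha>) sequentially" using t by (intro order_tendstoD) auto
      then obtain n where n: "\<delta> n < t - \<alpha>" by (auto simp: eventually_sequentially)
      define m where "m = (LEAST n. \<alpha> + \<delta> n < t)"
      have m: "\<alpha> + \<delta> m < t" unfolding m_def by (rule LeastI[of _ n]) (use n in simp)
      then obtain k where k: "m = Suc k" using t by (cases m) auto
      have "\<not> \<alpha> + \<delta> k < t" by (rule not_less_Least[of k "\<lambda>n. \<alpha> + \<delta> n < t"]) (use k in \<open>simp add: m_def\<close>)
      hence "t \<in> I k" using m by (simp add: I_def k)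
      thus "t \<in> (\<Union>k. I k)" by blast
    qed
  qed
  have "{\<alpha><..\<alpha> + \<delta> 0} \<union> {\<alpha> + \<delta> 0<..} = {\<alpha><..}" "{\<alpha><..\<alpha> + \<delta> 0} \<inter> {\<alpha> + \<delta> 0<..} = {}" using \<delta>(1)[of 0] by auto
  with E_additive[of "{\<alpha><..\<alpha> + \<delta> 0}" "{\<alpha> + \<delta> 0<..}"] top0
  have "spectral_proj A (\<Union>k. I k) = spectral_proj A {\<alpha><..}" by (simp add: U)
  hence esum: "(\<lambda>k. e k x) sums spectral_proj A {\<alpha><..} x" for x
    using E_sums[of I x] dj Ib by (simp add: e_def image_subset_iff)
  have Tp: "X \<cdot> e k \<in> positives M" for k
    unfolding e_def posM positive_op_iff XE(2)
  proof (intro conjI allI XE(1))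
    show "X \<cdot> spectral_proj A (I k) \<in> M" using spectral_M[OF A] X(2) by (simp add: M_compose projM)
    show "0 \<le> qf X ((spectral_proj A (I k)) x)" for x
      by (rule Dge[OF Ib]) (use \<delta>(1)[of "Suc k"] in \<open>auto simp: I_def\<close>)
  qed
  have Dsum: "\<tau> D = (\<Sum>k. \<tau> (X \<cdot> e k))"
    unfolding D_def by (rule tau_sums[OF Tp sums_compose_left[OF esum]])
  have Tle: "\<tau> (X \<cdot> e k) \<le> ennreal (\<delta> k) * \<tau> (e k)" for k
  proof -
    have "\<tau> (X \<cdot> e k) \<le> \<tau> (\<delta> k *\<^sub>R e k)"
    proof (rule tau_mono[OF Tp])
      show "\<delta> k *\<^sub>R e k \<in> positives M"
        using compartD(5)[OF e] \<delta>(1)[of k] by (simp add: posM M_scaleR positive_scaleR)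
      have "qf A (e k x) \<le> (\<alpha> + \<delta> k) * (norm (e k x))\<^sup>2" for x
        unfolding e_def by (rule E_le[OF Ib]) (auto simp: I_def)
      thus "qf (X \<cdot> e k) x \<le> qf (\<delta> k *\<^sub>R e k) x" for x
        unfolding e_def XE(2) qX qf_scaleR qf_E by (simp add: algebra_simps)
    qed
    also have "\<dots> = ennreal (\<delta> k) * \<tau> (e k)" using \<delta>(1)[of k] by (simp add: tau_scaleR compartD(5)[OF e])
    finally show ?thesis .
  qed

  define C where "C v \<longleftrightarrow> compart v \<and> v \<noteq> 0 \<and> \<tau> P0 \<le> \<tau> v \<and> \<tau> v \<le> 2 * \<tau> P0 \<and> (\<exists>k. e k \<cdot> v = v)" for v
  obtain V where V: "orth_seq V" "\<And>n. V n \<noteq> 0 \<Longrightarrow> C (V n)" "\<And>n. compart (V n)" "\<And>v. C v \<Longrightarrow> \<exists>n. v \<cdot> V n \<noteq> 0"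
    using maximal_parts[of C] by (auto simp: C_def)
  have "\<exists>k. e k \<cdot> V n = V n" for n using V(2)[of n] by (cases "V n = 0") (auto simp: C_def)
  then obtain \<kappa> where \<kappa>: "\<And>n. e (\<kappa> n) \<cdot> V n = V n" by metis
  note VM = compartD(1)[OF V(3)]
  \<comment> \<open>Half of \<open>\<delta> (\<kappa> n)\<close> is the lower bound of
    \<open>A\<close> minus \<alpha> on the layer of \<open>V n\<close>. The value \<open>0\<close>
    marks the filling terms of the sequence, so that a positive \<epsilon> belongs to an actual
    block.\<close>
  define \<epsilon> where "\<epsilon> n = (if V n = 0 then 0 else \<delta> (\<kappa> n) / 2)" for n
  have \<epsilon>: "0 \<le> \<epsilon> n" "\<epsilon> n \<le> \<delta> 0" for n using \<delta>(1)[of "\<kappa> n"] \<delta>(1)[of 0] \<delta>_le[of "\<kappa> n"] by (simp_all add: \<epsilon>_def)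
  define \<nu> where "\<nu> k i = (if \<kappa> i = k then \<tau> (V i) else 0)" for k i
  \<comment> \<open>If more than \<open>\<tau> P0\<close> of a layer were left over,
    \<open>unit_part\<close> would cut a further member of the maximal family out of it.\<close>
  have layer: "\<tau> (e k) \<le> (\<Sum>i. \<nu> k i) + \<tau> P0" for k
  proof -
    define q where "q = bsum V {i. \<kappa> i = k}"
    have q: "q \<in> projections M" unfolding q_def by (rule bsum_M[OF V(1) VM])
    have eq: "e k \<cdot> q = q" unfolding q_def by (rule bsum_absorb_left[OF V(1)]) (use \<kappa> in auto)
    have "compart q"
      using q bsum_commute[OF V(1) compartD(3)[OF V(3), symmetric]] by (simp add: compart_def q_def)
    from compart_diff[OF this e eq] have r: "compart (e k - q)" .
    have er: "e k \<cdot> (e k - q) = e k - q" using proj_idem[OF compartD(2)[OF e]] eq by (simp add: compose_simps)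
    have rV: "(e k - q) \<cdot> V n = 0" for n
    proof (cases "\<kappa> n = k")
      case True thus ?thesis using \<kappa>[of n] bsum_absorb[OF V(1), of n "{i. \<kappa> i = k}"] by (simp add: q_def compose_simps)
    next
      case False
      have "(e k - q) \<cdot> e k = e k - q" by (rule proj_flip[OF compartD(2)[OF r] compartD(2)[OF e] er])
      moreover have "e k \<cdot> V n = 0" using zero_absorb_left[OF eo \<kappa>[of n], of k] False by simp
      ultimately show ?thesis by (rule zero_absorb_right)
    qed
    have "\<tau> (e k - q) \<le> \<tau> P0"
    proof (rule ccontr)
      assume n: "\<not> \<tau> (e k - q) \<le> \<tau> P0"
      have "\<tau> (e k - q) \<le> \<tau> (e k)" by (rule tau_proj_mono[OF compartD(4)[OF r] compartD(4)[OF e] er])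
      hence "\<tau> (e k - q) < \<infinity>" using efin[of k] by simp
      then obtain g where g: "compart g" "(e k - q) \<cdot> g = g" "\<tau> P0 \<le> \<tau> g" "\<tau> g \<le> 2 * \<tau> P0"
        using unit_part[OF r less_imp_le] n by (auto simp: not_le)
      have "e k \<cdot> g = g" using er g(2) by (metis compose_assoc)
      moreover have "g \<noteq> 0" using g(3) tau_pos[OF proj_posM[OF P0(1)] P0(2)] tau_0 by auto
      ultimately have "C g" using g by (auto simp: C_def)
      moreover have "g \<cdot> V n = 0" for n
        by (rule zero_absorb_right[OF proj_flip[OF compartD(2)[OF g(1)] compartD(2)[OF r] g(2)] rV])
      ultimately show False using V(4) by blast
    qed
    moreover have "\<tau> q = (\<Sum>i. \<nu> k i)"
    proof -
      have "\<tau> q = (\<Sum>i. \<tau> (if i \<in> {i. \<kappa> i = k} then V i else 0))"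
        unfolding q_def bsum_def by (rule tau_psum[OF bsum_seq[OF V(1)]]) (simp add: VM M_0)
      thus ?thesis by (simp add: \<nu>_def if_distrib[of \<tau>] tau_0 cong: if_cong)
    qed
    ultimately show ?thesis using tau_diff[OF q compartD(4)[OF e] eq] by (simp add: add_left_mono)
  qed

  have "\<not> summable \<epsilon>"
  proof
    assume S: "summable \<epsilon>"
    \<comment> \<open>The uncovered parts contribute at most the sum of the
      \<open>\<delta> k * \<tau> P0\<close>, a geometric series bounded by
      \<open>2 * \<delta> 0 * \<tau> P0\<close>. A block contributes at most
      \<open>\<delta> (\<kappa> i)\<close>, which is \<open>2 * \<epsilon> i\<close>, times
      \<open>2 * \<tau> P0\<close>; hence the factor \<open>4\<close>.\<close>
    have "(\<Sum>k<n. \<tau> (X \<cdot> e k)) \<le> ennreal (2 * \<delta> 0) * \<tau> P0 + ennreal (4 * suminf \<epsilon>) * \<tau> P0" for n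
    proof -
      have p1: "(\<Sum>k<n. \<delta> k) = 2 * \<delta> 0 - 2 * \<delta> n" by (induction n) (simp_all add: \<delta>(2))
      have "(\<Sum>k<n. \<tau> (X \<cdot> e k)) \<le> (\<Sum>k<n. ennreal (\<delta> k) * ((\<Sum>i. \<nu> k i) + \<tau> P0))"
        by (intro sum_mono order.trans[OF Tle] mult_left_mono layer) simp
      also have "\<dots> = (\<Sum>i. \<Sum>k<n. ennreal (\<delta> k) * \<nu> k i) + (\<Sum>k<n. ennreal (\<delta> k)) * \<tau> P0"
        by (simp add: distrib_left sum.distrib sum_distrib_right suminf_sum)
      also have "(\<Sum>k<n. ennreal (\<delta> k)) = ennreal (\<Sum>k<n. \<delta> k)" using \<delta>(1) by (simp add: sum_ennreal less_imp_le)
      also have "\<dots> \<le> ennreal (2 * \<delta> 0)" using \<delta>(1)[of n] by (intro ennreal_leI) (simp add: p1)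
      also have "(\<Sum>i. \<Sum>k<n. ennreal (\<delta> k) * \<nu> k i) \<le> (\<Sum>i. ennreal (4 * \<epsilon> i) * \<tau> P0)"
      proof (rule suminf_le)
        fix i
        have "(\<Sum>k<n. ennreal (\<delta> k) * \<nu> k i) \<le> ennreal (\<delta> (\<kappa> i)) * \<tau> (V i)"
        proof -
          have "(\<Sum>k<n. ennreal (\<delta> k) * \<nu> k i) = (\<Sum>k<n. if k = \<kappa> i then ennreal (\<delta> (\<kappa> i)) * \<tau> (V i) else 0)"
            by (intro sum.cong) (auto simp: \<nu>_def)
          thus ?thesis by (simp add: sum.delta')
        qed
        also have "\<dots> \<le> ennreal (4 * \<epsilon> i) * \<tau> P0"
        proof (cases "V i = 0")
          case False
          have "ennreal (\<delta> (\<kappa> i)) * \<tau> (V i) \<le> ennreal (\<delta> (\<kappa> i)) * (2 * \<tau> P0)"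
            using V(2)[OF False] by (intro mult_left_mono) (simp_all add: C_def)
          also have "\<dots> = ennreal (4 * \<epsilon> i) * \<tau> P0"
            using False \<delta>(1)[of "\<kappa> i"] by (simp add: \<epsilon>_def ennreal_mult mult_ac)
          finally show ?thesis .
        qed (simp add: tau_0)
        finally show "(\<Sum>k<n. ennreal (\<delta> k) * \<nu> k i) \<le> ennreal (4 * \<epsilon> i) * \<tau> P0" .
      qed simp_all
      also have "(\<Sum>i. ennreal (4 * \<epsilon> i) * \<tau> P0) = ennreal (4 * suminf \<epsilon>) * \<tau> P0"
        using S \<epsilon>(1) by (simp add: ennreal_suminf_multc suminf_ennreal2 summable_mult suminf_mult)
      finally show ?thesis by (simp add: add_mono mult_right_mono add.commute)
    qed
    hence "\<tau> D \<le> ennreal (2 * \<delta> 0) * \<tau> P0 + ennreal (4 * suminf \<epsilon>) * \<tau> P0"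
      unfolding Dsum suminf_eq_SUP by (rule SUP_least)
    also have "\<dots> < \<infinity>" using P0(3) by (simp add: ennreal_mult_less_top)
    finally show False using Dinf by simp
  qed
  moreover have blk: "sub P0 (V n)" "(\<alpha> + \<epsilon> n) * (norm (V n x))\<^sup>2 \<le> qf A (V n x)"
    if "0 < \<epsilon> n" for n x
  proof -
    have nz: "V n \<noteq> 0" using that by (auto simp: \<epsilon>_def)
    show "sub P0 (V n)" by (rule sub_of_tau[OF compartD(4)[OF V(3)]]) (use V(2)[OF nz] in \<open>simp add: C_def\<close>)
    have "(e (\<kappa> n)) (V n x) = V n x" using eq_applyD[OF \<kappa>[of n], of x] by simp
    moreover have "(\<alpha> + \<delta> (Suc (\<kappa> n))) * (norm ((e (\<kappa> n)) y))\<^sup>2 \<le> qf A ((e (\<kappa> n)) y)" for y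
      unfolding e_def by (rule E_ge[OF Ib]) (auto simp: I_def)
    note this[of "V n x"]
    ultimately show "(\<alpha> + \<epsilon> n) * (norm (V n x))\<^sup>2 \<le> qf A (V n x)"
      using nz by (simp add: \<epsilon>_def \<delta>(2))
  qed
  ultimately show ?thesis
    by (intro exI[of _ V] exI[of _ \<epsilon>] exI[of _ "\<delta> 0"] conjI allI impI V(1) VM compartD(3)[OF V(3)] \<epsilon> blk)
qed

end

end

section \<open>Essential norm, type dichotomy and assembly of the two cases\<close>

context sfactor
begin

lemma big_id: "big id_blinfun"
  by (simp add: big_def projM M_id sub_refl)

lemma sub_into_zero: "sub e 0 \<Longrightarrow> e = 0"
  by (auto simp: sub_def)

lemma norm_cutoff:
  assumes A: "positive_op A" and t: "0 \<le> t"
  shows "norm (A - A \<cdot> spectral_proj A {t<..}) \<le> t"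
proof -
  interpret spec A "spectral_proj A" by (rule spectral_proj_spec(1)[OF positive_selfadj[OF A]])
  have "- {t<..} = {..t}" by auto
  hence eq: "A - A \<cdot> spectral_proj A {t<..} = A \<cdot> spectral_proj A {..t}"
    using E_compl[of "{t<..}"] by (simp add: compose_simps)
  note c = commuting_proj[OF positive_selfadj[OF A] E_proj E_commute, of "{..t}"]
  show ?thesis
    unfolding eq
  proof (rule positive_norm_le[OF _ _ t])
    show "positive_op (A \<cdot> spectral_proj A {..t})"
      unfolding positive_op_iff c(2) using c(1) positive_qf[OF A] by blast
    fix y
    have "qf A (spectral_proj A {..t} y) \<le> t * (norm (spectral_proj A {..t} y))\<^sup>2"
      by (rule E_le) auto
    also have "\<dots> \<le> t * (norm y)\<^sup>2"
      using norm_proj_le[OF E_proj, of "{..t}" y] t by (intro mult_left_mono power_mono) auto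
    finally show "qf (A \<cdot> spectral_proj A {..t}) y \<le> t * (norm y)\<^sup>2" unfolding c(2) .
  qed
qed

lemma spectral_nonzero:
  fixes A :: "'h oper"
  assumes inf: "\<not> finite_projection M id_blinfun" and A: "positive_op A" and t: "t < norm A"
  shows "spectral_proj A {t<..} \<noteq> 0"
proof (cases "t < 0")
  case True
  show ?thesis using big_id not_big_zero[OF inf] unfolding spectral_neg[OF A True] by metis
next
  case False
  thus ?thesis using norm_cutoff[OF A, of t] t by auto
qed

text \<open>A spectral projection that is not big is finite, so \<open>A\<close> cut down to it lies
  in the ideal, and what remains of \<open>A\<close> has norm at most \<open>t\<close>.\<close>

lemma big_below_essential_norm:
  assumes A: "A \<in> M" "positive_op A" and t: "t < essential_norm M A"
  shows "big (spectral_proj A {t<..})"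
proof (cases "t < 0")
  case True
  thus ?thesis using spectral_neg[OF A(2)] big_id by simp
next
  case False
  show ?thesis
  proof (rule ccontr)
    assume "\<not> big (spectral_proj A {t<..})"
    hence "finite_projection M (spectral_proj A {t<..})" using nonfinite_big spectral_M[OF A] by blast
    hence "A \<cdot> spectral_proj A {t<..} \<in> finite_ideal M"
      unfolding finite_ideal_def hull_def using A(1) by (auto simp: closed_two_sided_ideal_def)
    from infdist_le[OF this, of A] norm_cutoff[OF A(2), of t] t False show False
      by (simp add: essential_norm_def dist_norm)
  qed
qed

lemma splitting_unit_purely_infinite:
  assumes inf: "\<not> finite_projection M id_blinfun" and III: "type_III_vna M" and P: "P \<in> projections M" "P \<noteq> 0"
  shows "splitting_unit P"
proof -
  have b: "big e" if "e \<in> projections M" "e \<noteq> 0" for e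
    using nonfinite_big[OF that(1)] that(2) III unfolding type_III_vna_def by blast
  show ?thesis
    unfolding splitting_unit_def
  proof (intro conjI allI impI P)
    fix e f assume e: "e \<in> projections M" and f: "f \<in> projections M" and "big (e + f)"
    have "e \<noteq> 0 \<or> f \<noteq> 0" using \<open>big (e + f)\<close> not_big_zero[OF inf] by auto
    thus "big e \<or> big f" using b e f by blast
  next
    fix r R assume r: "\<forall>n. r n \<in> projections M" "slim r R" "big R"
    have "\<exists>n. r n \<noteq> 0"
    proof (rule ccontr)
      assume "\<nexists>n. r n \<noteq> 0"
      hence "slim r 0" by simp
      hence "R = 0" using slim_unique[OF r(2)] by blast
      thus False using r(3) not_big_zero[OF inf] by simp
    qed
    thus "\<exists>n. sub P (r n)" using b r(1) big_sub[OF _ P(1)] by blast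
  qed
qed

text \<open>The centre is trivial, so a single nonzero finite projection already makes the factor
  semifinite.\<close>

lemma semifinite_or_purely_infinite: "semifinite_vna M \<or> type_III_vna M"
proof (rule disjCI)
  assume "\<not> type_III_vna M"
  then obtain P where P: "finite_projection M P" "P \<noteq> 0" by (auto simp: type_III_vna_def)
  have "op_le P Z" if Z: "Z \<in> projections M \<inter> center M" "Z \<noteq> 0" for Z
  proof -
    obtain c where c: "\<And>x. Z x = c *\<^sub>C x" using center_scalar Z(1) by (auto simp: center_def)
    have Zp: "projection_op Z" using Z by (simp add: projM)
    obtain x where x: "Z x \<noteq> 0" using Z(2) by (metis blinfun_eqI zero_blinfun.rep_eq)
    define y where "y = Z x"
    have "c *\<^sub>C y = y" using c[of y] proj_idem_apply[OF Zp, of x] by (simp add: y_def)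
    hence "c * cinner y y = cinner y y" by (metis cinner_scaleC_left)
    hence "c = 1" using x by (simp add: cinner_self y_def)
    hence "Z = id_blinfun" using c by (intro blinfun_eqI) simp
    moreover have "projection_op P" using P by (simp add: finite_projection_def projM)
    ultimately show ?thesis by (simp add: proj_le_iff compose_simps)
  qed
  thus "semifinite_vna M" unfolding semifinite_vna_def using P by blast
qed

text \<open>Semifiniteness of the trace only supplies a positive \<open>S\<close> below
  \<open>P\<close> of finite trace. A copy \<open>Q\<close> of the spectral projection of
  \<open>S\<close> for \<open>{e<..}\<close>, taken below that projection, satisfies
  \<open>e *\<^sub>R Q <= S\<close>; hence it lies under \<open>P\<close> and has finite
  trace.\<close>

lemma finite_trace_subprojection:
  assumes tr: "normalized_fns_trace M \<tau>" and P: "P \<in> projections M" "P \<noteq> 0"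
  shows "\<exists>Q\<in>projections M. Q \<noteq> 0 \<and> \<tau> Q < \<infinity> \<and> sub Q P"
proof -
  have Pp: "projection_op P" using P by (simp add: projM)
  have "P \<in> positives M" using P by (simp add: positives_def projM proj_positive)
  then obtain S where S: "S \<in> positives M" "S \<noteq> 0" "op_le S P" "\<tau> S < \<infinity>"
    using tr P(2) by (auto simp: normalized_fns_trace_def semifinite_on_def)
  hence S': "S \<in> M" "positive_op S" by (simp_all add: positives_def)
  from nonzero_spectral[OF S' S(2)] obtain e where e: "0 < e" "spectral_proj S {e<..} \<noteq> 0" by blast
  have "{e<..} \<subseteq> {e..}" by auto
  from spectral_subprojection[OF S' _ this _ sub_refl[OF spectral_M[OF S']]] spectral_M[OF S', of "{e<..}"]
  obtain Q where Q: "Q \<in> projections M" "sub (spectral_proj S {e<..}) Q"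
    and ge: "\<And>x. e * (norm (Q x))\<^sup>2 \<le> qf S x"
    using e(1) by (auto simp: projM)
  have Qp: "projection_op Q" using Q by (simp add: projM)
  have "Q \<noteq> 0" using sub_into_zero Q(2) e(2) by auto
  moreover have "P \<cdot> Q = Q"
  proof -
    have "Q (x - P x) = 0" for x
    proof -
      let ?y = "x - P x"
      have "P ?y = 0" by (simp add: blinfun.bilinear_simps proj_idem_apply[OF Pp])
      hence "qf P ?y = 0" by simp
      hence "e * (norm (Q ?y))\<^sup>2 \<le> 0" using order.trans[OF ge op_le_qf[OF S(3)], of ?y] by simp
      thus ?thesis using e(1) by (simp add: mult_le_0_iff)
    qed
    hence "Q \<cdot> P = Q" by (intro blinfun_eqI) (simp add: blinfun.bilinear_simps)
    from compose_flip[OF this proj_cl[OF Qp] proj_cl[OF Pp] proj_adj[OF Qp] proj_adj[OF Pp] proj_adj[OF Qp]] show ?thesis .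
  qed
  hence "sub Q P" by (rule sub_of_le[OF Q(1)])
  moreover have "\<tau> Q < \<infinity>"
  proof -
    have 1: "e *\<^sub>R Q \<in> positives M" "Q \<in> positives M"
      using Q e(1) by (simp_all add: positives_def projM M_scaleR positive_scaleR proj_positive)
    have 2: "S - e *\<^sub>R Q \<in> positives M"
      unfolding positives_def positive_op_iff mem_Collect_eq qf_diff qf_scaleR qf_proj[OF Qp]
      using S' Q(1) ge proj_selfadj[OF Qp]
      by (simp add: projM M_diff M_scaleR selfadj_diff selfadj_scaleR positive_selfadj)
    have add: "\<And>X Y. X \<in> positives M \<Longrightarrow> Y \<in> positives M \<Longrightarrow> \<tau> (X + Y) = \<tau> X + \<tau> Y"
      and sc: "\<tau> (e *\<^sub>R Q) = ennreal e * \<tau> Q"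
      using tr e(1) 1(2) by (simp_all add: normalized_fns_trace_def trace_on_def)
    have "\<tau> S = ennreal e * \<tau> Q + \<tau> (S - e *\<^sub>R Q)" using add[OF 1(1) 2] sc by simp
    hence "ennreal e * \<tau> Q < \<infinity>" using S(4) by simp
    thus ?thesis using e(1) by (auto simp: ennreal_mult_less_top)
  qed
  ultimately show ?thesis using Q(1) by blast
qed

context
  fixes A P0 :: "'h oper" and B :: "nat \<Rightarrow> 'h oper" and \<alpha> :: real
  assumes inf: "\<not> finite_projection M id_blinfun" and A: "A \<in> M" "positive_op A" and P0: "splitting_unit P0"
    and B: "\<And>j. B j \<in> M" "\<And>j. positive_op (B j)" "\<And>j. norm (B j) \<le> \<alpha>"
begin

lemma bound_pos:
  assumes "0 < \<beta>" "infinite {j. sub P0 (spectral_proj (B j) {\<beta><..})}"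
  shows "0 < \<alpha>"
proof (rule ccontr)
  assume "\<not> 0 < \<alpha>"
  hence "norm (B j) \<le> \<beta>" for j using B(3)[of j] assms(1) by simp
  hence "spectral_proj (B j) {\<beta><..} = 0" for j by (rule EA_top[OF inf B(1,2) P0])
  hence "\<not> sub P0 (spectral_proj (B j) {\<beta><..})" for j using sub_into_zero splitting_unit_proj(2)[OF P0] by auto
  thus False using assms(2) by simp
qed

text \<open>With a uniform gap all blocks can be given the same room, half of the gap, and the
  divergence is trivial. This covers type III, with \<open>lam = norm A\<close>, and the semifinite
  case when some spectral projection beyond \<alpha> is big.\<close>

lemma decomposition_gap:
  assumes \<beta>: "0 < \<beta>" "infinite {j. sub P0 (spectral_proj (B j) {\<beta><..})}"
    and lam: "\<alpha> < lam" "\<And>t. t < lam \<Longrightarrow> big (spectral_proj A {t<..})"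
  shows "\<exists>Y. (\<forall>j. Y j \<in> M \<and> adj (Y j) \<cdot> A \<cdot> Y j = B j) \<and> sot_sums (\<lambda>j. Y j \<cdot> adj (Y j)) id_blinfun"
proof -
  obtain b where "blocks A P0 (\<lambda>_. (\<alpha> + lam) / 2) b"
    using blocks_exist[OF inf A P0 lam(2), of lam "\<lambda>_. (\<alpha> + lam) / 2"] lam(1) by auto
  hence b: "orth_seq b" "\<And>k. b k \<in> M" "\<And>k. b k \<cdot> A = A \<cdot> b k" "\<And>k. sub P0 (b k)"
    "\<And>k x. (\<alpha> + lam) / 2 * (norm (b k x))\<^sup>2 \<le> qf A (b k x)"
    unfolding blocks_def[OF inf A P0] by blast+
  have half: "\<alpha> + (lam - \<alpha>) / 2 = (\<alpha> + lam) / 2" by (simp add: field_simps)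
  show ?thesis
    by (rule decomposition_i[OF A B splitting_unit_proj[OF P0] bound_pos[OF \<beta>] \<beta> b(1-3), of "\<lambda>_. (lam - \<alpha>) / 2" "(lam - \<alpha>) / 2"])
      (use lam(1) b(4) b(5)[folded half] in \<open>simp_all add: summable_const_iff\<close>)
qed

lemma decomposition_limit:
  assumes B\<alpha>: "\<And>j. spectral_proj (B j) {\<alpha>} = 0" and \<beta>: "0 < \<beta>" "\<beta> < \<gamma>" "\<gamma> < \<alpha>"
    and J: "infinite {j. sub P0 (spectral_proj (B j) {\<beta><..\<gamma>})}"
    and bigA: "\<And>t. t < \<alpha> \<Longrightarrow> big (spectral_proj A {t<..})"
  shows "\<exists>Y. (\<forall>j. Y j \<in> M \<and> adj (Y j) \<cdot> A \<cdot> Y j = B j) \<and> sot_sums (\<lambda>j. Y j \<cdot> adj (Y j)) id_blinfun"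
proof -
  \<comment> \<open>\<open>i + 2\<close> makes \<open>c 0\<close> the midpoint of \<gamma> and
    \<alpha>, strictly above \<gamma>.\<close>
  define c where "c i = \<alpha> - (\<alpha> - \<gamma>) / real (i + 2)" for i
  have c: "c i < \<alpha>" for i using \<beta> by (simp add: c_def)
  have inc: "incseq c"
    by (rule incseq_SucI) (use \<beta> in \<open>auto simp: c_def intro!: divide_left_mono\<close>)
  have "(\<lambda>i. (\<alpha> - \<gamma>) / real (i + 2)) \<longlonglongrightarrow> 0" by (rule LIMSEQ_ignore_initial_segment[OF lim_const_over_n])
  hence lim: "c \<longlonglongrightarrow> \<alpha>" using tendsto_diff[OF tendsto_const] unfolding c_def by fastforce
  obtain b where "blocks A P0 c b" using blocks_exist[OF inf A P0 bigA, of \<alpha> c] c by blast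
  hence b: "orth_seq b" "\<And>k. b k \<in> M" "\<And>k. b k \<cdot> A = A \<cdot> b k" "\<And>k. sub P0 (b k)"
    "\<And>k x. c k * (norm (b k x))\<^sup>2 \<le> qf A (b k x)"
    unfolding blocks_def[OF inf A P0] by blast+
  have "\<gamma> < c 0" using \<beta> by (simp add: c_def field_simps)
  from decomposition_ii[OF A B B\<alpha> splitting_unit_proj[OF P0] \<beta>(1,2) this inc lim c J b] show ?thesis .
qed

end

end

theorem corollary3p8:
  fixes M :: "'h::chilbert_space oper set"
    and \<tau> :: "'h oper \<Rightarrow> ennreal"
    and A :: "'h oper"
    and B :: "nat \<Rightarrow> 'h oper"
    and \<alpha> :: real
  assumes "factor M" and "sigma_finite_vna M" and "infinite_vna M"
    and "semifinite_vna M \<Longrightarrow> normalized_fns_trace M \<tau>"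
    and "A \<in> positives M"
    and "\<And>j. B j \<in> positives M"
    and "bdd_above (range (\<lambda>j. norm (B j)))"
    and "\<alpha> = (SUP j. norm (B j))"
    and "((semifinite_vna M \<longrightarrow> \<tau> (pos_part (A - \<alpha> *\<^sub>R id_blinfun)) = \<infinity>) \<and>
          (type_III_vna M \<longrightarrow> norm A > \<alpha>) \<and>
          (\<exists>\<beta>>0. \<exists>P\<in>projections M. P \<noteq> 0 \<and>
             infinite {j. subequivalent_in M P (spectral_proj (B j) {\<beta><..})}))
       \<or> ((semifinite_vna M \<longrightarrow> essential_norm M A \<ge> \<alpha>) \<and>
          (type_III_vna M \<longrightarrow> norm A \<ge> \<alpha>) \<and>
          (\<forall>j. spectral_proj (B j) {\<alpha>} = 0) \<and>
          (\<exists>\<beta> \<gamma>. 0 < \<beta> \<and> \<beta> < \<gamma> \<and> \<gamma> < \<alpha> \<and>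
             (\<exists>P\<in>projections M. P \<noteq> 0 \<and>
                infinite {j. subequivalent_in M P (spectral_proj (B j) {\<beta><..\<gamma>})})))"
  shows "\<exists>(E :: nat \<Rightarrow> 'h oper) V.
            (\<forall>j. E j \<in> projections M) \<and>
            (\<forall>i j. i \<noteq> j \<longrightarrow> E i o\<^sub>L E j = 0) \<and>
            sot_sums E id_blinfun \<and>
            (\<forall>j. equivalent_in M (E j) id_blinfun) \<and>
            V \<in> M \<and> partial_isometry V \<and>
            op_le (range_proj A) (cadjoint V o\<^sub>L V) \<and>
            (\<forall>j. equivalent_in M (E j o\<^sub>L V o\<^sub>L A o\<^sub>L cadjoint V o\<^sub>L E j) (B j)) \<and>
            (equivalent_in M (null_proj A) id_blinfun \<longrightarrow> V = id_blinfun)"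
proof -
  interpret sfactor M using assms(1,2) by unfold_locales (simp_all add: factor_def)
  have inf: "\<not> finite_projection M id_blinfun" using assms(3) by (simp add: infinite_vna_def)
  have A: "A \<in> M" "positive_op A" using assms(5) by (simp_all add: positives_def)
  have "norm (B j) \<le> \<alpha>" for j unfolding assms(8) by (rule cSUP_upper[OF UNIV_I assms(7)])
  hence B: "\<And>j. B j \<in> M" "\<And>j. positive_op (B j)" "\<And>j. norm (B j) \<le> \<alpha>"
    using assms(6) by (simp_all add: positives_def)
  have EB: "projection_op (spectral_proj (B j) S)" for j S
    using spectral_M[OF B(1,2)] by (simp add: projM)
  \<comment> \<open>The projection given in the hypothesis may have infinite trace; subequivalence
    passes to any smaller \<open>Q\<close>.\<close>
  have J: "infinite {j. sub Q (spectral_proj (B j) S)}"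
    if "infinite {j. subequivalent_in M P (spectral_proj (B j) S)}" "P \<in> projections M" "sub Q P" for P Q S
  proof (rule infinite_super[OF _ that(1)])
    show "{j. subequivalent_in M P (spectral_proj (B j) S)} \<subseteq> {j. sub Q (spectral_proj (B j) S)}"
      using sub_trans[OF that(3) subequivalent_sub[OF _ _ EB]] that(2) by (auto simp: projM)
  qed
  have III: "big (spectral_proj A {t<..})" if "type_III_vna M" "t < norm A" for t
    using spectral_nonzero[OF inf A(2) that(2)] nonfinite_big[OF spectral_M[OF A]] that(1)
    unfolding type_III_vna_def by blast
  have unit: "\<exists>Q. splitting_unit Q \<and> sub Q P \<and> (semifinite_vna M \<longrightarrow> tfactor M \<tau> Q)"
    if P: "P \<in> projections M" "P \<noteq> 0" for P
  proof (cases "semifinite_vna M")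
    case True
    from finite_trace_subprojection[OF assms(4)[OF True] P] obtain Q where
      Q: "Q \<in> projections M" "Q \<noteq> 0" "\<tau> Q < \<infinity>" "sub Q P" by blast
    have "tfactor M \<tau> Q" using assms(4)[OF True] inf Q(1-3) by unfold_locales
    thus ?thesis using Q(4) tfactor.splitting_unit_P0 by blast
  next
    case False
    hence "type_III_vna M" using semifinite_or_purely_infinite by blast
    thus ?thesis using splitting_unit_purely_infinite[OF inf _ P] sub_refl[OF P(1)] False by blast
  qed
  have "\<exists>Y. (\<forall>j. Y j \<in> M \<and> adj (Y j) \<cdot> A \<cdot> Y j = B j) \<and> sot_sums (\<lambda>j. Y j \<cdot> adj (Y j)) id_blinfun"
    using assms(9)
  proof (elim disjE conjE exE bexE)
    fix \<beta> P assume tau: "semifinite_vna M \<longrightarrow> \<tau> (pos_part (A - \<alpha> *\<^sub>R id_blinfun)) = \<infinity>"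
      and nA: "type_III_vna M \<longrightarrow> \<alpha> < norm A" and \<beta>: "0 < \<beta>" and P: "P \<in> projections M" "P \<noteq> 0"
      and inf': "infinite {j. subequivalent_in M P (spectral_proj (B j) {\<beta><..})}"
    obtain Q where Q: "splitting_unit Q" "sub Q P" "semifinite_vna M \<Longrightarrow> tfactor M \<tau> Q" using unit[OF P] by blast
    note JQ = J[OF inf' P(1) Q(2)]
    note gap = decomposition_gap[OF inf A Q(1) B \<beta> JQ]
    \<comment> \<open>If no spectral projection strictly above \<alpha> is big, then in the
      semifinite case all of them have finite trace, so the infinite trace of the positive part
      accumulates at \<alpha> and \<open>trace_blocks\<close> applies. In type III the strict
      inequality \<open>\<alpha> < norm A\<close> is itself a gap.\<close>
    show ?thesis
    proof (cases "\<exists>t>\<alpha>. big (spectral_proj A {t<..})")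
      case True
      then obtain t where t: "\<alpha> < t" "big (spectral_proj A {t<..})" by blast
      have "big (spectral_proj A {s<..})" if "s < t" for s
        by (rule EA_mono_big[OF inf A Q(1) t(2)]) (use that in auto)
      thus ?thesis using gap[OF t(1)] by blast
    next
      case nb: False
      show ?thesis
      proof (cases "semifinite_vna M")
        case True
        interpret tfactor M \<tau> Q by (rule Q(3)[OF True])
        have "\<tau> (spectral_proj A {t<..}) \<noteq> \<infinity>" if "\<alpha> < t" for t
          using tau_big[OF spectral_M[OF A], of "{t<..}"] nb that by blast
        hence fin: "\<tau> (spectral_proj A {t<..}) < \<infinity>" if "\<alpha> < t" for t using that by (simp add: less_top)
        have "\<exists>b \<epsilon> C. orth_seq b \<and> (\<forall>k. b k \<in> M \<and> b k \<cdot> A = A \<cdot> b k) \<and>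
            (\<forall>k. 0 \<le> \<epsilon> k \<and> \<epsilon> k \<le> C) \<and> \<not> summable \<epsilon> \<and> (\<forall>k. 0 < \<epsilon> k \<longrightarrow> sub Q (b k) \<and>
            (\<forall>x. (\<alpha> + \<epsilon> k) * (norm (b k x))\<^sup>2 \<le> qf A (b k x)))"
          by (rule trace_blocks[OF A tau[rule_format, OF True] fin])
        then obtain b \<epsilon> C where b: "orth_seq b \<and> (\<forall>k. b k \<in> M \<and> b k \<cdot> A = A \<cdot> b k) \<and>
            (\<forall>k. 0 \<le> \<epsilon> k \<and> \<epsilon> k \<le> C) \<and> \<not> summable \<epsilon> \<and> (\<forall>k. 0 < \<epsilon> k \<longrightarrow> sub Q (b k) \<and>
            (\<forall>x. (\<alpha> + \<epsilon> k) * (norm (b k x))\<^sup>2 \<le> qf A (b k x)))"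
          by (elim exE)
        note b1 = b[THEN conjunct1] and b2 = b[THEN conjunct2, THEN conjunct1, rule_format]
          and \<epsilon>1 = b[THEN conjunct2, THEN conjunct2, THEN conjunct1, rule_format]
          and \<epsilon>2 = b[THEN conjunct2, THEN conjunct2, THEN conjunct2, THEN conjunct1]
          and \<epsilon>3 = b[THEN conjunct2, THEN conjunct2, THEN conjunct2, THEN conjunct2, rule_format]
        show ?thesis
          by (rule decomposition_i[OF A B P0(1,2) bound_pos[OF inf A Q(1) B \<beta> JQ] \<beta> JQ b1
              conjunct1[OF b2] conjunct2[OF b2] conjunct1[OF \<epsilon>1] conjunct2[OF \<epsilon>1] \<epsilon>2 conjunct1[OF \<epsilon>3] conjunct2[OF \<epsilon>3, rule_format]])
      next
        case False
        hence "type_III_vna M" using semifinite_or_purely_infinite by blast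
        thus ?thesis using gap[of "norm A"] nA III by blast
      qed
    qed
  next
    fix \<beta> \<gamma> P assume e: "semifinite_vna M \<longrightarrow> \<alpha> \<le> essential_norm M A" and nA: "type_III_vna M \<longrightarrow> \<alpha> \<le> norm A"
      and B\<alpha>: "\<forall>j. spectral_proj (B j) {\<alpha>} = 0" and \<beta>: "0 < \<beta>" "\<beta> < \<gamma>" "\<gamma> < \<alpha>"
      and P: "P \<in> projections M" "P \<noteq> 0"
      and inf': "infinite {j. subequivalent_in M P (spectral_proj (B j) {\<beta><..\<gamma>})}"
    obtain Q where Q: "splitting_unit Q" "sub Q P" using unit[OF P] by blast
    have "big (spectral_proj A {t<..})" if t: "t < \<alpha>" for t
    proof (cases "semifinite_vna M")
      case True thus ?thesis using big_below_essential_norm[OF A, of t] e t by auto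
    next
      case False
      hence "type_III_vna M" using semifinite_or_purely_infinite by blast
      thus ?thesis using III nA t by auto
    qed
    from decomposition_limit[OF inf A Q(1) B B\<alpha>[rule_format] \<beta> J[OF inf' P(1) Q(2)] this] show ?thesis .
  qed
  then obtain Y where Y: "\<And>j. Y j \<in> M" "\<And>j. adj (Y j) \<cdot> A \<cdot> Y j = B j" "sot_sums (\<lambda>j. Y j \<cdot> adj (Y j)) id_blinfun"
    by blast
  from compression_of_decomposition[OF inf A(1) positive_selfadj[OF A(2)] B(1,2) Y] show ?thesis .
qed

end
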